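(* Let $d=d_n$ be positive integers, and for each $n$ let $\mathbf X=\mathbf X^{(n)}=(X_1,\dots,X_n)$ be an exchangeable and unconditional random vector in $\mathbb R^n$. Assume that one of the following two sets of hypotheses holds. (1) $d$ is fixed (independent of $n$), and: $\mathbb E X_1^2\to1$; $\mathbb E(X_1^2X_2^2)-\mathbb E(X_1^2)\mathbb E(X_2^2)\to0$; and there exists $\epsilon>0$ such that $\sup_n\mathbb E(|X_1|^{4d+\epsilon})<\infty$. (2) $d=o(\sqrt n)$, and: $\mathbb E X_1^2=1$; $\frac1{n^{4d}}\mathbb E\|\mathbf X\|_2^{8d}\to1$; and there exists a sequence $L=L_n$ satisfying $Ld^2/n\to0$ such that either $\mathbb E(X_1^8\cdots X_r^8)\le L^{2r}$ for all $1\le r\le d$, or $\frac1{n^{2r}}\mathbb E\|\mathbf X\|_4^{8r}\le L^{2r}$ for all $1\le r\le d$. Suppose that $\binom nd/m\to c$ for some constant $c>0$, where $m$ is the sample size, and let $\mathbf x^{(1)},\dots,\mathbf x^{(m)}$ be i.i.d. with law $\mathrm{PowerT}(n,d,\mathbf X)$. Let $\lambda_1\ge\lambda_2\ge\dots\ge\lambda_{n^d}$ be the eigenvalues (with multiplicity) of $K=\frac1m\sum_{k=1}^m\mathbf x^{(k)}(\mathbf x^{(k)})^{\mathrm T}\in\mathbb R^{n^d\times n^d}$. Then, with probability $1$, $$\frac1{\binom{n+d-1}{d}}\sum_{j=1}^{\binom{n+d-1}{d}}\delta_{\lambda_j/d!}$$ converges weakly to $\mu_{\mathrm{MP}(c)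}$.
   Context: All limits are as $n\to\infty$, and all samples, for all $n$, live on a common probability space. $\|\mathbf x\|_k$ denotes the $\ell^k$ norm of a vector. $\mathbf X$ is exchangeable if $(X_1,\dots,X_n)$ has the same law as $(X_{\sigma(1)},\dots,X_{\sigma(n)})$ for every permutation $\sigma$ of $[n]=\{1,\dots,n\}$; it is unconditional if $(X_1,\dots,X_n)$ has the same law as $(\varepsilon_1X_1,\dots,\varepsilon_nX_n)$ where $\varepsilon_i$ are independent Rademacher signs independent of $\mathbf X$. $\mathrm{PowerT}(n,d,\mathbf X)$ is the law of the random vector $\bigl(\prod_{j=1}^dX_{i_j}\bigr)_{i=(i_1,\dots,i_d)\in[n]^d}\in\mathbb R^{n^d}$, i.e. of $\mathbf X^{\otimes d}$. For $c>0$ the standard Marchenko–Pastur law is $$\mu_{\mathrm{MP}(c)}=\bigl(1-\tfrac1c\bigr)^+\delta_0+\frac{\sqrt{(b-x)(x-a)}}{2\pi c x}\mathbf 1_{[a,b]}(x)\,dx,\quad a=(1-\sqrt c)^2,\ b=(1+\sqrt c)^2.$$ *)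

theory Defs
  imports "HOL-Probability.Probability" "HOL-Library.Landau_Symbols"
    "Jordan_Normal_Form.Char_Poly"
begin

text \<open>
  A random vector in \<open>\<real>\<^sup>n\<close> on a probability space \<open>N\<close> is a measurable map from \<open>N\<close> into the
  product space below; its coordinates are indexed by \<open>{1..n}\<close>.
\<close>

abbreviation Rn :: "nat \<Rightarrow> (nat \<Rightarrow> real) measure" where
  "Rn n \<equiv> Pi\<^sub>M {1..n} (\<lambda>_. borel)"

definition exchangeable :: "'b measure \<Rightarrow> nat \<Rightarrow> ('b \<Rightarrow> nat \<Rightarrow> real) \<Rightarrow> bool" where
  "exchangeable N n X \<longleftrightarrow>
     (\<forall>\<sigma>. \<sigma> permutes {1..n} \<longrightarrow>
        distr N (Rn n) X = distr N (Rn n) (\<lambda>\<omega>. \<lambda>i\<in>{1..n}. X \<omega> (\<sigma> i)))"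

definition rademacher :: "real measure" where
  "rademacher = measure_pmf (pmf_of_set {-1, 1})"

text \<open>
  The independent signs live on the second factor of a product space, and so are independent
  of \<open>X\<close>.
\<close>

definition unconditional :: "'b measure \<Rightarrow> nat \<Rightarrow> ('b \<Rightarrow> nat \<Rightarrow> real) \<Rightarrow> bool" where
  "unconditional N n X \<longleftrightarrow>
     distr N (Rn n) X =
     distr (N \<Otimes>\<^sub>M Pi\<^sub>M {1..n} (\<lambda>_. rademacher)) (Rn n)
       (\<lambda>(\<omega>, \<epsilon>). \<lambda>i\<in>{1..n}. \<epsilon> i * X \<omega> i)"

definition lnorm :: "nat \<Rightarrow> nat \<Rightarrow> (nat \<Rightarrow> real) \<Rightarrow> real" where
  "lnorm k n x = root k (\<Sum>i=1..n. \<bar>x i\<bar> ^ k)"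

text \<open>
  The index set \<open>[n]\<^sup>d\<close> consists of lists; the component \<open>i\<^sub>j\<close> of \<open>i = (i\<^sub>1, \<dots>, i\<^sub>d)\<close> is
  \<open>i ! (j - 1)\<close>.
\<close>

definition multi_idx :: "nat \<Rightarrow> nat \<Rightarrow> nat list set" where
  "multi_idx n d = {i. length i = d \<and> set i \<subseteq> {1..n}}"

abbreviation Rnd :: "nat \<Rightarrow> nat \<Rightarrow> (nat list \<Rightarrow> real) measure" where
  "Rnd n d \<equiv> Pi\<^sub>M (multi_idx n d) (\<lambda>_. borel)"

definition PowerT ::
    "'b measure \<Rightarrow> nat \<Rightarrow> nat \<Rightarrow> ('b \<Rightarrow> nat \<Rightarrow> real) \<Rightarrow> (nat list \<Rightarrow> real) measure" where
  "PowerT N n d X =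
     distr N (Rnd n d) (\<lambda>\<omega>. \<lambda>i\<in>multi_idx n d. \<Prod>j=1..d. X \<omega> (i ! (j - 1)))"

text \<open>
  Rows and columns of library matrices are numbered from 0, so \<open>[n]\<^sup>d\<close> has to be enumerated. The
  spectrum does not depend on the enumeration; we take the lexicographic one.
\<close>

definition nth_idx :: "nat \<Rightarrow> nat \<Rightarrow> nat \<Rightarrow> nat list" where
  "nth_idx n d a = List.n_lists d [1..<Suc n] ! a"

lemma nth_idx_bij: "bij_betw (nth_idx n d) {..<n ^ d} (multi_idx n d)"
proof -
  have "distinct (List.n_lists d [1..<Suc n])"
    by (rule distinct_n_lists) simp
  moreover have "length (List.n_lists d [1..<Suc n]) = n ^ d"
    by (simp add: length_n_lists del: upt_Suc)
  moreover have "set (List.n_lists d [1..<Suc n]) = multi_idx n d"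
    by (auto simp: set_n_lists multi_idx_def)
  ultimately show ?thesis
    unfolding nth_idx_def by (intro bij_betw_nth) auto
qed

definition sample_cov :: "nat \<Rightarrow> nat \<Rightarrow> nat \<Rightarrow> (nat \<Rightarrow> nat list \<Rightarrow> real) \<Rightarrow> real mat" where
  "sample_cov n d m x =
     Matrix.mat (n ^ d) (n ^ d)
       (\<lambda>(a, b). 1 / real m * (\<Sum>k=1..m. x k (nth_idx n d a) * x k (nth_idx n d b)))"

text \<open>Eigenvalues with algebraic multiplicity, the largest first.\<close>

definition eigvals_desc :: "real mat \<Rightarrow> real list" where
  "eigvals_desc A = rev (sorted_list_of_multiset (proots (char_poly A)))"

text \<open>A symmetric matrix of size \<open>N\<close> thus has all \<open>N\<close> eigenvalues in its list.\<close>

lemma real_eigenvalue_of_symmetric: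
  fixes A :: "real mat"
  assumes A: "A \<in> carrier_mat N N" and sym: "transpose_mat A = A"
    and ev: "eigenvalue (map_mat complex_of_real A) e"
  shows "e \<in> \<real>"
proof -
  define B where "B = map_mat complex_of_real A"
  have B: "B \<in> carrier_mat N N" using A by (simp add: B_def)
  obtain v where v: "v \<in> carrier_vec N" "v \<noteq> 0\<^sub>v N" "B *\<^sub>v v = e \<cdot>\<^sub>v v"
    using ev B unfolding eigenvalue_def eigenvector_def B_def[symmetric] by auto
  have ent: "B $$ (i, j) = B $$ (j, i)" "cnj (B $$ (i, j)) = B $$ (i, j)"
    if "i < N" "j < N" for i j
  proof -
    have "A $$ (i, j) = transpose_mat A $$ (i, j)" by (simp add: sym)
    also have "\<dots> = A $$ (j, i)" using that A by simp
    finally show "B $$ (i, j) = B $$ (j, i)" using that A by (simp add: B_def)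
    show "cnj (B $$ (i, j)) = B $$ (i, j)" using that A by (simp add: B_def)
  qed
  define u where "u = Matrix.vec_index v"
  have row: "(\<Sum>j<N. B $$ (i, j) * u j) = e * u i" if "i < N" for i
  proof -
    have "Matrix.vec_index (B *\<^sub>v v) i = (\<Sum>j<N. B $$ (i, j) * u j)"
      using that B v(1)
      by (auto simp: scalar_prod_def u_def atLeast0LessThan intro!: sum.cong)
    then show ?thesis using v(3) v(1) that by (simp add: u_def)
  qed
  define q where "q = (\<Sum>i<N. cnj (u i) * (\<Sum>j<N. B $$ (i, j) * u j))"
  define s where "s = (\<Sum>i<N. (cmod (u i))\<^sup>2)"
  have q1: "q = e * complex_of_real s"
    unfolding q_def s_def of_real_sum sum_distrib_left[of e]
  proof (intro sum.cong refl)
    fix i assume "i \<in> {..<N}"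
    then show "cnj (u i) * (\<Sum>j<N. B $$ (i, j) * u j) = e * complex_of_real ((cmod (u i))\<^sup>2)"
      unfolding complex_norm_square by (simp add: row)
  qed
  have "cnj q = (\<Sum>i<N. \<Sum>j<N. u i * (B $$ (i, j) * cnj (u j)))"
    unfolding q_def cnj_sum complex_cnj_mult complex_cnj_cnj sum_distrib_left
    by (intro sum.cong refl) (use ent(2) in \<open>auto simp: algebra_simps\<close>)
  also have "\<dots> = (\<Sum>j<N. \<Sum>i<N. u i * (B $$ (i, j) * cnj (u j)))"
    by (rule sum.swap)
  also have "\<dots> = q"
    unfolding q_def sum_distrib_left
    by (intro sum.cong refl) (use ent(1) in \<open>auto simp: algebra_simps\<close>)
  finally have "cnj q = q" .
  moreover have "s \<noteq> 0"
  proof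
    assume "s = 0"
    then have "\<forall>i<N. u i = 0"
      unfolding s_def by (subst (asm) sum_nonneg_eq_0_iff) auto
    then have "v = 0\<^sub>v N" using v(1) by (intro eq_vecI) (auto simp: u_def)
    with v(2) show False by simp
  qed
  ultimately have "cnj e = e" using q1 by simp
  then show ?thesis by (simp add: Reals_cnj_iff)
qed

lemma length_eigvals_desc:
  fixes A :: "real mat"
  assumes A: "A \<in> carrier_mat N N" and sym: "transpose_mat A = A"
  shows "length (eigvals_desc A) = N"
proof -
  interpret c: inj_comm_ring_hom complex_of_real
    by unfold_locales auto
  interpret cp: map_poly_inj_comm_ring_hom complex_of_real ..
  define B where "B = map_mat complex_of_real A"
  have B: "B \<in> carrier_mat N N" using A by (simp add: B_def)
  obtain as where as: "char_poly B = (\<Prod>a\<leftarrow>as. [:- a, 1:])" "length as = N"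
    using char_poly_factorized[OF B] by auto
  have "a \<in> \<real>" if "a \<in> set as" for a
  proof -
    have "poly (char_poly B) a = 0"
      using that by (auto simp: as(1) poly_prod_list prod_list_zero_iff image_iff intro!: bexI[of _ a])
    then have "eigenvalue B a" using eigenvalue_root_char_poly[OF B] by simp
    then show ?thesis using real_eigenvalue_of_symmetric[OF A sym] by (simp add: B_def)
  qed
  then have "map complex_of_real (map Re as) = as"
    by (auto simp: o_def intro!: map_idI)
  then obtain bs where bs: "as = map complex_of_real bs" by metis
  have "map_poly complex_of_real (char_poly A) = char_poly B"
    unfolding B_def by (rule of_real_hom.char_poly_hom[OF A, symmetric])
  also have "\<dots> = map_poly complex_of_real (\<Prod>b\<leftarrow>bs. [:- b, 1:])"
    by (simp add: as(1) bs cp.hom_prod_list o_def)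
  finally have cp: "char_poly A = (\<Prod>b\<leftarrow>bs. [:- b, 1:])" by simp
  have "proots (\<Prod>b\<leftarrow>bs. [:- b, 1:]) = mset bs"
  proof (induction bs)
    case (Cons b bs)
    have nz: "(\<Prod>b\<leftarrow>bs. [:- b, 1:]) \<noteq> 0" by (auto simp: prod_list_zero_iff)
    have "proots ([:- b, 1:] * (\<Prod>b\<leftarrow>bs. [:- b, 1:])) = proots [:- b, 1:] + mset bs"
      by (subst proots_mult) (use nz Cons in auto)
    then show ?case by simp
  qed simp
  then have "mset (eigvals_desc A) = mset bs"
    by (simp add: eigvals_desc_def cp)
  then have "length (eigvals_desc A) = length bs" by (metis size_mset)
  then show ?thesis using as(2) bs by simp
qed

lemma length_eigvals_sample_cov: "length (eigvals_desc (sample_cov n d m x)) = n ^ d"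
  by (rule length_eigvals_desc) (auto simp: sample_cov_def mult.commute intro!: eq_matI)

definition eigval :: "real mat \<Rightarrow> nat \<Rightarrow> real" where
  "eigval A j = eigvals_desc A ! (j - 1)"

text \<open>\<open>1/N \<Sum>\<^sub>j \<delta>\<^bsub>f j\<^esub>\<close>, the sum over \<open>1 \<le> j \<le> N\<close>, is the image under \<open>f\<close> of the uniform distribution.\<close>

definition empirical_dist :: "nat \<Rightarrow> (nat \<Rightarrow> real) \<Rightarrow> real measure" where
  "empirical_dist N f = distr (uniform_count_measure {1..N}) borel f"

definition MP_density :: "real \<Rightarrow> real \<Rightarrow> real" where
  "MP_density c x =
     (let a = (1 - sqrt c)\<^sup>2; b = (1 + sqrt c)\<^sup>2
      in sqrt ((b - x) * (x - a)) / (2 * pi * c * x) * indicator {a..b} x)"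

definition MP_law :: "real \<Rightarrow> real measure" where
  "MP_law c = measure_of UNIV (sets borel)
     (\<lambda>A. ennreal (max 0 (1 - 1 / c)) * emeasure (return borel 0) A
        + emeasure (density lborel (\<lambda>x. ennreal (MP_density c x))) A)"

lemma sets_MP_law [simp, measurable_cong]: "sets (MP_law c) = sets borel"
  using sets.sigma_sets_eq[of "borel :: real measure"] by (simp add: MP_law_def)

lemma space_MP_law [simp]: "space (MP_law c) = UNIV"
  by (simp add: MP_law_def)

lemma emeasure_MP_law:
  assumes "A \<in> sets borel"
  shows "emeasure (MP_law c) A = ennreal (max 0 (1 - 1 / c)) * indicator A 0
           + (\<integral>\<^sup>+x\<in>A. ennreal (MP_density c x) \<partial>lborel)"
proof -
  have [measurable]: "MP_density c \<in> borel_measurable borel"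
    unfolding MP_density_def Let_def by measurable
  let ?\<mu> = "\<lambda>A. ennreal (max 0 (1 - 1 / c)) * emeasure (return borel 0) A
        + emeasure (density lborel (\<lambda>x. ennreal (MP_density c x))) A"
  have "countably_additive (sets (MP_law c)) ?\<mu>"
  proof (rule countably_additiveI)
    fix F :: "nat \<Rightarrow> real set"
    assume F: "range F \<subseteq> sets (MP_law c)" "disjoint_family F"
    then have sums: "(\<Sum>i. emeasure (return borel 0) (F i)) = emeasure (return borel 0) (\<Union>i. F i)"
      "(\<Sum>i. emeasure (density lborel (\<lambda>x. ennreal (MP_density c x))) (F i))
         = emeasure (density lborel (\<lambda>x. ennreal (MP_density c x))) (\<Union>i. F i)"
      by (intro suminf_emeasure; simp)+
    then show "(\<Sum>i. ?\<mu> (F i)) = ?\<mu> (\<Union>i. F i)"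
      unfolding sums[symmetric] by (subst suminf_add[symmetric]) simp_all
  qed
  then have "emeasure (MP_law c) A = ?\<mu> A"
    by (intro emeasure_measure_of[OF MP_law_def]) (use assms in \<open>auto simp: positive_def\<close>)
  then show ?thesis
    using assms by (simp add: emeasure_density)
qed

end

theory Submission
  imports Defs "HOL-Combinatorics.Multiset_Permutations"
begin

text \<open>
  It suffices to follow the Stieltjes transforms at points \<open>t > 0\<close>. The coordinates of a sample
  depend only on the sorted index, and all but a vanishing proportion of the sorted indices have no
  repetition; so the spectrum of \<open>K / d!\<close> is, up to a perturbation of small rank, that of
  \<open>1/m \<Sum>\<^sub>k y\<^sub>k y\<^sub>k\<^sup>T\<close> with \<open>y(S) = \<Prod>\<^sub>i\<^sub>\<in>\<^sub>S X\<^sub>i\<close> for \<open>d\<close>-subsets \<open>S\<close>. With \<open>R\<close> the resolvent of this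
  matrix, \<open>\<tau> = tr R / m\<close> almost solves \<open>c - 1 - t \<tau> + 1 / (1 + \<tau>) = 0\<close> as soon as
  \<open>y\<^sub>k\<^sup>T R\<^sub>k y\<^sub>k\<close> concentrates around \<open>tr R\<^sub>k\<close>, where \<open>R\<^sub>k\<close> leaves out the sample \<open>k\<close>.

  For this concentration, unconditionality kills every moment \<open>E (y(S) y(T) y(U) y(V))\<close> unless
  \<open>S \<triangle> T = U \<triangle> V\<close>, and exchangeability replaces the others by averages over index
  sets, that is by elementary symmetric polynomials in the \<open>X\<^sub>i\<^sup>2\<close>. Everything reduces to
  \<open>E \<parallel>X\<parallel>\<^sub>2\<^sup>2\<^sup>k / n\<^sup>k \<longrightarrow> 1\<close> for \<open>k = d, 2d\<close> and to \<open>d\<^sup>2 E (\<parallel>X\<parallel>\<^sub>4\<^sup>4 \<parallel>X\<parallel>\<^sub>2\<^bsup>4d-4\<^esup>) / n\<^bsup>2d\<^esup> \<longrightarrow> 0\<close>, which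
  both sets of hypotheses imply. McDiarmid's inequality and the Borel--Cantelli lemma turn convergence
  in mean into almost sure convergence.
\<close>

section \<open>The Stieltjes transform of the Marchenko--Pastur law\<close>

text \<open>Real points t > 0 suffice and keep every sign under control: tr R decreases when a
  sample is added, all quadratic forms are nonnegative, and 1 / (1 + \<tau>) - t \<tau> decreases at
  rate at least t, so that an approximate root is close to the true one. Countably many t,
  accumulating at 1, determine the limit law; this keeps the exceptional null sets countable in
  number. The obstacle is that the hypotheses give no rate: the error of concentration merely tends
  to 0, so a Markov bound is not summable. Hence the split. The mean is controlled by second moments
  of quadratic forms, conditionally on the other samples. The fluctuation is controlled by bounded
  differences: replacing one sample moves tr R / m by at most 1 / (m t), whatever the samples are.
  As m grows at least linearly in n, the tail is geometric. Of R_k only t |R_k(S,S)| <= 1 and the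
  bound p / t^2 on the squared Frobenius norm enter, with p = n choose d. The first meets the
  fluctuation of y(S)^2 on the diagonal; the second meets, off the diagonal, a factor 4 d / n that
  comes from S and T differing in at least one element.\<close>

lemma DERIV_arcsin_linear:
  fixes A B x :: real
  assumes "A < x" "x < B"
  shows "((\<lambda>y. arcsin ((2 * y - A - B) / (B - A))) has_real_derivative 1 / sqrt ((B - x) * (x - A))) (at x)"
proof -
  let ?u = "(2 * x - A - B) / (B - A)"
  have BA: "B - A > 0" using assms by simp
  have u: "- 1 < ?u" "?u < 1" using assms by (simp_all add: field_simps)
  have "1 - ?u\<^sup>2 = 4 * ((B - x) * (x - A)) / (B - A)\<^sup>2"
    using BA by (simp add: divide_simps) (simp add: power2_eq_square algebra_simps)
  then have s: "sqrt (1 - ?u\<^sup>2) = 2 * sqrt ((B - x) * (x - A)) / (B - A)"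
    using BA by (simp add: real_sqrt_divide real_sqrt_mult)
  have R: "sqrt ((B - x) * (x - A)) > 0" using assms by simp
  have "((\<lambda>y. arcsin ((2 * y - A - B) / (B - A))) has_real_derivative
      inverse (sqrt (1 - ?u\<^sup>2)) * (2 / (B - A))) (at x)"
  proof -
    have "((\<lambda>y. (2 * y - A - B) / (B - A)) has_real_derivative 2 / (B - A)) (at x)"
      by (rule DERIV_cdivide) (auto intro!: derivative_eq_intros)
    from DERIV_chain2[OF DERIV_arcsin[OF u] this] show ?thesis .
  qed
  also have "inverse (sqrt (1 - ?u\<^sup>2)) * (2 / (B - A)) = 1 / sqrt ((B - x) * (x - A))"
    unfolding s using BA R by (simp add: field_simps)
  finally show ?thesis .
qed

text \<open>Up to sign, the argument of arcsin is the affine map of [1/B, 1/A] onto [-1, 1],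
  evaluated at 1/y; so this is the antiderivative of \<open>DERIV_arcsin_linear\<close> after the
  inversion y |-> 1/y.\<close>

lemma DERIV_arcsin_moebius:
  fixes A B x :: real
  assumes "0 < A" "A < x" "x < B"
  shows "((\<lambda>y. arcsin (((A + B) * y - 2 * A * B) / (y * (B - A)))) has_real_derivative
    sqrt (A * B) / (x * sqrt ((B - x) * (x - A)))) (at x)"
proof -
  let ?u = "((A + B) * x - 2 * A * B) / (x * (B - A))"
  have BA: "B - A > 0" "x > 0" "B > 0" using assms by auto
  define r where "r = (B - x) * (x - A)"
  have r: "r > 0" using assms by (simp add: r_def)
  have e: "1 - ?u\<^sup>2 = 4 * (A * B) * r / (x * (B - A))\<^sup>2"
    using BA unfolding r_def by (simp add: divide_simps) (simp add: power2_eq_square algebra_simps)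
  then have "?u\<^sup>2 < 1" using BA assms r by (smt (verit) divide_pos_pos mult_pos_pos zero_less_power)
  then have u: "- 1 < ?u" "?u < 1" unfolding abs_square_less_1 abs_less_iff by linarith+
  have s: "sqrt (1 - ?u\<^sup>2) = 2 * sqrt (A * B) * sqrt r / (x * (B - A))"
    unfolding e using BA by (simp add: real_sqrt_divide real_sqrt_mult)
  have AB: "sqrt (A * B) > 0" "sqrt (A * B) * sqrt (A * B) = A * B" using assms by auto
  have "((\<lambda>y. arcsin (((A + B) * y - 2 * A * B) / (y * (B - A)))) has_real_derivative
      inverse (sqrt (1 - ?u\<^sup>2)) * (2 * A * B / (x\<^sup>2 * (B - A)))) (at x)"
  proof -
    have "((\<lambda>y. ((A + B) * y - 2 * A * B) / (y * (B - A))) has_real_derivative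
        (2 * A * B / (x\<^sup>2 * (B - A)))) (at x)"
      using BA by (auto intro!: derivative_eq_intros simp: divide_simps) (simp add: power2_eq_square algebra_simps)
    from DERIV_chain2[OF DERIV_arcsin[OF u] this] show ?thesis .
  qed
  also have "inverse (sqrt (1 - ?u\<^sup>2)) * (2 * A * B / (x\<^sup>2 * (B - A))) = sqrt (A * B) / (x * sqrt r)"
  proof -
    have "inverse (sqrt (1 - ?u\<^sup>2)) * (2 * A * B / (x\<^sup>2 * (B - A)))
       = (x * (B - A)) / (2 * sqrt (A * B) * sqrt r) * (2 * (sqrt (A * B) * sqrt (A * B)) / (x\<^sup>2 * (B - A)))"
      unfolding s AB(2) by (simp add: inverse_eq_divide mult.assoc)
    also have "\<dots> = sqrt (A * B) / (x * sqrt r)"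
      using BA AB(1) r by (simp add: divide_simps power2_eq_square del: real_sqrt_mult_self) 
    finally show ?thesis .
  qed
  finally show ?thesis by (simp add: r_def)
qed

text \<open>With r = (B - y) (y - A) the integrand is r / (y sqrt r), and r / y = ((A + B) / 2 - y)
  + (A + B) / 2 - A B / y. The three terms are matched by sqrt r, by the linear arcsin and by the
  inverted one. At the endpoints every arcsin is pi/2 or -pi/2, which gives the value. A = 0 is the
  hard edge, which occurs for c = 1; there the third term is absent.\<close>

lemma has_integral_sqrt_over:
  fixes A B :: real
  assumes "0 \<le> A" "A < B"
  shows "((\<lambda>y. sqrt ((B - y) * (y - A)) / y) has_integral pi * ((A + B) / 2 - sqrt (A * B))) {A..B}"
proof -
  define G where "G y = sqrt ((B - y) * (y - A)) + (A + B) / 2 * arcsin ((2 * y - A - B) / (B - A))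
     - (if A = 0 then 0 else sqrt (A * B) * arcsin (((A + B) * y - 2 * A * B) / (y * (B - A))))" for y
  have BA: "B - A > 0" "B > 0" using assms by auto
  have bnd: "- 1 \<le> (2 * y - A - B) / (B - A)" "(2 * y - A - B) / (B - A) \<le> 1"
    if "y \<in> {A..B}" for y using that assms by (auto simp: field_simps)
  have bnd2: "- 1 \<le> ((A + B) * y - 2 * A * B) / (y * (B - A))"
    "((A + B) * y - 2 * A * B) / (y * (B - A)) \<le> 1"
    if "y \<in> {A..B}" "A > 0" for y
  proof -
    have y: "y > 0" "y * (B - A) > 0" using that BA by auto
    have "A * (B - y) \<ge> 0" "B * (y - A) \<ge> 0" using that BA by auto
    then show "- 1 \<le> ((A + B) * y - 2 * A * B) / (y * (B - A))"
      "((A + B) * y - 2 * A * B) / (y * (B - A)) \<le> 1"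
      using y by (simp_all add: pos_le_divide_eq pos_divide_le_eq algebra_simps)
  qed
  have c2: "continuous_on {A..B} (\<lambda>y. arcsin ((2 * y - A - B) / (B - A)))"
    by (intro continuous_on_arcsin continuous_intros ballI conjI bnd) (use BA in auto)
  have c3: "continuous_on {A..B} (\<lambda>y. if A = 0 then 0 else sqrt (A * B) * arcsin (((A + B) * y - 2 * A * B) / (y * (B - A))))"
  proof (cases "A = 0")
    case False
    then have "A > 0" using assms by simp
    then have "continuous_on {A..B} (\<lambda>y. sqrt (A * B) * arcsin (((A + B) * y - 2 * A * B) / (y * (B - A))))"
      by (intro continuous_on_arcsin continuous_intros ballI conjI bnd2) (use BA in auto)
    then show ?thesis using False by simp
  qed simp
  have "((\<lambda>y. sqrt ((B - y) * (y - A)) / y) has_integral G B - G A) {A..B}"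
  \<comment> \<open>The derivatives of the single terms blow up at the ends, so only continuity is
    used there.\<close>
  proof (rule fundamental_theorem_of_calculus_interior)
    show "continuous_on {A..B} G"
      unfolding G_def by (intro continuous_intros c2 c3)
    fix x assume x: "x \<in> {A<..<B}"
    define r where "r = (B - x) * (x - A)"
    have r: "r > 0" "x > 0" using x assms by (auto simp: r_def)
    have d1: "((\<lambda>y. sqrt ((B - y) * (y - A))) has_real_derivative (A + B - 2 * x) / (2 * sqrt r)) (at x)"
      using r unfolding r_def by (auto intro!: derivative_eq_intros simp: divide_simps)
    have d2: "((\<lambda>y. arcsin ((2 * y - A - B) / (B - A))) has_real_derivative 1 / sqrt r) (at x)"
      unfolding r_def by (rule DERIV_arcsin_linear) (use x in auto)
    have d3: "((\<lambda>y. if A = 0 then 0 else sqrt (A * B) * arcsin (((A + B) * y - 2 * A * B) / (y * (B - A))))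
        has_real_derivative A * B / (x * sqrt r)) (at x)"
    proof (cases "A = 0")
      case False
      then have A: "A > 0" using assms by simp
      have "((\<lambda>y. sqrt (A * B) * arcsin (((A + B) * y - 2 * A * B) / (y * (B - A))))
        has_real_derivative sqrt (A * B) * (sqrt (A * B) / (x * sqrt r))) (at x)"
        unfolding r_def by (intro DERIV_cmult DERIV_arcsin_moebius) (use x A in auto)
      moreover have "sqrt (A * B) * (sqrt (A * B) / (x * sqrt r)) = A * B / (x * sqrt r)"
        using A BA by (simp only: times_divide_eq_right real_sqrt_mult_self abs_mult abs_of_pos)
      ultimately show ?thesis using False by (simp only: if_False)
    qed simp
    have "(G has_real_derivative (A + B - 2 * x) / (2 * sqrt r) + (A + B) / 2 * (1 / sqrt r) - A * B / (x * sqrt r)) (at x)"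
      unfolding G_def by (intro DERIV_diff DERIV_add DERIV_cmult d1 d2 d3)
    also have "(A + B - 2 * x) / (2 * sqrt r) + (A + B) / 2 * (1 / sqrt r) - A * B / (x * sqrt r) = r / (x * sqrt r)"
      using r by (simp add: field_simps) (simp add: r_def algebra_simps)
    also have "\<dots> = sqrt r / x" using r by (simp add: field_simps)
    finally show "(G has_vector_derivative sqrt ((B - x) * (x - A)) / x) (at x)"
      by (simp add: r_def has_real_derivative_iff_has_vector_derivative)
  qed (use assms in simp)
  also have "G B - G A = pi * ((A + B) / 2 - sqrt (A * B))"
  proof -
    have a: "(2 * B - A - B) / (B - A) = 1" "(2 * A - A - B) / (B - A) = - 1"
      using BA by (simp_all add: field_simps)
    have b: "((A + B) * B - 2 * A * B) / (B * (B - A)) = 1"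
       using BA by (simp add: field_simps)
    have c: "((A + B) * A - 2 * A * B) / (A * (B - A)) = - 1" if "A \<noteq> 0"
      using BA that by (simp add: field_simps)
    show ?thesis unfolding G_def a b using c by (simp add: algebra_simps)
  qed
  finally show ?thesis .
qed

text \<open>\<open>MP_law\<close> is a sum of two set functions, an atom and a density; the formula
  passes from sets to functions by the usual induction over nonnegative measurable
  functions.\<close>

lemma nn_integral_MP_law:
  assumes [measurable]: "f \<in> borel_measurable borel"
  shows "(\<integral>\<^sup>+x. f x \<partial>MP_law c) = ennreal (max 0 (1 - 1 / c)) * f 0
     + (\<integral>\<^sup>+x. ennreal (MP_density c x) * f x \<partial>lborel)"
proof -
  have [measurable]: "MP_density c \<in> borel_measurable borel"
    unfolding MP_density_def Let_def by measurable
  have "f \<in> borel_measurable (MP_law c)" by simp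
  then show ?thesis
  proof (induction f rule: borel_measurable_induct)
    case (cong f g)
    then have "f = g" by auto
    with cong show ?case by simp
  next
    case (set A)
    then show ?case by (simp add: emeasure_MP_law)
  next
    case (mult u v)
    then have [measurable]: "u \<in> borel_measurable borel" by simp
    have "(\<integral>\<^sup>+x. ennreal (MP_density c x) * (v * u x) \<partial>lborel)
        = v * (\<integral>\<^sup>+x. ennreal (MP_density c x) * u x \<partial>lborel)"
      by (subst nn_integral_cmult[symmetric]) (auto simp: ac_simps)
    then show ?case using mult
      by (simp add: nn_integral_cmult distrib_left ac_simps)
  next
    case (add u v)
    then have [measurable]: "u \<in> borel_measurable borel" "v \<in> borel_measurable borel" by simp_all
    have "(\<integral>\<^sup>+x. ennreal (MP_density c x) * (u x + v x) \<partial>lborel)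
        = (\<integral>\<^sup>+x. ennreal (MP_density c x) * u x \<partial>lborel) + (\<integral>\<^sup>+x. ennreal (MP_density c x) * v x \<partial>lborel)"
      by (subst nn_integral_add[symmetric]) (auto simp: distrib_left)
    then show ?case using add
      by (simp only: nn_integral_add distrib_left) (simp add: ac_simps)
  next
    case (seq U)
    then have [measurable]: "\<And>i. U i \<in> borel_measurable borel" by simp
    have "(\<integral>\<^sup>+x. (SUP i. U i) x \<partial>MP_law c) = (SUP i. \<integral>\<^sup>+x. U i x \<partial>MP_law c)"
      unfolding SUP_apply by (rule nn_integral_monotone_convergence_SUP) (use seq in auto)
    also have "\<dots> = (SUP i. ennreal (max 0 (1 - 1 / c)) * U i 0 + (\<integral>\<^sup>+x. ennreal (MP_density c x) * U i x \<partial>lborel))"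
      using seq by simp
    also have "\<dots> = (SUP i. ennreal (max 0 (1 - 1 / c)) * U i 0) + (SUP i. \<integral>\<^sup>+x. ennreal (MP_density c x) * U i x \<partial>lborel)"
      using seq(3) by (intro ennreal_SUP_add) (auto simp: incseq_def le_fun_def intro!: mult_left_mono nn_integral_mono)
    also have "(SUP i. \<integral>\<^sup>+x. ennreal (MP_density c x) * U i x \<partial>lborel)
        = (\<integral>\<^sup>+x. (SUP i. ennreal (MP_density c x) * U i x) \<partial>lborel)"
      using seq(3) by (intro nn_integral_monotone_convergence_SUP[symmetric])
        (auto simp: incseq_def le_fun_def intro!: mult_left_mono)
    finally show ?case by (simp only: SUP_apply SUP_mult_left_ennreal)
  qed
qed

text \<open>The nonnegative root of \<open>t \<tau>\<^sup>2 + (t + 1 - c) \<tau> - c = 0\<close>.\<close>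

definition MP_tau :: "real \<Rightarrow> real \<Rightarrow> real" where
  "MP_tau c t = (c - 1 - t + sqrt ((t + 1 - c)\<^sup>2 + 4 * c * t)) / (2 * t)"

lemma has_integral_sqrt_over_shift:
  fixes a b t :: real
  assumes "0 \<le> a" "a < b" "t \<ge> 0"
  shows "((\<lambda>x. sqrt ((b - x) * (x - a)) / (x + t)) has_integral
    pi * ((a + b) / 2 + t - sqrt ((a + t) * (b + t)))) {a..b}"
proof -
  have "((\<lambda>y. sqrt ((b + t - y) * (y - (a + t))) / y) has_integral
      pi * ((a + t + (b + t)) / 2 - sqrt ((a + t) * (b + t)))) (cbox (a + t) (b + t))"
    using has_integral_sqrt_over[of "a + t" "b + t"] assms by simp
  from has_integral_affinity[OF this, of 1 t]
  have "((\<lambda>x. sqrt ((b + t - (x + t)) * (x + t - (a + t))) / (x + t)) has_integral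
      pi * ((a + t + (b + t)) / 2 - sqrt ((a + t) * (b + t)))) ((\<lambda>x. x - t) ` {a + t..b + t})"
    by simp
  also have "(\<lambda>x. x - t) ` {a + t..b + t} = {a..b}"
    using image_add_atLeastAtMost[of "- t" "a + t" "b + t"] by (simp add: image_def)
  finally show ?thesis by (simp add: field_simps)
qed

context
  fixes c a b :: real
  assumes c: "c > 0"
  defines "a \<equiv> (1 - sqrt c)\<^sup>2" and "b \<equiv> (1 + sqrt c)\<^sup>2"
begin

lemma MP_edges: "0 \<le> a" "a < b" "a + b = 2 * (1 + c)" "a * b = (1 - c)\<^sup>2"
proof -
  show "0 \<le> a" by (simp add: a_def)
  have "b - a = 4 * sqrt c" by (simp add: a_def b_def power2_eq_square algebra_simps)
  then show "a < b" using c by (smt (verit) real_sqrt_gt_zero)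
  show "a + b = 2 * (1 + c)" using c by (simp add: a_def b_def power2_eq_square algebra_simps)
  have "a * b = ((1 - sqrt c) * (1 + sqrt c))\<^sup>2" by (simp add: a_def b_def power_mult_distrib)
  also have "(1 - sqrt c) * (1 + sqrt c) = 1 - c" using c by (simp add: algebra_simps)
  finally show "a * b = (1 - c)\<^sup>2" .
qed

lemma MP_density_eq:
  "MP_density c x = sqrt ((b - x) * (x - a)) / (2 * pi * c * x) * indicator {a..b} x"
  by (simp add: MP_density_def Let_def a_def b_def)

lemma MP_density_nonneg: "MP_density c x \<ge> 0"
  unfolding MP_density_eq using MP_edges(1,2) c
  by (auto simp: indicator_def intro!: divide_nonneg_nonneg mult_nonneg_nonneg)

lemma MP_density_neg: "x < 0 \<Longrightarrow> MP_density c x = 0"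
  using MP_edges(1) by (simp add: MP_density_eq)

lemma nn_integral_MP_density:
  assumes f: "\<And>x. x \<in> {a..b} \<Longrightarrow> 0 \<le> f x"
    and I: "((\<lambda>x. sqrt ((b - x) * (x - a)) / x * f x) has_integral I) {a..b}"
  shows "(\<integral>\<^sup>+x. ennreal (MP_density c x) * ennreal (f x) \<partial>lborel) = ennreal (I / (2 * pi * c))"
proof -
  have "((\<lambda>x. (sqrt ((b - x) * (x - a)) / x * f x) / (2 * pi * c)) has_integral I / (2 * pi * c)) {a..b}"
    by (rule has_integral_divide[OF I])
  then have "(\<integral>\<^sup>+x. ennreal ((sqrt ((b - x) * (x - a)) / x * f x) / (2 * pi * c)) * indicator {a..b} x \<partial>lborel)
      = ennreal (I / (2 * pi * c))"
    by (intro nn_integral_has_integral_lebesgue') (use MP_edges c f in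
      \<open>auto intro!: divide_nonneg_nonneg mult_nonneg_nonneg\<close>)
  also have "(\<integral>\<^sup>+x. ennreal ((sqrt ((b - x) * (x - a)) / x * f x) / (2 * pi * c)) * indicator {a..b} x \<partial>lborel)
      = (\<integral>\<^sup>+x. ennreal (MP_density c x) * ennreal (f x) \<partial>lborel)"
  proof (intro nn_integral_cong)
    fix x
    show "ennreal ((sqrt ((b - x) * (x - a)) / x * f x) / (2 * pi * c)) * indicator {a..b} x
        = ennreal (MP_density c x) * ennreal (f x)"
      using MP_density_nonneg[of x] f[of x]
      by (cases "x \<in> {a..b}") (auto simp: MP_density_eq ennreal_mult'[symmetric] ac_simps)
  qed
  finally show ?thesis .
qed

lemma sqrt_edges: "sqrt (a * b) = \<bar>1 - c\<bar>"
  by (simp add: MP_edges)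

text \<open>The second summand is min(1, 1/c), the mass of the absolutely continuous part, so the
  atom supplies exactly what is missing for c > 1.\<close>

lemma MP_weight: "max 0 (1 - 1 / c) + (1 + c - \<bar>1 - c\<bar>) / (2 * c) = 1"
  using c by (auto simp: max_def field_simps abs_if)

lemma real_distribution_MP_law: "real_distribution (MP_law c)"
proof -
  have "(\<integral>\<^sup>+x. 1 \<partial>MP_law c) = ennreal (max 0 (1 - 1 / c)) + (\<integral>\<^sup>+x. ennreal (MP_density c x) * ennreal 1 \<partial>lborel)"
    by (subst nn_integral_MP_law) auto
  also have "(\<integral>\<^sup>+x. ennreal (MP_density c x) * ennreal 1 \<partial>lborel)
      = ennreal (pi * ((a + b) / 2 - sqrt (a * b)) / (2 * pi * c))"
    using has_integral_sqrt_over[OF MP_edges(1,2)] by (intro nn_integral_MP_density) auto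
  also have "pi * ((a + b) / 2 - sqrt (a * b)) / (2 * pi * c) = (1 + c - \<bar>1 - c\<bar>) / (2 * c)"
    unfolding sqrt_edges MP_edges(3) using c by (simp add: field_simps)
  also have "ennreal (max 0 (1 - 1 / c)) + ennreal ((1 + c - \<bar>1 - c\<bar>) / (2 * c)) = ennreal 1"
    using c by (subst ennreal_plus[symmetric]) (auto simp: MP_weight abs_if simp del: ennreal_plus)
  finally have "emeasure (MP_law c) (space (MP_law c)) = 1" by simp
  then show ?thesis by (intro real_distribution.intro prob_spaceI real_distribution_axioms.intro) auto
qed

lemma AE_MP_law_nonneg: "AE x in MP_law c. 0 \<le> x"
proof (rule AE_I)
  show "{x \<in> space (MP_law c). \<not> 0 \<le> x} \<subseteq> {..<0}" by auto
  have "emeasure (MP_law c) {..<0} = (\<integral>\<^sup>+x\<in>{..<0}. ennreal (MP_density c x) \<partial>lborel)"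
    by (subst emeasure_MP_law) auto
  also have "\<dots> = (\<integral>\<^sup>+x. 0 \<partial>(lborel :: real measure))"
    by (intro nn_integral_cong) (auto simp: indicator_def MP_density_neg)
  finally show "emeasure (MP_law c) {..<0} = 0" by simp
qed auto

text \<open>The partial fractions 1 / (x (x + t)) = (1 / x - 1 / (x + t)) / t reduce the density
  part to \<open>has_integral_sqrt_over_shift\<close> at 0 and at t; the atom adds its mass over t.
  \<open>MP_tau\<close> is normalised by the sample size and the left side by the dimension, hence
  the quotient by c.\<close>

lemma MP_stieltjes:
  assumes t: "t > 0"
  shows "(\<integral>x. 1 / (x + t) \<partial>MP_law c) = MP_tau c t / c"
proof -
  let ?m = "(a + b) / 2"
  define J where "J = pi * (sqrt ((a + t) * (b + t)) - t - sqrt (a * b)) / t"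
  have "((\<lambda>x. (sqrt ((b - x) * (x - a)) / (x + 0) - sqrt ((b - x) * (x - a)) / (x + t)) / t) has_integral
      (pi * (?m + 0 - sqrt ((a + 0) * (b + 0))) - pi * (?m + t - sqrt ((a + t) * (b + t)))) / t) {a..b}"
    by (intro has_integral_divide has_integral_diff has_integral_sqrt_over_shift MP_edges) (use t in auto)
  also have "(pi * (?m + 0 - sqrt ((a + 0) * (b + 0))) - pi * (?m + t - sqrt ((a + t) * (b + t)))) / t = J"
    by (simp add: J_def algebra_simps)
  finally have "((\<lambda>x. sqrt ((b - x) * (x - a)) / x * (1 / (x + t))) has_integral J) {a..b}"
  proof (rule has_integral_eq[rotated])
    fix x assume x: "x \<in> {a..b}"
    show "(sqrt ((b - x) * (x - a)) / (x + 0) - sqrt ((b - x) * (x - a)) / (x + t)) / t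
        = sqrt ((b - x) * (x - a)) / x * (1 / (x + t))"
    \<comment> \<open>The point 0 is in the interval only if a = 0, and then both sides are 0
      because the square root vanishes there.\<close>
    proof (cases "x = 0")
      case True
      then have "a = 0" using x MP_edges(1) by auto
      with True show ?thesis by simp
    next
      case False
      then have "x > 0" using x MP_edges(1) by auto
      then have "(s / (x + 0) - s / (x + t)) / t = s / x * (1 / (x + t))" for s
        using t by (simp add: divide_simps) (simp add: algebra_simps)
      then show ?thesis .
    qed
  qed
  then have n: "(\<integral>\<^sup>+x. ennreal (MP_density c x) * ennreal (1 / (x + t)) \<partial>lborel) = ennreal (J / (2 * pi * c))"
    by (intro nn_integral_MP_density) (use t MP_edges(1) in auto)
  \<comment> \<open>The sign is needed because ennreal cuts off negative numbers; it amounts to 2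
    sqrt(a b) <= a + b.\<close>
  have J0: "J \<ge> 0"
  proof -
    have "(t + sqrt (a * b))\<^sup>2 \<le> (a + t) * (b + t)"
    proof -
      have "2 * sqrt (a * b) \<le> a + b"
        using arith_geo_mean_sqrt[of a b] MP_edges(1,2) by simp
      then have "t * (2 * sqrt (a * b)) \<le> t * (a + b)" using t by (intro mult_left_mono) auto
      moreover have "(sqrt (a * b))\<^sup>2 = a * b" using MP_edges(1,2) by simp
      ultimately show ?thesis by (simp add: power2_eq_square algebra_simps)
    qed
    then have "t + sqrt (a * b) \<le> sqrt ((a + t) * (b + t))" by (rule real_le_rsqrt)
    then show ?thesis using t unfolding J_def by (intro divide_nonneg_pos mult_nonneg_nonneg) auto
  qed
  have "(\<integral>x. 1 / (x + t) \<partial>MP_law c) = enn2real (\<integral>\<^sup>+x. ennreal (1 / (x + t)) \<partial>MP_law c)"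
    by (rule integral_eq_nn_integral) (use AE_MP_law_nonneg t in \<open>auto elim!: eventually_mono\<close>)
  also have "(\<integral>\<^sup>+x. ennreal (1 / (x + t)) \<partial>MP_law c)
      = ennreal (max 0 (1 - 1 / c)) * ennreal (1 / (0 + t)) + ennreal (J / (2 * pi * c))"
    unfolding n[symmetric] by (rule nn_integral_MP_law) auto
  also have "\<dots> = ennreal (max 0 (1 - 1 / c) * (1 / t) + J / (2 * pi * c))"
  proof -
    define w where "w = max 0 (1 - 1 / c)"
    have "w \<ge> 0" by (simp add: w_def)
    then show ?thesis unfolding w_def[symmetric]
      using t c J0 ennreal_mult[of w "1 / t"] by (subst ennreal_plus) auto
  qed
  also have "enn2real \<dots> = max 0 (1 - 1 / c) * (1 / t) + J / (2 * pi * c)"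
    using t c J0 by (intro enn2real_ennreal add_nonneg_nonneg) auto
  also have "J / (2 * pi * c) = (sqrt ((a + t) * (b + t)) - t - \<bar>1 - c\<bar>) / (2 * c * t)"
    using c t unfolding J_def sqrt_edges by (simp add: field_simps)
  also have "(a + t) * (b + t) = (t + 1 - c)\<^sup>2 + 4 * c * t"
  proof -
    have "(a + t) * (b + t) = a * b + t * (a + b) + t\<^sup>2" by (simp add: power2_eq_square algebra_simps)
    then show ?thesis unfolding MP_edges by (simp add: power2_eq_square algebra_simps)
  qed
  also have "max 0 (1 - 1 / c) * (1 / t) + (sqrt ((t + 1 - c)\<^sup>2 + 4 * c * t) - t - \<bar>1 - c\<bar>) / (2 * c * t)
      = MP_tau c t / c"
    using c t unfolding MP_tau_def by (auto simp: max_def abs_if field_simps)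
  finally show ?thesis .
qed

end

section \<open>Weak convergence from Stieltjes transforms\<close>

text \<open>A change of variable taking [0, \<infinity>) onto (0, 1], where polynomials are dense
  and moments determine a law. All measures in question live on the nonnegative reals; the maximum
  keeps the function bounded on the rest of the line.\<close>

definition cayley :: "real \<Rightarrow> real" where "cayley x = 1 / (1 + max 0 x)"

lemma cayley_bounds: "0 < cayley x" "cayley x \<le> 1"
  by (simp_all add: cayley_def max_def)

lemma cayley_measurable [measurable]: "cayley \<in> borel_measurable borel"
  unfolding cayley_def by measurable

lemma (in real_distribution) integrable_cayley:
  fixes F :: "real \<Rightarrow> real"
  assumes "continuous_on {0..1} F"
  shows "integrable M (\<lambda>x. F (cayley x))"
proof -
  have "compact (F ` {0..1})" using assms by (intro compact_continuous_image) auto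
  then obtain B where B: "\<And>v. v \<in> {0..1} \<Longrightarrow> norm (F v) \<le> B"
    by (meson bounded_iff compact_imp_bounded imageI)
  have "(\<lambda>x. indicator {0..1} (cayley x) *\<^sub>R F (cayley x)) \<in> borel_measurable borel"
    using borel_measurable_continuous_on_indicator[OF _ assms] 
    by (rule measurable_compose[OF cayley_measurable]) simp
  moreover have "(\<lambda>x. indicator {0..1} (cayley x) *\<^sub>R F (cayley x)) = (\<lambda>x. F (cayley x))"
    using cayley_bounds by (auto simp: fun_eq_iff less_imp_le)
  ultimately have "(\<lambda>x. F (cayley x)) \<in> borel_measurable M" by simp
  then show ?thesis
    using B cayley_bounds by (intro integrable_const_bound[of _ B]) (auto simp: less_imp_le)
qed

lemma (in real_distribution) integral_cayley_bounds:
  fixes F :: "real \<Rightarrow> real"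
  assumes "continuous_on {0..1} F" "\<And>v. v \<in> {0..1} \<Longrightarrow> \<bar>F v\<bar> \<le> B"
  shows "\<bar>\<integral>x. F (cayley x) \<partial>M\<bar> \<le> B"
proof -
  have "\<bar>\<integral>x. F (cayley x) \<partial>M\<bar> \<le> (\<integral>x. \<bar>F (cayley x)\<bar> \<partial>M)" by (rule integral_abs_bound)
  also have "\<dots> \<le> (\<integral>x. B \<partial>M)"
    by (intro integral_mono integrable_abs integrable_cayley assms)
      (use assms cayley_bounds in \<open>auto simp: less_imp_le\<close>)
  finally show ?thesis using prob_space by simp
qed

text \<open>With \<open>v = 1 / (1 + x)\<close>, the integrand is \<open>v / (1 - s v) = \<Sum>\<^sub>j s\<^sup>j v\<^bsup>j+1\<^esup>\<close>: Stieltjes transforms near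
  \<open>s = 0\<close> determine the moments of \<open>v\<close> one after the other.\<close>

lemma (in real_distribution) stieltjes_expansion:
  assumes nonneg: "AE x in M. 0 \<le> x" and s: "0 < s" "s < 1"
  shows "\<bar>(\<integral>x. 1 / (x + (1 - s)) \<partial>M) - (\<Sum>j\<le>k. s ^ j * (\<integral>x. cayley x ^ Suc j \<partial>M)) - s ^ Suc k / (2 * (1 - s))\<bar>
    \<le> s ^ Suc k / (2 * (1 - s))"
proof -
  define F where "F v = s ^ Suc k * v ^ (k + 2) / (1 - s * v)" for v
  have sv: "1 - s * v > 0" if "v \<in> {0..1}" for v
    using that s by (smt (verit) atLeastAtMost_iff mult_left_le)
  have F: "continuous_on {0..1} F"
    unfolding F_def using sv by (intro continuous_intros) (auto simp: less_le)
  have geo: "v / (1 - s * v) = (\<Sum>j\<le>k. s ^ j * v ^ Suc j) + F v" if v: "v \<in> {0..1}" for v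
  proof -
    have "(\<Sum>j\<le>k. s ^ j * v ^ Suc j) = v * (\<Sum>j\<le>k. (s * v) ^ j)"
      by (simp add: sum_distrib_left power_mult_distrib ac_simps)
    also have "(\<Sum>j\<le>k. (s * v) ^ j) = (1 - (s * v) ^ Suc k) / (1 - s * v)"
      using sv[OF v] by (subst sum_gp0) auto
    finally show ?thesis using sv[OF v] unfolding F_def
      by (simp add: field_simps power_mult_distrib)
  qed
  have "(\<integral>x. 1 / (x + (1 - s)) \<partial>M) = (\<integral>x. (\<Sum>j\<le>k. s ^ j * cayley x ^ Suc j) + F (cayley x) \<partial>M)"
  proof (rule integral_cong_AE)
    show "(\<lambda>x. (\<Sum>j\<le>k. s ^ j * cayley x ^ Suc j) + F (cayley x)) \<in> borel_measurable M"
      using integrable_cayley[OF F] by auto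
    show "AE x in M. 1 / (x + (1 - s)) = (\<Sum>j\<le>k. s ^ j * cayley x ^ Suc j) + F (cayley x)"
      using nonneg
    proof eventually_elim
      case (elim x)
      have "1 / (x + (1 - s)) = cayley x / (1 - s * cayley x)"
        using elim s by (simp add: cayley_def field_simps)
      then show ?case using geo[of "cayley x"] cayley_bounds[of x] by simp
    qed
  qed simp
  also have "\<dots> = (\<Sum>j\<le>k. s ^ j * (\<integral>x. cayley x ^ Suc j \<partial>M)) + (\<integral>x. F (cayley x) \<partial>M)"
  proof -
    have i: "integrable M (\<lambda>x. s ^ j * cayley x ^ Suc j)" for j
      by (rule integrable_cayley[where F="\<lambda>v. s ^ j * v ^ Suc j"]) (intro continuous_intros)
    have "integrable M (\<lambda>x. \<Sum>j\<le>k. s ^ j * cayley x ^ Suc j)"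
      by (intro Bochner_Integration.integrable_sum i)
    moreover have "(\<integral>x. (\<Sum>j\<le>k. s ^ j * cayley x ^ Suc j) \<partial>M) = (\<Sum>j\<le>k. s ^ j * (\<integral>x. cayley x ^ Suc j \<partial>M))"
      by (subst Bochner_Integration.integral_sum[OF i]) simp
    ultimately show ?thesis by (simp only: Bochner_Integration.integral_add[OF _ integrable_cayley[OF F]])
  qed
  finally have e: "(\<integral>x. 1 / (x + (1 - s)) \<partial>M) - (\<Sum>j\<le>k. s ^ j * (\<integral>x. cayley x ^ Suc j \<partial>M)) = (\<integral>x. F (cayley x) \<partial>M)"
    by simp
  \<comment> \<open>The remainder lies between 0 and 2 B. Recentring it at B makes the errors of two
    laws differ by at most 2 B, where a bound on absolute values would give 4 B.\<close>
  define B where "B = s ^ Suc k / (2 * (1 - s))"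
  have Fb: "\<bar>F v - B\<bar> \<le> B" if v: "v \<in> {0..1}" for v
  proof -
    have "0 \<le> F v" using sv[OF v] v s unfolding F_def by (intro divide_nonneg_pos) auto
    moreover have "F v \<le> s ^ Suc k * 1 / (1 - s)"
      unfolding F_def
    proof (rule frac_le)
      show "s ^ Suc k * v ^ (k + 2) \<le> s ^ Suc k * 1" using v s by (intro mult_left_mono power_le_one) auto
      show "1 - s \<le> 1 - s * v" using v s by (simp add: mult_left_le)
    qed (use s in auto)
    moreover have "s ^ Suc k * 1 / (1 - s) = 2 * B" using s by (simp add: B_def field_simps)
    ultimately show ?thesis by linarith
  qed
  have "\<bar>\<integral>x. F (cayley x) - B \<partial>M\<bar> \<le> B"
    by (rule integral_cayley_bounds[where F="\<lambda>v. F v - B"]) (use F Fb in \<open>auto intro!: continuous_intros\<close>)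
  moreover have "(\<integral>x. F (cayley x) - B \<partial>M) = (\<integral>x. F (cayley x) \<partial>M) - B"
    using prob_space by (subst Bochner_Integration.integral_diff) (auto simp: integrable_cayley[OF F])
  ultimately show ?thesis unfolding e B_def[symmetric] by simp
qed

context
  fixes \<mu> :: "nat \<Rightarrow> real measure" and \<nu> :: "real measure"
  assumes rd: "\<And>n. real_distribution (\<mu> n)" "real_distribution \<nu>"
    and nonneg: "\<And>n. AE x in \<mu> n. 0 \<le> x" "AE x in \<nu>. 0 \<le> x"
    and conv: "\<And>j::nat. (\<lambda>n. \<integral>x. 1 / (x + (1 - 1 / (real j + 2))) \<partial>\<mu> n)
        \<longlonglongrightarrow> (\<integral>x. 1 / (x + (1 - 1 / (real j + 2))) \<partial>\<nu>)"
begin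

text \<open>After subtraction of the lower moments and division by s^k, the expansion isolates the
  moment of order k + 1 up to an error s / (1 - s), uniformly in n. So s is fixed small first and n
  sent to infinity afterwards; the values s = 1 / (j + 2) are enough since they tend to 0.\<close>

lemma cayley_moment_conv: "(\<lambda>n. \<integral>x. cayley x ^ Suc k \<partial>\<mu> n) \<longlonglongrightarrow> (\<integral>x. cayley x ^ Suc k \<partial>\<nu>)"
proof (induction k rule: less_induct)
  case (less k)
  define D where "D n = (\<integral>x. cayley x ^ Suc k \<partial>\<mu> n) - (\<integral>x. cayley x ^ Suc k \<partial>\<nu>)" for n
  have "D \<longlonglongrightarrow> 0"
  proof (rule LIMSEQ_I)
    fix e :: real assume e: "e > 0"
    obtain j :: nat where j: "1 / (e / 4) < real j" using reals_Archimedean2 by blast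
    define s where "s = 1 / (real j + 2)"
    have s: "0 < s" "s \<le> 1 / 2" by (auto simp: s_def field_simps)
    then have s1: "s < 1" by simp
    have "s < e / 4"
    proof -
      have "1 < e / 4 * real j" using j e by (simp add: field_simps)
      also have "\<dots> \<le> e / 4 * (real j + 2)" using e by simp
      finally show ?thesis by (simp add: s_def field_simps)
    qed
    moreover have "s / (1 - s) \<le> 2 * s" using s by (simp add: pos_divide_le_eq)
    ultimately have se: "s / (1 - s) < e / 2" by linarith
    define A where "A n = ((\<integral>x. 1 / (x + (1 - s)) \<partial>\<mu> n) - (\<integral>x. 1 / (x + (1 - s)) \<partial>\<nu>))
       - (\<Sum>j<k. s ^ j * ((\<integral>x. cayley x ^ Suc j \<partial>\<mu> n) - (\<integral>x. cayley x ^ Suc j \<partial>\<nu>)))" for n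
    have "A \<longlonglongrightarrow> 0 - (\<Sum>j<k. s ^ j * 0)"
      unfolding A_def using conv[of j] less
      by (intro tendsto_diff tendsto_sum tendsto_mult tendsto_const)
        (auto simp: LIM_zero_iff s_def simp flip: s_def)
    then have "A \<longlonglongrightarrow> 0" by simp
    moreover have "s ^ k * e / 2 > 0" using e s by simp
    ultimately obtain N where N: "\<And>n. n \<ge> N \<Longrightarrow> norm (A n - 0) < s ^ k * e / 2"
      using LIMSEQ_D by blast
    show "\<exists>no. \<forall>n\<ge>no. norm (D n - 0) < e"
    proof (intro exI allI impI)
      fix n assume n: "n \<ge> N"
      interpret mu: real_distribution "\<mu> n" by (rule rd)
      interpret nu: real_distribution \<nu> by (rule rd)
      have "\<bar>A n - s ^ k * D n\<bar> \<le> s ^ Suc k / (1 - s)"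
      proof -
        have split: "(\<Sum>j\<le>k. f j) = (\<Sum>j<k. f j) + f k" for f :: "nat \<Rightarrow> real"
          by (simp add: lessThan_Suc_atMost[symmetric])
        have "A n - s ^ k * D n = ((\<integral>x. 1 / (x + (1 - s)) \<partial>\<mu> n) - (\<Sum>j\<le>k. s ^ j * (\<integral>x. cayley x ^ Suc j \<partial>\<mu> n)))
          - ((\<integral>x. 1 / (x + (1 - s)) \<partial>\<nu>) - (\<Sum>j\<le>k. s ^ j * (\<integral>x. cayley x ^ Suc j \<partial>\<nu>)))"
          unfolding A_def D_def split by (simp add: right_diff_distrib sum_subtractf)
        moreover have "s ^ Suc k / (1 - s) = 2 * (s ^ Suc k / (2 * (1 - s)))" using s1 by (simp add: field_simps)
        moreover have "\<bar>x - y\<bar> \<le> 2 * B" if "\<bar>x - B\<bar> \<le> B" "\<bar>y - B\<bar> \<le> B" for x y B :: real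
          using that by linarith
        ultimately show ?thesis
          using mu.stieltjes_expansion[OF nonneg(1) s(1) s1, of k] nu.stieltjes_expansion[OF nonneg(2) s(1) s1, of k]
          by (simp only:)
      qed
      moreover have "\<bar>A n\<bar> < s ^ k * e / 2" using N[OF n] by simp
      moreover have "s ^ Suc k / (1 - s) < s ^ k * (e / 2)"
      proof -
        have "s ^ Suc k / (1 - s) = s ^ k * (s / (1 - s))" by simp
        also have "\<dots> < s ^ k * (e / 2)" using se s by (intro mult_strict_left_mono) auto
        finally show ?thesis .
      qed
      ultimately have "\<bar>s ^ k * D n\<bar> < s ^ k * e" by linarith
      then have "s ^ k * \<bar>D n\<bar> < s ^ k * e" using s by (simp add: abs_mult)
      then show "norm (D n - 0) < e" using s by simp
    qed
  qed
  then show ?case unfolding D_def by (simp add: LIM_zero_iff)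
qed

text \<open>Convergence of moments gives convergence for polynomials, and Stone--Weierstrass on
  [0, 1] does the rest; the constant term uses that all the laws have mass 1.\<close>

lemma cayley_continuous_conv:
  fixes F :: "real \<Rightarrow> real"
  assumes F: "continuous_on {0..1} F"
  shows "(\<lambda>n. \<integral>x. F (cayley x) \<partial>\<mu> n) \<longlonglongrightarrow> (\<integral>x. F (cayley x) \<partial>\<nu>)"
proof (rule LIMSEQ_I)
  fix e :: real assume e: "e > 0"
  obtain g where g: "real_polynomial_function g" "\<And>v. v \<in> {0..1} \<Longrightarrow> \<bar>F v - g v\<bar> < e / 3"
    using Stone_Weierstrass_real_polynomial_function[OF _ F, of "e / 3"] e by auto
  obtain a N where gs: "g = (\<lambda>v. \<Sum>i\<le>N. a i * v ^ i)"
    using g(1) unfolding real_polynomial_function_iff_sum by auto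
  have gc: "continuous_on {0..1} g" unfolding gs by (intro continuous_intros)
  have sum: "(\<integral>x. g (cayley x) \<partial>M) = (\<Sum>i\<le>N. a i * (\<integral>x. cayley x ^ i \<partial>M))"
    if "real_distribution M" for M
  proof -
    interpret real_distribution M by fact
    have i: "integrable M (\<lambda>x. a j * cayley x ^ j)" for j
      by (rule integrable_cayley[where F="\<lambda>v. a j * v ^ j"]) (intro continuous_intros)
    show ?thesis unfolding gs by (subst Bochner_Integration.integral_sum[OF i]) simp
  qed
  have mom: "(\<lambda>n. \<integral>x. cayley x ^ i \<partial>\<mu> n) \<longlonglongrightarrow> (\<integral>x. cayley x ^ i \<partial>\<nu>)" for i
  proof (cases i)
    case 0
    have "(\<integral>x. 1 \<partial>M) = (1 :: real)" if "real_distribution M" for M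
    proof -
      interpret real_distribution M by fact
      show ?thesis using prob_space by simp
    qed
    with 0 rd show ?thesis by simp
  next
    case (Suc k)
    then show ?thesis using cayley_moment_conv by simp
  qed
  have "(\<lambda>n. \<integral>x. g (cayley x) \<partial>\<mu> n) \<longlonglongrightarrow> (\<integral>x. g (cayley x) \<partial>\<nu>)"
    unfolding sum[OF rd(1)] sum[OF rd(2)] by (intro tendsto_sum tendsto_mult tendsto_const mom)
  then obtain K where K: "\<And>n. n \<ge> K \<Longrightarrow> \<bar>(\<integral>x. g (cayley x) \<partial>\<mu> n) - (\<integral>x. g (cayley x) \<partial>\<nu>)\<bar> < e / 3"
    using LIMSEQ_D[of _ _ "e / 3"] e by (metis real_norm_def zero_less_divide_iff zero_less_numeral)
  have diff: "\<bar>(\<integral>x. F (cayley x) \<partial>M) - (\<integral>x. g (cayley x) \<partial>M)\<bar> \<le> e / 3"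
    if "real_distribution M" for M
  proof -
    interpret real_distribution M by fact
    have "(\<integral>x. F (cayley x) \<partial>M) - (\<integral>x. g (cayley x) \<partial>M) = (\<integral>x. F (cayley x) - g (cayley x) \<partial>M)"
      by (rule Bochner_Integration.integral_diff[symmetric]) (intro integrable_cayley F gc)+
    also have "\<bar>\<dots>\<bar> \<le> e / 3"
      by (rule integral_cayley_bounds[where F="\<lambda>v. F v - g v"])
        (use g(2) in \<open>auto intro!: continuous_intros F gc less_imp_le\<close>)
    finally show ?thesis .
  qed
  show "\<exists>no. \<forall>n\<ge>no. norm ((\<integral>x. F (cayley x) \<partial>\<mu> n) - (\<integral>x. F (cayley x) \<partial>\<nu>)) < e"
  proof (intro exI allI impI)
    fix n assume "n \<ge> K"
    from K[OF this] diff[OF rd(1), of n] diff[OF rd(2)]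
    show "norm ((\<integral>x. F (cayley x) \<partial>\<mu> n) - (\<integral>x. F (cayley x) \<partial>\<nu>)) < e"
      by (simp only: real_norm_def)
  qed
qed

lemma weak_conv_stieltjes: "weak_conv_m \<mu> \<nu>"
proof (rule integral_cts_step_conv_imp_weak_conv[OF rd])
  fix a b :: real assume ab: "a < b"
  \<comment> \<open>For v < \<delta> the point 1 / v - 1 lies beyond b, where
    \<open>cts_step\<close> has already reached its final value. Freezing v at \<delta> thus changes
    nothing and removes the singularity at v = 0.\<close>
  define \<delta> where "\<delta> = 1 / (2 + \<bar>b\<bar>)"
  have \<delta>: "\<delta> > 0" "1 / \<delta> - 1 = 1 + \<bar>b\<bar>" by (simp_all add: \<delta>_def add_pos_nonneg)
  define F where "F v = cts_step a b (1 / max v \<delta> - 1)" for v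
  have "continuous_on UNIV (cts_step a b)"
    using cts_step_uniformly_continuous[OF ab] by (rule uniformly_continuous_imp_continuous)
  moreover have "continuous_on {0..1} (\<lambda>v. 1 / max v \<delta> - 1)"
  proof (intro continuous_intros ballI)
    fix v :: real
    show "max v \<delta> \<noteq> 0" using \<delta>(1) by (auto simp: max_def)
  qed
  ultimately have F: "continuous_on {0..1} F"
    unfolding F_def by (rule continuous_on_compose2) auto
  have eq: "cts_step a b x = F (cayley x)" if "x \<ge> 0" for x
  proof (cases "cayley x \<ge> \<delta>")
    case True
    then have "1 / max (cayley x) \<delta> - 1 = x" using that by (simp add: cayley_def)
    then show ?thesis by (simp add: F_def)
  next
    case False
    then have "1 / \<delta> < 1 / cayley x" using cayley_bounds[of x] by (intro divide_strict_left_mono) auto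
    then have "x > 1 + \<bar>b\<bar>" using that \<delta>(2) by (simp add: cayley_def)
    then have "b \<le> x" "b \<le> 1 + \<bar>b\<bar>" by linarith+
    moreover have "1 / max (cayley x) \<delta> - 1 = 1 + \<bar>b\<bar>" using False \<delta>(2) by (simp only: max_def if_False if_True) simp
    ultimately show ?thesis unfolding F_def using ab by (simp add: cts_step_def)
  qed
  have int: "(\<integral>x. cts_step a b x \<partial>M) = (\<integral>x. F (cayley x) \<partial>M)"
    if "real_distribution M" "AE x in M. 0 \<le> x" for M
  proof -
    interpret real_distribution M by fact
    show ?thesis
    proof (rule integral_cong_AE)
      show "cts_step a b \<in> borel_measurable M" using integrable_cts_step[OF ab] by auto
      show "(\<lambda>x. F (cayley x)) \<in> borel_measurable M" using integrable_cayley[OF F] by auto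
      show "AE x in M. cts_step a b x = F (cayley x)" using that(2) eq by (auto elim!: eventually_mono)
    qed
  qed
  show "(\<lambda>n. integral\<^sup>L (\<mu> n) (cts_step a b)) \<longlonglongrightarrow> integral\<^sup>L \<nu> (cts_step a b)"
    unfolding int[OF rd(1) nonneg(1)] int[OF rd(2) nonneg(2)] by (rule cayley_continuous_conv[OF F])
qed

end

section \<open>Resolvents of Gram matrices\<close>

text \<open>Matrices are functions of two indices because the index sets vary: lists, sets of
  naturals, sample numbers. A symmetric right inverse of a symmetric matrix is also a left inverse,
  so one identity is enough.\<close>

definition inv_on :: "'i set \<Rightarrow> ('i \<Rightarrow> 'i \<Rightarrow> real) \<Rightarrow> ('i \<Rightarrow> 'i \<Rightarrow> real) \<Rightarrow> bool" where
  "inv_on I S R \<longleftrightarrow> (\<forall>i\<in>I. \<forall>j\<in>I. R i j = R j i) \<and>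
     (\<forall>i\<in>I. \<forall>j\<in>I. (\<Sum>k\<in>I. S i k * R k j) = (if i = j then 1 else 0))"

definition shifted :: "real \<Rightarrow> 'k set \<Rightarrow> ('k \<Rightarrow> 'i \<Rightarrow> real) \<Rightarrow> 'i \<Rightarrow> 'i \<Rightarrow> real" where
  "shifted t K V i j = (if i = j then t else 0) + (\<Sum>k\<in>K. V k i * V k j)"

text \<open>Only the entries with both indices in \<open>I\<close> are determined.\<close>

definition resolvent :: "'i set \<Rightarrow> real \<Rightarrow> 'k set \<Rightarrow> ('k \<Rightarrow> 'i \<Rightarrow> real) \<Rightarrow> 'i \<Rightarrow> 'i \<Rightarrow> real" where
  "resolvent I t K V = (SOME R. inv_on I (shifted t K V) R)"

definition rtrace :: "'i set \<Rightarrow> real \<Rightarrow> 'k set \<Rightarrow> ('k \<Rightarrow> 'i \<Rightarrow> real) \<Rightarrow> real" where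
  "rtrace I t K V = (\<Sum>i\<in>I. resolvent I t K V i i)"

definition app :: "'i set \<Rightarrow> ('i \<Rightarrow> 'i \<Rightarrow> real) \<Rightarrow> ('i \<Rightarrow> real) \<Rightarrow> 'i \<Rightarrow> real" where
  "app I R v i = (\<Sum>j\<in>I. R i j * v j)"

definition qform :: "'i set \<Rightarrow> ('i \<Rightarrow> 'i \<Rightarrow> real) \<Rightarrow> ('i \<Rightarrow> real) \<Rightarrow> real" where
  "qform I R v = (\<Sum>i\<in>I. v i * app I R v i)"

lemma shifted_sym: "shifted t K V i j = shifted t K V j i"
  by (simp add: shifted_def mult.commute)

lemma sum_delta_mult:
  fixes f :: "'i \<Rightarrow> real"
  assumes "finite I" "i \<in> I"
  shows "(\<Sum>k\<in>I. (if i = k then t else 0) * f k) = t * f i"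
    "(\<Sum>k\<in>I. (if k = i then t else 0) * f k) = t * f i"
  using assms by (simp_all add: if_distrib[of "\<lambda>x. x * _"] cong: if_cong)

lemma shifted_mult:
  assumes "finite I" "i \<in> I"
  shows "(\<Sum>k\<in>I. shifted t K V i k * w k) = t * w i + (\<Sum>l\<in>K. V l i * (\<Sum>k\<in>I. V l k * w k))"
proof -
  have "(\<Sum>k\<in>I. shifted t K V i k * w k)
      = (\<Sum>k\<in>I. (if i = k then t else 0) * w k) + (\<Sum>k\<in>I. \<Sum>l\<in>K. V l i * (V l k * w k))"
    by (simp add: shifted_def distrib_right sum.distrib sum_distrib_right mult.assoc)
  also have "(\<Sum>k\<in>I. \<Sum>l\<in>K. V l i * (V l k * w k)) = (\<Sum>l\<in>K. V l i * (\<Sum>k\<in>I. V l k * w k))"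
    by (subst sum.swap) (simp add: sum_distrib_left)
  finally show ?thesis using assms by (simp add: sum_delta_mult)
qed

lemma inv_on_app:
  assumes "finite I" "inv_on I S R" "i \<in> I"
  shows "(\<Sum>k\<in>I. S i k * app I R v k) = v i"
proof -
  have "(\<Sum>k\<in>I. S i k * app I R v k) = (\<Sum>j\<in>I. (\<Sum>k\<in>I. S i k * R k j) * v j)"
    unfolding app_def sum_distrib_left sum_distrib_right
    by (subst sum.swap) (simp add: mult.assoc)
  also have "\<dots> = (\<Sum>j\<in>I. (if i = j then 1 else 0) * v j)"
    using assms by (intro sum.cong) (auto simp: inv_on_def)
  also have "\<dots> = v i" using assms by (simp add: sum_delta_mult)
  finally show ?thesis .
qed

text \<open>Transposition, which the symmetry of S and R allows, turns the right-inverse identity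
  into the left-inverse one.\<close>

lemma app_inv_on:
  assumes "finite I" "inv_on I S R" "i \<in> I" "\<And>i j. S i j = S j i"
  shows "app I R (app I S v) i = v i"
proof -
  have "app I R (app I S v) i = (\<Sum>j\<in>I. (\<Sum>k\<in>I. S j k * R k i) * v j)"
    unfolding app_def sum_distrib_left sum_distrib_right
  proof (subst sum.swap, intro sum.cong refl)
    fix j k assume "j \<in> I" "k \<in> I"
    then have "R i k = R k i" using assms by (auto simp: inv_on_def)
    then show "R i k * (S k j * v j) = S j k * R k i * v j"
      using assms(4)[of j k] by simp
  qed
  also have "\<dots> = (\<Sum>j\<in>I. (if j = i then 1 else 0) * v j)"
    using assms by (intro sum.cong) (auto simp: inv_on_def)
  also have "\<dots> = v i" using assms by (simp add: sum_delta_mult)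
  finally show ?thesis .
qed

lemma inv_on_unique:
  assumes I: "finite I" and R: "inv_on I S R" "inv_on I S R'" and S: "\<And>i j. S i j = S j i"
    and ij: "i \<in> I" "j \<in> I"
  shows "R i j = R' i j"
proof -
  have "R i j = (\<Sum>k\<in>I. (if k = j then 1 else 0) * R i k)"
    using I ij by (simp add: sum_delta_mult)
  also have "\<dots> = (\<Sum>k\<in>I. R i k * (\<Sum>l\<in>I. S k l * R' l j))"
    using R ij by (intro sum.cong) (auto simp: inv_on_def)
  also have "\<dots> = app I R (app I S (\<lambda>l. R' l j)) i" by (simp add: app_def)
  also have "\<dots> = R' i j" using app_inv_on[OF I R(1) ij(1) S] .
  finally show ?thesis .
qed

lemma inv_on_cong:
  assumes "inv_on I S R" "\<And>i j. i \<in> I \<Longrightarrow> j \<in> I \<Longrightarrow> S i j = S' i j"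
    "\<And>i j. i \<in> I \<Longrightarrow> j \<in> I \<Longrightarrow> R i j = R' i j"
  shows "inv_on I S' R'"
proof -
  have "(\<Sum>k\<in>I. S' i k * R' k j) = (\<Sum>k\<in>I. S i k * R k j)" if "i \<in> I" "j \<in> I" for i j
    using assms(2,3) that by (intro sum.cong) auto
  then show ?thesis using assms(1) unfolding inv_on_def by (auto simp flip: assms(3))
qed

text \<open>With w = R v the form equals w^T (t + V^T V) w = t |w|^2 + |V w|^2. This one inequality
  is the source of the bounds on resolvents: positivity, the diagonal, the Frobenius norm, the
  effect of one sample.\<close>

lemma qform_ge:
  assumes I: "finite I" and R: "inv_on I (shifted t K V) R"
  shows "t * (\<Sum>i\<in>I. (app I R v i)\<^sup>2) \<le> qform I R v"
proof -
  define w where "w = app I R v"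
  have "qform I R v = (\<Sum>i\<in>I. (\<Sum>k\<in>I. shifted t K V i k * w k) * w i)"
    unfolding qform_def w_def using inv_on_app[OF I R] by (intro sum.cong) auto
  also have "\<dots> = (\<Sum>i\<in>I. t * (w i)\<^sup>2) + (\<Sum>i\<in>I. \<Sum>l\<in>K. (V l i * w i) * (\<Sum>k\<in>I. V l k * w k))"
    using I by (simp add: shifted_mult distrib_right sum.distrib power2_eq_square sum_distrib_right mult.assoc)
      (simp add: sum_distrib_left sum_distrib_right ac_simps)
  also have "(\<Sum>i\<in>I. \<Sum>l\<in>K. (V l i * w i) * (\<Sum>k\<in>I. V l k * w k)) = (\<Sum>l\<in>K. (\<Sum>k\<in>I. V l k * w k)\<^sup>2)"
    by (subst sum.swap) (simp add: sum_distrib_right[symmetric] power2_eq_square)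
  finally show ?thesis by (simp add: w_def sum_distrib_left sum_nonneg)
qed

lemma qform_nonneg:
  assumes "finite I" "inv_on I (shifted t K V) R" "t > 0"
  shows "0 \<le> qform I R v"
proof -
  have "0 \<le> t * (\<Sum>i\<in>I. (app I R v i)\<^sup>2)" using assms by (simp add: sum_nonneg)
  with qform_ge[OF assms(1,2)] show ?thesis by (rule order_trans[rotated])
qed

text \<open>Sherman--Morrison for the rank-one update by V k; q >= 0 keeps the denominator positive.
  It also yields existence of the inverse: starting from t times the identity, the samples are added
  one at a time, without determinants.\<close>

lemma inv_on_insert:
  assumes I: "finite I" and K: "finite K" "k \<notin> K" and t: "t > 0"
    and R: "inv_on I (shifted t K V) R"
  defines "u \<equiv> app I R (V k)" and "q \<equiv> qform I R (V k)"
  shows "inv_on I (shifted t (insert k K) V) (\<lambda>i j. R i j - u i * u j / (1 + q))"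
  unfolding inv_on_def
proof (intro conjI ballI)
  fix i j assume ij: "i \<in> I" "j \<in> I"
  show "R i j - u i * u j / (1 + q) = R j i - u j * u i / (1 + q)"
  proof -
    have "R i j = R j i" using R ij unfolding inv_on_def by blast
    then show ?thesis by (simp only: mult.commute)
  qed
  have q: "1 + q > 0" using qform_nonneg[OF I R t, of "V k"] by (simp add: q_def)
  let ?S = "shifted t K V"
  have a: "(\<Sum>l\<in>I. ?S i l * R l j) = (if i = j then 1 else 0)"
    using R ij by (simp add: inv_on_def)
  have b: "(\<Sum>l\<in>I. ?S i l * u l) = V k i"
    unfolding u_def by (rule inv_on_app[OF I R ij(1)])
  have c: "(\<Sum>l\<in>I. V k l * R l j) = u j"
    unfolding u_def app_def using R ij by (intro sum.cong) (auto simp: inv_on_def)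
  have d: "(\<Sum>l\<in>I. V k l * u l) = q" by (simp add: q_def qform_def u_def)
  have "(\<Sum>l\<in>I. shifted t (insert k K) V i l * (R l j - u l * u j / (1 + q)))
     = (\<Sum>l\<in>I. (?S i l * R l j - (?S i l * u l) * (u j / (1 + q)))
         + (V k i * (V k l * R l j) - V k i * (V k l * u l) * (u j / (1 + q))))"
    using K by (intro sum.cong refl) (simp add: shifted_def algebra_simps)
  also have "\<dots> = (\<Sum>l\<in>I. ?S i l * R l j) - (\<Sum>l\<in>I. ?S i l * u l) * (u j / (1 + q))
      + (V k i * (\<Sum>l\<in>I. V k l * R l j) - V k i * (\<Sum>l\<in>I. V k l * u l) * (u j / (1 + q)))"
    by (simp only: sum.distrib sum_subtractf sum_distrib_right[symmetric] sum_distrib_left[symmetric])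
  also have "\<dots> = (if i = j then 1 else 0)"
  proof -
    have "V k i * u j = V k i * (u j / (1 + q)) + V k i * q * (u j / (1 + q))"
    proof -
      have "x = x / (1 + q) + x * q / (1 + q)" for x
        using q by (simp add: add_divide_distrib[symmetric] distrib_left[of x 1 q, simplified, symmetric])
      from this[of "V k i * u j"] show ?thesis by (simp add: ac_simps)
    qed
    then show ?thesis unfolding a b c d by linarith
  qed
  finally show "(\<Sum>l\<in>I. shifted t (insert k K) V i l * (R l j - u l * u j / (1 + q)))
    = (if i = j then 1 else 0)" .
qed

lemma inv_on_empty: "finite I \<Longrightarrow> t > 0 \<Longrightarrow> inv_on I (shifted t {} V) (\<lambda>i j. if i = j then 1 / t else 0)"
  by (auto simp: inv_on_def shifted_def if_distrib[of "\<lambda>x. x * _"] cong: if_cong)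

lemma inv_on_ex:
  assumes "finite I" "finite K" "t > 0"
  shows "\<exists>R. inv_on I (shifted t K V) R"
  using assms(2)
proof (induction K rule: finite_induct)
  case empty
  show ?case by (rule exI, rule inv_on_empty[OF assms(1,3)])
next
  case (insert k K)
  then obtain R where "inv_on I (shifted t K V) R" by auto
  then show ?case by (intro exI, rule inv_on_insert[OF assms(1) insert(1,2) assms(3)])
qed

lemma inv_on_resolvent:
  assumes "finite I" "finite K" "t > 0"
  shows "inv_on I (shifted t K V) (resolvent I t K V)"
  unfolding resolvent_def by (rule someI_ex[OF inv_on_ex[OF assms]])

lemma resolvent_eqI:
  assumes "finite I" "finite K" "t > 0" "inv_on I (shifted t K V) R" "i \<in> I" "j \<in> I"
  shows "resolvent I t K V i j = R i j"
  using inv_on_unique[OF assms(1) inv_on_resolvent[OF assms(1-3)] assms(4) shifted_sym assms(5,6)] .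

lemma resolvent_sym:
  "finite I \<Longrightarrow> finite K \<Longrightarrow> t > 0 \<Longrightarrow> i \<in> I \<Longrightarrow> j \<in> I \<Longrightarrow>
    resolvent I t K V i j = resolvent I t K V j i"
  using inv_on_resolvent[of I K t V] by (auto simp: inv_on_def)

lemma resolvent_empty:
  "finite I \<Longrightarrow> t > 0 \<Longrightarrow> i \<in> I \<Longrightarrow> j \<in> I \<Longrightarrow>
    resolvent I t {} V i j = (if i = j then 1 / t else 0)"
  by (intro resolvent_eqI inv_on_empty) auto

lemma resolvent_insert:
  fixes V :: "'k \<Rightarrow> 'i \<Rightarrow> real"
  assumes "finite I" "finite K" "k \<notin> K" "t > 0" "i \<in> I" "j \<in> I"
  defines "R \<equiv> resolvent I t K V"
  shows "resolvent I t (insert k K) V i j =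
    R i j - app I R (V k) i * app I R (V k) j / (1 + qform I R (V k))"
  unfolding R_def using assms(1-6)
  by (intro resolvent_eqI inv_on_insert inv_on_resolvent) auto

text \<open>The resolvent depends on the family only through its Gram matrix, even when the families
  are indexed by different sets. This is what allows equal coordinates to be merged.\<close>

lemma resolvent_cong_gram:
  assumes "finite I" "finite K" "finite K'" "t > 0" "i \<in> I" "j \<in> I"
    "\<And>i j. i \<in> I \<Longrightarrow> j \<in> I \<Longrightarrow> (\<Sum>k\<in>K. V k i * V k j) = (\<Sum>k\<in>K'. V' k i * V' k j)"
  shows "resolvent I t K V i j = resolvent I t K' V' i j"
proof (rule resolvent_eqI[OF assms(1,2,4) _ assms(5,6)], rule inv_on_cong)
  show "inv_on I (shifted t K' V') (resolvent I t K' V')" by (rule inv_on_resolvent[OF assms(1,3,4)])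
  show "shifted t K' V' i j = shifted t K V i j" if "i \<in> I" "j \<in> I" for i j
    unfolding shifted_def assms(7)[OF that] ..
qed simp

lemma rtrace_cong_gram:
  assumes "finite I" "finite K" "finite K'" "t > 0"
    "\<And>i j. i \<in> I \<Longrightarrow> j \<in> I \<Longrightarrow> (\<Sum>k\<in>K. V k i * V k j) = (\<Sum>k\<in>K'. V' k i * V' k j)"
  shows "rtrace I t K V = rtrace I t K' V'"
  unfolding rtrace_def by (rule sum.cong[OF refl]) (rule resolvent_cong_gram[OF assms(1-4) _ _ assms(5)])

section \<open>Bounds and trace identities for one resolvent\<close>

context
  fixes I :: "'i set" and K :: "'k set" and t :: real and V :: "'k \<Rightarrow> 'i \<Rightarrow> real"
  assumes I: "finite I" and K: "finite K" and t: "t > 0"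
begin

lemma resolvent_inv: "inv_on I (shifted t K V) (resolvent I t K V)"
  using I K t by (rule inv_on_resolvent)

text \<open>The inequality \<open>qform_ge\<close> at the i-th unit vector: the form is the diagonal
  entry, and R applied to the vector is the i-th row.\<close>

lemma resolvent_row_le:
  assumes i: "i \<in> I"
  shows "t * (\<Sum>j\<in>I. ((resolvent I t K V) i j)\<^sup>2) \<le> (resolvent I t K V) i i"
proof -
  let ?e = "\<lambda>j. if j = i then 1 else 0 :: real"
  have a: "app I (resolvent I t K V) ?e j = (resolvent I t K V) j i" for j
    using I i by (simp add: app_def if_distrib[of "\<lambda>x. _ * x"] cong: if_cong)
  have "qform I (resolvent I t K V) ?e = (resolvent I t K V) i i"
    using I i by (simp add: qform_def a if_distrib[of "\<lambda>x. x * _"] cong: if_cong)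
  moreover have "(\<Sum>j\<in>I. (app I (resolvent I t K V) ?e j)\<^sup>2) = (\<Sum>j\<in>I. ((resolvent I t K V) i j)\<^sup>2)"
    unfolding a using resolvent_inv i by (intro sum.cong) (auto simp: inv_on_def)
  ultimately show ?thesis using qform_ge[OF I resolvent_inv, of ?e] by simp
qed

lemma resolvent_diag_nonneg: "i \<in> I \<Longrightarrow> 0 \<le> (resolvent I t K V) i i"
  by (rule order_trans[OF _ resolvent_row_le]) (use t in \<open>auto intro!: mult_nonneg_nonneg sum_nonneg\<close>)

lemma resolvent_diag_le:
  assumes i: "i \<in> I"
  shows "(resolvent I t K V) i i \<le> 1 / t"
proof (rule ccontr)
  assume "\<not> (resolvent I t K V) i i \<le> 1 / t"
  then have c: "1 < t * (resolvent I t K V) i i" using t by (simp add: field_simps)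
  have "t * ((resolvent I t K V) i i)\<^sup>2 \<le> t * (\<Sum>j\<in>I. ((resolvent I t K V) i j)\<^sup>2)"
    using t I i by (intro mult_left_mono member_le_sum[where f = "\<lambda>j. (resolvent I t K V i j)\<^sup>2"]) auto
  also have "\<dots> \<le> (resolvent I t K V) i i" by (rule resolvent_row_le[OF i])
  finally have "(t * (resolvent I t K V) i i) * (resolvent I t K V) i i \<le> 1 * (resolvent I t K V) i i" by (simp add: power2_eq_square mult.assoc)
  moreover have "(resolvent I t K V) i i > 0"
  proof (rule ccontr)
    assume "\<not> resolvent I t K V i i > 0"
    then have "t * resolvent I t K V i i \<le> 0" using t by (intro mult_nonneg_nonpos) auto
    with c show False by linarith
  qed
  ultimately show False using c by simp
qed

text \<open>Each row contributes at most 1 / t^2, by \<open>resolvent_row_le\<close> and the bound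
  on the diagonal. This stands in for an operator norm bound.\<close>

lemma resolvent_frobenius_le: "(\<Sum>i\<in>I. \<Sum>j\<in>I. ((resolvent I t K V) i j)\<^sup>2) \<le> real (card I) / t\<^sup>2"
proof -
  have "(\<Sum>i\<in>I. \<Sum>j\<in>I. ((resolvent I t K V) i j)\<^sup>2) \<le> (\<Sum>i\<in>I. 1 / t\<^sup>2)"
  proof (rule sum_mono)
    fix i assume i: "i \<in> I"
    have "t * (\<Sum>j\<in>I. ((resolvent I t K V) i j)\<^sup>2) \<le> 1 / t"
      using resolvent_row_le[OF i] resolvent_diag_le[OF i] by simp
    then show "(\<Sum>j\<in>I. ((resolvent I t K V) i j)\<^sup>2) \<le> 1 / t\<^sup>2"
      using t by (simp add: pos_le_divide_eq power2_eq_square ac_simps)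
  qed
  then show ?thesis by simp
qed

lemma rtrace_nonneg: "0 \<le> rtrace I t K V"
  unfolding rtrace_def using resolvent_diag_nonneg by (auto intro: sum_nonneg)

lemma rtrace_le: "rtrace I t K V \<le> real (card I) / t"
proof -
  have "rtrace I t K V \<le> (\<Sum>i\<in>I. 1 / t)"
    unfolding rtrace_def by (rule sum_mono) (rule resolvent_diag_le)
  then show ?thesis by simp
qed

text \<open>By Sherman--Morrison the trace drops by |R v|^2 / (1 + q), with v the new sample, and t
  |R v|^2 <= q by \<open>qform_ge\<close>. The bound 1 / t holds for every sample, however large,
  and takes the place of eigenvalue interlacing.\<close>

lemma rtrace_insert:
  assumes k: "k \<notin> K"
  shows "rtrace I t (insert k K) V \<le> rtrace I t K V"
    "rtrace I t K V \<le> rtrace I t (insert k K) V + 1 / t"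
proof -
  define u where "u = app I (resolvent I t K V) (V k)"
  define q where "q = qform I (resolvent I t K V) (V k)"
  have q: "q \<ge> 0" unfolding q_def by (rule qform_nonneg[OF I resolvent_inv t])
  have "rtrace I t (insert k K) V = (\<Sum>i\<in>I. (resolvent I t K V) i i - u i * u i / (1 + q))"
    unfolding rtrace_def u_def q_def using I K t k
    by (intro sum.cong refl) (simp add: resolvent_insert)
  also have "\<dots> = rtrace I t K V - (\<Sum>i\<in>I. (u i)\<^sup>2) / (1 + q)"
    by (simp add: rtrace_def sum_subtractf sum_divide_distrib power2_eq_square)
  finally have e: "rtrace I t (insert k K) V = rtrace I t K V - (\<Sum>i\<in>I. (u i)\<^sup>2) / (1 + q)" .
  show "rtrace I t (insert k K) V \<le> rtrace I t K V" using e q by (simp add: sum_nonneg)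
  have "t * (\<Sum>i\<in>I. (u i)\<^sup>2) \<le> q" unfolding u_def q_def by (rule qform_ge[OF I resolvent_inv])
  then have "(\<Sum>i\<in>I. (u i)\<^sup>2) / (1 + q) \<le> 1 / t" using t q by (simp add: field_simps)
  then show "rtrace I t K V \<le> rtrace I t (insert k K) V + 1 / t" using e by simp
qed

text \<open>Inserting v divides R v by 1 + q. Thus the form in the full resolvent is expressed
  through the form in the resolvent that does not involve v.\<close>

lemma qform_resolvent_insert:
  assumes k: "k \<notin> K"
  defines "q \<equiv> qform I (resolvent I t K V) (V k)"
  shows "qform I (resolvent I t (insert k K) V) (V k) = q / (1 + q)"
proof -
  define u where "u = app I (resolvent I t K V) (V k)"
  have q: "q \<ge> 0" unfolding q_def by (rule qform_nonneg[OF I resolvent_inv t])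
  have uq: "(\<Sum>i\<in>I. V k i * u i) = q" by (simp add: u_def q_def qform_def)
  have "app I (resolvent I t (insert k K) V) (V k) i = u i / (1 + q)" if i: "i \<in> I" for i
  proof -
    have "app I (resolvent I t (insert k K) V) (V k) i
        = (\<Sum>j\<in>I. (resolvent I t K V) i j * V k j - u i / (1 + q) * (V k j * u j))"
      unfolding app_def u_def q_def using I K t k i
      by (intro sum.cong refl) (simp add: resolvent_insert app_def algebra_simps)
    also have "\<dots> = u i - u i / (1 + q) * q"
      by (simp only: sum_subtractf sum_distrib_left[symmetric] uq) (simp add: u_def app_def)
    finally show ?thesis using q by (simp add: field_simps)
  qed
  then have "qform I (resolvent I t (insert k K) V) (V k) = (\<Sum>i\<in>I. V k i * u i) / (1 + q)"
    by (simp add: qform_def sum_divide_distrib)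
  then show ?thesis by (simp add: uq)
qed

text \<open>The trace of the identity (t + V^T V) R = 1, with the trace of V^T V R written sample by
  sample.\<close>

lemma sum_qform_resolvent:
  "(\<Sum>k\<in>K. qform I (resolvent I t K V) (V k)) = real (card I) - t * rtrace I t K V"
proof -
  have "real (card I) = (\<Sum>i\<in>I. \<Sum>k\<in>I. shifted t K V i k * (resolvent I t K V) k i)"
  proof -
    have "(\<Sum>k\<in>I. shifted t K V i k * (resolvent I t K V) k i) = 1" if "i \<in> I" for i
      using resolvent_inv that by (auto simp: inv_on_def)
    then show ?thesis by simp
  qed
  also have "\<dots> = (\<Sum>i\<in>I. t * (resolvent I t K V) i i) + (\<Sum>i\<in>I. \<Sum>l\<in>K. V l i * (\<Sum>k\<in>I. V l k * (resolvent I t K V) k i))"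
    using I by (simp add: shifted_mult sum.distrib)
  also have "(\<Sum>i\<in>I. \<Sum>l\<in>K. V l i * (\<Sum>k\<in>I. V l k * (resolvent I t K V) k i)) = (\<Sum>k\<in>K. qform I (resolvent I t K V) (V k))"
    unfolding qform_def app_def
    by (subst sum.swap, intro sum.cong refl arg_cong[of _ _ "\<lambda>x. _ * x"])
      (simp add: resolvent_sym[OF I K t] mult.commute)
  finally show ?thesis by (simp add: rtrace_def sum_distrib_left)
qed

text \<open>Woodbury: with \<open>R\<close> the resolvent of \<open>V\<^sup>T V\<close>, that of \<open>V V\<^sup>T\<close> is \<open>(1 - V R V\<^sup>T) / t\<close>.\<close>

lemma rtrace_dual:
  "rtrace K t I (\<lambda>i k. V k i) = rtrace I t K V + (real (card K) - real (card I)) / t"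
proof -
  define Q where "Q k l = ((if k = l then 1 else 0) - (\<Sum>i\<in>I. V k i * app I (resolvent I t K V) (V l) i)) / t" for k l
  have "inv_on K (shifted t I (\<lambda>i k. V k i)) Q"
    unfolding inv_on_def
  proof (intro conjI ballI)
    fix k l assume kl: "k \<in> K" "l \<in> K"
    have "(\<Sum>i\<in>I. V k i * app I (resolvent I t K V) (V l) i) = (\<Sum>i\<in>I. \<Sum>j\<in>I. V k i * (resolvent I t K V) i j * V l j)"
      by (simp add: app_def sum_distrib_left mult.assoc)
    also have "\<dots> = (\<Sum>i\<in>I. \<Sum>j\<in>I. V l i * (resolvent I t K V) i j * V k j)"
    proof (subst sum.swap, intro sum.cong refl)
      fix i j assume "j \<in> I" "i \<in> I"
      then show "V k j * (resolvent I t K V) j i * V l i = V l i * (resolvent I t K V) i j * V k j"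
        using resolvent_sym[OF I K t, of i j V] by simp
    qed
    also have "\<dots> = (\<Sum>i\<in>I. V l i * app I (resolvent I t K V) (V k) i)"
      by (simp add: app_def sum_distrib_left mult.assoc)
    finally show "Q k l = Q l k"
      unfolding Q_def by (intro arg_cong2[where f = "(/)"] arg_cong2[where f = "(-)"]) auto
    define u where "u = app I (resolvent I t K V) (V l)"
    have u: "t * u i + (\<Sum>k\<in>K. V k i * (\<Sum>j\<in>I. V k j * u j)) = V l i" if "i \<in> I" for i
      unfolding u_def using inv_on_app[OF I resolvent_inv that, of "V l"] unfolding shifted_mult[OF I that] .
    have Qu: "t * Q j l = (if j = l then 1 else 0) - (\<Sum>i\<in>I. V j i * u i)" for j
      using t by (simp add: Q_def u_def)
    have "(\<Sum>j\<in>K. shifted t I (\<lambda>i k. V k i) k j * Q j l)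
        = t * Q k l + (\<Sum>i\<in>I. V k i * (\<Sum>j\<in>K. V j i * Q j l))"
      using shifted_mult[OF K kl(1), of t I "\<lambda>i k. V k i" "\<lambda>j. Q j l"] by simp
    also have "(\<Sum>i\<in>I. V k i * (\<Sum>j\<in>K. V j i * Q j l)) = (\<Sum>i\<in>I. V k i * u i)"
    proof (intro sum.cong refl arg_cong[of _ _ "\<lambda>x. _ * x"])
      fix i assume i: "i \<in> I"
      have "t * (\<Sum>j\<in>K. V j i * Q j l) = (\<Sum>j\<in>K. V j i * (t * Q j l))"
        by (subst sum_distrib_left) (simp only: mult.left_commute)
      also have "\<dots> = (\<Sum>j\<in>K. (if j = l then 1 else 0) * V j i - V j i * (\<Sum>i\<in>I. V j i * u i))"
        unfolding Qu by (simp only: right_diff_distrib mult.commute)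
      also have "\<dots> = V l i - (\<Sum>k\<in>K. V k i * (\<Sum>j\<in>I. V k j * u j))"
        unfolding sum_subtractf sum_delta_mult(2)[OF K kl(2)] by simp
      also have "\<dots> = t * u i" using u[OF i] by simp
      finally show "(\<Sum>j\<in>K. V j i * Q j l) = u i" using t by simp
    qed
    finally show "(\<Sum>j\<in>K. shifted t I (\<lambda>i k. V k i) k j * Q j l) = (if k = l then 1 else 0)"
      using Qu by simp
  qed
  then have "rtrace K t I (\<lambda>i k. V k i) = (\<Sum>k\<in>K. Q k k)"
    unfolding rtrace_def using I K t by (intro sum.cong resolvent_eqI) auto
  also have "\<dots> = (real (card K) - (\<Sum>k\<in>K. qform I (resolvent I t K V) (V k))) / t"
    by (simp add: Q_def qform_def sum_subtractf sum_divide_distrib[symmetric])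
  finally show ?thesis
    unfolding sum_qform_resolvent using t by (simp add: field_simps)
qed

end

text \<open>A perturbation costs at most its rank over t. In the application the roles of samples
  and coordinates are exchanged by \<open>rtrace_dual\<close>, and K' consists of the coordinates to
  be discarded.\<close>

lemma rtrace_union:
  assumes I: "finite I" and K: "finite K" and t: "t > 0" and K': "finite K'" "K \<inter> K' = {}"
  shows "rtrace I t (K \<union> K') V \<le> rtrace I t K V \<and>
    rtrace I t K V \<le> rtrace I t (K \<union> K') V + real (card K') / t"
  using K'
proof (induction K' rule: finite_induct)
  case empty
  then show ?case by simp
next
  case (insert k K')
  have k: "k \<notin> K \<union> K'" "finite (K \<union> K')" using insert K by auto
  have a: "rtrace I t (insert k (K \<union> K')) V \<le> rtrace I t (K \<union> K') V"
    by (rule rtrace_insert(1)[OF I k(2) t k(1)])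
  have b: "rtrace I t (K \<union> K') V \<le> rtrace I t (insert k (K \<union> K')) V + 1 / t"
    by (rule rtrace_insert(2)[OF I k(2) t k(1)])
  have c: "real (card (insert k K')) / t = real (card K') / t + 1 / t"
    using insert by (simp add: add_divide_distrib)
  have d: "rtrace I t (K \<union> K') V \<le> rtrace I t K V"
      "rtrace I t K V \<le> rtrace I t (K \<union> K') V + real (card K') / t"
    using insert by auto
  show ?case unfolding Un_insert_right c using a b d by linarith
qed

section \<open>McDiarmid's inequality\<close>

text \<open>One coordinate is integrated out at a time. Given the others, f lies within \<delta> of
  its average g over that coordinate, so Hoeffding's lemma on an interval of length 2 \<delta> gives
  the factor exp(l^2 \<delta>^2 / 2); and g inherits the bounded differences, so the induction
  hypothesis applies to it.\<close>

lemma mcdiarmid_mgf: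
  fixes P :: "'b measure" and f :: "('k \<Rightarrow> 'b) \<Rightarrow> real"
  assumes P: "prob_space P" and K: "finite K" and l: "l > 0"
    and f: "f \<in> borel_measurable (Pi\<^sub>M K (\<lambda>_. P))"
    and bounded: "\<And>x. x \<in> space (Pi\<^sub>M K (\<lambda>_. P)) \<Longrightarrow> \<bar>f x\<bar> \<le> B"
    and diff: "\<And>x k y. x \<in> space (Pi\<^sub>M K (\<lambda>_. P)) \<Longrightarrow> k \<in> K \<Longrightarrow> y \<in> space P \<Longrightarrow>
      \<bar>f x - f (x(k := y))\<bar> \<le> \<delta>"
  shows "(\<integral>\<^sup>+x. ennreal (exp (l * (f x - (\<integral>x. f x \<partial>Pi\<^sub>M K (\<lambda>_. P))))) \<partial>Pi\<^sub>M K (\<lambda>_. P))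
    \<le> ennreal (exp (real (card K) * (l\<^sup>2 * \<delta>\<^sup>2 / 2)))"
  using K f bounded diff
proof (induction K arbitrary: f rule: finite_induct)
  case empty
  interpret P0: prob_space "Pi\<^sub>M ({} :: 'k set) (\<lambda>_. P)" by (intro prob_space_PiM P)
  have "(\<integral>x. f x \<partial>Pi\<^sub>M {} (\<lambda>_. P)) = (\<integral>x. f (\<lambda>_. undefined) \<partial>Pi\<^sub>M ({} :: 'k set) (\<lambda>_. P))"
    by (intro Bochner_Integration.integral_cong) (auto simp: space_PiM)
  then have "(\<integral>x. f x \<partial>Pi\<^sub>M {} (\<lambda>_. P)) = f (\<lambda>_. undefined)" by (simp add: P0.prob_space)
  moreover have "(\<integral>\<^sup>+x. ennreal (exp (l * (f x - f (\<lambda>_. undefined)))) \<partial>Pi\<^sub>M {} (\<lambda>_. P))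
     = (\<integral>\<^sup>+x. 1 \<partial>Pi\<^sub>M ({} :: 'k set) (\<lambda>_. P))"
    by (intro nn_integral_cong) (auto simp: space_PiM)
  ultimately show ?case by (simp add: P0.emeasure_space_1)
next
  case (insert k K)
  interpret P: prob_space P by (rule P)
  interpret PK: prob_space "Pi\<^sub>M K (\<lambda>_. P)" by (intro prob_space_PiM P)
  interpret PkK: prob_space "Pi\<^sub>M (insert k K) (\<lambda>_. P)" by (intro prob_space_PiM P)
  interpret ps: product_sigma_finite "\<lambda>_ :: 'k. P" by unfold_locales
  note [measurable] = insert.prems(1)
  have add [measurable]: "(\<lambda>(x, y). x(k := y)) \<in> (Pi\<^sub>M K (\<lambda>_. P)) \<Otimes>\<^sub>M P \<rightarrow>\<^sub>M Pi\<^sub>M (insert k K) (\<lambda>_. P)"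
    by (rule measurable_add_dim)
  have upd: "x(k := y) \<in> space (Pi\<^sub>M (insert k K) (\<lambda>_. P))"
    if "x \<in> space (Pi\<^sub>M K (\<lambda>_. P))" "y \<in> space P" for x y
    using that by (auto simp: space_PiM PiE_def extensional_def)
  have f2 [measurable]: "(\<lambda>(x, y). f (x(k := y))) \<in> borel_measurable ((Pi\<^sub>M K (\<lambda>_. P)) \<Otimes>\<^sub>M P)"
    using measurable_compose[OF add insert.prems(1)] by (simp add: case_prod_unfold)
  have fx: "(\<lambda>y. f (x(k := y))) \<in> borel_measurable P" if "x \<in> space (Pi\<^sub>M K (\<lambda>_. P))" for x
    using measurable_Pair2[OF f2 that] by simp
  have fB: "\<bar>f (x(k := y))\<bar> \<le> B" if "x \<in> space (Pi\<^sub>M K (\<lambda>_. P))" "y \<in> space P" for x y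
    by (rule insert.prems(2)[OF upd[OF that]])
  define g where "g x = (\<integral>y. f (x(k := y)) \<partial>P)" for x
  have fi: "integrable P (\<lambda>y. f (x(k := y)))" if "x \<in> space (Pi\<^sub>M K (\<lambda>_. P))" for x
    using fx[OF that] fB[OF that] by (intro P.integrable_const_bound[of _ B] AE_I2) (simp_all only: real_norm_def)
  have g [measurable]: "g \<in> borel_measurable (Pi\<^sub>M K (\<lambda>_. P))"
    unfolding g_def using f2 by (rule P.borel_measurable_lebesgue_integral)
  have gB: "\<bar>g x\<bar> \<le> B" if x: "x \<in> space (Pi\<^sub>M K (\<lambda>_. P))" for x
  proof -
    have "\<bar>g x\<bar> \<le> (\<integral>y. \<bar>f (x(k := y))\<bar> \<partial>P)" unfolding g_def by (rule integral_abs_bound)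
    also have "\<dots> \<le> (\<integral>y. B \<partial>P)"
      using fi[OF x] fB[OF x] by (intro integral_mono integrable_abs P.integrable_const) (simp_all only:)
    finally show ?thesis by (simp add: P.prob_space)
  qed
  have avg: "\<bar>\<integral>y. h y \<partial>P\<bar> \<le> \<delta>" if "integrable P h" "\<And>y. y \<in> space P \<Longrightarrow> \<bar>h y\<bar> \<le> \<delta>" for h :: "'b \<Rightarrow> real"
  proof -
    have "\<bar>\<integral>y. h y \<partial>P\<bar> \<le> (\<integral>y. \<bar>h y\<bar> \<partial>P)" by (rule integral_abs_bound)
    also have "\<dots> \<le> (\<integral>y. \<delta> \<partial>P)" using that by (intro integral_mono) auto
    finally show ?thesis by (simp add: P.prob_space)
  qed
  have gdiff: "\<bar>g x - g (x(j := y))\<bar> \<le> \<delta>"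
    if x: "x \<in> space (Pi\<^sub>M K (\<lambda>_. P))" and j: "j \<in> K" and y: "y \<in> space P" for x j y
  proof -
    have x': "x(j := y) \<in> space (Pi\<^sub>M K (\<lambda>_. P))"
      using x j y by (auto simp: space_PiM PiE_def extensional_def)
    have jk: "j \<noteq> k" using j insert.hyps by auto
    have "g x - g (x(j := y)) = (\<integral>z. f (x(k := z)) - f (x(j := y, k := z)) \<partial>P)"
      unfolding g_def using fi[OF x] fi[OF x'] by (rule Bochner_Integration.integral_diff[symmetric])
    also have "\<bar>\<dots>\<bar> \<le> \<delta>"
    proof (rule avg)
      show "integrable P (\<lambda>z. f (x(k := z)) - f (x(j := y, k := z)))"
        using fi[OF x] fi[OF x'] by (rule Bochner_Integration.integrable_diff)
      fix z assume z: "z \<in> space P"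
      have "x(j := y, k := z) = x(k := z, j := y)" using jk by (rule fun_upd_twist)
      moreover have "\<bar>f (x(k := z)) - f (x(k := z, j := y))\<bar> \<le> \<delta>"
        by (rule insert.prems(3)[OF upd[OF x z]]) (use j y in auto)
      ultimately show "\<bar>f (x(k := z)) - f (x(j := y, k := z))\<bar> \<le> \<delta>" by (simp only:)
    qed
    finally show ?thesis .
  qed
  have Ef: "(\<integral>x. f x \<partial>Pi\<^sub>M (insert k K) (\<lambda>_. P)) = (\<integral>x. g x \<partial>Pi\<^sub>M K (\<lambda>_. P))"
    unfolding g_def using insert.hyps insert.prems(2)
    by (intro ps.product_integral_insert PkK.integrable_const_bound[of _ B]) auto
  have inner: "(\<integral>\<^sup>+y. ennreal (exp (l * (f (x(k := y)) - g x))) \<partial>P) \<le> ennreal (exp (l\<^sup>2 * \<delta>\<^sup>2 / 2))"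
    if x: "x \<in> space (Pi\<^sub>M K (\<lambda>_. P))" for x
  proof -
    have "\<bar>f (x(k := y)) - g x\<bar> \<le> \<delta>" if y: "y \<in> space P" for y
    proof -
      have "f (x(k := y)) - g x = (\<integral>z. f (x(k := y)) - f (x(k := z)) \<partial>P)"
        unfolding g_def using fi[OF x] by (subst Bochner_Integration.integral_diff) (auto simp: P.prob_space)
      also have "\<bar>\<dots>\<bar> \<le> \<delta>"
      proof (rule avg)
        show "integrable P (\<lambda>z. f (x(k := y)) - f (x(k := z)))" using fi[OF x] by auto
        fix z assume z: "z \<in> space P"
        show "\<bar>f (x(k := y)) - f (x(k := z))\<bar> \<le> \<delta>"
          using insert.prems(3)[OF upd[OF x y], of k z] z by (simp only: fun_upd_upd insertI1)
      qed
      finally show ?thesis .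
    qed
    then interpret b: interval_bounded_random_variable P "\<lambda>y. f (x(k := y))" "g x - \<delta>" "g x + \<delta>"
      using fx[OF x] by unfold_locales (auto simp: abs_le_iff intro!: AE_I2, (smt (verit))+)
    have "(\<integral>\<^sup>+y. ennreal (exp (l * (f (x(k := y)) - g x))) \<partial>P) \<le> ennreal (exp (l\<^sup>2 * (g x + \<delta> - (g x - \<delta>))\<^sup>2 / 8))"
      using b.Hoeffdings_lemma_nn_integral[OF l] by (simp add: g_def)
    also have "l\<^sup>2 * (g x + \<delta> - (g x - \<delta>))\<^sup>2 / 8 = l\<^sup>2 * \<delta>\<^sup>2 / 2" by (simp add: power2_eq_square)
    finally show ?thesis .
  qed
  define Eg where "Eg = (\<integral>x. g x \<partial>Pi\<^sub>M K (\<lambda>_. P))"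
  have "(\<integral>\<^sup>+x. ennreal (exp (l * (f x - Eg))) \<partial>Pi\<^sub>M (insert k K) (\<lambda>_. P))
      = (\<integral>\<^sup>+x. \<integral>\<^sup>+y. ennreal (exp (l * (f (x(k := y)) - Eg))) \<partial>P \<partial>Pi\<^sub>M K (\<lambda>_. P))"
    using insert.hyps by (intro ps.product_nn_integral_insert) auto
  also have "\<dots> = (\<integral>\<^sup>+x. ennreal (exp (l * (g x - Eg))) * (\<integral>\<^sup>+y. ennreal (exp (l * (f (x(k := y)) - g x))) \<partial>P) \<partial>Pi\<^sub>M K (\<lambda>_. P))"
  proof (intro nn_integral_cong)
    fix x assume x: "x \<in> space (Pi\<^sub>M K (\<lambda>_. P))"
    note [measurable] = fx[OF x]
    have "ennreal (exp (l * (f (x(k := y)) - Eg))) = ennreal (exp (l * (g x - Eg))) * ennreal (exp (l * (f (x(k := y)) - g x)))" for y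
      by (simp add: ennreal_mult'[symmetric] exp_add[symmetric] algebra_simps)
    then show "(\<integral>\<^sup>+y. ennreal (exp (l * (f (x(k := y)) - Eg))) \<partial>P)
      = ennreal (exp (l * (g x - Eg))) * (\<integral>\<^sup>+y. ennreal (exp (l * (f (x(k := y)) - g x))) \<partial>P)"
      by (simp add: nn_integral_cmult)
  qed
  also have "\<dots> \<le> (\<integral>\<^sup>+x. ennreal (exp (l * (g x - Eg))) * ennreal (exp (l\<^sup>2 * \<delta>\<^sup>2 / 2)) \<partial>Pi\<^sub>M K (\<lambda>_. P))"
    using inner by (intro nn_integral_mono mult_left_mono) auto
  also have "\<dots> = (\<integral>\<^sup>+x. ennreal (exp (l * (g x - Eg))) \<partial>Pi\<^sub>M K (\<lambda>_. P)) * ennreal (exp (l\<^sup>2 * \<delta>\<^sup>2 / 2))"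
    by (rule nn_integral_multc) auto
  also have "\<dots> \<le> ennreal (exp (real (card K) * (l\<^sup>2 * \<delta>\<^sup>2 / 2))) * ennreal (exp (l\<^sup>2 * \<delta>\<^sup>2 / 2))"
    unfolding Eg_def by (intro mult_right_mono insert.IH g gB gdiff) auto
  also have "\<dots> = ennreal (exp (real (card (insert k K)) * (l\<^sup>2 * \<delta>\<^sup>2 / 2)))"
    using insert.hyps by (simp add: ennreal_mult'[symmetric] exp_add[symmetric] algebra_simps)
  finally show ?case unfolding Ef Eg_def .
qed

lemma mcdiarmid_ge:
  fixes P :: "'b measure" and f :: "('k \<Rightarrow> 'b) \<Rightarrow> real"
  assumes P: "prob_space P" and K: "finite K" "K \<noteq> {}" and e: "e > 0" and d: "\<delta> > 0"
    and f: "f \<in> borel_measurable (Pi\<^sub>M K (\<lambda>_. P))"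
    and bounded: "\<And>x. x \<in> space (Pi\<^sub>M K (\<lambda>_. P)) \<Longrightarrow> \<bar>f x\<bar> \<le> B"
    and diff: "\<And>x k y. x \<in> space (Pi\<^sub>M K (\<lambda>_. P)) \<Longrightarrow> k \<in> K \<Longrightarrow> y \<in> space P \<Longrightarrow>
      \<bar>f x - f (x(k := y))\<bar> \<le> \<delta>"
  defines "Q \<equiv> Pi\<^sub>M K (\<lambda>_. P)"
  shows "measure Q {x \<in> space Q. f x - (\<integral>x. f x \<partial>Q) \<ge> e} \<le> exp (- e\<^sup>2 / (2 * real (card K) * \<delta>\<^sup>2))"
proof -
  interpret Q: prob_space Q unfolding Q_def by (intro prob_space_PiM P)
  have [measurable]: "f \<in> borel_measurable Q" using f by (simp add: Q_def)
  define m where "m = real (card K)"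
  have m: "m > 0" using K by (simp add: m_def card_gt_0_iff)
  \<comment> \<open>The minimiser of - l e + m l^2 \<delta>^2 / 2, the exponent in Chernoff's
    bound.\<close>
  define l where "l = e / (m * \<delta>\<^sup>2)"
  have l: "l > 0" using e d m by (simp add: l_def)
  define h where "h x = f x - (\<integral>x. f x \<partial>Q)" for x
  have [measurable]: "h \<in> borel_measurable Q" unfolding h_def by measurable
  have "emeasure Q {x \<in> space Q. h x \<ge> e} \<le> emeasure Q ({x \<in> space Q. 1 \<le> ennreal (exp (- l * e)) * ennreal (exp (l * h x))})"
  proof (intro emeasure_mono subsetI)
    fix x assume "x \<in> {x \<in> space Q. h x \<ge> e}"
    then have "x \<in> space Q" "l * e \<le> l * h x" using l by auto
    then show "x \<in> {x \<in> space Q. 1 \<le> ennreal (exp (- l * e)) * ennreal (exp (l * h x))}"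
      by (auto simp: ennreal_mult'[symmetric] exp_add[symmetric] simp flip: ennreal_1)
  qed auto
  also have "\<dots> \<le> ennreal (exp (- l * e)) * (\<integral>\<^sup>+x. ennreal (exp (l * h x)) * indicator (space Q) x \<partial>Q)"
    by (rule order_trans[OF _ nn_integral_Markov_inequality[where A="space Q"]]) (auto intro!: emeasure_mono)
  also have "(\<integral>\<^sup>+x. ennreal (exp (l * h x)) * indicator (space Q) x \<partial>Q) = (\<integral>\<^sup>+x. ennreal (exp (l * h x)) \<partial>Q)"
    by (intro nn_integral_cong) auto
  also have "\<dots> \<le> ennreal (exp (m * (l\<^sup>2 * \<delta>\<^sup>2 / 2)))"
    unfolding h_def Q_def m_def by (rule mcdiarmid_mgf[OF P K(1) l f bounded diff])
  also have "ennreal (exp (- l * e)) * ennreal (exp (m * (l\<^sup>2 * \<delta>\<^sup>2 / 2))) = ennreal (exp (- l * e + m * (l\<^sup>2 * \<delta>\<^sup>2 / 2)))"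
    by (simp add: ennreal_mult'[symmetric] exp_add[symmetric])
  also have "- l * e + m * (l\<^sup>2 * \<delta>\<^sup>2 / 2) = - e\<^sup>2 / (2 * m * \<delta>\<^sup>2)"
    using m d by (simp add: l_def field_simps power2_eq_square)
  finally have "emeasure Q {x \<in> space Q. h x \<ge> e} \<le> ennreal (exp (- e\<^sup>2 / (2 * m * \<delta>\<^sup>2)))"
    by (simp add: mult_left_mono)
  then show ?thesis unfolding h_def m_def by (simp add: Q.emeasure_eq_measure)
qed

lemma mcdiarmid:
  fixes P :: "'b measure" and f :: "('k \<Rightarrow> 'b) \<Rightarrow> real"
  assumes P: "prob_space P" and K: "finite K" "K \<noteq> {}" and e: "e > 0" and d: "\<delta> > 0"
    and f: "f \<in> borel_measurable (Pi\<^sub>M K (\<lambda>_. P))"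
    and bounded: "\<And>x. x \<in> space (Pi\<^sub>M K (\<lambda>_. P)) \<Longrightarrow> \<bar>f x\<bar> \<le> B"
    and diff: "\<And>x k y. x \<in> space (Pi\<^sub>M K (\<lambda>_. P)) \<Longrightarrow> k \<in> K \<Longrightarrow> y \<in> space P \<Longrightarrow>
      \<bar>f x - f (x(k := y))\<bar> \<le> \<delta>"
  defines "Q \<equiv> Pi\<^sub>M K (\<lambda>_. P)"
  shows "measure Q {x \<in> space Q. \<bar>f x - (\<integral>x. f x \<partial>Q)\<bar> \<ge> e} \<le> 2 * exp (- e\<^sup>2 / (2 * real (card K) * \<delta>\<^sup>2))"
proof -
  interpret Q: prob_space Q unfolding Q_def by (intro prob_space_PiM P)
  have [measurable]: "f \<in> borel_measurable Q" using f by (simp add: Q_def)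
  have "{x \<in> space Q. \<bar>f x - (\<integral>x. f x \<partial>Q)\<bar> \<ge> e}
    \<subseteq> {x \<in> space Q. f x - (\<integral>x. f x \<partial>Q) \<ge> e} \<union> {x \<in> space Q. - f x - (\<integral>x. - f x \<partial>Q) \<ge> e}"
    by (auto simp: abs_if split: if_splits)
  then have "measure Q {x \<in> space Q. \<bar>f x - (\<integral>x. f x \<partial>Q)\<bar> \<ge> e} \<le>
    measure Q ({x \<in> space Q. f x - (\<integral>x. f x \<partial>Q) \<ge> e} \<union> {x \<in> space Q. - f x - (\<integral>x. - f x \<partial>Q) \<ge> e})"
    by (intro Q.finite_measure_mono) auto
  also have "\<dots> \<le> measure Q {x \<in> space Q. f x - (\<integral>x. f x \<partial>Q) \<ge> e} + measure Q {x \<in> space Q. - f x - (\<integral>x. - f x \<partial>Q) \<ge> e}"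
    by (intro measure_Un_le) auto
  also have "\<dots> \<le> exp (- e\<^sup>2 / (2 * real (card K) * \<delta>\<^sup>2)) + exp (- e\<^sup>2 / (2 * real (card K) * \<delta>\<^sup>2))"
    unfolding Q_def
    by (intro add_mono mcdiarmid_ge[OF P K e d, where B=B])
      (use f bounded diff in \<open>auto simp: abs_minus_commute\<close>)
  finally show ?thesis by simp
qed

section \<open>Spectra of Gram matrices\<close>

lemma rtrace_reindex:
  assumes I: "finite I" and K: "finite K" and t: "t > 0" and p: "bij_betw p J I"
  shows "rtrace J t K (\<lambda>k j. V k (p j)) = rtrace I t K V"
proof -
  have J: "finite J" using bij_betw_finite[OF p] I by simp
  have pI: "p j \<in> I" if "j \<in> J" for j using p that by (auto simp: bij_betw_def)
  have inj: "p i = p j \<longleftrightarrow> i = j" if "i \<in> J" "j \<in> J" for i j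
    using p that by (auto simp: bij_betw_def inj_on_def)
  note R = inv_on_resolvent[OF I K t, of V]
  have "inv_on J (shifted t K (\<lambda>k j. V k (p j))) (\<lambda>i j. resolvent I t K V (p i) (p j))"
    unfolding inv_on_def
  proof (intro conjI ballI)
    fix i j assume ij: "i \<in> J" "j \<in> J"
    show "resolvent I t K V (p i) (p j) = resolvent I t K V (p j) (p i)"
      by (rule resolvent_sym[OF I K t pI[OF ij(1)] pI[OF ij(2)]])
    have "(\<Sum>k\<in>J. shifted t K (\<lambda>k j. V k (p j)) i k * resolvent I t K V (p k) (p j))
      = (\<Sum>k\<in>J. shifted t K V (p i) (p k) * resolvent I t K V (p k) (p j))"
      by (rule sum.cong) (simp_all add: shifted_def inj ij)
    also have "\<dots> = (\<Sum>k\<in>I. shifted t K V (p i) k * resolvent I t K V k (p j))"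
      by (rule sum.reindex_bij_betw[OF p])
    also have "\<dots> = (if i = j then 1 else 0)"
      using R pI[OF ij(1)] pI[OF ij(2)] inj[OF ij] by (simp add: inv_on_def)
    finally show "(\<Sum>k\<in>J. shifted t K (\<lambda>k j. V k (p j)) i k * resolvent I t K V (p k) (p j))
      = (if i = j then 1 else 0)" .
  qed
  then have "rtrace J t K (\<lambda>k j. V k (p j)) = (\<Sum>j\<in>J. resolvent I t K V (p j) (p j))"
    unfolding rtrace_def by (intro sum.cong[OF refl] resolvent_eqI[OF J K t])
  also have "\<dots> = rtrace I t K V"
    unfolding rtrace_def by (rule sum.reindex_bij_betw[OF p])
  finally show ?thesis .
qed

text \<open>Having as many roots as the degree replaces algebraic closedness; for the characteristic
  polynomial of a symmetric matrix \<open>length_eigvals_desc\<close> supplies it.\<close>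

lemma proots_factorization:
  fixes p :: "'a :: field poly"
  assumes "p \<noteq> 0" "size (proots p) = degree p"
  shows "p = Polynomial.smult (lead_coeff p) (\<Prod>x\<in>#proots p. [:- x, 1:])"
  using assms
proof (induction "degree p" arbitrary: p)
  case 0
  then obtain a where "p = [:a:]" by (metis degree_eq_zeroE)
  then show ?case by simp
next
  case (Suc k)
  then have "proots p \<noteq> {#}" by auto
  then obtain a where "a \<in># proots p" by blast
  then have "poly p a = 0" using Suc.prems by simp
  then obtain q where q: "p = [:- a, 1:] * q" by (auto simp: poly_eq_0_iff_dvd dvd_def)
  then have q0: "q \<noteq> 0" using Suc.prems by auto
  have pr: "proots p = add_mset a (proots q)" unfolding q by (subst proots_mult) (use q0 in auto)
  have dg: "degree p = Suc (degree q)" unfolding q by (subst degree_mult_eq) (use q0 in auto)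
  have "q = Polynomial.smult (lead_coeff q) (\<Prod>x\<in>#proots q. [:- x, 1:])"
    by (rule Suc.hyps(1)) (use Suc pr dg q0 in auto)
  moreover have "lead_coeff p = lead_coeff q" unfolding q by (subst lead_coeff_mult) simp
  ultimately have "p = [:- a, 1:] * Polynomial.smult (lead_coeff p) (\<Prod>x\<in>#proots q. [:- x, 1:])"
    using q by (metis (no_types))
  then show ?case unfolding pr by (simp only: image_mset_add_mset prod_mset.add_mset mult_smult_right)
qed

text \<open>The logarithmic derivative p'/p, which turns a sum over the spectrum into a quotient of
  two polynomial values.\<close>

lemma poly_pderiv_prod_linear:
  fixes s :: "'a :: field"
  assumes "s \<notin># M"
  shows "poly (pderiv (\<Prod>x\<in>#M. [:- x, 1:])) s = poly (\<Prod>x\<in>#M. [:- x, 1:]) s * (\<Sum>x\<in>#M. 1 / (s - x))"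
  using assms
proof (induction M)
  case (add x M)
  then have "s - x \<noteq> 0" by auto
  let ?q = "\<Prod>x\<in>#M. [:- x, 1:]"
  define h where "h = (\<Sum>x\<in>#M. 1 / (s - x))"
  have "poly (pderiv ([:- x, 1:] * ?q)) s = (s - x) * poly (pderiv ?q) s + poly ?q s"
    by (simp only: pderiv_mult pderiv_pCons) (simp add: algebra_simps)
  also have "poly (pderiv ?q) s = poly ?q s * h" using add by (simp add: h_def)
  also have "(s - x) * (poly ?q s * h) + poly ?q s
      = (s - x) * poly ?q s * (1 / (s - x) + h)"
    unfolding distrib_left using \<open>s - x \<noteq> 0\<close> by simp
  also have "(s - x) * poly ?q s = poly ([:- x, 1:] * ?q) s" by (simp add: algebra_simps)
  finally show ?case by (simp add: h_def)
qed simp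

text \<open>Cramer's rule: a diagonal cofactor is the determinant times the diagonal entry of the
  inverse. The sign is there because the characteristic polynomial at -t is the determinant of - (t
  + V^T V), whose inverse is - R.\<close>

lemma det_uminus_shifted:
  fixes V :: "'k \<Rightarrow> nat \<Rightarrow> real" and n :: nat
  assumes K: "finite K" and t: "t > 0"
  defines "C \<equiv> mat n n (\<lambda>(a, b). - shifted t K V a b)"
  shows "det C \<noteq> 0" "i < n \<Longrightarrow> det (mat_delete C i i) = - det C * resolvent {..<n} t K V i i"
proof -
  let ?R = "resolvent {..<n} t K V"
  have C: "C \<in> carrier_mat n n" by (simp add: C_def)
  define D where "D = mat n n (\<lambda>(a, b). - ?R a b)"
  have D: "D \<in> carrier_mat n n" by (simp add: D_def)
  have inv: "inv_on {..<n} (shifted t K V) ?R" by (rule inv_on_resolvent[OF _ K t]) simp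
  have "C * D = 1\<^sub>m n"
    by (rule eq_matI) (use inv in \<open>auto simp: C_def D_def scalar_prod_def inv_on_def atLeast0LessThan sum_negf\<close>)
  then have "det C * det D = 1" using det_mult[OF C D] by simp
  then show "det C \<noteq> 0" by auto
  have "det C * 1 = det C" by simp
  assume i: "i < n"
  have "D = D * 1\<^sub>m n" using D by simp
  have "D * C = 1\<^sub>m n" by (rule mat_mult_left_right_inverse[OF C D \<open>C * D = 1\<^sub>m n\<close>])
  have "adj_mat C = (D * C) * adj_mat C" using \<open>D * C = 1\<^sub>m n\<close> adj_mat(1)[OF C] by simp
  also have "\<dots> = D * (C * adj_mat C)" using C D adj_mat(1)[OF C] by simp
  also have "\<dots> = D * (det C \<cdot>\<^sub>m 1\<^sub>m n)" using adj_mat(2)[OF C] by simp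
  also have "\<dots> = det C \<cdot>\<^sub>m D" by (simp only: mult_smult_distrib[OF D one_carrier_mat] right_mult_one_mat[OF D])
  finally have "adj_mat C $$ (i, i) = det C * D $$ (i, i)" using D i by simp
  moreover have "adj_mat C $$ (i, i) = det (mat_delete C i i)"
    using C i by (simp add: adj_mat_def cofactor_def)
  ultimately show "det (mat_delete C i i) = - det C * ?R i i" using i by (simp add: D_def)
qed

text \<open>The derivative of the characteristic polynomial p is the sum of those of the principal
  submatrices, and at -t these are diagonal cofactors. Hence p'(-t) / p(-t) = - tr R, while the
  factorisation into linear factors gives minus the sum of 1 / (x + t); no diagonalisation takes
  place. Eigenvalues are nonnegative because p does not vanish at any -t.\<close>

lemma gram_spectrum:
  fixes V :: "'k \<Rightarrow> nat \<Rightarrow> real" and n :: nat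
  assumes K: "finite K"
  defines "S \<equiv> mat n n (\<lambda>(a, b). \<Sum>k\<in>K. V k a * V k b)"
  shows "length (eigvals_desc S) = n"
    "\<And>x. x \<in> set (eigvals_desc S) \<Longrightarrow> x \<ge> 0"
    "\<And>t. t > 0 \<Longrightarrow> (\<Sum>x\<leftarrow>eigvals_desc S. 1 / (x + t)) = rtrace {..<n} t K V"
proof -
  have S: "S \<in> carrier_mat n n" by (simp add: S_def)
  show len: "length (eigvals_desc S) = n"
    by (rule length_eigvals_desc[OF S]) (auto simp: S_def mult.commute intro!: eq_matI)
  let ?p = "char_poly S"
  have p: "degree ?p = n" "lead_coeff ?p = 1" using degree_monic_char_poly[OF S] by auto
  have ms: "mset (eigvals_desc S) = proots ?p" by (simp add: eigvals_desc_def)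
  have size: "size (proots ?p) = degree ?p" using len unfolding ms[symmetric] p by simp
  have p0: "?p \<noteq> 0" using p(2) by auto
  have fac: "?p = (\<Prod>x\<in>#proots ?p. [:- x, 1:])"
    using proots_factorization[OF p0 size] p(2) by simp
  let ?C = "\<lambda>t. mat n n (\<lambda>(a, b). - shifted t K V a b)"
  have cm: "- char_matrix S (- t) = ?C t" for t
    by (rule eq_matI) (auto simp: char_matrix_def S_def shifted_def)
  have pC: "poly ?p (- t) = det (?C t)" for t
    unfolding char_poly_matrix[OF S] cm ..
  have nz: "poly ?p (- t) \<noteq> 0" if "t > 0" for t
    unfolding pC by (rule det_uminus_shifted(1)[OF K that])
  have pos: "x \<ge> 0" if "x \<in># proots ?p" for x
  proof (rule ccontr)
    assume "\<not> x \<ge> 0"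
    then have "poly ?p (- (- x)) \<noteq> 0" by (intro nz) simp
    then show False using that p0 by simp
  qed
  then show "x \<ge> 0" if "x \<in> set (eigvals_desc S)" for x using that by (metis ms set_mset_mset)
  fix t :: real assume t: "t > 0"
  have del: "poly (char_poly (mat_delete S i i)) (- t) = det (mat_delete (?C t) i i)" if i: "i < n" for i
  proof -
    have Sd: "mat_delete S i i \<in> carrier_mat (n - 1) (n - 1)" by (rule mat_delete_carrier[OF S])
    have "- char_matrix (mat_delete S i i) (- t) = mat_delete (?C t) i i"
      by (rule eq_matI) (use i in \<open>auto simp: char_matrix_def S_def shifted_def mat_delete_def\<close>)
    then show ?thesis unfolding char_poly_matrix[OF Sd] by simp
  qed
  have "poly (pderiv ?p) (- t) = (\<Sum>i<n. det (mat_delete (?C t) i i))"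
    unfolding pderiv_char_poly[OF S] poly_sum using del by simp
  also have "\<dots> = (\<Sum>i<n. - det (?C t) * resolvent {..<n} t K V i i)"
    by (rule sum.cong[OF refl]) (simp add: det_uminus_shifted(2)[OF K t])
  also have "\<dots> = - poly ?p (- t) * rtrace {..<n} t K V"
    unfolding pC rtrace_def sum_distrib_left ..
  finally have a: "poly (pderiv ?p) (- t) = - poly ?p (- t) * rtrace {..<n} t K V" .
  have "- t \<notin># proots ?p" using pos[of "- t"] t by auto
  from poly_pderiv_prod_linear[OF this]
  have "poly (pderiv ?p) (- t) = poly ?p (- t) * (\<Sum>x\<in>#proots ?p. 1 / (- t - x))"
    unfolding fac[symmetric] .
  with a have "poly ?p (- t) * (\<Sum>x\<in>#proots ?p. 1 / (- t - x)) = poly ?p (- t) * (- rtrace {..<n} t K V)"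
    by (simp only: mult_minus_left mult_minus_right)
  with nz[OF t] have "(\<Sum>x\<in>#proots ?p. 1 / (- t - x)) = - rtrace {..<n} t K V"
    by (metis mult_left_cancel)
  moreover have "(\<Sum>x\<leftarrow>eigvals_desc S. 1 / (x + t)) = (\<Sum>x\<in>#proots ?p. 1 / (x + t))"
    unfolding ms[symmetric] by (simp flip: sum_mset_sum_list)
  moreover have "(\<Sum>x\<in>#M. 1 / (- t - x)) = - (\<Sum>x\<in>#M. 1 / (x + t))" for M
  proof (induction M)
    case (add x M)
    have "1 / (- t - x) = - (1 / (x + t))" by (metis add.commute minus_add_distrib minus_divide_right diff_conv_add_uminus)
    with add show ?case by simp
  qed simp
  ultimately show "(\<Sum>x\<leftarrow>eigvals_desc S. 1 / (x + t)) = rtrace {..<n} t K V" by simp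
qed

section \<open>Symmetric indices\<close>

lemma rtrace_scale:
  assumes I: "finite I" and K: "finite K" and t: "t > 0" and c: "c > 0"
  shows "rtrace I t K (\<lambda>k i. V k i / sqrt c) = c * rtrace I (c * t) K V"
proof -
  note R = inv_on_resolvent[OF I K, of "c * t" V]
  have sh: "shifted t K (\<lambda>k i. V k i / sqrt c) i j = shifted (c * t) K V i j / c" for i j
    using c by (simp add: shifted_def add_divide_distrib sum_divide_distrib)
  have "inv_on I (shifted t K (\<lambda>k i. V k i / sqrt c)) (\<lambda>i j. c * resolvent I (c * t) K V i j)"
    using R t c unfolding inv_on_def sh by auto
  then have "rtrace I t K (\<lambda>k i. V k i / sqrt c) = (\<Sum>i\<in>I. c * resolvent I (c * t) K V i i)"
    unfolding rtrace_def by (intro sum.cong[OF refl] resolvent_eqI[OF I K t])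
  then show ?thesis by (simp add: rtrace_def sum_distrib_left)
qed

definition sorted_idx :: "nat \<Rightarrow> nat \<Rightarrow> nat list set" where
  "sorted_idx n d = {i \<in> multi_idx n d. sorted i}"

definition subset_idx :: "nat \<Rightarrow> nat \<Rightarrow> nat set set" where
  "subset_idx n d = {S. S \<subseteq> {1..n} \<and> card S = d}"

lemma finite_subset_idx [simp]: "finite (subset_idx n d)"
  by (simp add: subset_idx_def)

lemma card_subset_idx: "card (subset_idx n d) = n choose d"
  using n_subsets[of "{1..n}" d] by (simp add: subset_idx_def)

lemma multi_idx_altdef: "multi_idx n d = set (List.n_lists d [1..<Suc n])"
  by (auto simp: set_n_lists multi_idx_def)

lemma finite_multi_idx [simp]: "finite (multi_idx n d)"
  unfolding multi_idx_altdef by simp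

lemma card_multi_idx: "card (multi_idx n d) = n ^ d"
  using bij_betw_same_card[OF nth_idx_bij[of n d]] by simp

lemma finite_sorted_idx [simp]: "finite (sorted_idx n d)"
  by (simp add: sorted_idx_def)

text \<open>Pascal's rule: the last entry of a nondecreasing list is n, or else all entries are
  below n. The truncated subtraction is right at n = 0 too: one list for d = 0, and (d - 1) choose d
  = 0 lists otherwise.\<close>

lemma card_sorted_idx: "card (sorted_idx n d) = (n + d - 1) choose d"
proof (induction "n + d" arbitrary: n d)
  case 0
  have "sorted_idx 0 0 = {[]}" by (auto simp: sorted_idx_def multi_idx_def)
  then show ?case using 0 by simp
next
  case (Suc k)
  show ?case
  proof (cases "n = 0 \<or> d = 0")
    case True
    then show ?thesis
    proof
      assume "d = 0"
      moreover have "sorted_idx n 0 = {[]}" by (auto simp: sorted_idx_def multi_idx_def)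
      ultimately show ?thesis by simp
    next
      assume n: "n = 0"
      then have d: "d > 0" using Suc by simp
      then have "sorted_idx 0 d = {}" by (auto simp: sorted_idx_def multi_idx_def)
      then show ?thesis using n d by simp
    qed
  next
    case False
    then obtain n' d' where nd: "n = Suc n'" "d = Suc d'" by (metis not0_implies_Suc)
    have eq: "sorted_idx n d = sorted_idx n' d \<union> (\<lambda>i. i @ [n]) ` sorted_idx n d'" (is "?A = ?B \<union> ?C")
    proof (intro equalityI subsetI)
      fix i assume i: "i \<in> ?A"
      then have "i \<noteq> []" by (auto simp: sorted_idx_def multi_idx_def nd)
      then obtain j a where ja: "i = j @ [a]" by (metis rev_exhaust)
      show "i \<in> ?B \<union> ?C"
      proof (cases "a = n")
        case True
        then show ?thesis using i unfolding ja
          by (auto simp: sorted_idx_def multi_idx_def nd sorted_append)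
      next
        case False
        then have "\<forall>b\<in>set i. b \<le> n'" using i unfolding ja
          by (fastforce simp: sorted_idx_def multi_idx_def nd sorted_append)
        then show ?thesis using i by (auto simp: sorted_idx_def multi_idx_def)
      qed
    next
      fix i assume "i \<in> ?B \<union> ?C"
      then show "i \<in> ?A"
        by (auto simp: sorted_idx_def multi_idx_def nd sorted_append subset_iff)
    qed
    have disj: "?B \<inter> ?C = {}" by (auto simp: sorted_idx_def multi_idx_def nd)
    have "card ?A = card ?B + card ?C" unfolding eq by (rule card_Un_disjoint) (use disj in auto)
    also have "card ?C = card (sorted_idx n d')" by (rule card_image) (auto simp: inj_on_def)
    also have "card ?B = (n' + d - 1) choose d" by (rule Suc(1)) (use Suc nd in auto)
    also have "card (sorted_idx n d') = (n + d' - 1) choose d'" by (rule Suc(1)) (use Suc nd in auto)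
    finally show ?thesis using nd by simp
  qed
qed

lemma sort_multi_idx: "i \<in> multi_idx n d \<Longrightarrow> sort i \<in> sorted_idx n d"
  by (simp add: multi_idx_def sorted_idx_def)

lemma card_sort_fibre:
  assumes "a \<in> sorted_idx n d" "distinct a"
  shows "card {i \<in> multi_idx n d. sort i = a} = fact d"
proof -
  have "{i \<in> multi_idx n d. sort i = a} = permutations_of_set (set a)"
  proof (intro equalityI subsetI)
    fix i assume "i \<in> {i \<in> multi_idx n d. sort i = a}"
    then show "i \<in> permutations_of_set (set a)"
      using assms by (auto simp: permutations_of_set_def)
  next
    fix i assume "i \<in> permutations_of_set (set a)"
    then have i: "set i = set a" "distinct i" by (auto simp: permutations_of_set_def)
    have "sort i = a"
      using assms i by (intro sorted_distinct_set_unique) (auto simp: sorted_idx_def)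
    moreover have "length i = length a" using i assms(2) by (metis distinct_card)
    ultimately show "i \<in> {i \<in> multi_idx n d. sort i = a}"
      using assms i by (auto simp: sorted_idx_def multi_idx_def)
  qed
  then have "card {i \<in> multi_idx n d. sort i = a} = fact (card (set a))" by simp
  also have "card (set a) = d" using assms by (simp add: distinct_card sorted_idx_def multi_idx_def)
  finally show ?thesis .
qed

lemma bij_sorted_list_of_set:
  "bij_betw sorted_list_of_set (subset_idx n d) {a \<in> sorted_idx n d. distinct a}"
proof (rule bij_betwI[where g = set])
  show "sorted_list_of_set \<in> subset_idx n d \<rightarrow> {a \<in> sorted_idx n d. distinct a}"
  proof
    fix S assume "S \<in> subset_idx n d"
    then have S: "S \<subseteq> {1..n}" "card S = d" "finite S" by (auto simp: subset_idx_def intro: finite_subset)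
    then show "sorted_list_of_set S \<in> {a \<in> sorted_idx n d. distinct a}"
      by (simp add: sorted_idx_def multi_idx_def)
  qed
  show "set \<in> {a \<in> sorted_idx n d. distinct a} \<rightarrow> subset_idx n d"
    by (auto simp: subset_idx_def sorted_idx_def multi_idx_def distinct_card)
  show "set (sorted_list_of_set S) = S" if "S \<in> subset_idx n d" for S
    using that by (auto simp: subset_idx_def finite_subset)
  show "sorted_list_of_set (set a) = a" if "a \<in> {a \<in> sorted_idx n d. distinct a}" for a
    using that by (auto simp: sorted_idx_def sorted_list_of_set_sort_remdups distinct_remdups_id sorted_sort_id)
qed

text \<open>A Stieltjes sum that blows up at least like (length - N) / t as t tends to 0 forces that
  many zero entries. Positions count from 0, so a nonzero entry at j >= N means j + 1 > N entries
  bounded away from 0.\<close>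

lemma desc_list_zeros:
  fixes es :: "real list"
  assumes desc: "sorted (rev es)" and nonneg: "\<And>x. x \<in> set es \<Longrightarrow> x \<ge> 0" and c: "c > 0"
    and many: "\<And>t. t > 0 \<Longrightarrow> (real (length es) - real N) / t \<le> (\<Sum>x\<leftarrow>es. 1 / (x / c + t))"
    and j: "N \<le> j" "j < length es"
  shows "es ! j = 0"
proof (rule ccontr)
  assume "es ! j \<noteq> 0"
  define e where "e = es ! j / c"
  have e: "e > 0" using \<open>es ! j \<noteq> 0\<close> nonneg[of "es ! j"] j c by (simp add: e_def less_le)
  \<comment> \<open>Small enough that (j + 1) / (e + t) < 1 / t: the j + 1 large entries together
    contribute less than a single zero would.\<close>
  define t where "t = e / (real j + 1)"
  have t: "t > 0" using e by (simp add: t_def)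
  have big: "e \<le> es ! i / c" if "i \<le> j" for i
    using sorted_wrt_nth_less[of "(\<ge>)" es] desc that j c unfolding e_def
    by (metis divide_right_mono less_imp_le order_refl sorted_rev_nth_mono)
  let ?D = "length es"
  have "(\<Sum>x\<leftarrow>es. 1 / (x / c + t)) = (\<Sum>i<?D. 1 / (es ! i / c + t))"
    by (simp add: sum_list_sum_nth atLeast0LessThan)
  also have "\<dots> = (\<Sum>i\<in>{..j}. 1 / (es ! i / c + t)) + (\<Sum>i\<in>{Suc j..<?D}. 1 / (es ! i / c + t))"
    using j by (subst sum.union_disjoint[symmetric]) (auto intro!: sum.cong)
  also have "\<dots> \<le> (\<Sum>i\<in>{..j}. 1 / (e + t)) + (\<Sum>i\<in>{Suc j..<?D}. 1 / t)"
  proof (intro add_mono sum_mono)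
    fix i assume "i \<in> {..j}"
    then show "1 / (es ! i / c + t) \<le> 1 / (e + t)" using big[of i] e t by (intro divide_left_mono) auto
  next
    fix i assume "i \<in> {Suc j..<?D}"
    then have "es ! i / c \<ge> 0" using nonneg[of "es ! i"] c by simp
    then show "1 / (es ! i / c + t) \<le> 1 / t" using t by (intro divide_left_mono) auto
  qed
  also have "\<dots> = (real j + 1) / (e + t) + (real ?D - real j - 1) / t"
  proof -
    have "real (?D - Suc j) = real ?D - real j - 1" using j by simp
    then show ?thesis by simp
  qed
  finally have "(real ?D - real N) / t \<le> (real j + 1) / (e + t) + (real ?D - real j - 1) / t"
    using many[OF t] by linarith
  then have "(real j + 1 - real N) / t \<le> (real j + 1) / (e + t)"
    by (simp add: diff_divide_distrib add_divide_distrib)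
  moreover have "1 / t \<le> (real j + 1 - real N) / t" using j t by (intro divide_right_mono) auto
  moreover have "(real j + 1) / (e + t) < 1 / t"
  proof -
    have "(real j + 1) * t = e" by (simp add: t_def)
    then have "(real j + 1) * t < 1 * (e + t)" using t by simp
    then show ?thesis using e t by (simp add: divide_simps)
  qed
  ultimately show False by linarith
qed

lemma sample_cov_eq:
  "sample_cov n d m x = mat (n ^ d) (n ^ d)
     (\<lambda>(a, b). \<Sum>k\<in>{1..m}. (x k (nth_idx n d a) / sqrt (real m)) * (x k (nth_idx n d b) / sqrt (real m)))"
proof -
  have "u / sqrt (real m) * (v / sqrt (real m)) = 1 / real m * (u * v)" for u v :: real by simp
  then show ?thesis by (simp only: sample_cov_def sum_distrib_left)
qed

text \<open>The sorted index \<open>a\<close> stands for as many equal coordinates as \<open>a\<close> has rearrangements, exactly \<open>d!\<close> if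
  its entries are distinct. The other \<open>N - p\<close> sorted indices cost at most \<open>1 / t\<close> each, and the
  \<open>n\<^sup>d - N\<close> eigenvalues left out are zero.\<close>

lemma sample_cov_stieltjes:
  fixes x :: "nat \<Rightarrow> nat list \<Rightarrow> real"
  assumes n: "n \<ge> 1" and d: "d \<ge> 1"
    and sym: "\<And>k i. k \<in> {1..m} \<Longrightarrow> i \<in> multi_idx n d \<Longrightarrow> x k i = x k (sort i)"
  defines "N \<equiv> (n + d - 1) choose d" and "p \<equiv> n choose d"
    and "Y \<equiv> \<lambda>k S. x k (sorted_list_of_set S) / sqrt (real m)"
    and "lam \<equiv> \<lambda>j. eigval (sample_cov n d m x) j / fact d"
  shows "N \<le> n ^ d" "p \<le> N" "\<And>j. j \<in> {1..N} \<Longrightarrow> lam j \<ge> 0"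
    "\<And>t. t > 0 \<Longrightarrow> rtrace (subset_idx n d) t {1..m} Y \<le> (\<Sum>j=1..N. 1 / (lam j + t))"
    "\<And>t. t > 0 \<Longrightarrow> (\<Sum>j=1..N. 1 / (lam j + t)) \<le> rtrace (subset_idx n d) t {1..m} Y + (real N - real p) / t"
proof -
  let ?K = "{1..m}" and ?I = "multi_idx n d" and ?A = "sorted_idx n d"
  let ?B = "{a \<in> ?A. distinct a}"
  have Ncard: "card ?A = N" by (simp add: N_def card_sorted_idx)
  have pcard: "card ?B = p"
    using bij_betw_same_card[OF bij_sorted_list_of_set[of n d]] by (simp add: p_def card_subset_idx)
  show pN: "p \<le> N" unfolding Ncard[symmetric] pcard[symmetric] by (intro card_mono) auto
  have "card ?A \<le> card ?I" by (intro card_mono) (auto simp: sorted_idx_def)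
  then show ND: "N \<le> n ^ d" by (simp add: Ncard card_multi_idx)
  define es where "es = eigvals_desc (sample_cov n d m x)"
  define f :: real where "f = fact d"
  have f: "f > 0" by (simp add: f_def)
  define V where "V k i = x k i / sqrt (real m)" for k i
  note gs = gram_spectrum[where K = ?K and n = "n ^ d" and V = "\<lambda>k a. V k (nth_idx n d a)"]
  have es_eq: "es = eigvals_desc (mat (n ^ d) (n ^ d) (\<lambda>(a, b). \<Sum>k\<in>?K. V k (nth_idx n d a) * V k (nth_idx n d b)))"
    unfolding es_def sample_cov_eq V_def ..
  have es_len: "length es = n ^ d" unfolding es_eq by (rule gs(1)) simp
  have es_nonneg: "y \<ge> 0" if "y \<in> set es" for y using that unfolding es_eq by (rule gs(2)[rotated]) simp
  have es_sum: "(\<Sum>y\<leftarrow>es. 1 / (y + t)) = rtrace {..<n ^ d} t ?K (\<lambda>k a. V k (nth_idx n d a))" if "t > 0" for t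
    unfolding es_eq by (rule gs(3)[OF _ that]) simp
  \<comment> \<open>The squared weight of a is the number of its rearrangements over d!, so W agrees
    with V on indices with distinct entries.\<close>
  define W where "W a k = sqrt (real (card {i \<in> ?I. sort i = a})) * (V k a / sqrt f)" for a k
  \<comment> \<open>Spectra are compared on the side of the m by m Gram matrix, which is a sum over
    indices: there equal coordinates merge into one weighted term, and dropping an index is a
    rank-one change. Each passage to this side shifts the trace by a difference of dimensions over
    t.\<close>
  have sumK: "(\<Sum>y\<leftarrow>es. 1 / (y / f + t)) = rtrace ?K t ?A W + (real (n ^ d) - real m) / t" if t: "t > 0" for t
  proof -
    have "(\<Sum>y\<leftarrow>es. 1 / (y / f + t)) = (\<Sum>y\<leftarrow>es. f * (1 / (y + f * t)))"
      using f by (intro arg_cong[of _ _ sum_list] map_cong refl) (simp add: field_simps)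
    also have "\<dots> = f * (\<Sum>y\<leftarrow>es. 1 / (y + f * t))" by (rule sum_list_const_mult)
    also have "\<dots> = f * rtrace ?I (f * t) ?K V"
      using f t by (simp add: es_sum rtrace_reindex[OF finite_multi_idx _ _ nth_idx_bij])
    also have "\<dots> = rtrace ?I t ?K (\<lambda>k i. V k i / sqrt f)"
      using f t by (simp add: rtrace_scale)
    also have "\<dots> = rtrace ?K t ?I (\<lambda>i k. V k i / sqrt f) + (real (n ^ d) - real m) / t"
      using rtrace_dual[of ?K ?I t "\<lambda>i k. V k i / sqrt f"] t by (simp add: card_multi_idx)
    also have "rtrace ?K t ?I (\<lambda>i k. V k i / sqrt f) = rtrace ?K t ?A W"
    proof (rule rtrace_cong_gram)
      fix k l assume kl: "k \<in> ?K" "l \<in> ?K"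
      have "(\<Sum>i\<in>?I. V k i / sqrt f * (V l i / sqrt f)) = (\<Sum>i\<in>?I. V k (sort i) / sqrt f * (V l (sort i) / sqrt f))"
        unfolding V_def by (rule sum.cong[OF refl]) (simp only: sym[OF kl(1)] sym[OF kl(2)])
      also have "\<dots> = (\<Sum>a\<in>?A. real (card {i \<in> ?I. sort i = a}) * (V k a / sqrt f * (V l a / sqrt f)))"
        by (rule sum_fun_comp) (auto simp: sort_multi_idx)
      also have "\<dots> = (\<Sum>a\<in>?A. W a k * W a l)"
        by (rule sum.cong[OF refl]) (simp add: W_def ac_simps del: times_divide_eq_right times_divide_eq_left)
      finally show "(\<Sum>i\<in>?I. V k i / sqrt f * (V l i / sqrt f)) = (\<Sum>a\<in>?A. W a k * W a l)" .
    qed (use t in auto)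
    finally show ?thesis .
  qed
  have dualA: "rtrace ?K t ?A W = rtrace ?A t ?K (\<lambda>k a. W a k) + (real m - real N) / t" if "t > 0" for t
    using rtrace_dual[of ?A ?K t "\<lambda>k a. W a k"] that by (simp add: Ncard)
  \<comment> \<open>After merging only N coordinates remain; as their trace is nonnegative, the full
    Stieltjes sum is at least (n^d - N) / t.\<close>
  have zero: "es ! j = 0" if "N \<le> j" "j < length es" for j
  proof (rule desc_list_zeros[OF _ es_nonneg f _ that])
    show "sorted (rev es)" by (simp add: es_def eigvals_desc_def)
    fix t :: real assume t: "t > 0"
    have "0 \<le> rtrace ?A t ?K (\<lambda>k a. W a k)" by (rule rtrace_nonneg) (use t in auto)
    moreover have "(real (n ^ d) - real N) / t = (real m - real N) / t + (real (n ^ d) - real m) / t"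
      by (simp add: diff_divide_distrib)
    ultimately show "(real (length es) - real N) / t \<le> (\<Sum>x\<leftarrow>es. 1 / (x / f + t))"
      unfolding sumK[OF t] dualA[OF t] es_len by linarith
  qed
  have lam: "lam j = es ! (j - 1) / f" for j by (simp add: lam_def eigval_def es_def f_def)
  show "lam j \<ge> 0" if "j \<in> {1..N}" for j
    unfolding lam using that ND es_len f by (intro divide_nonneg_pos es_nonneg nth_mem) auto
  have sumN: "(\<Sum>j=1..N. 1 / (lam j + t)) = rtrace ?K t ?A W + (real N - real m) / t" if t: "t > 0" for t
  proof -
    have "(\<Sum>y\<leftarrow>es. 1 / (y / f + t)) = (\<Sum>j<n ^ d. 1 / (es ! j / f + t))"
      by (simp add: sum_list_sum_nth atLeast0LessThan es_len)
    also have "\<dots> = (\<Sum>j<N. 1 / (es ! j / f + t)) + (\<Sum>j\<in>{N..<n ^ d}. 1 / (es ! j / f + t))"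
      using ND by (subst sum.union_disjoint[symmetric]) (auto intro!: sum.cong)
    also have "(\<Sum>j\<in>{N..<n ^ d}. 1 / (es ! j / f + t)) = (\<Sum>j\<in>{N..<n ^ d}. 1 / t)"
      by (rule sum.cong[OF refl]) (simp add: zero es_len)
    also have "\<dots> = (real (n ^ d) - real N) / t" using ND by (simp add: of_nat_diff)
    also have "(\<Sum>j<N. 1 / (es ! j / f + t)) = (\<Sum>j=1..N. 1 / (lam j + t))"
      unfolding lam by (rule sum.reindex_bij_witness[of _ "\<lambda>j. j - 1" Suc]) auto
    finally show ?thesis using sumK[OF t] by (simp add: diff_divide_distrib)
  qed
  fix t :: real assume t: "t > 0"
  have "rtrace ?B t ?K V = rtrace ?K t ?B W + (real p - real m) / t"
  proof -
    have "rtrace ?B t ?K V = rtrace ?K t ?B (\<lambda>a k. V k a) + (real p - real m) / t"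
      using rtrace_dual[of ?K ?B t "\<lambda>a k. V k a"] t by (simp add: pcard)
    also have "rtrace ?K t ?B (\<lambda>a k. V k a) = rtrace ?K t ?B W"
    proof (rule rtrace_cong_gram)
      fix k l
      show "(\<Sum>a\<in>?B. V k a * V l a) = (\<Sum>a\<in>?B. W a k * W a l)"
      proof (rule sum.cong[OF refl])
        fix a assume "a \<in> ?B"
        then have "W a k = V k a" for k using f by (simp add: W_def card_sort_fibre f_def)
        then show "V k a * V l a = W a k * W a l" by simp
      qed
    qed (use t in auto)
    finally show ?thesis .
  qed
  moreover have "rtrace (subset_idx n d) t ?K Y = rtrace ?B t ?K V"
    unfolding Y_def V_def by (rule rtrace_reindex[OF _ _ t bij_sorted_list_of_set]) auto
  ultimately have Yeq: "rtrace (subset_idx n d) t ?K Y = rtrace ?K t ?B W + (real p - real m) / t" by simp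
  have AB: "?B \<union> (?A - ?B) = ?A" by auto
  have "card (?A - ?B) = N - p"
    using card_Diff_subset[of ?B ?A] by (simp add: Ncard pcard) 
  then have cAB: "real (card (?A - ?B)) = real N - real p" using pN by (simp add: of_nat_diff)
  \<comment> \<open>Here the coordinates act as the rank-one terms: \<open>?A\<close> exceeds
    \<open>?B\<close> by the N - p sorted indices with a repetition.\<close>
  have u: "rtrace ?K t ?A W \<le> rtrace ?K t ?B W \<and> rtrace ?K t ?B W \<le> rtrace ?K t ?A W + (real N - real p) / t"
    using rtrace_union[of ?K ?B t "?A - ?B" W] t unfolding AB cAB by simp
  have fr: "(real N - real p) / t + (real p - real m) / t = (real N - real m) / t"
    by (simp add: diff_divide_distrib)
  show "rtrace (subset_idx n d) t ?K Y \<le> (\<Sum>j=1..N. 1 / (lam j + t))"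
    unfolding Yeq sumN[OF t] using u fr by linarith
  show "(\<Sum>j=1..N. 1 / (lam j + t)) \<le> rtrace (subset_idx n d) t ?K Y + (real N - real p) / t"
    unfolding Yeq sumN[OF t] using u fr by linarith
qed

section \<open>Elementary symmetric polynomials\<close>

definition esym :: "nat \<Rightarrow> nat \<Rightarrow> (nat \<Rightarrow> real) \<Rightarrow> real" where
  "esym n q a = (\<Sum>S\<in>subset_idx n q. \<Prod>i\<in>S. a i)"

lemma subset_idxD: "S \<in> subset_idx n q \<Longrightarrow> finite S \<and> S \<subseteq> {1..n} \<and> card S = q"
  by (auto simp: subset_idx_def intro: finite_subset)

lemma esym_0 [simp]: "esym n 0 a = 1"
proof -
  have "subset_idx n 0 = {{}}" by (auto simp: subset_idx_def dest: finite_subset)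
  then show ?thesis by (simp add: esym_def)
qed

lemma esym_nonneg: "(\<And>i. a i \<ge> 0) \<Longrightarrow> esym n q a \<ge> 0"
  unfolding esym_def by (intro sum_nonneg prod_nonneg) auto

text \<open>Each set T of size q + 1 arises from q + 1 pairs (i, T - {i}); the pairs with i already
  in S form the second sum, whose terms carry a square.\<close>

lemma esym_Suc:
  "(\<Sum>i=1..n. a i) * esym n q a = real (Suc q) * esym n (Suc q) a
     + (\<Sum>i=1..n. \<Sum>S\<in>{S \<in> subset_idx n q. i \<in> S}. a i * (\<Prod>j\<in>S. a j))"
proof -
  have "(\<Sum>i=1..n. a i) * esym n q a = (\<Sum>i=1..n. \<Sum>S\<in>subset_idx n q. a i * (\<Prod>j\<in>S. a j))"
    unfolding esym_def by (rule sum_product)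
  also have "\<dots> = (\<Sum>i=1..n. (\<Sum>S\<in>{S \<in> subset_idx n q. i \<notin> S}. a i * (\<Prod>j\<in>S. a j))
      + (\<Sum>S\<in>{S \<in> subset_idx n q. i \<in> S}. a i * (\<Prod>j\<in>S. a j)))"
    by (intro sum.cong[OF refl], subst sum.union_disjoint[symmetric])
      (auto intro!: sum.cong[OF _ refl])
  also have "\<dots> = (\<Sum>i=1..n. \<Sum>S\<in>{S \<in> subset_idx n q. i \<notin> S}. a i * (\<Prod>j\<in>S. a j))
      + (\<Sum>i=1..n. \<Sum>S\<in>{S \<in> subset_idx n q. i \<in> S}. a i * (\<Prod>j\<in>S. a j))"
    by (rule sum.distrib)
  also have "(\<Sum>i=1..n. \<Sum>S\<in>{S \<in> subset_idx n q. i \<notin> S}. a i * (\<Prod>j\<in>S. a j))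
      = (\<Sum>T\<in>subset_idx n (Suc q). \<Sum>i\<in>T. \<Prod>j\<in>T. a j)"
  proof -
    have "(\<Sum>i=1..n. \<Sum>S\<in>{S \<in> subset_idx n q. i \<notin> S}. a i * (\<Prod>j\<in>S. a j))
      = (\<Sum>(i, S)\<in>Sigma {1..n} (\<lambda>i. {S \<in> subset_idx n q. i \<notin> S}). a i * (\<Prod>j\<in>S. a j))"
      by (rule sum.Sigma) auto
    also have "\<dots> = (\<Sum>(T, i)\<in>Sigma (subset_idx n (Suc q)) (\<lambda>T. T). \<Prod>j\<in>T. a j)"
    proof (rule sum.reindex_bij_witness[of _ "\<lambda>(T, i). (i, T - {i})" "\<lambda>(i, S). (insert i S, i)"])
      fix b assume "b \<in> Sigma (subset_idx n (Suc q)) (\<lambda>T. T)"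
      then show "(case case b of (T, i) \<Rightarrow> (i, T - {i}) of (i, S) \<Rightarrow> (insert i S, i)) = b"
        "(case b of (T, i) \<Rightarrow> (i, T - {i})) \<in> Sigma {1..n} (\<lambda>i. {S \<in> subset_idx n q. i \<notin> S})"
        by (auto dest!: subset_idxD simp: subset_idx_def)
    next
      fix b assume b: "b \<in> Sigma {1..n} (\<lambda>i. {S \<in> subset_idx n q. i \<notin> S})"
      then show "(case case b of (i, S) \<Rightarrow> (insert i S, i) of (T, i) \<Rightarrow> (i, T - {i})) = b"
        by auto
      show "(case b of (i, S) \<Rightarrow> (insert i S, i)) \<in> Sigma (subset_idx n (Suc q)) (\<lambda>T. T)"
        using b by (auto simp: subset_idx_def card_insert_if finite_subset[of _ "{Suc 0..n}"])
      show "(case case b of (i, S) \<Rightarrow> (insert i S, i) of (T, i) \<Rightarrow> \<Prod>j\<in>T. a j) = (case b of (i, S) \<Rightarrow> a i * (\<Prod>j\<in>S. a j))"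
        using b by (auto dest!: subset_idxD)
    qed
    also have "\<dots> = (\<Sum>T\<in>subset_idx n (Suc q). \<Sum>i\<in>T. \<Prod>j\<in>T. a j)"
      by (rule sum.Sigma[symmetric]) (auto dest: subset_idxD)
    finally show ?thesis .
  qed
  also have "\<dots> = real (Suc q) * esym n (Suc q) a"
    unfolding esym_def sum_distrib_left
    by (rule sum.cong[OF refl]) (auto dest!: subset_idxD)
  finally show ?thesis .
qed

text \<open>For i in S the term is \<open>(a i)\<^sup>2\<close> times a product over the q - 1 other
  indices; forgetting that these avoid i only enlarges the sum. The factorials fit a recursion for
  q! e_q. At q = 0 the truncated q - 1 is harmless because of the factor q.\<close>

lemma esym_remainder:
  fixes a :: "nat \<Rightarrow> real" and n q :: nat
  assumes a: "\<And>i. a i \<ge> 0"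
  defines "R \<equiv> \<Sum>i=1..n. \<Sum>S\<in>{S \<in> subset_idx n q. i \<in> S}. a i * (\<Prod>j\<in>S. a j)"
  shows "0 \<le> R"
    "fact q * R \<le> real q * (\<Sum>i=1..n. (a i)\<^sup>2) * (fact (q - 1) * esym n (q - 1) a)"
proof -
  show "0 \<le> R" unfolding R_def using a by (intro sum_nonneg mult_nonneg_nonneg prod_nonneg) auto
  show "fact q * R \<le> real q * (\<Sum>i=1..n. (a i)\<^sup>2) * (fact (q - 1) * esym n (q - 1) a)"
  proof (cases q)
    case 0
    have "{S \<in> subset_idx n q. i \<in> S} = {}" for i using 0 by (auto simp: subset_idx_def dest: finite_subset)
    then show ?thesis unfolding R_def by (simp only: sum.empty 0) simp
  next
    case (Suc r)
    have "(\<Sum>S\<in>{S \<in> subset_idx n q. i \<in> S}. a i * (\<Prod>j\<in>S. a j)) \<le> (a i)\<^sup>2 * esym n r a" for i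
    proof -
      have "(\<Sum>S\<in>{S \<in> subset_idx n q. i \<in> S}. a i * (\<Prod>j\<in>S. a j))
         = (\<Sum>S\<in>{S \<in> subset_idx n q. i \<in> S}. (a i)\<^sup>2 * (\<Prod>j\<in>S - {i}. a j))"
        by (rule sum.cong[OF refl]) (auto dest!: subset_idxD simp: prod.remove power2_eq_square)
      also have "\<dots> = (a i)\<^sup>2 * (\<Sum>S\<in>{S \<in> subset_idx n q. i \<in> S}. \<Prod>j\<in>S - {i}. a j)"
        by (simp add: sum_distrib_left)
      also have "(\<Sum>S\<in>{S \<in> subset_idx n q. i \<in> S}. \<Prod>j\<in>S - {i}. a j)
          = (\<Sum>S\<in>(\<lambda>S. S - {i}) ` {S \<in> subset_idx n q. i \<in> S}. \<Prod>j\<in>S. a j)"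
        by (rule sum.reindex_cong[symmetric, OF _ refl refl, unfolded comp_def]) (auto simp: inj_on_def)
      also have "\<dots> \<le> esym n r a"
        unfolding esym_def
        by (rule sum_mono2) (use Suc a in \<open>auto simp: subset_idx_def intro: prod_nonneg dest: finite_subset\<close>)
      finally show ?thesis by (simp add: mult_left_mono)
    qed
    then have "R \<le> (\<Sum>i=1..n. (a i)\<^sup>2 * esym n r a)" unfolding R_def by (rule sum_mono)
    then have "fact q * R \<le> fact q * ((\<Sum>i=1..n. (a i)\<^sup>2) * esym n r a)"
      by (intro mult_left_mono) (simp_all add: sum_distrib_right)
    then show ?thesis using Suc by (simp add: ac_simps)
  qed
qed

text \<open>P^q is a sum over all q-tuples and q! e_q over those without repetition. A repetition
  occurs at one of q (q - 1) / 2 pairs of positions, each costing at most Q P^(q-2). Formally this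
  is the recursion F(q+1) = P F(q) - R(q) with 0 <= R(q) <= q Q F(q-1); for q < 2 the factor q (q -
  1) disarms the truncated exponent.\<close>

lemma esym_power_bounds:
  fixes a :: "nat \<Rightarrow> real" and n :: nat
  assumes a: "\<And>i. a i \<ge> 0"
  defines "P \<equiv> \<Sum>i=1..n. a i" and "Q \<equiv> \<Sum>i=1..n. (a i)\<^sup>2"
  shows "fact q * esym n q a \<le> P ^ q"
    "P ^ q - fact q * esym n q a \<le> real q * (real q - 1) / 2 * Q * P ^ (q - 2)"
proof -
  have P: "P \<ge> 0" and Q: "Q \<ge> 0" using a by (auto simp: P_def Q_def intro: sum_nonneg)
  define F where "F q = fact q * esym n q a" for q
  have F0: "F q \<ge> 0" for q using esym_nonneg[OF a] by (simp add: F_def)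
  obtain R where R: "\<And>q. F (Suc q) = P * F q - R q" "\<And>q. 0 \<le> R q" "\<And>q. R q \<le> real q * Q * F (q - 1)"
  proof
    let ?R = "\<lambda>q. fact q * (\<Sum>i=1..n. \<Sum>S\<in>{S \<in> subset_idx n q. i \<in> S}. a i * (\<Prod>j\<in>S. a j))"
    show "F (Suc q) = P * F q - ?R q" for q
    proof -
      have "P * F q = fact q * (P * esym n q a)" by (simp add: F_def)
      also have "\<dots> = F (Suc q) + ?R q" unfolding P_def esym_Suc F_def by (simp add: algebra_simps)
      finally show ?thesis by simp
    qed
    show "0 \<le> ?R q" for q using esym_remainder(1)[OF a] by simp
    show "?R q \<le> real q * Q * F (q - 1)" for q unfolding Q_def F_def by (rule esym_remainder(2)[OF a])
  qed
  have up: "F q \<le> P ^ q" for q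
  proof (induction q)
    case (Suc q)
    have "F (Suc q) \<le> P * F q" using R(1,2)[of q] by simp
    also have "\<dots> \<le> P * P ^ q" using Suc P by (rule mult_left_mono)
    finally show ?case by simp
  qed (simp add: F_def)
  then show "fact q * esym n q a \<le> P ^ q" by (simp add: F_def)
  have "P ^ q - F q \<le> real q * (real q - 1) / 2 * Q * P ^ (q - 2)"
  proof (induction q)
    case (Suc q)
    have "P ^ Suc q - F (Suc q) = P * (P ^ q - F q) + R q" by (simp add: R(1) algebra_simps)
    also have "\<dots> \<le> P * (real q * (real q - 1) / 2 * Q * P ^ (q - 2)) + real q * Q * P ^ (q - 1)"
    proof (intro add_mono mult_left_mono[OF Suc P] order_trans[OF R(3)])
      show "real q * Q * F (q - 1) \<le> real q * Q * P ^ (q - 1)" using up Q by (intro mult_left_mono) auto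
    qed
    also have "P * (real q * (real q - 1) / 2 * Q * P ^ (q - 2)) = real q * (real q - 1) / 2 * Q * P ^ (q - 1)"
    proof (cases "q \<ge> 2")
      case True
      then have "P ^ (q - 1) = P * P ^ (q - 2)"
        by (metis Suc_diff_Suc Suc_1 Suc_le_lessD diff_Suc_1 diff_Suc_Suc power_Suc less_eq_Suc_le)
      then show ?thesis by simp
    next
      case False
      then have "q = 0 \<or> q = 1" by auto
      then show ?thesis by auto
    qed
    also have "real q * (real q - 1) / 2 * Q * P ^ (q - 1) + real q * Q * P ^ (q - 1)
        = (real q * (real q - 1) / 2 + real q) * Q * P ^ (q - 1)"
      by (simp only: distrib_right)
    also have "real q * (real q - 1) / 2 + real q = real (Suc q) * (real (Suc q) - 1) / 2"
      by (simp add: field_simps)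
    also have "q - 1 = Suc q - 2" by simp
    finally show ?case .
  qed (simp add: F_def)
  then show "P ^ q - fact q * esym n q a \<le> real q * (real q - 1) / 2 * Q * P ^ (q - 2)" by (simp add: F_def)
qed

lemma prod_le_esym:
  assumes a: "\<And>i. a i \<ge> 0" and S: "S \<in> subset_idx n q"
  shows "(\<Prod>i\<in>S. a i) \<le> esym n q a"
  unfolding esym_def
  by (rule member_le_sum[where f = "\<lambda>S. \<Prod>i\<in>S. a i", OF S]) (use a in \<open>auto intro: prod_nonneg\<close>)

lemma esym_permute:
  assumes s: "\<sigma> permutes {1..n}"
  shows "esym n q (\<lambda>i. a (\<sigma> i)) = esym n q a"
proof -
  have inj: "inj_on \<sigma> S" for S using permutes_inj[OF s] by (rule inj_on_subset) auto
  have bij: "bij_betw (\<lambda>S. \<sigma> ` S) (subset_idx n q) (subset_idx n q)"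
  proof (rule bij_betw_byWitness[where f' = "\<lambda>S. inv_into UNIV \<sigma> ` S"])
    show "\<forall>S\<in>subset_idx n q. inv_into UNIV \<sigma> ` \<sigma> ` S = S" using permutes_inverses(2)[OF s] by (auto simp: image_image)
    show "\<forall>S\<in>subset_idx n q. \<sigma> ` inv_into UNIV \<sigma> ` S = S" using permutes_inverses(1)[OF s] by (auto simp: image_image)
    have *: "\<tau> ` S \<in> subset_idx n q" if "\<tau> permutes {1..n}" "S \<in> subset_idx n q" for \<tau> S
      using that permutes_image[OF that(1)] permutes_inj_on[OF that(1)]
      by (auto simp: subset_idx_def card_image)
    show "(\<lambda>S. \<sigma> ` S) ` subset_idx n q \<subseteq> subset_idx n q" using *[OF s] by auto
    show "(\<lambda>S. inv_into UNIV \<sigma> ` S) ` subset_idx n q \<subseteq> subset_idx n q" using *[OF permutes_inv[OF s]] by auto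
  qed
  have "esym n q (\<lambda>i. a (\<sigma> i)) = (\<Sum>S\<in>subset_idx n q. \<Prod>i\<in>\<sigma> ` S. a i)"
    unfolding esym_def by (rule sum.cong[OF refl]) (simp add: prod.reindex[OF inj])
  also have "\<dots> = esym n q a" unfolding esym_def by (rule sum.reindex_bij_betw[OF bij])
  finally show ?thesis .
qed

lemma permutes_image_subset_idx:
  assumes "D \<in> subset_idx n q" "D' \<in> subset_idx n q"
  obtains \<sigma> where "\<sigma> permutes {1..n}" "\<sigma> ` D = D'"
proof -
  have D: "D \<subseteq> {1..n}" "D' \<subseteq> {1..n}" "card D = card D'" "finite D" "finite D'"
    using assms by (auto dest!: subset_idxD)
  have "card ({1..n} - D) = card ({1..n} - D')" using D by (simp add: card_Diff_subset)
  then obtain g where g: "bij_betw g ({1..n} - D) ({1..n} - D')"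
    using finite_same_card_bij[of "{1..n} - D" "{1..n} - D'"] by auto
  obtain f where f: "bij_betw f D D'" using finite_same_card_bij D by blast
  define \<sigma> where "\<sigma> i = (if i \<in> D then f i else if i \<in> {1..n} then g i else i)" for i
  have "bij_betw \<sigma> D D'" using f by (rule bij_betw_cong[THEN iffD1, rotated]) (simp add: \<sigma>_def)
  moreover have "bij_betw \<sigma> ({1..n} - D) ({1..n} - D')"
    using g by (rule bij_betw_cong[THEN iffD1, rotated]) (simp add: \<sigma>_def)
  ultimately have "bij_betw \<sigma> (D \<union> ({1..n} - D)) (D' \<union> ({1..n} - D'))"
    by (rule bij_betw_combine) auto
  moreover have "D \<union> ({1..n} - D) = {1..n}" "D' \<union> ({1..n} - D') = {1..n}" using D by auto
  ultimately have "\<sigma> permutes {1..n}" using D by (intro bij_imp_permutes) (auto simp: \<sigma>_def)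
  moreover have "\<sigma> ` D = D'" using \<open>bij_betw \<sigma> D D'\<close> by (simp add: bij_betw_def)
  ultimately show ?thesis by (rule that)
qed

section \<open>Moments under exchangeability and unconditionality\<close>

lemma measurable_Rn_component:
  assumes "X \<in> measurable N (Rn n)" "i \<in> {1..n}"
  shows "(\<lambda>\<omega>. X \<omega> i) \<in> borel_measurable N"
  using measurable_compose[OF assms(1) measurable_component_singleton[OF assms(2)]] .

lemma exchangeable_integral:
  fixes g :: "(nat \<Rightarrow> real) \<Rightarrow> real"
  assumes X: "X \<in> measurable N (Rn n)" and ex: "exchangeable N n X" and s: "\<sigma> permutes {1..n}"
    and g: "g \<in> borel_measurable (Rn n)"
  shows "(\<integral>\<omega>. g (X \<omega>) \<partial>N) = (\<integral>\<omega>. g (\<lambda>i\<in>{1..n}. X \<omega> (\<sigma> i)) \<partial>N)"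
proof -
  have m: "(\<lambda>\<omega>. \<lambda>i\<in>{1..n}. X \<omega> (\<sigma> i)) \<in> measurable N (Rn n)"
    by (intro measurable_restrict measurable_Rn_component[OF X]) (use permutes_in_image[OF s] in auto)
  have "(\<integral>\<omega>. g (X \<omega>) \<partial>N) = (\<integral>x. g x \<partial>distr N (Rn n) X)"
    by (rule integral_distr[OF X g, symmetric])
  also have "distr N (Rn n) X = distr N (Rn n) (\<lambda>\<omega>. \<lambda>i\<in>{1..n}. X \<omega> (\<sigma> i))"
    using ex s unfolding exchangeable_def by blast
  also have "(\<integral>x. g x \<partial>\<dots>) = (\<integral>\<omega>. g (\<lambda>i\<in>{1..n}. X \<omega> (\<sigma> i)) \<partial>N)"
    by (rule integral_distr[OF m g])
  finally show ?thesis .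
qed

lemma prob_space_rademacher: "prob_space rademacher"
  unfolding rademacher_def by (rule prob_space_measure_pmf)

lemma measurable_rademacher: "f \<in> borel_measurable rademacher"
  by (simp add: rademacher_def)

lemma integrable_rademacher: "integrable rademacher (f :: real \<Rightarrow> real)"
  unfolding rademacher_def by (rule integrable_measure_pmf_finite) simp

lemma integral_rademacher_odd: "odd k \<Longrightarrow> (\<integral>e. e ^ k \<partial>rademacher) = 0"
  unfolding rademacher_def by (subst integral_pmf_of_set) auto

text \<open>By Fubini the integral over the signs splits off and has a factor E \<epsilon>^k = 0
  with k odd. If the product is not integrable, the Bochner integral is 0 by convention, so the
  identity holds in that case too.\<close>

lemma unconditional_odd:
  assumes N: "prob_space N" and X: "X \<in> measurable N (Rn n)" and un: "unconditional N n X"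
    and j: "j \<in> {1..n}" "odd (k j)"
  shows "(\<integral>\<omega>. (\<Prod>i\<in>{1..n}. X \<omega> i ^ k i) \<partial>N) = 0"
proof -
  let ?E = "Pi\<^sub>M {1..n} (\<lambda>_. rademacher)"
  interpret N: prob_space N by (rule N)
  interpret E: prob_space ?E by (intro prob_space_PiM prob_space_rademacher)
  interpret NE: pair_prob_space N ?E ..
  interpret R: prob_space rademacher by (rule prob_space_rademacher)
  interpret PR: product_sigma_finite "\<lambda>_::nat. rademacher" ..
  have g: "(\<lambda>x. \<Prod>i\<in>{1..n}. x i ^ k i) \<in> borel_measurable (Rn n)"
    by measurable
  have m: "(\<lambda>(\<omega>, \<epsilon>). \<lambda>i\<in>{1..n}. \<epsilon> i * X \<omega> i) \<in> measurable (N \<Otimes>\<^sub>M ?E) (Rn n)"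
    unfolding case_prod_unfold
  proof (intro measurable_restrict borel_measurable_times)
    fix i assume i: "i \<in> {1..n}"
    have "(\<lambda>\<epsilon>. \<epsilon> i) \<in> borel_measurable ?E"
      using measurable_compose[OF measurable_component_singleton[OF i] measurable_rademacher[of "\<lambda>x. x"]] .
    then show "(\<lambda>x. snd x i) \<in> borel_measurable (N \<Otimes>\<^sub>M ?E)" by (rule measurable_compose[OF measurable_snd])
    show "(\<lambda>x. X (fst x) i) \<in> borel_measurable (N \<Otimes>\<^sub>M ?E)"
      using measurable_Rn_component[OF X i] by (rule measurable_compose[OF measurable_fst])
  qed
  have "(\<integral>\<omega>. (\<Prod>i\<in>{1..n}. X \<omega> i ^ k i) \<partial>N) = (\<integral>x. (\<Prod>i\<in>{1..n}. x i ^ k i) \<partial>distr N (Rn n) X)"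
    by (rule integral_distr[OF X g, symmetric])
  also have "distr N (Rn n) X = distr (N \<Otimes>\<^sub>M ?E) (Rn n) (\<lambda>(\<omega>, \<epsilon>). \<lambda>i\<in>{1..n}. \<epsilon> i * X \<omega> i)"
    using un unfolding unconditional_def .
  also have "(\<integral>x. (\<Prod>i\<in>{1..n}. x i ^ k i) \<partial>\<dots>)
      = (\<integral>z. (\<Prod>i\<in>{1..n}. (case z of (\<omega>, \<epsilon>) \<Rightarrow> \<lambda>i\<in>{1..n}. \<epsilon> i * X \<omega> i) i ^ k i) \<partial>(N \<Otimes>\<^sub>M ?E))"
    by (rule integral_distr[OF m g])
  also have "\<dots> = (\<integral>z. (case z of (\<omega>, \<epsilon>) \<Rightarrow> (\<Prod>i\<in>{1..n}. \<epsilon> i ^ k i) * (\<Prod>i\<in>{1..n}. X \<omega> i ^ k i)) \<partial>(N \<Otimes>\<^sub>M ?E))"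
    by (rule Bochner_Integration.integral_cong)
      (auto simp: power_mult_distrib prod.distrib)
  also have "\<dots> = 0"
  proof (cases "integrable (N \<Otimes>\<^sub>M ?E) (\<lambda>(\<omega>, \<epsilon>). (\<Prod>i\<in>{1..n}. \<epsilon> i ^ k i) * (\<Prod>i\<in>{1..n}. X \<omega> i ^ k i))")
    case True
    have "(\<integral>\<epsilon>. (\<Prod>i\<in>{1..n}. \<epsilon> i ^ k i) \<partial>?E) = (\<Prod>i\<in>{1..n}. \<integral>e. e ^ k i \<partial>rademacher)"
      by (rule PR.product_integral_prod) (auto intro: integrable_rademacher)
    also have "\<dots> = 0" using j(1) integral_rademacher_odd[OF j(2)] by (intro prod_zero bexI[of _ j]) auto
    finally have z: "(\<integral>\<epsilon>. (\<Prod>i\<in>{1..n}. \<epsilon> i ^ k i) \<partial>?E) = 0" .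
    have "(\<integral>z. (case z of (\<omega>, \<epsilon>) \<Rightarrow> (\<Prod>i\<in>{1..n}. \<epsilon> i ^ k i) * (\<Prod>i\<in>{1..n}. X \<omega> i ^ k i)) \<partial>(N \<Otimes>\<^sub>M ?E))
      = (\<integral>\<omega>. \<integral>\<epsilon>. (\<Prod>i\<in>{1..n}. \<epsilon> i ^ k i) * (\<Prod>i\<in>{1..n}. X \<omega> i ^ k i) \<partial>?E \<partial>N)"
      using NE.integral_fst'[OF True] by (simp only: prod.case)
    also have "\<dots> = 0"
      by (simp only: integral_mult_left_zero z mult_zero_left integral_zero)
    finally show ?thesis .
  next
    case False
    then show ?thesis by (rule not_integrable_integral_eq)
  qed
  finally show ?thesis .
qed

lemma prod_as_powers:
  fixes x :: "nat \<Rightarrow> 'a :: comm_monoid_mult"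
  assumes "S \<subseteq> {1..n}"
  shows "(\<Prod>i\<in>S. x i) = (\<Prod>i\<in>{1..n}. x i ^ (if i \<in> S then 1 else 0))"
proof -
  have "(\<Prod>i\<in>{1..n}. x i ^ (if i \<in> S then 1 else 0)) = (\<Prod>i\<in>{1..n}. if i \<in> S then x i else 1)"
    by (rule prod.cong) auto
  also have "\<dots> = (\<Prod>i\<in>{1..n} \<inter> S. x i)" by (simp add: prod.inter_restrict)
  also have "{1..n} \<inter> S = S" using assms by auto
  finally show ?thesis ..
qed

definition sdiff :: "'a set \<Rightarrow> 'a set \<Rightarrow> 'a set" where "sdiff S T = (S - T) \<union> (T - S)"

lemma prod4_powers:
  fixes x :: "nat \<Rightarrow> 'a :: comm_monoid_mult"
  assumes "S \<subseteq> {1..n}" "T \<subseteq> {1..n}" "U \<subseteq> {1..n}" "V \<subseteq> {1..n}"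
  shows "(\<Prod>i\<in>S. x i) * (\<Prod>i\<in>T. x i) * ((\<Prod>i\<in>U. x i) * (\<Prod>i\<in>V. x i)) =
    (\<Prod>i\<in>{1..n}. x i ^ ((if i \<in> S then 1 else 0) + (if i \<in> T then 1 else 0)
       + ((if i \<in> U then 1 else 0) + (if i \<in> V then 1 else 0))))"
  unfolding prod_as_powers[OF assms(1)] prod_as_powers[OF assms(2)] prod_as_powers[OF assms(3)]
    prod_as_powers[OF assms(4)] prod.distrib[symmetric] power_add[symmetric] ..

text \<open>Only exponents are compared. On the common symmetric difference each pair contributes 1,
  and off it each contributes 0 or 2; \<open>S \<union> T\<close> carries the symmetric difference
  for both pairs. The asymmetric form leaves a fixed set on one side and, on the other, the part to
  be summed over (U, V).\<close>

lemma prod4_sdiff_eq: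
  fixes x :: "nat \<Rightarrow> real"
  assumes "S \<subseteq> {1..n}" "T \<subseteq> {1..n}" "U \<subseteq> {1..n}" "V \<subseteq> {1..n}" "sdiff S T = sdiff U V"
  shows "(\<Prod>i\<in>S. x i) * (\<Prod>i\<in>T. x i) * ((\<Prod>i\<in>U. x i) * (\<Prod>i\<in>V. x i)) =
    (\<Prod>i\<in>S \<union> T. (x i)\<^sup>2) * (\<Prod>i\<in>U \<inter> V. (x i)\<^sup>2)"
proof -
  have "(\<Prod>i\<in>S \<union> T. (x i)\<^sup>2) * (\<Prod>i\<in>U \<inter> V. (x i)\<^sup>2)
    = (\<Prod>i\<in>S \<union> T. x i) * (\<Prod>i\<in>U \<inter> V. x i) * ((\<Prod>i\<in>S \<union> T. x i) * (\<Prod>i\<in>U \<inter> V. x i))"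
    by (simp add: power2_eq_square prod.distrib)
  also have "\<dots> = (\<Prod>i\<in>S. x i) * (\<Prod>i\<in>T. x i) * ((\<Prod>i\<in>U. x i) * (\<Prod>i\<in>V. x i))"
  proof -
    have "S \<union> T \<subseteq> {1..n}" "U \<inter> V \<subseteq> {1..n}" using assms by auto
    note sub = this
    show ?thesis
      unfolding prod4_powers[OF assms(1-4)] prod4_powers[OF sub sub]
    proof (rule prod.cong[OF refl], rule arg_cong[where f = "(^) _"])
      fix i
      have "(i \<in> S) \<noteq> (i \<in> T) \<longleftrightarrow> (i \<in> U) \<noteq> (i \<in> V)" using assms(5) unfolding sdiff_def by blast
      then show "(if i \<in> S \<union> T then 1 else 0) + (if i \<in> U \<inter> V then 1 else 0) +
         ((if i \<in> S \<union> T then 1 else 0) + (if i \<in> U \<inter> V then 1 else 0)) =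
         (if i \<in> S then 1 else 0) + (if i \<in> T then 1 else 0) +
         ((if i \<in> U then 1 else 0) + (if i \<in> V then 1 else (0::nat)))"
        by auto
    qed
  qed
  finally show ?thesis ..
qed

text \<open>A pair with symmetric difference \<open>W\<close> is determined by \<open>U \<inter> W\<close> and \<open>U \<inter> V\<close>.\<close>

lemma sum_pairs_sdiff_le:
  fixes a :: "nat \<Rightarrow> real"
  assumes a: "\<And>i. a i \<ge> 0" and ST: "S \<in> subset_idx n d" "T \<in> subset_idx n d"
  defines "k \<equiv> card (S - T)"
  shows "(\<Sum>(U, V)\<in>{(U, V). U \<in> subset_idx n d \<and> V \<in> subset_idx n d \<and> sdiff U V = sdiff S T}. \<Prod>i\<in>U \<inter> V. a i)
    \<le> 4 ^ k * esym n (d - k) a"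
proof -
  define W where "W = sdiff S T"
  have cardW: "card (sdiff U V) = 2 * (d - card (U \<inter> V))" "card (U \<inter> V) + card (U - V) = d"
    if "U \<in> subset_idx n d" "V \<in> subset_idx n d" for U V
  proof -
    have f: "finite U" "finite V" "card U = d" "card V = d" using that by (auto dest!: subset_idxD)
    have 1: "card (U \<inter> V) + card (U - V) = d" using f card_Int_Diff[of U V] by simp
    moreover have 2: "card (V \<inter> U) + card (V - U) = d" using f card_Int_Diff[of V U] by simp
    moreover have "card (sdiff U V) = card (U - V) + card (V - U)"
      unfolding sdiff_def using f by (intro card_Un_disjoint) auto
    ultimately show "card (sdiff U V) = 2 * (d - card (U \<inter> V))" "card (U \<inter> V) + card (U - V) = d"
      by (simp_all add: Int_commute)
  qed
  have W: "card W = 2 * k" "finite W"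
    using cardW[OF ST] ST by (auto simp: W_def k_def sdiff_def dest!: subset_idxD)
  define Q where "Q = {(U, V). U \<in> subset_idx n d \<and> V \<in> subset_idx n d \<and> sdiff U V = W}"
  define \<phi> where "\<phi> p = (fst p \<inter> W, fst p \<inter> snd p)" for p :: "nat set \<times> nat set"
  have inj: "inj_on \<phi> Q"
  proof (rule inj_onI)
    fix p q assume p: "p \<in> Q" and q: "q \<in> Q" and e: "\<phi> p = \<phi> q"
    have r: "fst p = (fst p \<inter> W) \<union> (fst p \<inter> snd p)" "snd p = (W - (fst p \<inter> W)) \<union> (fst p \<inter> snd p)"
      if "p \<in> Q" for p
      using that by (auto simp: Q_def sdiff_def)
    show "p = q"
      using r[OF p] r[OF q] e by (auto simp: \<phi>_def prod_eq_iff)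
  qed
  have sub: "\<phi> ` Q \<subseteq> Pow W \<times> subset_idx n (d - k)"
  proof
    fix z assume "z \<in> \<phi> ` Q"
    then obtain U V where UV: "U \<in> subset_idx n d" "V \<in> subset_idx n d" "sdiff U V = W" "z = (U \<inter> W, U \<inter> V)"
      by (auto simp: Q_def \<phi>_def)
    have "card (U \<inter> V) = d - k" using cardW[OF UV(1,2)] UV(3) W by simp
    then show "z \<in> Pow W \<times> subset_idx n (d - k)" using UV by (auto simp: subset_idx_def)
  qed
  have "(\<Sum>(U, V)\<in>Q. \<Prod>i\<in>U \<inter> V. a i) = (\<Sum>p\<in>Q. \<Prod>i\<in>snd (\<phi> p). a i)"
    by (rule sum.cong[OF refl]) (auto simp: \<phi>_def)
  also have "\<dots> = (\<Sum>z\<in>\<phi> ` Q. \<Prod>i\<in>snd z. a i)" by (simp add: sum.reindex[OF inj])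
  also have "\<dots> \<le> (\<Sum>z\<in>Pow W \<times> subset_idx n (d - k). \<Prod>i\<in>snd z. a i)"
    by (rule sum_mono2[OF _ sub]) (use W a in \<open>auto intro: prod_nonneg\<close>)
  also have "\<dots> = (\<Sum>A\<in>Pow W. esym n (d - k) a)"
    unfolding esym_def by (subst sum.cartesian_product) (rule sum.cong, auto)
  \<comment> \<open>W has 2 k elements, hence \<open>4 ^ k\<close> subsets.\<close>
  also have "\<dots> = 4 ^ k * esym n (d - k) a"
    using W by (simp add: card_Pow power_mult)
  finally show ?thesis by (simp add: Q_def W_def)
qed

section \<open>Quadratic forms in power vectors\<close>

lemma integral_double_sum:
  fixes f :: "'p \<Rightarrow> 'q \<Rightarrow> 'b \<Rightarrow> real"
  assumes "\<And>p q. p \<in> A \<Longrightarrow> q \<in> B \<Longrightarrow> integrable M (f p q)"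
  shows "(\<integral>x. (\<Sum>p\<in>A. \<Sum>q\<in>B. c p q * f p q x) \<partial>M) = (\<Sum>p\<in>A. \<Sum>q\<in>B. c p q * (\<integral>x. f p q x \<partial>M))"
proof -
  have i: "integrable M (\<lambda>x. c p q * f p q x)" if "p \<in> A" "q \<in> B" for p q
    using assms[OF that] by (rule integrable_mult_right)
  have "(\<integral>x. (\<Sum>p\<in>A. \<Sum>q\<in>B. c p q * f p q x) \<partial>M) = (\<Sum>p\<in>A. \<integral>x. (\<Sum>q\<in>B. c p q * f p q x) \<partial>M)"
    by (rule Bochner_Integration.integral_sum) (rule Bochner_Integration.integrable_sum, rule i)
  also have "\<dots> = (\<Sum>p\<in>A. \<Sum>q\<in>B. \<integral>x. c p q * f p q x \<partial>M)"
    by (rule sum.cong[OF refl], rule Bochner_Integration.integral_sum) (rule i)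
  finally show ?thesis by simp
qed

section \<open>Falling factorials against powers\<close>

lemma fact_binomial_step:
  assumes "q < n"
  shows "fact (Suc q) * real (n choose Suc q) = fact q * real (n choose q) * (real n - real q)"
proof -
  have "Suc q * (n choose Suc q) = (n - q) * (n choose q)"
    by (simp only: binomial_absorption binomial_absorb_comp)
  then have "real (Suc q) * real (n choose Suc q) = real (n - q) * real (n choose q)"
    by (simp only: of_nat_mult[symmetric])
  then show ?thesis using assms by (simp add: of_nat_diff) 
qed

text \<open>The quotient is the product of 1 - j / n over j < q, the probability that q uniform
  draws from n are distinct, so it decreases in q.\<close>

lemma fact_binomial_antimono:
  assumes "q \<le> r" "r \<le> n" "n \<ge> 1"
  shows "fact r * real (n choose r) / real n ^ r \<le> fact q * real (n choose q) / real n ^ q"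
  using assms(1,2)
proof (induction r rule: dec_induct)
  case (step r)
  let ?F = "fact r * real (n choose r)"
  have n: "real n > 0" using assms(3) by simp
  have "fact (Suc r) * real (n choose Suc r) / real n ^ Suc r = ?F * (real n - real r) / real n ^ Suc r"
    using step by (simp only: fact_binomial_step Suc_le_eq)
  also have "\<dots> \<le> ?F * real n / real n ^ Suc r" using n by (intro divide_right_mono mult_left_mono) auto
  also have "\<dots> = ?F / real n ^ r" using n by simp
  also have "\<dots> \<le> fact q * real (n choose q) / real n ^ q" using step by simp
  finally show ?case .
qed simp

text \<open>Both sides are n! / (n - 2 d)!. Up to the factor (d!)^2 the left side counts ordered
  pairs of disjoint d-sets, which is what the diagonal part of a quadratic form requires.\<close>

lemma fact_binomial_disjoint:
  assumes "2 * d \<le> n"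
  shows "fact d * real (n choose d) * (fact d * real ((n - d) choose d)) = fact (2 * d) * real (n choose (2 * d))"
proof -
  have "real (n choose d) = fact n / (fact d * fact (n - d))" using assms by (intro binomial_fact) simp
  moreover have "real ((n - d) choose d) = fact (n - d) / (fact d * fact (n - d - d))" using assms by (intro binomial_fact) simp
  moreover have "real (n choose (2 * d)) = fact n / (fact (2 * d) * fact (n - 2 * d))" using assms by (intro binomial_fact) simp
  moreover have "n - d - d = n - 2 * d" by simp
  ultimately show ?thesis by simp
qed

lemma fact_div_fact_le_power: "k \<le> d \<Longrightarrow> fact d / fact (d - k) \<le> real d ^ k"
proof (induction k)
  case (Suc k)
  have "fact (d - k) = real (d - k) * fact (d - Suc k)"
    using Suc.prems by (metis Suc_diff_Suc Suc_le_lessD fact_Suc of_nat_fact of_nat_mult)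
  then have "fact d / fact (d - Suc k) = real (d - k) * (fact d / fact (d - k))"
  proof -
    have "c \<noteq> 0 \<Longrightarrow> F / G = c * (F / (c * G))" for c F G :: real by simp
    from this[of "real (d - k)" "fact d" "fact (d - Suc k)"] show ?thesis
      using Suc.prems unfolding \<open>fact (d - k) = real (d - k) * fact (d - Suc k)\<close> by simp
  qed
  also have "\<dots> \<le> real d * real d ^ k" using Suc by (intro mult_mono) auto
  finally show ?case by simp
qed simp

lemma card_disjoint_subsets:
  assumes "S \<in> subset_idx n d"
  shows "card {T \<in> subset_idx n d. S \<inter> T = {}} = (n - d) choose d"
proof -
  have "{T \<in> subset_idx n d. S \<inter> T = {}} = {T. T \<subseteq> {1..n} - S \<and> card T = d}"
    by (auto simp: subset_idx_def)
  moreover have "card ({1..n} - S) = n - d"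
    using assms by (auto simp: card_Diff_subset dest!: subset_idxD)
  ultimately show ?thesis using n_subsets[of "{1..n} - S" d] by simp
qed

lemma esym_cong: "(\<And>i. i \<in> {1..n} \<Longrightarrow> a i = b i) \<Longrightarrow> esym n q a = esym n q b"
  unfolding esym_def by (intro sum.cong[OF refl] prod.cong[OF refl]) (auto dest!: subset_idxD)

text \<open>Everything here is for one n. The integrability assumption dominates all products of
  four coordinates y(S), and \<open>nd\<close> makes 4 d / n at most 1 and the binomials n choose k
  positive for k <= 2 d.\<close>

locale power_vector = prob_space N for N :: "'b measure" +
  fixes n d :: nat and X :: "'b \<Rightarrow> nat \<Rightarrow> real"
  assumes X: "X \<in> measurable N (Rn n)"
    and ex: "exchangeable N n X" and un: "unconditional N n X"
    and d1: "d \<ge> 1" and nd: "4 * d \<le> n"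
    and int_norm: "integrable N (\<lambda>\<omega>. (\<Sum>i=1..n. (X \<omega> i)\<^sup>2) ^ (2 * d))"
begin

text \<open>The first summand of \<open>defect\<close> comes from the off-diagonal part of a quadratic form, the others from
  its diagonal part. Dividing \<open>F1 / n\<^sup>d\<close> by \<open>\<kappa>1\<close> and \<open>F2 / n\<^sup>2\<^sup>d\<close> by \<open>\<kappa>\<close> gives the expectations of
  \<open>\<Prod>\<^sub>i\<^sub>\<in>\<^sub>S X\<^sub>i\<^sup>2\<close> for one set \<open>S\<close> of size \<open>d\<close> and \<open>2 d\<close>.\<close>

definition "sq \<omega> i = (X \<omega> i)\<^sup>2"
definition "M2 = expectation (\<lambda>\<omega>. (\<Sum>i=1..n. sq \<omega> i) ^ (2 * d))"
definition "F1 = expectation (\<lambda>\<omega>. fact d * esym n d (sq \<omega>))"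
definition "F2 = expectation (\<lambda>\<omega>. fact (2 * d) * esym n (2 * d) (sq \<omega>))"
definition "\<kappa> = fact (2 * d) * real (n choose (2 * d)) / real n ^ (2 * d)"
definition "\<kappa>1 = fact d * real (n choose d) / real n ^ d"
definition "defect = 4 * real d / real n * (M2 / real n ^ (2 * d)) / \<kappa>\<^sup>2
   + \<bar>F2 / real n ^ (2 * d) / \<kappa> - 2 * (F1 / real n ^ d) / \<kappa>1 + 1\<bar>
   + (M2 / real n ^ (2 * d) - F2 / real n ^ (2 * d)) / \<kappa>1\<^sup>2
   + (2 * (F1 / real n ^ d) / \<kappa>1 + 1) * (1 - \<kappa>)"

lemma sq_nonneg [simp]: "sq \<omega> i \<ge> 0" by (simp add: sq_def)

lemma meas_X: "i \<in> {1..n} \<Longrightarrow> (\<lambda>\<omega>. X \<omega> i) \<in> borel_measurable N"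
  by (rule measurable_Rn_component[OF X])

lemma meas_prod_sq: "D \<subseteq> {1..n} \<Longrightarrow> (\<lambda>\<omega>. \<Prod>i\<in>D. sq \<omega> i) \<in> borel_measurable N"
  unfolding sq_def by (intro borel_measurable_prod borel_measurable_power meas_X) auto

lemma meas_esym: "(\<lambda>\<omega>. esym n q (sq \<omega>)) \<in> borel_measurable N"
  unfolding esym_def by (intro borel_measurable_sum meas_prod_sq) (use subset_idxD in blast)

lemma esym_le_power: "esym n q (sq \<omega>) \<le> (\<Sum>i=1..n. sq \<omega> i) ^ q"
proof -
  have "1 * esym n q (sq \<omega>) \<le> fact q * esym n q (sq \<omega>)"
    by (intro mult_right_mono esym_nonneg) auto
  also have "\<dots> \<le> (\<Sum>i=1..n. sq \<omega> i) ^ q" by (rule esym_power_bounds) simp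
  finally show ?thesis by simp
qed

lemma power_le_one_plus:
  fixes z :: real assumes "z \<ge> 0" "k \<le> m" shows "z ^ k \<le> 1 + z ^ m"
proof (cases "z \<le> 1")
  case True
  then have "z ^ k \<le> 1" using assms by (simp add: power_le_one)
  then show ?thesis using assms by (simp add: add_increasing2)
next
  case False
  then have "z ^ k \<le> z ^ m" using assms by (intro power_increasing) auto
  then show ?thesis by simp
qed

lemma integrable_dominated:
  assumes f: "f \<in> borel_measurable N" and le: "\<And>\<omega>. \<bar>f \<omega>\<bar> \<le> (\<Sum>i=1..n. sq \<omega> i) ^ k" and k: "k \<le> 2 * d"
  shows "integrable N f"
proof (rule Bochner_Integration.integrable_bound)
  show "integrable N (\<lambda>\<omega>. 1 + (\<Sum>i=1..n. sq \<omega> i) ^ (2 * d))"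
    using int_norm unfolding sq_def by simp
  show "AE \<omega> in N. norm (f \<omega>) \<le> norm (1 + (\<Sum>i=1..n. sq \<omega> i) ^ (2 * d))"
  proof (rule AE_I2)
    fix \<omega>
    have "0 \<le> (\<Sum>i=1..n. sq \<omega> i)" by (intro sum_nonneg) simp
    then have "(\<Sum>i=1..n. sq \<omega> i) ^ k \<le> 1 + (\<Sum>i=1..n. sq \<omega> i) ^ (2 * d)"
      using k by (intro power_le_one_plus)
    then show "norm (f \<omega>) \<le> norm (1 + (\<Sum>i=1..n. sq \<omega> i) ^ (2 * d))" using le[of \<omega>] by simp
  qed
qed (rule f)

lemma integrable_esym2:
  assumes "r + q \<le> 2 * d"
  shows "integrable N (\<lambda>\<omega>. esym n r (sq \<omega>) * esym n q (sq \<omega>))"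
proof (rule integrable_dominated[OF _ _ assms])
  show "(\<lambda>\<omega>. esym n r (sq \<omega>) * esym n q (sq \<omega>)) \<in> borel_measurable N"
    by (intro borel_measurable_times meas_esym)
  show "\<bar>esym n r (sq \<omega>) * esym n q (sq \<omega>)\<bar> \<le> (\<Sum>i=1..n. sq \<omega> i) ^ (r + q)" for \<omega>
  proof -
    have "\<bar>esym n r (sq \<omega>)\<bar> \<le> (\<Sum>i=1..n. sq \<omega> i) ^ r" for r
      using esym_le_power[of r \<omega>] esym_nonneg[of "sq \<omega>" n r] by (simp add: sq_def)
    then show ?thesis unfolding power_add abs_mult
      by (intro mult_mono) (auto intro!: zero_le_power sum_nonneg)
  qed
qed

lemma integrable_prod_esym:
  assumes "D \<in> subset_idx n r" "r + q \<le> 2 * d"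
  shows "integrable N (\<lambda>\<omega>. (\<Prod>i\<in>D. sq \<omega> i) * esym n q (sq \<omega>))"
proof (rule Bochner_Integration.integrable_bound[OF integrable_esym2[OF assms(2)]])
  show "(\<lambda>\<omega>. (\<Prod>i\<in>D. sq \<omega> i) * esym n q (sq \<omega>)) \<in> borel_measurable N"
    using subset_idxD[OF assms(1)] by (intro borel_measurable_times meas_esym meas_prod_sq) blast
  show "AE \<omega> in N. norm ((\<Prod>i\<in>D. sq \<omega> i) * esym n q (sq \<omega>)) \<le> norm (esym n r (sq \<omega>) * esym n q (sq \<omega>))"
    by (intro AE_I2)
      (auto simp: abs_mult esym_nonneg prod_nonneg intro!: mult_right_mono prod_le_esym assms(1))
qed

text \<open>By exchangeability the expectation is the same for every r-set D, the second factor
  being symmetric; so it is the average over D, and the products over D sum to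
  \<open>esym n r\<close>.\<close>

lemma expectation_prod_esym:
  assumes D: "D \<in> subset_idx n r" and rq: "r + q \<le> 2 * d"
  shows "real (n choose r) * expectation (\<lambda>\<omega>. (\<Prod>i\<in>D. sq \<omega> i) * esym n q (sq \<omega>))
    = expectation (\<lambda>\<omega>. esym n r (sq \<omega>) * esym n q (sq \<omega>))"
proof -
  have eq: "expectation (\<lambda>\<omega>. (\<Prod>i\<in>D. sq \<omega> i) * esym n q (sq \<omega>))
    = expectation (\<lambda>\<omega>. (\<Prod>i\<in>D'. sq \<omega> i) * esym n q (sq \<omega>))" if D': "D' \<in> subset_idx n r" for D'
  proof -
    obtain \<sigma> where s: "\<sigma> permutes {1..n}" "\<sigma> ` D = D'" using permutes_image_subset_idx[OF D D'] .
    define g where "g x = (\<Prod>i\<in>D. (x i)\<^sup>2) * esym n q (\<lambda>i. (x i)\<^sup>2)" for x :: "nat \<Rightarrow> real"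
    have sub: "D \<subseteq> {1..n}" using subset_idxD[OF D] by simp
    have g: "g \<in> borel_measurable (Rn n)"
      unfolding g_def esym_def using sub
      by (intro borel_measurable_times borel_measurable_sum borel_measurable_prod borel_measurable_power
          measurable_component_singleton) (auto dest!: subset_idxD)
    have "expectation (\<lambda>\<omega>. (\<Prod>i\<in>D. sq \<omega> i) * esym n q (sq \<omega>)) = expectation (\<lambda>\<omega>. g (X \<omega>))"
      by (simp add: g_def sq_def[abs_def])
    also have "\<dots> = expectation (\<lambda>\<omega>. g (\<lambda>i\<in>{1..n}. X \<omega> (\<sigma> i)))"
      by (rule exchangeable_integral[OF X ex s(1) g])
    also have "\<dots> = expectation (\<lambda>\<omega>. (\<Prod>i\<in>D'. sq \<omega> i) * esym n q (sq \<omega>))"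
    proof (rule Bochner_Integration.integral_cong[OF refl])
      fix \<omega>
      have "(\<Prod>i\<in>D. ((\<lambda>i\<in>{1..n}. X \<omega> (\<sigma> i)) i)\<^sup>2) = (\<Prod>i\<in>D. sq \<omega> (\<sigma> i))"
        using sub by (intro prod.cong[OF refl]) (auto simp: sq_def)
      also have "\<dots> = (\<Prod>i\<in>\<sigma> ` D. sq \<omega> i)"
        using permutes_inj_on[OF s(1)] by (simp add: prod.reindex)
      finally have 1: "(\<Prod>i\<in>D. ((\<lambda>i\<in>{1..n}. X \<omega> (\<sigma> i)) i)\<^sup>2) = (\<Prod>i\<in>D'. sq \<omega> i)" unfolding s(2) .
      have "esym n q (\<lambda>i. ((\<lambda>i\<in>{1..n}. X \<omega> (\<sigma> i)) i)\<^sup>2) = esym n q (\<lambda>i. sq \<omega> (\<sigma> i))"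
        by (rule esym_cong) (auto simp: sq_def)
      then have 2: "esym n q (\<lambda>i. ((\<lambda>i\<in>{1..n}. X \<omega> (\<sigma> i)) i)\<^sup>2) = esym n q (sq \<omega>)"
        unfolding esym_permute[OF s(1)] .
      show "g (\<lambda>i\<in>{1..n}. X \<omega> (\<sigma> i)) = (\<Prod>i\<in>D'. sq \<omega> i) * esym n q (sq \<omega>)"
        unfolding g_def 1 2 ..
    qed
    finally show ?thesis .
  qed
  have "expectation (\<lambda>\<omega>. esym n r (sq \<omega>) * esym n q (sq \<omega>))
     = expectation (\<lambda>\<omega>. \<Sum>D'\<in>subset_idx n r. (\<Prod>i\<in>D'. sq \<omega> i) * esym n q (sq \<omega>))"
    by (simp add: esym_def[of n r] sum_distrib_right)
  also have "\<dots> = (\<Sum>D'\<in>subset_idx n r. expectation (\<lambda>\<omega>. (\<Prod>i\<in>D'. sq \<omega> i) * esym n q (sq \<omega>)))"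
    by (rule Bochner_Integration.integral_sum) (rule integrable_prod_esym[OF _ rq])
  also have "\<dots> = (\<Sum>D'\<in>subset_idx n r. expectation (\<lambda>\<omega>. (\<Prod>i\<in>D. sq \<omega> i) * esym n q (sq \<omega>)))"
    by (rule sum.cong[OF refl]) (rule eq[symmetric])
  finally show ?thesis by (simp add: card_subset_idx)
qed

definition "y S \<omega> = (\<Prod>i\<in>S. X \<omega> i)"

lemma y_square: "(y S \<omega>)\<^sup>2 = (\<Prod>i\<in>S. sq \<omega> i)"
  by (simp add: y_def sq_def prod_power_distrib)

lemma meas_y: "S \<in> subset_idx n d \<Longrightarrow> y S \<in> borel_measurable N"
  unfolding y_def by (intro borel_measurable_prod meas_X) (auto dest!: subset_idxD)

text \<open>Each y(S)^2 is at most the d-th power of the squared norm of X, so by the inequality of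
  means a product of two coordinates is as well.\<close>

lemma integrable_y4:
  assumes "S \<in> subset_idx n d" "T \<in> subset_idx n d" "U \<in> subset_idx n d" "V \<in> subset_idx n d"
  shows "integrable N (\<lambda>\<omega>. y S \<omega> * y T \<omega> * (y U \<omega> * y V \<omega>))"
proof (rule integrable_dominated[where k = "2 * d"])
  show "(\<lambda>\<omega>. y S \<omega> * y T \<omega> * (y U \<omega> * y V \<omega>)) \<in> borel_measurable N"
    using assms by (intro borel_measurable_times meas_y)
  fix \<omega>
  let ?P = "\<Sum>i=1..n. sq \<omega> i"
  have P: "?P \<ge> 0" by (intro sum_nonneg) simp
  have b: "\<bar>y S \<omega>\<bar> * \<bar>y T \<omega>\<bar> \<le> ?P ^ d" if "S \<in> subset_idx n d" "T \<in> subset_idx n d" for S T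
  proof -
    have "(y S \<omega>)\<^sup>2 \<le> ?P ^ d" if "S \<in> subset_idx n d" for S
      unfolding y_square by (rule order_trans[OF prod_le_esym[OF _ that] esym_le_power]) simp
    from this[OF that(1)] this[OF that(2)]
    have "(y S \<omega>)\<^sup>2 + (y T \<omega>)\<^sup>2 \<le> 2 * ?P ^ d" by simp
    moreover have "0 \<le> (\<bar>y S \<omega>\<bar> - \<bar>y T \<omega>\<bar>)\<^sup>2" by simp
    ultimately show ?thesis by (simp add: power2_diff)
  qed
  have "\<bar>y S \<omega> * y T \<omega> * (y U \<omega> * y V \<omega>)\<bar> \<le> ?P ^ d * ?P ^ d"
    unfolding abs_mult using b assms P by (intro mult_mono) auto
  then show "\<bar>y S \<omega> * y T \<omega> * (y U \<omega> * y V \<omega>)\<bar> \<le> ?P ^ (2 * d)"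
    by (simp add: power_add[symmetric] mult_2)
qed simp

lemma expectation_y4_zero:
  assumes "S \<in> subset_idx n d" "T \<in> subset_idx n d" "U \<in> subset_idx n d" "V \<in> subset_idx n d"
    "sdiff S T \<noteq> sdiff U V"
  shows "expectation (\<lambda>\<omega>. y S \<omega> * y T \<omega> * (y U \<omega> * y V \<omega>)) = 0"
proof -
  define k where "k i = (if i \<in> S then 1 else 0) + (if i \<in> T then 1 else 0)
       + ((if i \<in> U then 1 else 0) + (if i \<in> V then 1 else (0::nat)))" for i
  have sub: "S \<subseteq> {1..n}" "T \<subseteq> {1..n}" "U \<subseteq> {1..n}" "V \<subseteq> {1..n}" using assms by (auto dest!: subset_idxD)
  obtain j where j: "(j \<in> sdiff S T) \<noteq> (j \<in> sdiff U V)" using assms(5) by blast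
  then have "odd (k j)" unfolding k_def sdiff_def by auto
  moreover have "j \<in> {1..n}" using j sub unfolding sdiff_def by blast
  ultimately have "expectation (\<lambda>\<omega>. \<Prod>i\<in>{1..n}. X \<omega> i ^ k i) = 0"
    by (intro unconditional_odd[OF _ X un]) unfold_locales
  then show ?thesis unfolding y_def prod4_powers[OF sub] k_def .
qed

lemma y4_eq:
  assumes "S \<in> subset_idx n d" "T \<in> subset_idx n d" "U \<in> subset_idx n d" "V \<in> subset_idx n d"
    "sdiff S T = sdiff U V"
  shows "y S \<omega> * y T \<omega> * (y U \<omega> * y V \<omega>) = (\<Prod>i\<in>S \<union> T. sq \<omega> i) * (\<Prod>i\<in>U \<inter> V. sq \<omega> i)"
  unfolding y_def sq_def by (rule prod4_sdiff_eq) (use assms in \<open>auto dest!: subset_idxD\<close>)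

abbreviation "J \<equiv> {(S, T). S \<in> subset_idx n d \<and> T \<in> subset_idx n d \<and> S \<noteq> T}"

lemma finite_J: "finite J"
  by (rule finite_subset[of _ "subset_idx n d \<times> subset_idx n d"]) auto

definition "z p \<omega> = y (fst p) \<omega> * y (snd p) \<omega>"

lemma integrable_z2: "p \<in> J \<Longrightarrow> q \<in> J \<Longrightarrow> integrable N (\<lambda>\<omega>. z p \<omega> * z q \<omega>)"
  unfolding z_def by (rule integrable_y4) auto

text \<open>The sign is what makes the row-sum estimate in \<open>off_diagonal_bound\<close>
  possible: an upper bound on B p B q may then be multiplied by the moment.\<close>

lemma expectation_z2_nonneg: "p \<in> J \<Longrightarrow> q \<in> J \<Longrightarrow> 0 \<le> expectation (\<lambda>\<omega>. z p \<omega> * z q \<omega>)"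
proof (cases "sdiff (fst p) (snd p) = sdiff (fst q) (snd q)")
  case True
  assume "p \<in> J" "q \<in> J"
  then have "z p \<omega> * z q \<omega> = (\<Prod>i\<in>fst p \<union> snd p. sq \<omega> i) * (\<Prod>i\<in>fst q \<inter> snd q. sq \<omega> i)" for \<omega>
    unfolding z_def using True by (intro y4_eq) auto
  then show ?thesis by (simp add: prod_nonneg)
next
  case False
  assume "p \<in> J" "q \<in> J"
  then have "expectation (\<lambda>\<omega>. z p \<omega> * z q \<omega>) = 0"
    unfolding z_def using False by (intro expectation_y4_zero) auto
  then show ?thesis by simp
qed

lemma n_pos: "real n > 0" using d1 nd by simp

lemma \<kappa>_bounds: "\<kappa> > 0" "\<kappa> \<le> \<kappa>1" "\<kappa>1 \<le> 1" "q \<le> 2 * d \<Longrightarrow> \<kappa> * real n ^ q \<le> fact q * real (n choose q)"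
proof -
  have "n choose (2 * d) > 0" using nd by (simp add: zero_less_binomial)
  then show "\<kappa> > 0" unfolding \<kappa>_def using n_pos by simp
  show "\<kappa> \<le> \<kappa>1" unfolding \<kappa>_def \<kappa>1_def using nd d1 by (intro fact_binomial_antimono) auto
  have "\<kappa>1 \<le> fact 0 * real (n choose 0) / real n ^ 0"
    unfolding \<kappa>1_def using nd d1 by (intro fact_binomial_antimono) auto
  then show "\<kappa>1 \<le> 1" by simp
  assume "q \<le> 2 * d"
  then have "\<kappa> \<le> fact q * real (n choose q) / real n ^ q"
    unfolding \<kappa>_def using nd d1 by (intro fact_binomial_antimono) auto
  then show "\<kappa> * real n ^ q \<le> fact q * real (n choose q)" using n_pos by (simp add: field_simps)
qed

lemma M2_nonneg: "M2 \<ge> 0"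
  unfolding M2_def by (intro Bochner_Integration.integral_nonneg zero_le_power sum_nonneg) simp

text \<open>A row of the matrix of moments E (z p z q). Only pairs with the same symmetric
  difference survive, of size 2 k with k >= 1; \<open>sum_pairs_sdiff_le\<close> sums them to at
  most \<open>4 ^ k\<close> e_(d-k), and averaging over the sets of size d + k brings in M2.
  Compared with n choose d this leaves (4 d / n)^k, and k >= 1 yields the small factor 4 d /
  n.\<close>

lemma sum_z2_le:
  assumes p: "p \<in> J"
  shows "(\<Sum>q\<in>J. expectation (\<lambda>\<omega>. z p \<omega> * z q \<omega>))
    \<le> real (n choose d) * (4 * real d / real n * (M2 / real n ^ (2 * d)) / \<kappa>\<^sup>2)"
proof -
  obtain S T where pST: "p = (S, T)" by (cases p)
  have S: "S \<in> subset_idx n d" and T: "T \<in> subset_idx n d" and ne: "S \<noteq> T" using p pST by auto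
  note SD = subset_idxD[OF S] and TD = subset_idxD[OF T]
  define k where "k = card (S - T)"
  have k1: "k \<ge> 1"
  proof (rule ccontr)
    assume "\<not> k \<ge> 1"
    moreover have "finite (S - T)" using SD by auto
    ultimately have "S - T = {}" unfolding k_def by (simp only: not_le less_one card_0_eq)
    then have "S = T" using SD TD by (intro card_subset_eq) auto
    with ne show False ..
  qed
  have kd: "k \<le> d" unfolding k_def using SD card_mono[of S "S - T"] by auto
  have D: "S \<union> T \<in> subset_idx n (d + k)"
  proof -
    have "card (S \<union> T) = card (T \<union> (S - T))" by (simp add: Un_commute)
    also have "\<dots> = d + k" using SD TD by (subst card_Un_disjoint) (auto simp: k_def)
    finally show ?thesis using SD TD by (simp add: subset_idx_def)
  qed
  have dk: "d + k + (d - k) \<le> 2 * d" using kd by simp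
  let ?Q = "{(U, V). U \<in> subset_idx n d \<and> V \<in> subset_idx n d \<and> sdiff U V = sdiff S T}"
  have fQ: "finite ?Q" by (rule finite_subset[of _ "subset_idx n d \<times> subset_idx n d"]) auto
  have "(\<Sum>q\<in>J. expectation (\<lambda>\<omega>. z p \<omega> * z q \<omega>)) = (\<Sum>q\<in>?Q \<inter> J. expectation (\<lambda>\<omega>. z p \<omega> * z q \<omega>))"
  proof (rule sum.mono_neutral_right[OF finite_J])
    show "\<forall>q\<in>J - ?Q \<inter> J. expectation (\<lambda>\<omega>. z p \<omega> * z q \<omega>) = 0"
    proof
      fix q assume q: "q \<in> J - ?Q \<inter> J"
      then obtain U V where "q = (U, V)" "U \<in> subset_idx n d" "V \<in> subset_idx n d" "sdiff S T \<noteq> sdiff U V" by force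
      then show "expectation (\<lambda>\<omega>. z p \<omega> * z q \<omega>) = 0"
        unfolding z_def pST fst_conv snd_conv using S T by (simp add: expectation_y4_zero)
    qed
  qed auto
  also have "\<dots> = expectation (\<lambda>\<omega>. \<Sum>q\<in>?Q \<inter> J. z p \<omega> * z q \<omega>)"
    by (rule Bochner_Integration.integral_sum[symmetric]) (rule integrable_z2[OF p], auto)
  also have "\<dots> \<le> expectation (\<lambda>\<omega>. 4 ^ k * ((\<Prod>i\<in>S \<union> T. sq \<omega> i) * esym n (d - k) (sq \<omega>)))"
  proof (rule integral_mono)
    show "integrable N (\<lambda>\<omega>. \<Sum>q\<in>?Q \<inter> J. z p \<omega> * z q \<omega>)"
      by (rule Bochner_Integration.integrable_sum) (rule integrable_z2[OF p], auto)
    show "integrable N (\<lambda>\<omega>. 4 ^ k * ((\<Prod>i\<in>S \<union> T. sq \<omega> i) * esym n (d - k) (sq \<omega>)))"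
      by (intro integrable_mult_right integrable_prod_esym[OF D dk])
    fix \<omega>
    have "(\<Sum>q\<in>?Q \<inter> J. z p \<omega> * z q \<omega>) = (\<Sum>q\<in>?Q \<inter> J. (\<Prod>i\<in>S \<union> T. sq \<omega> i) * (\<Prod>i\<in>fst q \<inter> snd q. sq \<omega> i))"
    proof (rule sum.cong[OF refl])
      fix q assume "q \<in> ?Q \<inter> J"
      then have "fst q \<in> subset_idx n d" "snd q \<in> subset_idx n d" "sdiff S T = sdiff (fst q) (snd q)"
        by (simp_all only: Int_iff mem_Collect_eq case_prod_beta)
      from y4_eq[OF S T this]
      show "z p \<omega> * z q \<omega> = (\<Prod>i\<in>S \<union> T. sq \<omega> i) * (\<Prod>i\<in>fst q \<inter> snd q. sq \<omega> i)"
        unfolding z_def pST fst_conv snd_conv .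
    qed
    also have "\<dots> \<le> (\<Sum>q\<in>?Q. (\<Prod>i\<in>S \<union> T. sq \<omega> i) * (\<Prod>i\<in>fst q \<inter> snd q. sq \<omega> i))"
      by (rule sum_mono2[OF fQ Int_lower1]) (intro mult_nonneg_nonneg prod_nonneg ballI sq_nonneg)
    also have "\<dots> = (\<Prod>i\<in>S \<union> T. sq \<omega> i) * (\<Sum>(U, V)\<in>?Q. \<Prod>i\<in>U \<inter> V. sq \<omega> i)"
      unfolding case_prod_beta sum_distrib_left ..
    also have "\<dots> \<le> (\<Prod>i\<in>S \<union> T. sq \<omega> i) * (4 ^ k * esym n (d - k) (sq \<omega>))"
      unfolding k_def by (intro mult_left_mono sum_pairs_sdiff_le S T prod_nonneg) auto
    finally show "(\<Sum>q\<in>?Q \<inter> J. z p \<omega> * z q \<omega>) \<le> 4 ^ k * ((\<Prod>i\<in>S \<union> T. sq \<omega> i) * esym n (d - k) (sq \<omega>))"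
      by (simp add: ac_simps)
  qed
  also have "\<dots> = 4 ^ k * expectation (\<lambda>\<omega>. (\<Prod>i\<in>S \<union> T. sq \<omega> i) * esym n (d - k) (sq \<omega>))" by simp
  also have "expectation (\<lambda>\<omega>. (\<Prod>i\<in>S \<union> T. sq \<omega> i) * esym n (d - k) (sq \<omega>))
      \<le> M2 / (fact (d - k) * (fact (d + k) * real (n choose (d + k))))"
  proof -
    have c: "real (n choose (d + k)) > 0" using kd nd by (simp add: zero_less_binomial)
    have "fact (d + k) * fact (d - k) * expectation (\<lambda>\<omega>. esym n (d + k) (sq \<omega>) * esym n (d - k) (sq \<omega>))
        = expectation (\<lambda>\<omega>. fact (d + k) * fact (d - k) * (esym n (d + k) (sq \<omega>) * esym n (d - k) (sq \<omega>)))"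
      by simp
    also have "\<dots> \<le> M2"
      unfolding M2_def
    proof (rule integral_mono)
      show "integrable N (\<lambda>\<omega>. fact (d + k) * fact (d - k) * (esym n (d + k) (sq \<omega>) * esym n (d - k) (sq \<omega>)))"
        by (intro integrable_mult_right integrable_esym2[OF dk])
      show "integrable N (\<lambda>\<omega>. (\<Sum>i = 1..n. sq \<omega> i) ^ (2 * d))" using int_norm by (simp add: sq_def)
      fix \<omega>
      have "(fact (d + k) * esym n (d + k) (sq \<omega>)) * (fact (d - k) * esym n (d - k) (sq \<omega>))
        \<le> (\<Sum>i = 1..n. sq \<omega> i) ^ (d + k) * (\<Sum>i = 1..n. sq \<omega> i) ^ (d - k)"
        by (intro mult_mono esym_power_bounds) (auto intro!: mult_nonneg_nonneg esym_nonneg zero_le_power sum_nonneg)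
      also have "\<dots> = (\<Sum>i = 1..n. sq \<omega> i) ^ (2 * d)"
        unfolding power_add[symmetric] using kd by (intro arg_cong[where f = "(^) _"]) simp
      finally show "fact (d + k) * fact (d - k) * (esym n (d + k) (sq \<omega>) * esym n (d - k) (sq \<omega>))
        \<le> (\<Sum>i = 1..n. sq \<omega> i) ^ (2 * d)" by (simp add: ac_simps)
    qed
    finally have "fact (d + k) * fact (d - k) * (real (n choose (d + k)) * expectation (\<lambda>\<omega>. (\<Prod>i\<in>S \<union> T. sq \<omega> i) * esym n (d - k) (sq \<omega>))) \<le> M2"
      unfolding expectation_prod_esym[OF D dk] .
    then show ?thesis using c by (simp add: pos_le_divide_eq ac_simps)
  qed
  also have "4 ^ k * (M2 / (fact (d - k) * (fact (d + k) * real (n choose (d + k)))))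
      \<le> real (n choose d) * (4 * real d / real n * (M2 / real n ^ (2 * d)) / \<kappa>\<^sup>2)"
  proof -
    let ?n = "real n"
    have a: "\<kappa> * ?n ^ (d + k) \<le> fact (d + k) * real (n choose (d + k))" by (rule \<kappa>_bounds(4)) (use kd in simp)
    have b: "\<kappa> * ?n ^ d \<le> fact d * real (n choose d)" by (rule \<kappa>_bounds(4)) simp
    have pos: "\<kappa> * ?n ^ (d + k) > 0" "\<kappa> * ?n ^ d > 0" using \<kappa>_bounds(1) n_pos by auto
    have nz: "?n \<noteq> 0" "\<kappa> \<noteq> 0" "real (fact d) \<noteq> 0" using \<kappa>_bounds(1) n_pos by auto
    have pos': "fact (d + k) * real (n choose (d + k)) > 0" using a pos by linarith
    have "4 ^ k * (M2 / (fact (d - k) * (fact (d + k) * real (n choose (d + k)))))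
      \<le> 4 ^ k * (M2 / (fact (d - k) * (\<kappa> * ?n ^ (d + k))))"
    proof (intro mult_left_mono divide_left_mono)
      show "0 < fact (d - k) * (fact (d + k) * real (n choose (d + k))) * (fact (d - k) * (\<kappa> * ?n ^ (d + k)))"
        by (intro mult_pos_pos[OF mult_pos_pos[OF _ pos'] mult_pos_pos[OF _ pos(1)]]) simp_all
    qed (use a M2_nonneg in simp_all)
    also have "\<dots> = 4 ^ k * M2 / (\<kappa> * ?n ^ (d + k)) * (fact d / fact (d - k)) / fact d" by simp
    also have "\<dots> \<le> 4 ^ k * M2 / (\<kappa> * ?n ^ (d + k)) * real d ^ k / fact d"
      using pos M2_nonneg fact_div_fact_le_power[OF kd] by (intro divide_right_mono mult_left_mono) auto
    also have "\<dots> = ((4 * real d / ?n) ^ k * (M2 / ?n ^ (2 * d)) / \<kappa>\<^sup>2) * (\<kappa> * ?n ^ d / fact d)"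
    proof -
      have e: "?n ^ (2 * d) = ?n ^ d * ?n ^ d" by (simp add: mult_2 power_add)
      show ?thesis
        unfolding e power_add power_divide power_mult_distrib power2_eq_square using nz by (simp add: ac_simps)
    qed
    also have "\<dots> \<le> ((4 * real d / ?n) * (M2 / ?n ^ (2 * d)) / \<kappa>\<^sup>2) * real (n choose d)"
    proof (rule mult_mono)
      have "real (4 * d) \<le> ?n" using nd by (simp only: of_nat_le_iff)
      then have "4 * real d / ?n \<le> 1" using n_pos by simp
      then have "(4 * real d / ?n) ^ k \<le> (4 * real d / ?n) ^ 1" using k1 by (intro power_decreasing) auto
      then have "(4 * real d / ?n) ^ k \<le> 4 * real d / ?n" by simp
      then show "(4 * real d / ?n) ^ k * (M2 / ?n ^ (2 * d)) / \<kappa>\<^sup>2 \<le> 4 * real d / ?n * (M2 / ?n ^ (2 * d)) / \<kappa>\<^sup>2"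
        using M2_nonneg by (intro divide_right_mono mult_right_mono) auto
      show "\<kappa> * ?n ^ d / fact d \<le> real (n choose d)" using b by (simp add: pos_divide_le_eq mult.commute)
    qed (use M2_nonneg pos in auto)
    finally show ?thesis by (simp add: mult.commute)
  qed
  finally show ?thesis by simp
qed

text \<open>Schur's test: B p B q <= ((B p)^2 + (B q)^2) / 2 against the symmetric, nonnegative
  matrix of moments, and then the row sums. One factor n choose d comes from the Frobenius norm, the
  other from the rows.\<close>

lemma off_diagonal_bound:
  assumes frob: "(\<Sum>p\<in>J. (B p)\<^sup>2) \<le> real (n choose d)"
  shows "integrable N (\<lambda>\<omega>. (\<Sum>p\<in>J. B p * z p \<omega>)\<^sup>2)"
    "expectation (\<lambda>\<omega>. (\<Sum>p\<in>J. B p * z p \<omega>)\<^sup>2) \<le>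
      (real (n choose d))\<^sup>2 * (4 * real d / real n * (M2 / real n ^ (2 * d)) / \<kappa>\<^sup>2)"
proof -
  define H where "H = 4 * real d / real n * (M2 / real n ^ (2 * d)) / \<kappa>\<^sup>2"
  have H: "H \<ge> 0" using M2_nonneg by (simp add: H_def)
  define c where "c p q = expectation (\<lambda>\<omega>. z p \<omega> * z q \<omega>)" for p q
  have sq: "(\<Sum>p\<in>J. B p * z p \<omega>)\<^sup>2 = (\<Sum>p\<in>J. \<Sum>q\<in>J. (B p * B q) * (z p \<omega> * z q \<omega>))" for \<omega>
    unfolding power2_eq_square sum_product by (intro sum.cong[OF refl]) (simp only: ac_simps)
  show "integrable N (\<lambda>\<omega>. (\<Sum>p\<in>J. B p * z p \<omega>)\<^sup>2)"
    unfolding sq by (intro Bochner_Integration.integrable_sum integrable_mult_right integrable_z2)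
  have "expectation (\<lambda>\<omega>. (\<Sum>p\<in>J. B p * z p \<omega>)\<^sup>2) = (\<Sum>p\<in>J. \<Sum>q\<in>J. (B p * B q) * c p q)"
    unfolding sq c_def
    by (rule integral_double_sum[where f = "\<lambda>p q \<omega>. z p \<omega> * z q \<omega>" and c = "\<lambda>p q. B p * B q"])
      (rule integrable_z2)
  also have "\<dots> \<le> (\<Sum>p\<in>J. \<Sum>q\<in>J. ((B p)\<^sup>2 / 2 + (B q)\<^sup>2 / 2) * c p q)"
  proof (intro sum_mono mult_right_mono)
    fix p q assume "p \<in> J" "q \<in> J"
    then show "0 \<le> c p q" unfolding c_def by (rule expectation_z2_nonneg)
    have "0 \<le> (B p - B q)\<^sup>2" by simp
    then show "B p * B q \<le> (B p)\<^sup>2 / 2 + (B q)\<^sup>2 / 2" by (simp add: power2_diff)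
  qed
  also have "\<dots> = (\<Sum>p\<in>J. \<Sum>q\<in>J. (B p)\<^sup>2 / 2 * c p q) + (\<Sum>p\<in>J. \<Sum>q\<in>J. (B q)\<^sup>2 / 2 * c p q)"
    by (simp only: distrib_right sum.distrib)
  also have "(\<Sum>p\<in>J. \<Sum>q\<in>J. (B q)\<^sup>2 / 2 * c p q) = (\<Sum>p\<in>J. \<Sum>q\<in>J. (B p)\<^sup>2 / 2 * c p q)"
  proof (subst sum.swap, intro sum.cong[OF refl] arg_cong[where f = "(*) _"])
    show "c q p = c p q" for p q by (simp only: c_def mult.commute)
  qed
  also have "(\<Sum>p\<in>J. \<Sum>q\<in>J. (B p)\<^sup>2 / 2 * c p q) + (\<Sum>p\<in>J. \<Sum>q\<in>J. (B p)\<^sup>2 / 2 * c p q)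
      = (\<Sum>p\<in>J. (B p)\<^sup>2 * (\<Sum>q\<in>J. c p q))"
    unfolding sum.distrib[symmetric] sum_distrib_left
    by (intro sum.cong[OF refl]) (simp add: sum_distrib_left)
  also have "\<dots> \<le> (\<Sum>p\<in>J. (B p)\<^sup>2 * (real (n choose d) * H))"
    unfolding c_def H_def by (intro sum_mono mult_left_mono sum_z2_le) auto
  also have "\<dots> = (\<Sum>p\<in>J. (B p)\<^sup>2) * (real (n choose d) * H)" by (simp only: sum_distrib_right)
  also have "\<dots> \<le> real (n choose d) * (real (n choose d) * H)"
    using frob H by (intro mult_right_mono) auto
  finally show "expectation (\<lambda>\<omega>. (\<Sum>p\<in>J. B p * z p \<omega>)\<^sup>2) \<le> (real (n choose d))\<^sup>2 * (4 * real d / real n * (M2 / real n ^ (2 * d)) / \<kappa>\<^sup>2)"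
    by (simp add: H_def power2_eq_square mult.assoc)
qed

lemma expectation_prod_sq:
  assumes "D \<in> subset_idx n r" "r \<le> 2 * d"
  shows "integrable N (\<lambda>\<omega>. \<Prod>i\<in>D. sq \<omega> i)"
    "fact r * real (n choose r) * expectation (\<lambda>\<omega>. \<Prod>i\<in>D. sq \<omega> i) = expectation (\<lambda>\<omega>. fact r * esym n r (sq \<omega>))"
  using integrable_prod_esym[of D r 0] expectation_prod_esym[of D r 0] assms by simp_all

text \<open>Pairs S, T are split by whether they meet. For disjoint ones exchangeability gives one
  common value of the mixed moment, in the limit 1 - 2 + 1 = 0; this is the first summand. For the
  others the crude bound E (v_S v_T) + 2 \<theta> + 1 is affordable: the total of E (v_S v_T) is at
  most M2 / (d!)^2 and its disjoint part is F2 / (d!)^2, leaving M2 - F2, and meeting pairs are a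
  fraction of at most 1 - \<kappa>.\<close>

lemma diagonal_bound:
  assumes b: "\<And>S. S \<in> subset_idx n d \<Longrightarrow> \<bar>b S\<bar> \<le> 1"
  shows "integrable N (\<lambda>\<omega>. (\<Sum>S\<in>subset_idx n d. b S * ((\<Prod>i\<in>S. sq \<omega> i) - 1))\<^sup>2)"
    "expectation (\<lambda>\<omega>. (\<Sum>S\<in>subset_idx n d. b S * ((\<Prod>i\<in>S. sq \<omega> i) - 1))\<^sup>2) \<le>
      (real (n choose d))\<^sup>2 * (\<bar>F2 / real n ^ (2 * d) / \<kappa> - 2 * (F1 / real n ^ d) / \<kappa>1 + 1\<bar>
   + (M2 / real n ^ (2 * d) - F2 / real n ^ (2 * d)) / \<kappa>1\<^sup>2
   + (2 * (F1 / real n ^ d) / \<kappa>1 + 1) * (1 - \<kappa>))"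
proof -
  let ?I = "subset_idx n d" and ?p = "real (n choose d)" and ?n = "real n"
  define v where "v S \<omega> = (\<Prod>i\<in>S. sq \<omega> i)" for S \<omega>
  define \<theta> where "\<theta> = F1 / ?n ^ d / \<kappa>1"
  define e0 where "e0 = F2 / ?n ^ (2 * d) / \<kappa>"
  have p: "?p > 0" using nd d1 by (simp add: zero_less_binomial)
  have n: "?n > 0" by (rule n_pos)
  have iv: "integrable N (v S)" "expectation (v S) = \<theta>" if "S \<in> ?I" for S
  proof -
    show "integrable N (v S)" unfolding v_def by (rule expectation_prod_sq(1)[OF that]) simp
    have "fact d * ?p * expectation (v S) = F1"
      unfolding v_def F1_def by (rule expectation_prod_sq(2)[OF that]) simp
    moreover have "fact d * ?p = \<kappa>1 * ?n ^ d" using n by (simp add: \<kappa>1_def)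
    ultimately have "\<kappa>1 * ?n ^ d * expectation (v S) = F1" by (simp only:)
    moreover have "\<kappa>1 * ?n ^ d \<noteq> 0" using \<kappa>_bounds n by simp
    ultimately show "expectation (v S) = \<theta>" unfolding \<theta>_def by (metis divide_divide_eq_left nonzero_mult_div_cancel_left mult.commute)
  qed
  have ivv: "integrable N (\<lambda>\<omega>. v S \<omega> * v T \<omega>)" if "S \<in> ?I" "T \<in> ?I" for S T
    using integrable_y4[OF that(1) that(1) that(2) that(2)]
    unfolding v_def y_square[symmetric] power2_eq_square .
  have e0: "expectation (\<lambda>\<omega>. v S \<omega> * v T \<omega>) = e0" if "S \<in> ?I" "T \<in> ?I" "S \<inter> T = {}" for S T
  proof -
    have D: "S \<union> T \<in> subset_idx n (2 * d)"
      using subset_idxD[OF that(1)] subset_idxD[OF that(2)] that(3) card_Un_disjoint[of S T]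
      by (simp add: subset_idx_def)
    have "v S \<omega> * v T \<omega> = (\<Prod>i\<in>S \<union> T. sq \<omega> i)" for \<omega>
      unfolding v_def using that by (subst prod.union_disjoint) (auto dest: subset_idxD)
    then have "fact (2 * d) * real (n choose (2 * d)) * expectation (\<lambda>\<omega>. v S \<omega> * v T \<omega>) = F2"
      unfolding F2_def using expectation_prod_sq(2)[OF D] by simp
    moreover have "fact (2 * d) * real (n choose (2 * d)) = \<kappa> * ?n ^ (2 * d)" using n by (simp add: \<kappa>_def)
    ultimately have "\<kappa> * ?n ^ (2 * d) * expectation (\<lambda>\<omega>. v S \<omega> * v T \<omega>) = F2" by (simp only:)
    moreover have "\<kappa> * ?n ^ (2 * d) \<noteq> 0" using \<kappa>_bounds n by simp
    ultimately show ?thesis unfolding e0_def by (metis divide_divide_eq_left nonzero_mult_div_cancel_left mult.commute)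
  qed
  define w where "w S \<omega> = v S \<omega> - 1" for S \<omega>
  have ww: "w S \<omega> * w T \<omega> = v S \<omega> * v T \<omega> - v S \<omega> - v T \<omega> + 1" for S T \<omega>
    by (simp add: w_def algebra_simps)
  have iww: "integrable N (\<lambda>\<omega>. w S \<omega> * w T \<omega>)" if "S \<in> ?I" "T \<in> ?I" for S T
    unfolding ww using ivv[OF that] iv(1)[OF that(1)] iv(1)[OF that(2)] by simp
  have Eww: "expectation (\<lambda>\<omega>. w S \<omega> * w T \<omega>) = expectation (\<lambda>\<omega>. v S \<omega> * v T \<omega>) - 2 * \<theta> + 1"
    if "S \<in> ?I" "T \<in> ?I" for S T
    unfolding ww using ivv[OF that] iv[OF that(1)] iv[OF that(2)] prob_space by simp
  have v0: "v S \<omega> \<ge> 0" for S \<omega> by (simp add: v_def prod_nonneg)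
  have \<theta>0: "\<theta> \<ge> 0"
  proof -
    have "F1 \<ge> 0" unfolding F1_def by (intro Bochner_Integration.integral_nonneg mult_nonneg_nonneg esym_nonneg) auto
    then show ?thesis using \<kappa>_bounds n by (simp add: \<theta>_def)
  qed
  define c0 where "c0 = 2 * \<theta> + 1"
  \<comment> \<open>The correction for disjoint pairs: added to the crude bound it restores the
    exact value |e0 - 2 \<theta> + 1|.\<close>
  define r0 where "r0 = \<bar>e0 - 2 * \<theta> + 1\<bar> - e0 - (2 * \<theta> + 1)"
  have sq: "(\<Sum>S\<in>?I. b S * w S \<omega>)\<^sup>2 = (\<Sum>S\<in>?I. \<Sum>T\<in>?I. (b S * b T) * (w S \<omega> * w T \<omega>))" for \<omega>
    unfolding power2_eq_square sum_product by (intro sum.cong[OF refl]) (simp only: ac_simps)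
  have int: "integrable N (\<lambda>\<omega>. (\<Sum>S\<in>?I. b S * w S \<omega>)\<^sup>2)"
    unfolding sq by (intro Bochner_Integration.integrable_sum integrable_mult_right iww)
  have "expectation (\<lambda>\<omega>. (\<Sum>S\<in>?I. b S * w S \<omega>)\<^sup>2)
      = (\<Sum>S\<in>?I. \<Sum>T\<in>?I. (b S * b T) * expectation (\<lambda>\<omega>. w S \<omega> * w T \<omega>))"
    unfolding sq
    by (rule integral_double_sum[where f = "\<lambda>S T \<omega>. w S \<omega> * w T \<omega>" and c = "\<lambda>S T. b S * b T"]) (rule iww)
  also have "\<dots> \<le> (\<Sum>S\<in>?I. \<Sum>T\<in>?I. \<bar>expectation (\<lambda>\<omega>. w S \<omega> * w T \<omega>)\<bar>)"
  proof (intro sum_mono)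
    fix S T assume "S \<in> ?I" "T \<in> ?I"
    then have "\<bar>b S\<bar> * \<bar>b T\<bar> \<le> 1 * 1" using b by (intro mult_mono) auto
    then have "\<bar>b S * b T\<bar> * \<bar>expectation (\<lambda>\<omega>. w S \<omega> * w T \<omega>)\<bar> \<le> 1 * \<bar>expectation (\<lambda>\<omega>. w S \<omega> * w T \<omega>)\<bar>"
      by (intro mult_right_mono) (auto simp: abs_mult)
    then have "\<bar>(b S * b T) * expectation (\<lambda>\<omega>. w S \<omega> * w T \<omega>)\<bar> \<le> \<bar>expectation (\<lambda>\<omega>. w S \<omega> * w T \<omega>)\<bar>"
      by (simp only: abs_mult mult_1)
    then show "(b S * b T) * expectation (\<lambda>\<omega>. w S \<omega> * w T \<omega>) \<le> \<bar>expectation (\<lambda>\<omega>. w S \<omega> * w T \<omega>)\<bar>"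
      by (rule order_trans[OF abs_ge_self])
  qed
  also have "\<dots> \<le> (\<Sum>S\<in>?I. \<Sum>T\<in>?I. expectation (\<lambda>\<omega>. v S \<omega> * v T \<omega>) + c0
      + (if S \<inter> T = {} then r0 else 0))"
  proof (intro sum_mono)
    fix S T assume ST: "S \<in> ?I" "T \<in> ?I"
    have "expectation (\<lambda>\<omega>. v S \<omega> * v T \<omega>) \<ge> 0" by (intro Bochner_Integration.integral_nonneg mult_nonneg_nonneg v0)
    then show "\<bar>expectation (\<lambda>\<omega>. w S \<omega> * w T \<omega>)\<bar> \<le> expectation (\<lambda>\<omega>. v S \<omega> * v T \<omega>) + c0
      + (if S \<inter> T = {} then r0 else 0)"
      unfolding Eww[OF ST] using e0[OF ST] \<theta>0 by (cases "S \<inter> T = {}") (auto simp: c0_def r0_def)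
  qed
  also have "\<dots> = (\<Sum>S\<in>?I. \<Sum>T\<in>?I. expectation (\<lambda>\<omega>. v S \<omega> * v T \<omega>)) + ?p * ?p * c0
      + ?p * real ((n - d) choose d) * r0"
  proof -
    have "(\<Sum>T\<in>?I. if S \<inter> T = {} then r0 else 0) = real ((n - d) choose d) * r0" if "S \<in> ?I" for S
    proof -
      have "(\<Sum>T\<in>?I. if S \<inter> T = {} then r0 else 0) = (\<Sum>T\<in>{T \<in> ?I. S \<inter> T = {}}. r0)"
        by (rule sum.inter_filter[symmetric]) simp
      then show ?thesis by (simp add: card_disjoint_subsets[OF that])
    qed
    then have "(\<Sum>S\<in>?I. \<Sum>T\<in>?I. if S \<inter> T = {} then r0 else 0) = ?p * (real ((n - d) choose d) * r0)"
      by (simp add: card_subset_idx)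
    moreover have "(\<Sum>S\<in>?I. \<Sum>T\<in>?I. c0) = ?p * ?p * c0" by (simp add: card_subset_idx)
    ultimately show ?thesis by (simp only: sum.distrib mult.assoc)
  qed
  also have "(\<Sum>S\<in>?I. \<Sum>T\<in>?I. expectation (\<lambda>\<omega>. v S \<omega> * v T \<omega>)) \<le> M2 / (fact d)\<^sup>2"
  proof -
    have "(\<Sum>S\<in>?I. \<Sum>T\<in>?I. expectation (\<lambda>\<omega>. v S \<omega> * v T \<omega>)) = expectation (\<lambda>\<omega>. \<Sum>S\<in>?I. \<Sum>T\<in>?I. v S \<omega> * v T \<omega>)"
      using integral_double_sum[of ?I ?I N "\<lambda>S T \<omega>. v S \<omega> * v T \<omega>" "\<lambda>_ _. 1", OF ivv] by simp
    also have "\<dots> \<le> expectation (\<lambda>\<omega>. (\<Sum>i = 1..n. sq \<omega> i) ^ (2 * d) / (fact d)\<^sup>2)"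
    proof (rule integral_mono)
      show "integrable N (\<lambda>\<omega>. \<Sum>S\<in>?I. \<Sum>T\<in>?I. v S \<omega> * v T \<omega>)"
        by (intro Bochner_Integration.integrable_sum ivv)
      show "integrable N (\<lambda>\<omega>. (\<Sum>i = 1..n. sq \<omega> i) ^ (2 * d) / (fact d)\<^sup>2)" using int_norm by (simp add: sq_def)
      fix \<omega>
      have "(\<Sum>S\<in>?I. \<Sum>T\<in>?I. v S \<omega> * v T \<omega>) = (esym n d (sq \<omega>))\<^sup>2"
        unfolding esym_def v_def power2_eq_square sum_product ..
      moreover have "(fact d * esym n d (sq \<omega>))\<^sup>2 \<le> ((\<Sum>i = 1..n. sq \<omega> i) ^ d)\<^sup>2"
        by (intro power_mono esym_power_bounds mult_nonneg_nonneg esym_nonneg) auto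
      ultimately show "(\<Sum>S\<in>?I. \<Sum>T\<in>?I. v S \<omega> * v T \<omega>) \<le> (\<Sum>i = 1..n. sq \<omega> i) ^ (2 * d) / (fact d)\<^sup>2"
        by (simp add: pos_le_divide_eq power_mult_distrib power_mult[symmetric] mult.commute)
    qed
    also have "\<dots> = M2 / (fact d)\<^sup>2" by (simp add: M2_def)
    finally show ?thesis .
  qed
  finally have main: "expectation (\<lambda>\<omega>. (\<Sum>S\<in>?I. b S * w S \<omega>)\<^sup>2) \<le> M2 / (fact d)\<^sup>2 + ?p * ?p * (2 * \<theta> + 1)
      + ?p * real ((n - d) choose d) * (\<bar>e0 - 2 * \<theta> + 1\<bar> - e0 - (2 * \<theta> + 1))"
    by (simp add: c0_def r0_def)
  \<comment> \<open>\<open>?p * q\<close> is the number of ordered pairs of disjoint d-sets.\<close>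
  define q where "q = real ((n - d) choose d)"
  have fq: "?p = \<kappa>1 * ?n ^ d / fact d" using n by (simp add: \<kappa>1_def)
  have pq: "?p * q * (fact d)\<^sup>2 = \<kappa> * ?n ^ (2 * d)"
    using fact_binomial_disjoint[of d n] nd n unfolding q_def \<kappa>_def by (simp add: power2_eq_square ac_simps)
  have pp: "?p * ?p * (fact d)\<^sup>2 = \<kappa>1\<^sup>2 * ?n ^ (2 * d)"
    unfolding fq by (simp add: power2_eq_square mult_2 power_add)
  have k1: "\<kappa>1 > 0" "\<kappa>1\<^sup>2 \<le> 1" using \<kappa>_bounds by (auto intro: power_le_one)
  \<comment> \<open>The fraction of disjoint pairs is \<kappa> / \<kappa>1^2, which is at least
    \<kappa> because \<kappa>1 <= 1.\<close>
  have q1: "?p * q \<le> ?p * ?p" "?p * ?p - ?p * q \<le> ?p * ?p * (1 - \<kappa>)"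
  proof -
    have "q \<le> ?p" unfolding q_def by (simp add: binomial_right_mono)
    then show "?p * q \<le> ?p * ?p" using p by simp
    have "?p * ?p * \<kappa> * (fact d)\<^sup>2 \<le> ?p * q * (fact d)\<^sup>2"
    proof -
      have "?p * ?p * \<kappa> * (fact d)\<^sup>2 = \<kappa>1\<^sup>2 * (\<kappa> * ?n ^ (2 * d))" using pp by (simp add: ac_simps)
      also have "\<dots> \<le> 1 * (\<kappa> * ?n ^ (2 * d))" using k1 \<kappa>_bounds(1) n by (intro mult_right_mono) auto
      finally show ?thesis unfolding pq by simp
    qed
    then have "?p * ?p * \<kappa> \<le> ?p * q" by (rule mult_right_le_imp_le) simp
    then show "?p * ?p - ?p * q \<le> ?p * ?p * (1 - \<kappa>)" by (simp add: algebra_simps)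
  qed
  have "M2 / (fact d)\<^sup>2 - ?p * q * e0 = ?p * ?p * ((M2 / ?n ^ (2 * d) - F2 / ?n ^ (2 * d)) / \<kappa>1\<^sup>2)"
  proof -
    have "?p * q * e0 * (fact d)\<^sup>2 = F2"
    proof -
      have "?p * q * e0 * (fact d)\<^sup>2 = (?p * q * (fact d)\<^sup>2) * e0" by (simp add: ac_simps)
      also have "\<dots> = F2" unfolding pq e0_def using n \<kappa>_bounds(1) by simp
      finally show ?thesis .
    qed
    moreover have "?p * ?p * ((M2 / ?n ^ (2 * d) - F2 / ?n ^ (2 * d)) / \<kappa>1\<^sup>2) * (fact d)\<^sup>2 = M2 - F2"
    proof -
      have "?p * ?p * ((M2 / ?n ^ (2 * d) - F2 / ?n ^ (2 * d)) / \<kappa>1\<^sup>2) * (fact d)\<^sup>2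
         = (?p * ?p * (fact d)\<^sup>2) * ((M2 / ?n ^ (2 * d) - F2 / ?n ^ (2 * d)) / \<kappa>1\<^sup>2)" by (simp add: ac_simps)
      also have "\<dots> = M2 - F2" unfolding pp using n k1 by (simp add: diff_divide_distrib[symmetric])
      finally show ?thesis .
    qed
    moreover have "(M2 / (fact d)\<^sup>2 - ?p * q * e0) * (fact d)\<^sup>2 = M2 - ?p * q * e0 * (fact d)\<^sup>2"
      by (simp add: left_diff_distrib)
    ultimately have "(M2 / (fact d)\<^sup>2 - ?p * q * e0) * (fact d)\<^sup>2
      = ?p * ?p * ((M2 / ?n ^ (2 * d) - F2 / ?n ^ (2 * d)) / \<kappa>1\<^sup>2) * (fact d)\<^sup>2" by (simp only:)
    then show ?thesis by (rule mult_right_cancel[THEN iffD1, rotated]) simp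
  qed
  moreover have "?p * q * \<bar>e0 - 2 * \<theta> + 1\<bar> \<le> ?p * ?p * \<bar>e0 - 2 * \<theta> + 1\<bar>"
    using q1(1) by (intro mult_right_mono) auto
  moreover have "(?p * ?p - ?p * q) * (2 * \<theta> + 1) \<le> ?p * ?p * (1 - \<kappa>) * (2 * \<theta> + 1)"
    using q1(2) \<theta>0 by (intro mult_right_mono) auto
  moreover note main[folded q_def]
  ultimately have "expectation (\<lambda>\<omega>. (\<Sum>S\<in>?I. b S * w S \<omega>)\<^sup>2) \<le>
     ?p * ?p * \<bar>e0 - 2 * \<theta> + 1\<bar> + ?p * ?p * ((M2 / ?n ^ (2 * d) - F2 / ?n ^ (2 * d)) / \<kappa>1\<^sup>2)
      + ?p * ?p * (1 - \<kappa>) * (2 * \<theta> + 1)"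
    by (simp only: right_diff_distrib left_diff_distrib)
  also have "\<dots> = ?p\<^sup>2 * (\<bar>e0 - 2 * \<theta> + 1\<bar> + (M2 / ?n ^ (2 * d) - F2 / ?n ^ (2 * d)) / \<kappa>1\<^sup>2 + (2 * \<theta> + 1) * (1 - \<kappa>))"
    by (simp only: power2_eq_square distrib_left ac_simps)
  finally show "expectation (\<lambda>\<omega>. (\<Sum>S\<in>?I. b S * ((\<Prod>i\<in>S. sq \<omega> i) - 1))\<^sup>2) \<le>
      ?p\<^sup>2 * (\<bar>F2 / ?n ^ (2 * d) / \<kappa> - 2 * (F1 / ?n ^ d) / \<kappa>1 + 1\<bar>
   + (M2 / ?n ^ (2 * d) - F2 / ?n ^ (2 * d)) / \<kappa>1\<^sup>2
   + (2 * (F1 / ?n ^ d) / \<kappa>1 + 1) * (1 - \<kappa>))"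
    unfolding w_def v_def e0_def \<theta>_def by (simp only: times_divide_eq_right)
  show "integrable N (\<lambda>\<omega>. (\<Sum>S\<in>?I. b S * ((\<Prod>i\<in>S. sq \<omega> i) - 1))\<^sup>2)"
    using int unfolding w_def v_def .
qed

text \<open>The form splits into the pairs S \<noteq> T and the centred diagonal, and (f + g)^2 <= 2
  f^2 + 2 g^2. Both assumptions are modelled on B = t R with a resolvent R.\<close>

lemma quadratic_form_bound:
  assumes diag: "\<And>S. S \<in> subset_idx n d \<Longrightarrow> \<bar>B S S\<bar> \<le> 1"
    and frob: "(\<Sum>S\<in>subset_idx n d. \<Sum>T\<in>subset_idx n d. (B S T)\<^sup>2) \<le> real (n choose d)"
  defines "q \<equiv> \<lambda>\<omega>. (\<Sum>S\<in>subset_idx n d. y S \<omega> * (\<Sum>T\<in>subset_idx n d. B S T * y T \<omega>))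
      - (\<Sum>S\<in>subset_idx n d. B S S)"
  shows "integrable N (\<lambda>\<omega>. (q \<omega>)\<^sup>2)" "expectation (\<lambda>\<omega>. (q \<omega>)\<^sup>2) \<le> 2 * (real (n choose d))\<^sup>2 * defect"
proof -
  let ?I = "subset_idx n d"
  define f where "f \<omega> = (\<Sum>p\<in>J. B (fst p) (snd p) * z p \<omega>)" for \<omega>
  define g where "g \<omega> = (\<Sum>S\<in>?I. B S S * ((\<Prod>i\<in>S. sq \<omega> i) - 1))" for \<omega>
  have J: "(\<Sum>S\<in>?I. \<Sum>T\<in>?I. h S T) = (\<Sum>p\<in>J. h (fst p) (snd p)) + (\<Sum>S\<in>?I. h S S)" for h :: "nat set \<Rightarrow> nat set \<Rightarrow> real"
  proof -
    have "(\<Sum>S\<in>?I. \<Sum>T\<in>?I. h S T) = (\<Sum>p\<in>?I \<times> ?I. h (fst p) (snd p))"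
      by (simp add: sum.cartesian_product case_prod_unfold)
    also have "?I \<times> ?I = J \<union> (\<lambda>S. (S, S)) ` ?I" by auto
    also have "(\<Sum>p\<in>J \<union> (\<lambda>S. (S, S)) ` ?I. h (fst p) (snd p))
        = (\<Sum>p\<in>J. h (fst p) (snd p)) + (\<Sum>p\<in>(\<lambda>S. (S, S)) ` ?I. h (fst p) (snd p))"
      by (rule sum.union_disjoint[OF finite_J]) auto
    also have "(\<Sum>p\<in>(\<lambda>S. (S, S)) ` ?I. h (fst p) (snd p)) = (\<Sum>S\<in>?I. h S S)"
      by (subst sum.reindex) (auto simp: inj_on_def)
    finally show ?thesis .
  qed
  have q: "q \<omega> = f \<omega> + g \<omega>" for \<omega>
  proof -
    have "(\<Sum>S\<in>?I. y S \<omega> * (\<Sum>T\<in>?I. B S T * y T \<omega>)) = (\<Sum>S\<in>?I. \<Sum>T\<in>?I. B S T * (y S \<omega> * y T \<omega>))"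
      by (simp add: sum_distrib_left ac_simps)
    also have "\<dots> = f \<omega> + (\<Sum>S\<in>?I. B S S * (y S \<omega>)\<^sup>2)"
      unfolding J f_def z_def power2_eq_square ..
    finally show ?thesis
      unfolding q_def g_def y_square by (simp add: right_diff_distrib sum_subtractf)
  qed
  have "(\<Sum>p\<in>J. (B (fst p) (snd p))\<^sup>2) \<le> (\<Sum>S\<in>?I. \<Sum>T\<in>?I. (B S T)\<^sup>2)"
    unfolding J by (simp add: sum_nonneg)
  with frob have fr: "(\<Sum>p\<in>J. (B (fst p) (snd p))\<^sup>2) \<le> real (n choose d)" by linarith
  note off = off_diagonal_bound[OF fr, folded f_def]
  have dg: "integrable N (\<lambda>\<omega>. (g \<omega>)\<^sup>2)" "expectation (\<lambda>\<omega>. (g \<omega>)\<^sup>2) \<le>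
      (real (n choose d))\<^sup>2 * (\<bar>F2 / real n ^ (2 * d) / \<kappa> - 2 * (F1 / real n ^ d) / \<kappa>1 + 1\<bar>
   + (M2 / real n ^ (2 * d) - F2 / real n ^ (2 * d)) / \<kappa>1\<^sup>2
   + (2 * (F1 / real n ^ d) / \<kappa>1 + 1) * (1 - \<kappa>))"
    unfolding g_def
    by (rule diagonal_bound(1)[of "\<lambda>S. B S S"], rule diag, assumption)
      (rule diagonal_bound(2)[of "\<lambda>S. B S S"], rule diag, assumption)
  have mq: "q \<in> borel_measurable N"
    unfolding q_def by (intro borel_measurable_diff borel_measurable_sum borel_measurable_times meas_y borel_measurable_const)
  have le: "(q \<omega>)\<^sup>2 \<le> 2 * (f \<omega>)\<^sup>2 + 2 * (g \<omega>)\<^sup>2" for \<omega>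
  proof -
    have "0 \<le> (f \<omega> - g \<omega>)\<^sup>2" by simp
    then show ?thesis unfolding q by (simp add: power2_sum power2_diff)
  qed
  have i2: "integrable N (\<lambda>\<omega>. 2 * (f \<omega>)\<^sup>2 + 2 * (g \<omega>)\<^sup>2)" using off(1) dg(1) by simp
  show i: "integrable N (\<lambda>\<omega>. (q \<omega>)\<^sup>2)"
    by (rule Bochner_Integration.integrable_bound[OF i2])
      (use mq le in \<open>auto intro!: AE_I2 order_trans[OF _ abs_ge_self]\<close>)
  have "expectation (\<lambda>\<omega>. (q \<omega>)\<^sup>2) \<le> expectation (\<lambda>\<omega>. 2 * (f \<omega>)\<^sup>2 + 2 * (g \<omega>)\<^sup>2)"
    by (rule integral_mono[OF i i2 le])
  also have "\<dots> = 2 * expectation (\<lambda>\<omega>. (f \<omega>)\<^sup>2) + 2 * expectation (\<lambda>\<omega>. (g \<omega>)\<^sup>2)"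
    using off(1) dg(1) by simp
  also have "\<dots> \<le> 2 * (real (n choose d))\<^sup>2 * defect"
    using off(2) dg(2) unfolding defect_def by (simp only: distrib_left mult.assoc)
  finally show "expectation (\<lambda>\<omega>. (q \<omega>)\<^sup>2) \<le> 2 * (real (n choose d))\<^sup>2 * defect" .
qed

end

section \<open>Vanishing of the defect\<close>

text \<open>The k-th moment of Z = |X|^2 / n, the squared norm scaled to have mean near 1.\<close>

definition zmom :: "'b measure \<Rightarrow> nat \<Rightarrow> ('b \<Rightarrow> nat \<Rightarrow> real) \<Rightarrow> nat \<Rightarrow> real" where
  "zmom N n X k = (\<integral>\<omega>. (\<Sum>i=1..n. (X \<omega> i)\<^sup>2) ^ k \<partial>N) / real n ^ k"

text \<open>The normalised expectation of |X|_4^4 |X|_2^(4d-4): the weight of the 2d-tuples of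
  indices with one prescribed coincidence. The truncated exponent is exact for d >= 1.\<close>

definition dmom :: "'b measure \<Rightarrow> nat \<Rightarrow> nat \<Rightarrow> ('b \<Rightarrow> nat \<Rightarrow> real) \<Rightarrow> real" where
  "dmom N n d X = (\<integral>\<omega>. (\<Sum>i=1..n. (X \<omega> i) ^ 4) * (\<Sum>i=1..n. (X \<omega> i)\<^sup>2) ^ (2 * d - 2) \<partial>N) / real n ^ (2 * d)"

text \<open>Birthday bound: the factors are 1 - j / n with j < q, and the deficits j / n add up to
  at most q^2 / n.\<close>

lemma fact_binomial_ge:
  assumes n: "n \<ge> 1" and q: "q \<le> n"
  shows "1 - (real q)\<^sup>2 / real n \<le> fact q * real (n choose q) / real n ^ q"
  using q
proof (induction q)
  case (Suc q)
  have n0: "real n > 0" using n by simp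
  let ?t = "real q / real n"
  have "1 - (real (Suc q))\<^sup>2 / real n \<le> (1 - (real q)\<^sup>2 / real n) * (1 - ?t)"
  proof -
    have "(1 - (real q)\<^sup>2 / real n) * (1 - ?t) = 1 - (real q)\<^sup>2 / real n - ?t + (real q)\<^sup>2 / real n * ?t"
    proof -
      have "(1 - a) * (1 - t) = 1 - a - t + a * t" for a t :: real by (simp add: algebra_simps)
      then show ?thesis .
    qed
    moreover have "(real (Suc q))\<^sup>2 / real n = (real q)\<^sup>2 / real n + ?t + ?t + 1 / real n"
      by (simp add: power2_eq_square add_divide_distrib algebra_simps)
    moreover have "(real q)\<^sup>2 / real n * ?t \<ge> 0" "?t \<ge> 0" "1 / real n \<ge> 0" by auto
    ultimately show ?thesis by linarith
  qed
  also have "\<dots> \<le> fact q * real (n choose q) / real n ^ q * (1 - ?t)"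
    using Suc n0 by (intro mult_right_mono) auto
  also have "\<dots> = fact q * real (n choose q) * (real n - real q) / real n ^ Suc q"
    using n0 by (simp add: field_simps)
  also have "\<dots> = fact (Suc q) * real (n choose Suc q) / real n ^ Suc q"
    using Suc.prems by (simp only: fact_binomial_step Suc_le_eq)
  finally show ?case .
qed simp

lemma (in prob_space) expectation_square_le:
  fixes f :: "'a \<Rightarrow> real"
  assumes "integrable M f" "integrable M (\<lambda>x. (f x)\<^sup>2)"
  shows "(expectation f)\<^sup>2 \<le> expectation (\<lambda>x. (f x)\<^sup>2)"
  using variance_eq[OF assms] variance_positive[of f] by simp

context power_vector
begin

lemma zmom_eq: "zmom N n X k = expectation (\<lambda>\<omega>. (\<Sum>i=1..n. sq \<omega> i) ^ k) / real n ^ k"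
  by (simp add: zmom_def sq_def)

lemma dmom_eq: "dmom N n d X = expectation (\<lambda>\<omega>. (\<Sum>i=1..n. (sq \<omega> i)\<^sup>2) * (\<Sum>i=1..n. sq \<omega> i) ^ (2 * d - 2)) / real n ^ (2 * d)"
  by (simp add: dmom_def sq_def power_mult[symmetric])

lemma meas_sq: "i \<in> {1..n} \<Longrightarrow> (\<lambda>\<omega>. sq \<omega> i) \<in> borel_measurable N"
  unfolding sq_def by (intro borel_measurable_power meas_X)

lemma meas_P: "(\<lambda>\<omega>. (\<Sum>i=1..n. sq \<omega> i) ^ k) \<in> borel_measurable N"
  by (intro borel_measurable_power borel_measurable_sum meas_sq)

lemma P_nonneg: "(\<Sum>i=1..n. sq \<omega> i) \<ge> 0"
  by (intro sum_nonneg) simp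

lemma integrable_P: "k \<le> 2 * d \<Longrightarrow> integrable N (\<lambda>\<omega>. (\<Sum>i=1..n. sq \<omega> i) ^ k)"
  by (rule integrable_dominated[OF meas_P, of k]) (use P_nonneg in auto)

lemma Q_le: "(\<Sum>i=1..n. (sq \<omega> i)\<^sup>2) \<le> (\<Sum>i=1..n. sq \<omega> i)\<^sup>2"
proof -
  have "(\<Sum>i=1..n. (sq \<omega> i)\<^sup>2) \<le> (\<Sum>i=1..n. sq \<omega> i * (\<Sum>i=1..n. sq \<omega> i))"
    unfolding power2_eq_square
    by (intro sum_mono mult_left_mono member_le_sum[where f = "sq \<omega>"]) auto
  then show ?thesis by (simp add: sum_distrib_right power2_eq_square)
qed

lemma integrable_QP: "integrable N (\<lambda>\<omega>. (\<Sum>i=1..n. (sq \<omega> i)\<^sup>2) * (\<Sum>i=1..n. sq \<omega> i) ^ (2 * d - 2))"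
proof (rule integrable_dominated[where k = "2 * d"])
  show "(\<lambda>\<omega>. (\<Sum>i=1..n. (sq \<omega> i)\<^sup>2) * (\<Sum>i=1..n. sq \<omega> i) ^ (2 * d - 2)) \<in> borel_measurable N"
    by (intro borel_measurable_times meas_P borel_measurable_sum borel_measurable_power meas_sq)
  fix \<omega>
  have "(\<Sum>i=1..n. (sq \<omega> i)\<^sup>2) * (\<Sum>i=1..n. sq \<omega> i) ^ (2 * d - 2)
    \<le> (\<Sum>i=1..n. sq \<omega> i)\<^sup>2 * (\<Sum>i=1..n. sq \<omega> i) ^ (2 * d - 2)"
    by (intro mult_right_mono Q_le zero_le_power P_nonneg)
  also have "\<dots> = (\<Sum>i=1..n. sq \<omega> i) ^ (2 * d)"
    unfolding power_add[symmetric] using d1 by (intro arg_cong[where f = "(^) _"]) simp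
  finally show "\<bar>(\<Sum>i=1..n. (sq \<omega> i)\<^sup>2) * (\<Sum>i=1..n. sq \<omega> i) ^ (2 * d - 2)\<bar> \<le> (\<Sum>i=1..n. sq \<omega> i) ^ (2 * d)"
    by (subst abs_of_nonneg) (auto intro!: mult_nonneg_nonneg sum_nonneg zero_le_power)
qed simp

text \<open>These are \<open>esym_power_bounds\<close> at q = 2 d under the expectation, with 2 d (2
  d - 1) / 2 <= 2 d^2.\<close>

lemma F2_bounds:
  "F2 / real n ^ (2 * d) \<le> zmom N n X (2 * d)"
  "zmom N n X (2 * d) - 2 * (real d)\<^sup>2 * dmom N n d X \<le> F2 / real n ^ (2 * d)"
proof -
  let ?P = "\<lambda>\<omega>. \<Sum>i=1..n. sq \<omega> i" and ?Q = "\<lambda>\<omega>. \<Sum>i=1..n. (sq \<omega> i)\<^sup>2"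
  have iF: "integrable N (\<lambda>\<omega>. fact (2 * d) * esym n (2 * d) (sq \<omega>))"
    using integrable_esym2[of "2 * d" 0] by simp
  have "F2 \<le> expectation (\<lambda>\<omega>. ?P \<omega> ^ (2 * d))"
    unfolding F2_def by (intro integral_mono iF integrable_P esym_power_bounds) auto
  then show "F2 / real n ^ (2 * d) \<le> zmom N n X (2 * d)"
    unfolding zmom_eq by (intro divide_right_mono) auto
  have "expectation (\<lambda>\<omega>. ?P \<omega> ^ (2 * d)) - F2
      = expectation (\<lambda>\<omega>. ?P \<omega> ^ (2 * d) - fact (2 * d) * esym n (2 * d) (sq \<omega>))"
    unfolding F2_def by (rule Bochner_Integration.integral_diff[symmetric, OF integrable_P iF]) simp
  also have "\<dots> \<le> expectation (\<lambda>\<omega>. 2 * (real d)\<^sup>2 * (?Q \<omega> * ?P \<omega> ^ (2 * d - 2)))"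
  proof (rule integral_mono)
    show "integrable N (\<lambda>\<omega>. ?P \<omega> ^ (2 * d) - fact (2 * d) * esym n (2 * d) (sq \<omega>))"
      by (intro Bochner_Integration.integrable_diff iF integrable_P) simp
    show "integrable N (\<lambda>\<omega>. 2 * (real d)\<^sup>2 * (?Q \<omega> * ?P \<omega> ^ (2 * d - 2)))"
      by (intro integrable_mult_right integrable_QP)
    fix \<omega>
    have "?P \<omega> ^ (2 * d) - fact (2 * d) * esym n (2 * d) (sq \<omega>)
        \<le> real (2 * d) * (real (2 * d) - 1) / 2 * ?Q \<omega> * ?P \<omega> ^ (2 * d - 2)"
      by (rule esym_power_bounds) simp
    also have "\<dots> \<le> 2 * (real d)\<^sup>2 * ?Q \<omega> * ?P \<omega> ^ (2 * d - 2)"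
    proof (intro mult_right_mono)
      show "real (2 * d) * (real (2 * d) - 1) / 2 \<le> 2 * (real d)\<^sup>2"
        by (simp add: power2_eq_square algebra_simps)
    qed (auto intro!: sum_nonneg zero_le_power)
    finally show "?P \<omega> ^ (2 * d) - fact (2 * d) * esym n (2 * d) (sq \<omega>) \<le> 2 * (real d)\<^sup>2 * (?Q \<omega> * ?P \<omega> ^ (2 * d - 2))"
      by (simp only: mult.assoc)
  qed
  also have "\<dots> = 2 * (real d)\<^sup>2 * expectation (\<lambda>\<omega>. ?Q \<omega> * ?P \<omega> ^ (2 * d - 2))" by simp
  finally have "expectation (\<lambda>\<omega>. ?P \<omega> ^ (2 * d)) / real n ^ (2 * d) - F2 / real n ^ (2 * d)
    \<le> 2 * (real d)\<^sup>2 * expectation (\<lambda>\<omega>. ?Q \<omega> * ?P \<omega> ^ (2 * d - 2)) / real n ^ (2 * d)"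
    unfolding diff_divide_distrib[symmetric] by (intro divide_right_mono) auto
  then show "zmom N n X (2 * d) - 2 * (real d)\<^sup>2 * dmom N n d X \<le> F2 / real n ^ (2 * d)"
    unfolding zmom_eq dmom_eq by simp
qed

text \<open>At q = d the repetition bound produces E (Q P^(d-2)), not the quantity in
  \<open>dmom\<close>. Bounding the square of the deficit u by P^d u raises the degree to 2 d, and
  (E u)^2 <= E u^2 brings it back, which is where the square root comes from.\<close>

lemma F1_bounds:
  "F1 / real n ^ d \<le> zmom N n X d"
  "zmom N n X d - sqrt ((real d)\<^sup>2 * dmom N n d X) \<le> F1 / real n ^ d"
proof -
  let ?P = "\<lambda>\<omega>. \<Sum>i=1..n. sq \<omega> i" and ?Q = "\<lambda>\<omega>. \<Sum>i=1..n. (sq \<omega> i)\<^sup>2"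
  have n: "real n > 0" by (rule n_pos)
  have iF: "integrable N (\<lambda>\<omega>. fact d * esym n d (sq \<omega>))"
    using integrable_esym2[of d 0] by simp
  have "F1 \<le> expectation (\<lambda>\<omega>. ?P \<omega> ^ d)"
    unfolding F1_def by (intro integral_mono iF integrable_P esym_power_bounds) auto
  then show "F1 / real n ^ d \<le> zmom N n X d"
    unfolding zmom_eq by (intro divide_right_mono) auto
  define u where "u \<omega> = ?P \<omega> ^ d - fact d * esym n d (sq \<omega>)" for \<omega>
  have u0: "u \<omega> \<ge> 0" for \<omega>
    unfolding u_def using esym_power_bounds(1)[of "sq \<omega>" d n] by simp
  have iu: "integrable N u" unfolding u_def by (intro Bochner_Integration.integrable_diff iF integrable_P) simp
  have u2: "(u \<omega>)\<^sup>2 \<le> (real d)\<^sup>2 * (?Q \<omega> * ?P \<omega> ^ (2 * d - 2))" for \<omega>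
  \<comment> \<open>For d = 1 the deficit is 0; the case is separate because the truncated exponents
    satisfy d + (d - 2) = 2 d - 2 only from d = 2 on.\<close>
  proof (cases "d = 1")
    case True
    have "u \<omega> \<le> real d * (real d - 1) / 2 * ?Q \<omega> * ?P \<omega> ^ (d - 2)"
      unfolding u_def by (rule esym_power_bounds) simp
    then have "u \<omega> = 0" using True u0[of \<omega>] by simp
    then show ?thesis by (auto intro!: mult_nonneg_nonneg sum_nonneg zero_le_power)
  next
    case False
    then have d2: "d \<ge> 2" using d1 by simp
    have "u \<omega> \<le> ?P \<omega> ^ d" unfolding u_def by (simp add: esym_nonneg)
    then have "(u \<omega>)\<^sup>2 \<le> ?P \<omega> ^ d * u \<omega>" using u0[of \<omega>] by (simp add: power2_eq_square mult_right_mono)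
    also have "\<dots> \<le> ?P \<omega> ^ d * (real d * (real d - 1) / 2 * ?Q \<omega> * ?P \<omega> ^ (d - 2))"
      unfolding u_def by (intro mult_left_mono esym_power_bounds zero_le_power P_nonneg) simp
    also have "\<dots> = real d * (real d - 1) / 2 * (?Q \<omega> * (?P \<omega> ^ d * ?P \<omega> ^ (d - 2)))" by (simp only: ac_simps)
    also have "?P \<omega> ^ d * ?P \<omega> ^ (d - 2) = ?P \<omega> ^ (2 * d - 2)"
      unfolding power_add[symmetric] using d2 by (intro arg_cong[where f = "(^) _"]) simp
    also have "real d * (real d - 1) / 2 * (?Q \<omega> * ?P \<omega> ^ (2 * d - 2)) \<le> (real d)\<^sup>2 * (?Q \<omega> * ?P \<omega> ^ (2 * d - 2))"
    proof (rule mult_right_mono)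
      have "real d * (real d - 1) \<le> real d * (2 * real d)" by (intro mult_left_mono) auto
      then show "real d * (real d - 1) / 2 \<le> (real d)\<^sup>2" by (simp add: power2_eq_square)
    qed (auto intro!: mult_nonneg_nonneg sum_nonneg zero_le_power)
    finally show ?thesis .
  qed
  have iQ: "integrable N (\<lambda>\<omega>. (real d)\<^sup>2 * (?Q \<omega> * ?P \<omega> ^ (2 * d - 2)))"
    by (intro integrable_mult_right integrable_QP)
  have iu2: "integrable N (\<lambda>\<omega>. (u \<omega>)\<^sup>2)"
  proof (rule Bochner_Integration.integrable_bound[OF iQ])
    show "(\<lambda>\<omega>. (u \<omega>)\<^sup>2) \<in> borel_measurable N" using iu by auto
    show "AE \<omega> in N. norm ((u \<omega>)\<^sup>2) \<le> norm ((real d)\<^sup>2 * (?Q \<omega> * ?P \<omega> ^ (2 * d - 2)))"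
      using order_trans[OF u2 abs_ge_self] by (intro AE_I2) (simp only: real_norm_def abs_power2)
  qed
  have "(expectation u)\<^sup>2 \<le> expectation (\<lambda>\<omega>. (u \<omega>)\<^sup>2)" by (rule expectation_square_le[OF iu iu2])
  also have "\<dots> \<le> expectation (\<lambda>\<omega>. (real d)\<^sup>2 * (?Q \<omega> * ?P \<omega> ^ (2 * d - 2)))"
    by (rule integral_mono[OF iu2 iQ u2])
  also have "\<dots> = (real d)\<^sup>2 * dmom N n d X * (real n ^ d)\<^sup>2"
    unfolding dmom_eq using n by (simp add: power_mult[symmetric] mult.commute)
  finally have "(expectation u / real n ^ d)\<^sup>2 \<le> (real d)\<^sup>2 * dmom N n d X"
    using n by (simp add: power_divide pos_divide_le_eq)
  then have "expectation u / real n ^ d \<le> sqrt ((real d)\<^sup>2 * dmom N n d X)" by (rule real_le_rsqrt)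
  moreover have "expectation u = expectation (\<lambda>\<omega>. ?P \<omega> ^ d) - F1"
    unfolding u_def F1_def by (rule Bochner_Integration.integral_diff[OF integrable_P iF]) simp
  ultimately show "zmom N n X d - sqrt ((real d)\<^sup>2 * dmom N n d X) \<le> F1 / real n ^ d"
    unfolding zmom_eq by (simp add: diff_divide_distrib)
qed

lemma \<kappa>_ge: "1 - 4 * ((real d)\<^sup>2 / real n) \<le> \<kappa>"
  using fact_binomial_ge[of n "2 * d"] d1 nd unfolding \<kappa>_def by (simp add: power_mult_distrib)

lemma M2_zmom: "M2 / real n ^ (2 * d) = zmom N n X (2 * d)"
  by (simp add: M2_def zmom_eq)

end

text \<open>By sandwiching, \<kappa>, \<kappa>1, F1 / n^d and F2 / n^(2d) all tend to 1 together
  with the moments of Z, and then each summand of \<open>defect\<close> vanishes in the limit. The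
  hypothesis on d^2 / n enters through the birthday bound on \<kappa>.\<close>

lemma defect_tendsto_0:
  fixes N :: "nat \<Rightarrow> 'b measure" and d :: "nat \<Rightarrow> nat"
  assumes pv: "\<forall>\<^sub>F n in sequentially. power_vector (N n) n (d n) (X n)"
    and d: "(\<lambda>n. (real (d n))\<^sup>2 / real n) \<longlonglongrightarrow> 0"
    and z1: "(\<lambda>n. zmom (N n) n (X n) (d n)) \<longlonglongrightarrow> 1"
    and z2: "(\<lambda>n. zmom (N n) n (X n) (2 * d n)) \<longlonglongrightarrow> 1"
    and D: "(\<lambda>n. (real (d n))\<^sup>2 * dmom (N n) n (d n) (X n)) \<longlonglongrightarrow> 0"
  shows "(\<lambda>n. power_vector.defect (N n) n (d n) (X n)) \<longlonglongrightarrow> 0"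
proof -
  define k where "k n = power_vector.\<kappa> n (d n)" for n
  define k1 where "k1 n = power_vector.\<kappa>1 n (d n)" for n
  define \<alpha> where "\<alpha> n = power_vector.F1 (N n) n (d n) (X n) / real n ^ d n" for n
  define \<beta> where "\<beta> n = power_vector.F2 (N n) n (d n) (X n) / real n ^ (2 * d n)" for n
  have k: "k \<longlonglongrightarrow> 1"
  proof (rule tendsto_sandwich)
    show "(\<lambda>n. 1 - 4 * ((real (d n))\<^sup>2 / real n)) \<longlonglongrightarrow> 1"
      using tendsto_diff[OF tendsto_const tendsto_mult[OF tendsto_const d], of 1 4] by simp
    show "\<forall>\<^sub>F n in sequentially. 1 - 4 * ((real (d n))\<^sup>2 / real n) \<le> k n"
      using pv by eventually_elim (simp only: k_def power_vector.\<kappa>_ge)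
    show "\<forall>\<^sub>F n in sequentially. k n \<le> 1"
      using pv by eventually_elim (auto simp: k_def intro: order_trans[OF power_vector.\<kappa>_bounds(2) power_vector.\<kappa>_bounds(3)])
  qed simp
  have k1: "k1 \<longlonglongrightarrow> 1"
  proof (rule tendsto_sandwich[OF _ _ k])
    show "\<forall>\<^sub>F n in sequentially. k n \<le> k1 n"
      using pv by eventually_elim (simp only: k_def k1_def power_vector.\<kappa>_bounds)
    show "\<forall>\<^sub>F n in sequentially. k1 n \<le> 1"
      using pv by eventually_elim (simp only: k1_def power_vector.\<kappa>_bounds)
  qed simp
  have \<beta>: "\<beta> \<longlonglongrightarrow> 1"
  proof (rule tendsto_sandwich[OF _ _ _ z2])
    show "(\<lambda>n. zmom (N n) n (X n) (2 * d n) - 2 * ((real (d n))\<^sup>2 * dmom (N n) n (d n) (X n))) \<longlonglongrightarrow> 1"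
      using tendsto_diff[OF z2 tendsto_mult[OF tendsto_const D], of 2] by simp
    show "\<forall>\<^sub>F n in sequentially. zmom (N n) n (X n) (2 * d n) - 2 * ((real (d n))\<^sup>2 * dmom (N n) n (d n) (X n)) \<le> \<beta> n"
      using pv by eventually_elim (simp only: \<beta>_def mult.assoc[symmetric] power_vector.F2_bounds)
    show "\<forall>\<^sub>F n in sequentially. \<beta> n \<le> zmom (N n) n (X n) (2 * d n)"
      using pv by eventually_elim (simp only: \<beta>_def power_vector.F2_bounds)
  qed
  have \<alpha>: "\<alpha> \<longlonglongrightarrow> 1"
  proof (rule tendsto_sandwich[OF _ _ _ z1])
    show "(\<lambda>n. zmom (N n) n (X n) (d n) - sqrt ((real (d n))\<^sup>2 * dmom (N n) n (d n) (X n))) \<longlonglongrightarrow> 1"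
      using tendsto_diff[OF z1 tendsto_real_sqrt[OF D]] by simp
    show "\<forall>\<^sub>F n in sequentially. zmom (N n) n (X n) (d n) - sqrt ((real (d n))\<^sup>2 * dmom (N n) n (d n) (X n)) \<le> \<alpha> n"
      using pv by eventually_elim (simp only: \<alpha>_def power_vector.F1_bounds)
    show "\<forall>\<^sub>F n in sequentially. \<alpha> n \<le> zmom (N n) n (X n) (d n)"
      using pv by eventually_elim (simp only: \<alpha>_def power_vector.F1_bounds)
  qed
  have dn: "(\<lambda>n. real (d n) / real n) \<longlonglongrightarrow> 0"
  proof (rule tendsto_sandwich[OF _ _ tendsto_const d])
    show "\<forall>\<^sub>F n in sequentially. real (d n) / real n \<le> (real (d n))\<^sup>2 / real n"
      using pv
    proof eventually_elim
      case (elim n)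
      then have "real (d n) \<ge> 1" using power_vector.d1 by fastforce
      then have "real (d n) * 1 \<le> real (d n) * real (d n)" by (intro mult_left_mono) auto
      then show ?case by (intro divide_right_mono) (auto simp: power2_eq_square)
    qed
  qed simp
  have lim: "(\<lambda>n. 4 * (real (d n) / real n) * zmom (N n) n (X n) (2 * d n) / (k n)\<^sup>2
     + \<bar>\<beta> n / k n - 2 * \<alpha> n / k1 n + 1\<bar> + (zmom (N n) n (X n) (2 * d n) - \<beta> n) / (k1 n)\<^sup>2
     + (2 * \<alpha> n / k1 n + 1) * (1 - k n)) \<longlonglongrightarrow>
     4 * 0 * 1 / 1\<^sup>2 + \<bar>1 / 1 - 2 * 1 / 1 + 1\<bar> + (1 - 1) / 1\<^sup>2 + (2 * 1 / 1 + 1) * (1 - 1)"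
    by (intro tendsto_intros dn z2 k k1 \<alpha> \<beta>) simp_all
  have "\<forall>\<^sub>F n in sequentially. power_vector.defect (N n) n (d n) (X n) =
     4 * (real (d n) / real n) * zmom (N n) n (X n) (2 * d n) / (k n)\<^sup>2
     + \<bar>\<beta> n / k n - 2 * \<alpha> n / k1 n + 1\<bar> + (zmom (N n) n (X n) (2 * d n) - \<beta> n) / (k1 n)\<^sup>2
     + (2 * \<alpha> n / k1 n + 1) * (1 - k n)"
    using pv
    by eventually_elim (simp add: power_vector.defect_def power_vector.M2_zmom k_def k1_def \<alpha>_def \<beta>_def)
  then have "(\<lambda>n. power_vector.defect (N n) n (d n) (X n)) \<longlonglongrightarrow>
     4 * 0 * 1 / 1\<^sup>2 + \<bar>1 / 1 - 2 * 1 / 1 + 1\<bar> + (1 - 1) / 1\<^sup>2 + (2 * 1 / 1 + 1) * (1 - 1)"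
    using lim by (simp only: tendsto_cong)
  then show ?thesis by simp
qed

section \<open>Moments of the normalised norm and the case of growing degree\<close>

lemma exchangeable_nn_integral:
  assumes X: "X \<in> measurable N (Rn n)" and ex: "exchangeable N n X" and i: "i \<in> {1..n}"
    and f: "f \<in> borel_measurable borel"
  shows "(\<integral>\<^sup>+\<omega>. f (X \<omega> i) \<partial>N) = (\<integral>\<^sup>+\<omega>. f (X \<omega> 1) \<partial>N)"
proof -
  have n: "1 \<in> {1..n}" using i by auto
  define \<sigma> where "\<sigma> = Transposition.transpose 1 i"
  have s: "\<sigma> permutes {1..n}" unfolding \<sigma>_def using n i by (rule permutes_swap_id)
  have g: "(\<lambda>x. f (x 1)) \<in> borel_measurable (Rn n)"
    using measurable_compose[OF measurable_component_singleton[OF n] f] .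
  have m: "(\<lambda>\<omega>. \<lambda>i\<in>{1..n}. X \<omega> (\<sigma> i)) \<in> measurable N (Rn n)"
    by (intro measurable_restrict measurable_Rn_component[OF X]) (use permutes_in_image[OF s] in auto)
  have "(\<integral>\<^sup>+\<omega>. f (X \<omega> 1) \<partial>N) = (\<integral>\<^sup>+x. f (x 1) \<partial>distr N (Rn n) X)"
    by (rule nn_integral_distr[OF X, symmetric]) (use g in simp)
  also have "distr N (Rn n) X = distr N (Rn n) (\<lambda>\<omega>. \<lambda>i\<in>{1..n}. X \<omega> (\<sigma> i))"
    using ex s unfolding exchangeable_def by blast
  also have "(\<integral>\<^sup>+x. f (x 1) \<partial>\<dots>) = (\<integral>\<^sup>+\<omega>. f ((\<lambda>i\<in>{1..n}. X \<omega> (\<sigma> i)) 1) \<partial>N)"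
    by (rule nn_integral_distr[OF m]) (use g in simp)
  finally show ?thesis using n by (simp add: \<sigma>_def)
qed

lemma esym_1: "esym n 1 a = (\<Sum>i=1..n. a i)"
proof -
  have "{S \<in> subset_idx n 0. i \<in> S} = {}" for i
    by (auto dest!: subset_idxD)
  then show ?thesis using esym_Suc[where q = 0 and n = n and a = a] by (simp only: sum.empty) simp
qed

context power_vector
begin

lemma zmom_1: "zmom N n X 1 = expectation (\<lambda>\<omega>. (X \<omega> 1)\<^sup>2)"
proof -
  have D: "{1} \<in> subset_idx n 1" using nd d1 by (auto simp: subset_idx_def)
  have "real n * expectation (\<lambda>\<omega>. sq \<omega> 1) = expectation (\<lambda>\<omega>. \<Sum>i=1..n. sq \<omega> i)"
    using expectation_prod_sq(2)[OF D] d1 unfolding esym_1 by simp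
  then show ?thesis unfolding zmom_eq using n_pos by (simp add: sq_def field_simps)
qed

lemma zmom_square_le:
  assumes "integrable N (\<lambda>\<omega>. (\<Sum>i=1..n. (X \<omega> i)\<^sup>2) ^ k)" "integrable N (\<lambda>\<omega>. (\<Sum>i=1..n. (X \<omega> i)\<^sup>2) ^ (2 * k))"
  shows "(zmom N n X k)\<^sup>2 \<le> zmom N n X (2 * k)"
proof -
  have "(expectation (\<lambda>\<omega>. (\<Sum>i=1..n. (X \<omega> i)\<^sup>2) ^ k))\<^sup>2 \<le> expectation (\<lambda>\<omega>. ((\<Sum>i=1..n. (X \<omega> i)\<^sup>2) ^ k)\<^sup>2)"
    using assms by (intro expectation_square_le) (simp_all add: power_mult[symmetric] mult.commute)
  then show ?thesis
    unfolding zmom_def power_divide by (simp add: power_mult[symmetric] mult.commute divide_right_mono)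
qed

text \<open>Bernoulli's inequality z^k >= 1 + k (z - 1) under the expectation; with mean 1 all these
  moments are at least 1.\<close>

lemma zmom_ge:
  assumes "k \<le> 2 * d"
  shows "1 + real k * (zmom N n X 1 - 1) \<le> zmom N n X k"
proof -
  let ?Z = "\<lambda>\<omega>. (\<Sum>i=1..n. sq \<omega> i) / real n"
  have Z: "zmom N n X k = expectation (\<lambda>\<omega>. ?Z \<omega> ^ k)" for k by (simp add: zmom_eq power_divide)
  have i: "integrable N (\<lambda>\<omega>. ?Z \<omega> ^ k)" if "k \<le> 2 * d" for k
    using integrable_P[OF that] by (simp add: power_divide)
  have i1: "integrable N ?Z" using i[of 1] d1 by simp
  have "1 + real k * (zmom N n X 1 - 1) = expectation (\<lambda>\<omega>. 1 + real k * (?Z \<omega> - 1))"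
    unfolding Z using i1 prob_space by simp
  also have "\<dots> \<le> expectation (\<lambda>\<omega>. ?Z \<omega> ^ k)"
  proof (rule integral_mono)
    show "integrable N (\<lambda>\<omega>. 1 + real k * (?Z \<omega> - 1))" using i1 by simp
    show "integrable N (\<lambda>\<omega>. ?Z \<omega> ^ k)" by (rule i[OF assms])
    fix \<omega>
    have "0 \<le> ?Z \<omega>" by (intro divide_nonneg_nonneg P_nonneg) simp
    then show "1 + real k * (?Z \<omega> - 1) \<le> ?Z \<omega> ^ k"
      using Bernoulli_inequality[of "?Z \<omega> - 1" k] by simp
  qed
  finally show ?thesis unfolding Z .
qed

lemma dmom_nonneg: "dmom N n d X \<ge> 0"
  unfolding dmom_eq
  by (intro divide_nonneg_nonneg Bochner_Integration.integral_nonneg mult_nonneg_nonneg sum_nonneg zero_le_power) auto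

text \<open>With x = |X|_4^4 / n one has E x^2 <= L^2. In x y <= x^2 / (2 L) + L y^2 / 2 the weight
  L balances both terms at order L, and y^2 is at most 1 + Z^(4d).\<close>

lemma dmom_le_fourth:
  assumes Q: "(\<integral>\<^sup>+\<omega>. ennreal ((\<Sum>i=1..n. (X \<omega> i) ^ 4)\<^sup>2) \<partial>N) \<le> ennreal ((real n * L)\<^sup>2)" and L: "L \<ge> 1"
    and P: "integrable N (\<lambda>\<omega>. (\<Sum>i=1..n. (X \<omega> i)\<^sup>2) ^ (4 * d))"
  shows "dmom N n d X \<le> L / real n * (1 + zmom N n X (4 * d))"
proof -
  let ?n = "real n"
  have n: "?n > 0" by (rule n_pos)
  define x where "x \<omega> = (\<Sum>i=1..n. (X \<omega> i) ^ 4) / ?n" for \<omega>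
  define Z where "Z \<omega> = (\<Sum>i=1..n. (X \<omega> i)\<^sup>2) / ?n" for \<omega>
  have Z0: "Z \<omega> \<ge> 0" for \<omega> unfolding Z_def by (intro divide_nonneg_nonneg sum_nonneg) auto
  have mx: "x \<in> borel_measurable N"
    unfolding x_def by (intro borel_measurable_divide borel_measurable_sum borel_measurable_power meas_X) auto
  have mZ: "Z \<in> borel_measurable N"
    unfolding Z_def by (intro borel_measurable_divide borel_measurable_sum borel_measurable_power meas_X) auto
  have x2: "(\<integral>\<^sup>+\<omega>. ennreal ((x \<omega>)\<^sup>2) \<partial>N) \<le> ennreal (L\<^sup>2)"
  proof -
    have "(\<integral>\<^sup>+\<omega>. ennreal ((x \<omega>)\<^sup>2) \<partial>N) = (\<integral>\<^sup>+\<omega>. ennreal (1 / ?n\<^sup>2) * ennreal ((\<Sum>i=1..n. (X \<omega> i) ^ 4)\<^sup>2) \<partial>N)"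
      by (intro nn_integral_cong) (simp add: x_def power_divide ennreal_mult'[symmetric])
    also have "\<dots> = ennreal (1 / ?n\<^sup>2) * (\<integral>\<^sup>+\<omega>. ennreal ((\<Sum>i=1..n. (X \<omega> i) ^ 4)\<^sup>2) \<partial>N)"
      by (intro nn_integral_cmult measurable_compose[OF _ measurable_ennreal] borel_measurable_power borel_measurable_sum meas_X) auto
    also have "\<dots> \<le> ennreal (1 / ?n\<^sup>2) * ennreal ((?n * L)\<^sup>2)" by (intro mult_left_mono Q) simp
    also have "\<dots> = ennreal (L\<^sup>2)" using n by (simp add: ennreal_mult'[symmetric] power_mult_distrib)
    finally show ?thesis .
  qed
  have ix2: "integrable N (\<lambda>\<omega>. (x \<omega>)\<^sup>2)"
    using mx x2 by (intro integrableI_bounded) (auto simp: less_top[symmetric] top_unique intro: le_less_trans)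
  have Ex2: "expectation (\<lambda>\<omega>. (x \<omega>)\<^sup>2) \<le> L\<^sup>2"
    using x2 nn_integral_eq_integral[OF ix2] by simp
  have iZ: "integrable N (\<lambda>\<omega>. Z \<omega> ^ (4 * d))" using P unfolding Z_def power_divide by simp
  have EZ: "expectation (\<lambda>\<omega>. Z \<omega> ^ (4 * d)) = zmom N n X (4 * d)"
    by (simp add: zmom_def Z_def power_divide)
  have le: "x \<omega> * Z \<omega> ^ (2 * d - 2) \<le> (x \<omega>)\<^sup>2 / (2 * L) + L / 2 * (1 + Z \<omega> ^ (4 * d))" for \<omega>
  proof -
    let ?y = "Z \<omega> ^ (2 * d - 2)"
    have "0 \<le> (x \<omega> - L * ?y)\<^sup>2 / (2 * L)" using L by simp
    also have "\<dots> = (x \<omega>)\<^sup>2 / (2 * L) - x \<omega> * ?y + L / 2 * ?y\<^sup>2"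
      using L by (simp add: power2_diff field_simps power2_eq_square)
    finally have "x \<omega> * ?y \<le> (x \<omega>)\<^sup>2 / (2 * L) + L / 2 * ?y\<^sup>2" by simp
    moreover have "L / 2 * ?y\<^sup>2 \<le> L / 2 * (1 + Z \<omega> ^ (4 * d))"
    proof (rule mult_left_mono)
      have "?y\<^sup>2 = Z \<omega> ^ ((2 * d - 2) * 2)" by (simp only: power_mult)
      also have "\<dots> \<le> 1 + Z \<omega> ^ (4 * d)" by (rule power_le_one_plus[OF Z0]) simp
      finally show "?y\<^sup>2 \<le> 1 + Z \<omega> ^ (4 * d)" .
    qed (use L in simp)
    ultimately show ?thesis by linarith
  qed
  have e: "real n ^ (2 * d) = ?n * (?n * ?n ^ (2 * d - 2))"
  proof -
    have "real n ^ (2 * d) = real n ^ Suc (Suc (2 * d - 2))"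
      using d1 by (intro arg_cong[where f = "(^) _"]) simp
    then show ?thesis by (simp only: power_Suc)
  qed
  have "(\<Sum>i=1..n. (X \<omega> i) ^ 4) * (\<Sum>i=1..n. (X \<omega> i)\<^sup>2) ^ (2 * d - 2) = ?n * ?n ^ (2 * d - 2) * (x \<omega> * Z \<omega> ^ (2 * d - 2))" for \<omega>
    using n by (simp add: x_def Z_def power_divide)
  then have "dmom N n d X = expectation (\<lambda>\<omega>. x \<omega> * Z \<omega> ^ (2 * d - 2)) / ?n"
    unfolding dmom_def e using n by simp
  also have "\<dots> \<le> expectation (\<lambda>\<omega>. (x \<omega>)\<^sup>2 / (2 * L) + L / 2 * (1 + Z \<omega> ^ (4 * d))) / ?n"
  proof (intro divide_right_mono integral_mono le)
    show i: "integrable N (\<lambda>\<omega>. (x \<omega>)\<^sup>2 / (2 * L) + L / 2 * (1 + Z \<omega> ^ (4 * d)))"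
      using ix2 iZ by simp
    show "integrable N (\<lambda>\<omega>. x \<omega> * Z \<omega> ^ (2 * d - 2))"
    proof (rule Bochner_Integration.integrable_bound[OF i])
      show "(\<lambda>\<omega>. x \<omega> * Z \<omega> ^ (2 * d - 2)) \<in> borel_measurable N"
        by (intro borel_measurable_times borel_measurable_power mx mZ)
      have x0: "x \<omega> * Z \<omega> ^ (2 * d - 2) \<ge> 0" for \<omega>
      proof -
        have "0 \<le> (\<Sum>i=1..n. (X \<omega> i) ^ 4)" by (intro sum_nonneg) auto
        then show ?thesis unfolding x_def by (intro mult_nonneg_nonneg divide_nonneg_nonneg zero_le_power Z0) auto
      qed
      show "AE \<omega> in N. norm (x \<omega> * Z \<omega> ^ (2 * d - 2)) \<le> norm ((x \<omega>)\<^sup>2 / (2 * L) + L / 2 * (1 + Z \<omega> ^ (4 * d)))"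
        using order_trans[OF le abs_ge_self] x0 by (intro AE_I2) (simp only: real_norm_def abs_of_nonneg)
    qed
  qed simp
  also have "expectation (\<lambda>\<omega>. (x \<omega>)\<^sup>2 / (2 * L) + L / 2 * (1 + Z \<omega> ^ (4 * d)))
      = expectation (\<lambda>\<omega>. (x \<omega>)\<^sup>2) / (2 * L) + L / 2 * (1 + zmom N n X (4 * d))"
    using ix2 iZ prob_space by (simp add: EZ)
  also have "\<dots> \<le> L\<^sup>2 / (2 * L) + L / 2 * (1 + zmom N n X (4 * d))"
    using Ex2 L by (intro add_right_mono divide_right_mono) auto
  also have "\<dots> \<le> L * (1 + zmom N n X (4 * d))"
  proof -
    have z: "zmom N n X (4 * d) \<ge> 0" unfolding EZ[symmetric] by (intro Bochner_Integration.integral_nonneg zero_le_power Z0)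
    then have "L * zmom N n X (4 * d) \<ge> 0" using L by simp
    then show ?thesis using L z by (simp add: power2_eq_square distrib_left)
  qed
  finally show ?thesis using n by (simp add: divide_right_mono)
qed

end

text \<open>The hypothesis \<open>E8\<close> says that E Z^(4d) tends to 1. Since E Z = 1,
  Bernoulli's inequality and Cauchy--Schwarz squeeze the lower moments: 1 <= E Z^d <= (E
  Z^(2d))^(1/2) <= (E Z^(4d))^(1/4). Both variants of the condition on L bound E |X|_4^8 by n^2 L^2,
  which makes d^2 \<open>dmom\<close> of order (|L| + 1) d^2 / n.\<close>

lemma defect_tendsto_0_growing_degree:
  fixes N :: "nat \<Rightarrow> 'b measure" and d :: "nat \<Rightarrow> nat" and X :: "nat \<Rightarrow> 'b \<Rightarrow> nat \<Rightarrow> real"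
  assumes d_pos: "\<And>n. n \<ge> 1 \<Longrightarrow> d n \<ge> 1"
    and N: "\<And>n. n \<ge> 1 \<Longrightarrow> prob_space (N n)"
    and X: "\<And>n. n \<ge> 1 \<Longrightarrow> X n \<in> measurable (N n) (Rn n)"
    and exch: "\<And>n. n \<ge> 1 \<Longrightarrow> exchangeable (N n) n (X n)"
    and uncond: "\<And>n. n \<ge> 1 \<Longrightarrow> unconditional (N n) n (X n)"
    and d: "(\<lambda>n. real (d n)) \<in> o(\<lambda>n. sqrt (real n))"
    and EX: "\<And>n. n \<ge> 1 \<Longrightarrow> (\<integral>\<omega>. (X n \<omega> 1)\<^sup>2 \<partial>N n) = 1"
    and E8: "(\<lambda>n. 1 / real n ^ (4 * d n) * (\<integral>\<omega>. lnorm 2 n (X n \<omega>) ^ (8 * d n) \<partial>N n)) \<longlonglongrightarrow> 1"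
    and L: "(\<lambda>n. L n * (real (d n))\<^sup>2 / real n) \<longlonglongrightarrow> 0"
    and L8: "(\<forall>n\<ge>1. \<forall>r. 1 \<le> r \<and> r \<le> d n \<and> r \<le> n \<longrightarrow>
                 (\<integral>\<^sup>+\<omega>. ennreal (\<Prod>i=1..r. (X n \<omega> i) ^ 8) \<partial>N n) \<le> ennreal (L n ^ (2 * r)))
              \<or>
              (\<forall>n\<ge>1. \<forall>r. 1 \<le> r \<and> r \<le> d n \<longrightarrow>
                 ennreal (1 / real n ^ (2 * r)) *
                   (\<integral>\<^sup>+\<omega>. ennreal (lnorm 4 n (X n \<omega>) ^ (8 * r)) \<partial>N n) \<le> ennreal (L n ^ (2 * r)))"
  shows "(\<lambda>n. (real (d n))\<^sup>2 / real n) \<longlonglongrightarrow> 0"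
    "\<forall>\<^sub>F n in sequentially. power_vector (N n) n (d n) (X n)"
    "(\<lambda>n. power_vector.defect (N n) n (d n) (X n)) \<longlonglongrightarrow> 0"
proof -
  have "(\<lambda>n. real (d n) / sqrt (real n)) \<longlonglongrightarrow> 0"
    using d by (rule smalloD_tendsto)
  from tendsto_power[OF this, of 2]
  show d2: "(\<lambda>n. (real (d n))\<^sup>2 / real n) \<longlonglongrightarrow> 0" by (simp add: power_divide)
  have ln2: "lnorm 2 n x ^ (8 * k) = (\<Sum>i=1..n. (x i)\<^sup>2) ^ (4 * k)" for n k x
  proof -
    have "lnorm 2 n x ^ 2 = (\<Sum>i=1..n. (x i)\<^sup>2)"
      unfolding lnorm_def by (subst real_root_pow_pos2) (auto intro: sum_nonneg)
    then have "(lnorm 2 n x ^ 2) ^ (4 * k) = (\<Sum>i=1..n. (x i)\<^sup>2) ^ (4 * k)" by simp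
    then show ?thesis by (simp add: power_mult[symmetric])
  qed
  have ln4: "lnorm 4 n x ^ 8 = (\<Sum>i=1..n. (x i) ^ 4)\<^sup>2" for n x
  proof -
    have "lnorm 4 n x ^ 4 = (\<Sum>i=1..n. (x i) ^ 4)"
      unfolding lnorm_def by (subst real_root_pow_pos2) (auto intro: sum_nonneg)
    then have "(lnorm 4 n x ^ 4)\<^sup>2 = (\<Sum>i=1..n. (x i) ^ 4)\<^sup>2" by simp
    then show ?thesis by (simp add: power_mult[symmetric])
  qed
  have z4: "(\<lambda>n. zmom (N n) n (X n) (4 * d n)) \<longlonglongrightarrow> 1"
    using E8 unfolding ln2 zmom_def by simp
  have "\<forall>\<^sub>F n in sequentially. (real (d n))\<^sup>2 / real n < 1 / 4"
    using d2 by (rule order_tendstoD) simp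
  moreover have "\<forall>\<^sub>F n in sequentially. zmom (N n) n (X n) (4 * d n) > 0"
    using z4 by (rule order_tendstoD) simp
  moreover have "\<forall>\<^sub>F n in sequentially. n \<ge> (1::nat)" by (rule eventually_ge_at_top)
  ultimately have ev: "\<forall>\<^sub>F n in sequentially. n \<ge> 1 \<and> power_vector (N n) n (d n) (X n) \<and>
    integrable (N n) (\<lambda>\<omega>. (\<Sum>i=1..n. (X n \<omega> i)\<^sup>2) ^ (4 * d n))"
  proof eventually_elim
    case (elim n)
    interpret prob_space "N n" by (rule N) fact
    have m: "(\<lambda>\<omega>. \<Sum>i=1..n. (X n \<omega> i)\<^sup>2) \<in> borel_measurable (N n)"
      by (intro borel_measurable_sum borel_measurable_power measurable_Rn_component[OF X[OF elim(3)]]) auto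
    have i4: "integrable (N n) (\<lambda>\<omega>. (\<Sum>i=1..n. (X n \<omega> i)\<^sup>2) ^ (4 * d n))"
    \<comment> \<open>Integrability is extracted from the limit: a Bochner integral that does not
      exist is 0, whereas these are eventually positive.\<close>
    proof (rule ccontr)
      assume "\<not> ?thesis"
      then have "(\<integral>\<omega>. (\<Sum>i=1..n. (X n \<omega> i)\<^sup>2) ^ (4 * d n) \<partial>N n) = 0" by (rule not_integrable_integral_eq)
      then have "zmom (N n) n (X n) (4 * d n) = 0" unfolding zmom_def by (simp only: div_0)
      with elim(2) show False by simp
    qed
    have "integrable (N n) (\<lambda>\<omega>. (\<Sum>i=1..n. (X n \<omega> i)\<^sup>2) ^ (2 * d n))"
    proof (rule Bochner_Integration.integrable_bound)
      show "integrable (N n) (\<lambda>\<omega>. 1 + (\<Sum>i=1..n. (X n \<omega> i)\<^sup>2) ^ (4 * d n))" using i4 by simp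
      show "(\<lambda>\<omega>. (\<Sum>i=1..n. (X n \<omega> i)\<^sup>2) ^ (2 * d n)) \<in> borel_measurable (N n)"
        by (rule borel_measurable_power[OF m])
      have b: "0 \<le> z \<Longrightarrow> norm (z ^ (2 * d n)) \<le> norm (1 + z ^ (4 * d n))" for z :: real
      proof -
        assume z: "0 \<le> z"
        have "z ^ (2 * d n) \<le> 1 + z ^ (4 * d n)"
        proof (cases "z \<le> 1")
          case True
          then have "z ^ (2 * d n) \<le> 1" using z by (intro power_le_one)
          then show ?thesis using z by (simp add: add_increasing2)
        next
          case False
          then have "z ^ (2 * d n) \<le> z ^ (4 * d n)" by (intro power_increasing) auto
          then show ?thesis by simp
        qed
        then show ?thesis using z by simp
      qed
      show "AE \<omega> in N n. norm ((\<Sum>i=1..n. (X n \<omega> i)\<^sup>2) ^ (2 * d n)) \<le> norm (1 + (\<Sum>i=1..n. (X n \<omega> i)\<^sup>2) ^ (4 * d n))"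
        by (intro AE_I2 b sum_nonneg) simp
    qed
    moreover have "4 * d n \<le> n"
    proof -
      have "(real (d n))\<^sup>2 < real n / 4" using elim by (simp add: field_simps)
      moreover have "real (d n) * 1 \<le> real (d n) * real (d n)" using d_pos[OF elim(3)] by (intro mult_left_mono) auto
      ultimately have "4 * real (d n) \<le> real n" by (simp add: power2_eq_square)
      then have "real (4 * d n) \<le> real n" by simp
      then show ?thesis by (simp only: of_nat_le_iff)
    qed
    ultimately show ?case
      using elim(3) i4 d_pos X exch uncond by (auto intro!: power_vector.intro power_vector_axioms.intro prob_space_axioms)
  qed
  show pv: "\<forall>\<^sub>F n in sequentially. power_vector (N n) n (d n) (X n)"
    using ev by eventually_elim simp
  have s1: "\<forall>\<^sub>F n in sequentially. 1 \<le> zmom (N n) n (X n) (d n) \<and> 1 \<le> zmom (N n) n (X n) (2 * d n)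
    \<and> zmom (N n) n (X n) (d n) \<le> sqrt (zmom (N n) n (X n) (2 * d n))
    \<and> zmom (N n) n (X n) (2 * d n) \<le> sqrt (zmom (N n) n (X n) (4 * d n))"
    using ev
  proof eventually_elim
    case (elim n)
    then interpret power_vector "N n" n "d n" "X n" by simp
    have z1: "zmom (N n) n (X n) 1 = 1" unfolding zmom_1 using EX elim by simp
    have i: "integrable (N n) (\<lambda>\<omega>. (\<Sum>i=1..n. (X n \<omega> i)\<^sup>2) ^ k)" if "k \<le> 2 * d n" for k
      using integrable_P[OF that] unfolding sq_def .
    have "(zmom (N n) n (X n) (d n))\<^sup>2 \<le> zmom (N n) n (X n) (2 * d n)"
      by (rule zmom_square_le) (rule i, simp)+
    moreover have "(zmom (N n) n (X n) (2 * d n))\<^sup>2 \<le> zmom (N n) n (X n) (2 * (2 * d n))"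
      by (rule zmom_square_le) (use i elim in simp_all)
    moreover have "1 \<le> zmom (N n) n (X n) (d n)" using zmom_ge[of "d n"] z1 by simp
    moreover have "1 \<le> zmom (N n) n (X n) (2 * d n)" using zmom_ge[of "2 * d n"] z1 by simp
    ultimately show ?case by (auto intro!: real_le_rsqrt)
  qed
  have z2: "(\<lambda>n. zmom (N n) n (X n) (2 * d n)) \<longlonglongrightarrow> 1"
  proof (rule tendsto_sandwich[where f = "\<lambda>_. 1"])
    show "(\<lambda>n. sqrt (zmom (N n) n (X n) (4 * d n))) \<longlonglongrightarrow> 1" using tendsto_real_sqrt[OF z4] by simp
  qed (use s1 in \<open>auto elim: eventually_mono\<close>)
  have z1: "(\<lambda>n. zmom (N n) n (X n) (d n)) \<longlonglongrightarrow> 1"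
  proof (rule tendsto_sandwich[where f = "\<lambda>_. 1"])
    show "(\<lambda>n. sqrt (zmom (N n) n (X n) (2 * d n))) \<longlonglongrightarrow> 1" using tendsto_real_sqrt[OF z2] by simp
  qed (use s1 in \<open>auto elim: eventually_mono\<close>)
  have D: "(\<lambda>n. (real (d n))\<^sup>2 * dmom (N n) n (d n) (X n)) \<longlonglongrightarrow> 0"
  proof (rule tendsto_sandwich[OF _ _ tendsto_const])
    show "\<forall>\<^sub>F n in sequentially. 0 \<le> (real (d n))\<^sup>2 * dmom (N n) n (d n) (X n)"
      using pv by eventually_elim (simp add: power_vector.dmom_nonneg)
    show "(\<lambda>n. (\<bar>L n * (real (d n))\<^sup>2 / real n\<bar> + (real (d n))\<^sup>2 / real n) * (1 + zmom (N n) n (X n) (4 * d n))) \<longlonglongrightarrow> 0"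
      using tendsto_mult[OF tendsto_add[OF tendsto_rabs[OF L] d2] tendsto_add[OF tendsto_const[of 1] z4]] by simp
    show "\<forall>\<^sub>F n in sequentially. (real (d n))\<^sup>2 * dmom (N n) n (d n) (X n) \<le>
      (\<bar>L n * (real (d n))\<^sup>2 / real n\<bar> + (real (d n))\<^sup>2 / real n) * (1 + zmom (N n) n (X n) (4 * d n))"
      using ev
    proof eventually_elim
      case (elim n)
      then interpret power_vector "N n" n "d n" "X n" by simp
      have nn: "ennreal (1 / (real n)\<^sup>2) * (\<integral>\<^sup>+\<omega>. ennreal ((\<Sum>i=1..n. (X n \<omega> i) ^ 4)\<^sup>2) \<partial>N n) \<le> ennreal ((L n)\<^sup>2)"
        using L8
      proof
        assume a: "\<forall>n\<ge>1. \<forall>r. 1 \<le> r \<and> r \<le> d n \<longrightarrow>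
                 ennreal (1 / real n ^ (2 * r)) *
                   (\<integral>\<^sup>+\<omega>. ennreal (lnorm 4 n (X n \<omega>) ^ (8 * r)) \<partial>N n) \<le> ennreal (L n ^ (2 * r))"
        have "ennreal (1 / real n ^ (2 * 1)) *
                   (\<integral>\<^sup>+\<omega>. ennreal (lnorm 4 n (X n \<omega>) ^ (8 * 1)) \<partial>N n) \<le> ennreal (L n ^ (2 * 1))"
          using a elim d1 by blast
        then show ?thesis unfolding mult_1_right ln4 .
      next
        assume a: "\<forall>n\<ge>1. \<forall>r. 1 \<le> r \<and> r \<le> d n \<and> r \<le> n \<longrightarrow>
                 (\<integral>\<^sup>+\<omega>. ennreal (\<Prod>i=1..r. (X n \<omega> i) ^ 8) \<partial>N n) \<le> ennreal (L n ^ (2 * r))"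
        have "(\<integral>\<^sup>+\<omega>. ennreal (\<Prod>i=1..1. (X n \<omega> i) ^ 8) \<partial>N n) \<le> ennreal (L n ^ (2 * 1))"
          using a elim d1 by blast
        then have x8: "(\<integral>\<^sup>+\<omega>. ennreal ((X n \<omega> 1) ^ 8) \<partial>N n) \<le> ennreal ((L n)\<^sup>2)" by simp
        have "(\<integral>\<^sup>+\<omega>. ennreal ((\<Sum>i=1..n. (X n \<omega> i) ^ 4)\<^sup>2) \<partial>N n)
            \<le> (\<integral>\<^sup>+\<omega>. ennreal (real n) * (\<Sum>i=1..n. ennreal ((X n \<omega> i) ^ 8)) \<partial>N n)"
        proof (intro nn_integral_mono)
          fix \<omega>
          \<comment> \<open>Cauchy--Schwarz against the constant vector; exchangeability then
            reduces the sum to the first coordinate.\<close>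
          have "(\<Sum>i=1..n. (X n \<omega> i) ^ 4)\<^sup>2 \<le> (\<Sum>i=1..n. ((X n \<omega> i) ^ 4)\<^sup>2) * real (card {1..n})"
            by (rule sum_squared_le_sum_of_squares)
          then have "(\<Sum>i=1..n. (X n \<omega> i) ^ 4)\<^sup>2 \<le> real n * (\<Sum>i=1..n. (X n \<omega> i) ^ 8)"
            by (simp add: power_mult[symmetric] mult.commute)
          then have "ennreal ((\<Sum>i=1..n. (X n \<omega> i) ^ 4)\<^sup>2) \<le> ennreal (real n * (\<Sum>i=1..n. (X n \<omega> i) ^ 8))"
            by (rule ennreal_leI)
          also have "\<dots> = ennreal (real n) * (\<Sum>i=1..n. ennreal ((X n \<omega> i) ^ 8))"
            by (subst sum_ennreal) (auto intro: ennreal_mult' zero_le_even_power)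
          finally show "ennreal ((\<Sum>i=1..n. (X n \<omega> i) ^ 4)\<^sup>2) \<le> ennreal (real n) * (\<Sum>i=1..n. ennreal ((X n \<omega> i) ^ 8))" .
        qed
        also have "\<dots> = ennreal (real n) * (\<Sum>i=1..n. \<integral>\<^sup>+\<omega>. ennreal ((X n \<omega> i) ^ 8) \<partial>N n)"
        proof -
          have m: "(\<lambda>\<omega>. ennreal ((X n \<omega> i) ^ 8)) \<in> borel_measurable (N n)" if "i \<in> {1..n}" for i
            by (rule measurable_compose[OF borel_measurable_power[OF meas_X[OF that]] measurable_ennreal])
          show ?thesis
            by (subst nn_integral_cmult, rule borel_measurable_sum, rule m, assumption, subst nn_integral_sum, rule m, assumption) simp
        qed
        also have "\<dots> = ennreal (real n) * (\<Sum>i=1..n. \<integral>\<^sup>+\<omega>. ennreal ((X n \<omega> 1) ^ 8) \<partial>N n)"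
        proof (intro arg_cong[where f = "(*) _"] sum.cong[OF refl])
          fix i assume "i \<in> {1..n}"
          then show "(\<integral>\<^sup>+\<omega>. ennreal ((X n \<omega> i) ^ 8) \<partial>N n) = (\<integral>\<^sup>+\<omega>. ennreal ((X n \<omega> 1) ^ 8) \<partial>N n)"
            by (rule exchangeable_nn_integral[OF local.X ex, where f = "\<lambda>x. ennreal (x ^ 8)"]) measurable
        qed
        also have "\<dots> \<le> ennreal (real n) * (ennreal (real n) * ennreal ((L n)\<^sup>2))"
          using x8 by (auto simp: ennreal_of_nat_eq_real_of_nat intro!: mult_left_mono)
        finally have "ennreal (1 / (real n)\<^sup>2) * (\<integral>\<^sup>+\<omega>. ennreal ((\<Sum>i=1..n. (X n \<omega> i) ^ 4)\<^sup>2) \<partial>N n)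
          \<le> ennreal (1 / (real n)\<^sup>2) * (ennreal (real n) * (ennreal (real n) * ennreal ((L n)\<^sup>2)))"
          by (rule mult_left_mono) simp
        also have "\<dots> = ennreal ((L n)\<^sup>2)"
          using n_pos by (simp add: ennreal_mult'[symmetric] power2_eq_square)
        finally show ?thesis .
      qed
      \<comment> \<open>\<open>dmom_le_fourth\<close> divides by its parameter and wants it to be at
        least 1, while L may have any sign and size; the added 1 costs d^2 / n, which vanishes as
        well.\<close>
      define L' where "L' = \<bar>L n\<bar> + 1"
      have "dmom (N n) n (d n) (X n) \<le> L' / real n * (1 + zmom (N n) n (X n) (4 * d n))"
      proof (rule dmom_le_fourth)
        have "ennreal ((real n)\<^sup>2) * (ennreal (1 / (real n)\<^sup>2) * (\<integral>\<^sup>+\<omega>. ennreal ((\<Sum>i=1..n. (X n \<omega> i) ^ 4)\<^sup>2) \<partial>N n))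
          \<le> ennreal ((real n)\<^sup>2) * ennreal ((L n)\<^sup>2)"
          by (rule mult_left_mono[OF nn]) simp
        then have "(\<integral>\<^sup>+\<omega>. ennreal ((\<Sum>i=1..n. (X n \<omega> i) ^ 4)\<^sup>2) \<partial>N n) \<le> ennreal ((real n)\<^sup>2 * (L n)\<^sup>2)"
          using n_pos by (simp add: mult.assoc[symmetric] ennreal_mult'[symmetric])
        also have "\<dots> \<le> ennreal ((real n * L')\<^sup>2)"
        proof (rule ennreal_leI)
          have "\<bar>L n\<bar>\<^sup>2 \<le> L'\<^sup>2" unfolding L'_def by (intro power_mono) auto
          then show "(real n)\<^sup>2 * (L n)\<^sup>2 \<le> (real n * L')\<^sup>2" by (simp add: power_mult_distrib mult_left_mono)
        qed
        finally show "(\<integral>\<^sup>+\<omega>. ennreal ((\<Sum>i=1..n. (X n \<omega> i) ^ 4)\<^sup>2) \<partial>N n) \<le> ennreal ((real n * L')\<^sup>2)" .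
      qed (use elim in \<open>simp_all add: L'_def\<close>)
      then have "(real (d n))\<^sup>2 * dmom (N n) n (d n) (X n) \<le> (real (d n))\<^sup>2 * (L' / real n * (1 + zmom (N n) n (X n) (4 * d n)))"
        by (rule mult_left_mono) simp
      also have "\<dots> = (\<bar>L n * (real (d n))\<^sup>2 / real n\<bar> + (real (d n))\<^sup>2 / real n) * (1 + zmom (N n) n (X n) (4 * d n))"
      proof -
        have "(real (d n))\<^sup>2 * (L' / real n) = \<bar>L n * (real (d n))\<^sup>2 / real n\<bar> + (real (d n))\<^sup>2 / real n"
          by (simp add: L'_def abs_mult distrib_left distrib_right add_divide_distrib mult.commute)
        then show ?thesis by (simp only: mult.assoc[symmetric])
      qed
      finally show ?case .
    qed
  qed
  show "(\<lambda>n. power_vector.defect (N n) n (d n) (X n)) \<longlonglongrightarrow> 0"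
    by (rule defect_tendsto_0[OF pv d2 z1 z2 D])
qed

section \<open>Truncation and the case of fixed degree\<close>

lemma power_minus_one_square_le:
  fixes z R e :: real
  assumes z: "z \<ge> 0" and R: "R \<ge> 1" and e: "e > 0"
  shows "(z ^ d - 1)\<^sup>2 \<le> (real d * R ^ d)\<^sup>2 * (z - 1)\<^sup>2 + R powr (- e) * z powr (2 * real d + e)"
proof (cases "z \<le> R")
  \<comment> \<open>Below R the factorisation z^d - 1 = (z - 1) (1 + ... + z^(d-1)) makes the power
    Lipschitz with constant at most d R^d.\<close>
  case True
  have "\<bar>\<Sum>i<d. z ^ i\<bar> \<le> real d * R ^ d"
  proof -
    have "(\<Sum>i<d. z ^ i) \<le> (\<Sum>i<d. R ^ d)"
    proof (rule sum_mono)
      fix i assume "i \<in> {..<d}"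
      have "z ^ i \<le> R ^ i" using True z by (intro power_mono)
      also have "\<dots> \<le> R ^ d" using R \<open>i \<in> _\<close> by (intro power_increasing) auto
      finally show "z ^ i \<le> R ^ d" .
    qed
    then show ?thesis using z by (simp add: sum_nonneg)
  qed
  then have "\<bar>z ^ d - 1\<bar> \<le> real d * R ^ d * \<bar>z - 1\<bar>"
    unfolding power_diff_1_eq abs_mult by (subst mult.commute) (rule mult_right_mono, auto)
  then have "\<bar>z ^ d - 1\<bar>\<^sup>2 \<le> (real d * R ^ d * \<bar>z - 1\<bar>)\<^sup>2" by (intro power_mono) auto
  then have "(z ^ d - 1)\<^sup>2 \<le> (real d * R ^ d)\<^sup>2 * (z - 1)\<^sup>2" by (simp only: power2_abs power_mult_distrib)
  then show ?thesis by (simp add: add_increasing2)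
next
  case False
  \<comment> \<open>Above R the square is at most z^(2d), and the factor (z / R)^e >= 1 may be
    inserted for free.\<close>
  then have z1: "z > 1" "z > R" using R by auto
  then have "0 \<le> z ^ d - 1" by simp
  then have "(z ^ d - 1)\<^sup>2 \<le> (z ^ d)\<^sup>2" by (intro power_mono) auto
  also have "\<dots> = z powr (2 * real d)"
    using z1 by (simp add: powr_realpow[symmetric] powr_powr mult.commute flip: power_mult)
  also have "\<dots> \<le> z powr (2 * real d) * (z / R) powr e"
  proof -
    have "1 \<le> (z / R) powr e" using z1 R e by (intro ge_one_powr_ge_zero) auto
    then have "z powr (2 * real d) * 1 \<le> z powr (2 * real d) * (z / R) powr e" by (intro mult_left_mono) auto
    then show ?thesis by simp
  qed
  also have "\<dots> = R powr (- e) * z powr (2 * real d + e)"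
    using z1 R by (simp add: powr_divide powr_add powr_minus_divide)
  finally show ?thesis by (simp add: add_increasing)
qed

text \<open>A threshold at b = \<delta> P: below it one factor b is traded for \<delta> P, above it
  every factor P is traded for b / \<delta>. So a coordinate is either negligible against the norm
  or pays with its own power of order 2 d.\<close>

lemma square_mult_power_le:
  fixes b P \<delta> :: real
  assumes "0 \<le> b" "b \<le> P" "0 < \<delta>" "d \<ge> (1::nat)"
  shows "b\<^sup>2 * P ^ (2 * d - 2) \<le> \<delta> * (b * P ^ (2 * d - 1)) + (1 / \<delta>) ^ (2 * d - 2) * b ^ (2 * d)"
proof -
  have e: "P ^ (2 * d - 1) = P * P ^ (2 * d - 2)" "b ^ (2 * d) = b\<^sup>2 * b ^ (2 * d - 2)"
  proof -
    have "2 * d - 1 = Suc (2 * d - 2)" using assms(4) by simp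
    then show "P ^ (2 * d - 1) = P * P ^ (2 * d - 2)" by (simp only: power_Suc)
    have "2 * d = 2 + (2 * d - 2)" using assms(4) by simp
    then show "b ^ (2 * d) = b\<^sup>2 * b ^ (2 * d - 2)" by (metis power_add)
  qed
  have P: "P \<ge> 0" using assms by simp
  show ?thesis
  proof (cases "b \<le> \<delta> * P")
    case True
    have "b\<^sup>2 * P ^ (2 * d - 2) = b * b * P ^ (2 * d - 2)" by (simp add: power2_eq_square)
    also have "\<dots> \<le> b * (\<delta> * P) * P ^ (2 * d - 2)"
      using True assms P by (intro mult_right_mono mult_left_mono) auto
    also have "\<dots> = \<delta> * (b * P ^ (2 * d - 1))" unfolding e by (simp only: ac_simps)
    finally show ?thesis using assms by (simp add: add_increasing2)
  next
    case False
    then have "P \<le> 1 / \<delta> * b" using assms by (simp add: field_simps)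
    then have "P ^ (2 * d - 2) \<le> (1 / \<delta> * b) ^ (2 * d - 2)" using P by (intro power_mono)
    then have "b\<^sup>2 * P ^ (2 * d - 2) \<le> b\<^sup>2 * (1 / \<delta> * b) ^ (2 * d - 2)" by (intro mult_left_mono) auto
    also have "\<dots> = (1 / \<delta>) ^ (2 * d - 2) * b ^ (2 * d)" unfolding e power_mult_distrib by (simp only: ac_simps)
    finally show ?thesis using assms P by (simp add: add_increasing)
  qed
qed

text \<open>Jensen's inequality for the convex function x powr p on the open half-line; zero entries
  are reached by adding 1 / (k + 1) to all entries and letting k grow.\<close>

lemma power_mean_powr:
  fixes x :: "nat \<Rightarrow> real"
  assumes x: "\<And>i. i \<in> {1..n} \<Longrightarrow> x i \<ge> 0" and n: "n \<ge> 1" and p: "p \<ge> 1"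
  shows "((\<Sum>i=1..n. x i) / real n) powr p \<le> (\<Sum>i=1..n. x i powr p) / real n"
proof (rule LIMSEQ_le_const)
  let ?e = "\<lambda>k. 1 / real (Suc k)"
  have e0: "?e \<longlonglongrightarrow> 0" using LIMSEQ_inverse_real_of_nat by (simp add: inverse_eq_divide)
  show "(\<lambda>k. (\<Sum>i=1..n. (x i + ?e k) powr p) / real n) \<longlonglongrightarrow> (\<Sum>i=1..n. x i powr p) / real n"
  proof (intro tendsto_divide tendsto_sum tendsto_const)
    fix i assume i: "i \<in> {1..n}"
    have "(\<lambda>k. (x i + ?e k) powr p) \<longlonglongrightarrow> (x i + 0) powr p"
      using x[OF i] p by (intro tendsto_powr' tendsto_add tendsto_const e0) (auto intro!: always_eventually)
    then show "(\<lambda>k. (x i + ?e k) powr p) \<longlonglongrightarrow> x i powr p" by simp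
  qed (use n in simp)
  show "\<exists>N. \<forall>k\<ge>N. ((\<Sum>i=1..n. x i) / real n) powr p \<le> (\<Sum>i=1..n. (x i + ?e k) powr p) / real n"
  proof (intro exI[of _ 0] allI impI)
    fix k :: nat
    have pos: "x i + ?e k \<in> {0<..}" if "i \<in> {1..n}" for i
      using x[OF that] by (simp add: add_nonneg_pos)
    have "((\<Sum>i=1..n. x i) / real n) powr p \<le> (\<Sum>i=1..n. 1 / real n * (x i + ?e k)) powr p"
    proof (rule powr_mono2)
      have "(\<Sum>i=1..n. x i) / real n = (\<Sum>i=1..n. 1 / real n * x i)" by (simp add: sum_divide_distrib)
      also have "\<dots> \<le> (\<Sum>i=1..n. 1 / real n * (x i + ?e k))" by (intro sum_mono mult_left_mono) auto
      finally show "(\<Sum>i=1..n. x i) / real n \<le> (\<Sum>i=1..n. 1 / real n * (x i + ?e k))" .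
      show "0 \<le> (\<Sum>i=1..n. x i) / real n" using x by (intro divide_nonneg_nonneg sum_nonneg) auto
    qed (use p in simp)
    also have "\<dots> = (\<Sum>i=1..n. (1 / real n) *\<^sub>R (x i + ?e k)) powr p" by simp
    also have "\<dots> \<le> (\<Sum>i=1..n. 1 / real n * (x i + ?e k) powr p)"
      by (rule convex_on_sum[OF _ _ powr_convex[OF p]]) (use n pos in auto)
    also have "\<dots> = (\<Sum>i=1..n. (x i + ?e k) powr p) / real n" by (simp add: sum_divide_distrib)
    finally show "((\<Sum>i=1..n. x i) / real n) powr p \<le> (\<Sum>i=1..n. (x i + ?e k) powr p) / real n" .
  qed
qed

context power_vector
begin

text \<open>When the square is expanded, the diagonal terms contribute at most n C, and the n (n -
  1) others all equal E (X_1^2 X_2^2) by exchangeability.\<close>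

lemma zmom_2_le:
  assumes q: "\<And>i. i \<in> {1..n} \<Longrightarrow> (\<integral>\<^sup>+\<omega>. ennreal ((X \<omega> i) ^ 4) \<partial>N) \<le> ennreal C" and C: "C \<ge> 0"
  shows "zmom N n X 2 \<le> C / real n + expectation (\<lambda>\<omega>. (X \<omega> 1)\<^sup>2 * (X \<omega> 2)\<^sup>2)"
proof -
  let ?c = "expectation (\<lambda>\<omega>. (X \<omega> 1)\<^sup>2 * (X \<omega> 2)\<^sup>2)"
  have n: "real n > 0" by (rule n_pos)
  have D: "{1, 2} \<in> subset_idx n 2" using nd d1 by (auto simp: subset_idx_def)
  have d2: "2 \<le> 2 * d" using d1 by simp
  have "(\<Prod>i\<in>{1, 2}. sq \<omega> i) = (X \<omega> 1)\<^sup>2 * (X \<omega> 2)\<^sup>2" for \<omega> by (simp add: sq_def)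
  then have e2: "fact 2 * real (n choose 2) * ?c = expectation (\<lambda>\<omega>. fact 2 * esym n 2 (sq \<omega>))"
    using expectation_prod_sq(2)[OF D d2] by simp
  have c0: "?c \<ge> 0" by (intro Bochner_Integration.integral_nonneg) auto
  have f2: "fact 2 * real (n choose 2) \<le> (real n)\<^sup>2"
  proof -
    have "fact 2 * real (n choose 2) / real n ^ 2 \<le> fact 0 * real (n choose 0) / real n ^ 0"
      using nd d1 by (intro fact_binomial_antimono) auto
    then show ?thesis using n by (simp add: field_simps)
  qed
  have iX: "integrable N (\<lambda>\<omega>. (sq \<omega> i)\<^sup>2)" and EX: "expectation (\<lambda>\<omega>. (sq \<omega> i)\<^sup>2) \<le> C" if i: "i \<in> {1..n}" for i
  proof -
    have s: "(sq \<omega> i)\<^sup>2 = (X \<omega> i) ^ 4" for \<omega> by (simp add: sq_def power_mult[symmetric])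
    show ii: "integrable N (\<lambda>\<omega>. (sq \<omega> i)\<^sup>2)"
    proof (rule integrableI_bounded)
      show "(\<lambda>\<omega>. (sq \<omega> i)\<^sup>2) \<in> borel_measurable N" by (intro borel_measurable_power meas_sq i)
      have "(\<integral>\<^sup>+\<omega>. ennreal (norm ((sq \<omega> i)\<^sup>2)) \<partial>N) = (\<integral>\<^sup>+\<omega>. ennreal ((X \<omega> i) ^ 4) \<partial>N)"
        by (simp add: s)
      also have "\<dots> < \<infinity>" using q[OF i] by (rule le_less_trans) simp
      finally show "(\<integral>\<^sup>+\<omega>. ennreal (norm ((sq \<omega> i)\<^sup>2)) \<partial>N) < \<infinity>" .
    qed
    have "ennreal (expectation (\<lambda>\<omega>. (sq \<omega> i)\<^sup>2)) \<le> ennreal C"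
      using q[OF i] nn_integral_eq_integral[OF ii] by (simp add: s)
    then show "expectation (\<lambda>\<omega>. (sq \<omega> i)\<^sup>2) \<le> C" using C by simp
  qed
  have "expectation (\<lambda>\<omega>. (\<Sum>i=1..n. sq \<omega> i) ^ 2)
     \<le> expectation (\<lambda>\<omega>. (\<Sum>i=1..n. (sq \<omega> i)\<^sup>2) + fact 2 * esym n 2 (sq \<omega>))"
  proof (rule integral_mono)
    show "integrable N (\<lambda>\<omega>. (\<Sum>i=1..n. sq \<omega> i) ^ 2)" by (rule integrable_P[OF d2])
    have "integrable N (\<lambda>\<omega>. esym n 2 (sq \<omega>))" using integrable_esym2[of 2 0] d2 by simp
    then show "integrable N (\<lambda>\<omega>. (\<Sum>i=1..n. (sq \<omega> i)\<^sup>2) + fact 2 * esym n 2 (sq \<omega>))"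
      by (intro Bochner_Integration.integrable_add Bochner_Integration.integrable_sum iX integrable_mult_right)
    fix \<omega>
    have "(\<Sum>i=1..n. sq \<omega> i) ^ 2 - fact 2 * esym n 2 (sq \<omega>)
      \<le> real 2 * (real 2 - 1) / 2 * (\<Sum>i=1..n. (sq \<omega> i)\<^sup>2) * (\<Sum>i=1..n. sq \<omega> i) ^ (2 - 2)"
      by (rule esym_power_bounds) simp
    then show "(\<Sum>i=1..n. sq \<omega> i) ^ 2 \<le> (\<Sum>i=1..n. (sq \<omega> i)\<^sup>2) + fact 2 * esym n 2 (sq \<omega>)" by simp
  qed
  also have "\<dots> = expectation (\<lambda>\<omega>. \<Sum>i=1..n. (sq \<omega> i)\<^sup>2) + expectation (\<lambda>\<omega>. fact 2 * esym n 2 (sq \<omega>))"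
    using integrable_esym2[of 2 0] d2 by (intro Bochner_Integration.integral_add Bochner_Integration.integrable_sum iX) simp_all
  also have "expectation (\<lambda>\<omega>. \<Sum>i=1..n. (sq \<omega> i)\<^sup>2) = (\<Sum>i=1..n. expectation (\<lambda>\<omega>. (sq \<omega> i)\<^sup>2))"
    by (rule Bochner_Integration.integral_sum[OF iX])
  also have "\<dots> \<le> (\<Sum>i=1..n. C)" by (intro sum_mono EX)
  also have "(\<Sum>i=1..n. C) = real n * C" by simp
  also have "expectation (\<lambda>\<omega>. fact 2 * esym n 2 (sq \<omega>)) \<le> (real n)\<^sup>2 * ?c"
    unfolding e2[symmetric] using f2 c0 by (rule mult_right_mono)
  finally have "expectation (\<lambda>\<omega>. (\<Sum>i=1..n. sq \<omega> i) ^ 2) \<le> real n * C + (real n)\<^sup>2 * ?c" by simp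
  then show "zmom N n X 2 \<le> C / real n + ?c"
    unfolding zmom_eq using n by (simp add: pos_divide_le_eq field_simps power2_eq_square)
qed

end

lemma power_le_one_plus_powr:
  fixes z :: real assumes "z \<ge> 0" "real k \<le> p" shows "z ^ k \<le> 1 + z powr p"
proof (cases "z \<le> 1")
  case True
  then have "z ^ k \<le> 1" using assms by (simp add: power_le_one)
  then show ?thesis by (simp add: add_increasing2)
next
  case False
  then have "z ^ k = z powr real k" by (simp add: powr_realpow)
  also have "\<dots> \<le> z powr p" using False assms by (intro powr_mono) auto
  finally show ?thesis by simp
qed

lemma square_powr: "(x\<^sup>2) powr p = \<bar>x :: real\<bar> powr (2 * p)"
proof (cases "x = 0")
  case False
  then have "\<bar>x\<bar> powr real 2 = \<bar>x\<bar>\<^sup>2" by (intro powr_realpow) simp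
  then have "x\<^sup>2 = \<bar>x\<bar> powr 2" by simp
  then show ?thesis by (simp only: powr_powr)
qed simp

text \<open>The power mean inequality moves the p-th power inside the average over i, where the
  assumption bounds each term.\<close>

lemma normalized_powr_bound:
  assumes n: "n \<ge> 1" and X: "X \<in> measurable N (Rn n)" and p: "p \<ge> 1" and B: "B \<ge> 0"
    and b: "\<And>i. i \<in> {1..n} \<Longrightarrow> (\<integral>\<^sup>+\<omega>. ennreal (\<bar>X \<omega> i\<bar> powr (2 * p)) \<partial>N) \<le> ennreal B"
  defines "Z \<equiv> \<lambda>\<omega>. ((\<Sum>i=1..n. (X \<omega> i)\<^sup>2) / real n) powr p"
  shows "integrable N Z" "(\<integral>\<omega>. Z \<omega> \<partial>N) \<le> B"
proof -
  have mX: "(\<lambda>\<omega>. X \<omega> i) \<in> borel_measurable N" if "i \<in> {1..n}" for i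
    by (rule measurable_Rn_component[OF X that])
  have mZ: "Z \<in> borel_measurable N"
  proof -
    have "(\<lambda>\<omega>. \<Sum>i=1..n. (X \<omega> i)\<^sup>2) \<in> borel_measurable N"
      by (intro borel_measurable_sum borel_measurable_power mX)
    then show ?thesis unfolding Z_def by measurable
  qed
  have mp: "(\<lambda>\<omega>. ennreal (\<bar>X \<omega> i\<bar> powr (2 * p))) \<in> borel_measurable N" if "i \<in> {1..n}" for i
    using mX[OF that] by measurable
  have "(\<integral>\<^sup>+\<omega>. ennreal (Z \<omega>) \<partial>N) \<le> (\<integral>\<^sup>+\<omega>. ennreal (1 / real n) * (\<Sum>i=1..n. ennreal (\<bar>X \<omega> i\<bar> powr (2 * p))) \<partial>N)"
  proof (intro nn_integral_mono)
    fix \<omega>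
    have "Z \<omega> \<le> (\<Sum>i=1..n. (X \<omega> i)\<^sup>2 powr p) / real n"
      unfolding Z_def by (rule power_mean_powr) (use n p in auto)
    also have "\<dots> = 1 / real n * (\<Sum>i=1..n. \<bar>X \<omega> i\<bar> powr (2 * p))" by (simp add: square_powr)
    finally have "ennreal (Z \<omega>) \<le> ennreal (1 / real n * (\<Sum>i=1..n. \<bar>X \<omega> i\<bar> powr (2 * p)))" by (rule ennreal_leI)
    also have "\<dots> = ennreal (1 / real n) * ennreal (\<Sum>i=1..n. \<bar>X \<omega> i\<bar> powr (2 * p))" by (rule ennreal_mult') simp
    also have "ennreal (\<Sum>i=1..n. \<bar>X \<omega> i\<bar> powr (2 * p)) = (\<Sum>i=1..n. ennreal (\<bar>X \<omega> i\<bar> powr (2 * p)))"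
      by (rule sum_ennreal[symmetric]) simp
    finally show "ennreal (Z \<omega>) \<le> ennreal (1 / real n) * (\<Sum>i=1..n. ennreal (\<bar>X \<omega> i\<bar> powr (2 * p)))" .
  qed
  also have "\<dots> = ennreal (1 / real n) * (\<Sum>i=1..n. \<integral>\<^sup>+\<omega>. ennreal (\<bar>X \<omega> i\<bar> powr (2 * p)) \<partial>N)"
    by (subst nn_integral_cmult, rule borel_measurable_sum, rule mp, assumption, subst nn_integral_sum, rule mp, assumption) simp
  also have "\<dots> \<le> ennreal (1 / real n) * (\<Sum>i=1..n. ennreal B)"
    by (intro mult_left_mono sum_mono b) auto
  also have "\<dots> = ennreal B"
    using n B by (simp add: ennreal_of_nat_eq_real_of_nat ennreal_mult'[symmetric])
  finally have nn: "(\<integral>\<^sup>+\<omega>. ennreal (Z \<omega>) \<partial>N) \<le> ennreal B" .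
  show i: "integrable N Z"
  proof (rule integrableI_bounded[OF mZ])
    have "(\<integral>\<^sup>+\<omega>. ennreal (norm (Z \<omega>)) \<partial>N) = (\<integral>\<^sup>+\<omega>. ennreal (Z \<omega>) \<partial>N)" by (simp add: Z_def)
    also have "\<dots> < \<infinity>" using nn by (rule le_less_trans) simp
    finally show "(\<integral>\<^sup>+\<omega>. ennreal (norm (Z \<omega>)) \<partial>N) < \<infinity>" .
  qed
  have "ennreal (\<integral>\<omega>. Z \<omega> \<partial>N) \<le> ennreal B"
    using nn nn_integral_eq_integral[OF i] by (simp add: Z_def)
  then show "(\<integral>\<omega>. Z \<omega> \<partial>N) \<le> B" using B by simp
qed

context power_vector
begin

context
  fixes e B :: real
  assumes e: "e > 0" and B: "B \<ge> 0"
    and b: "\<And>i. i \<in> {1..n} \<Longrightarrow> (\<integral>\<^sup>+\<omega>. ennreal (\<bar>X \<omega> i\<bar> powr (2 * (2 * real d + e))) \<partial>N) \<le> ennreal B"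
begin

lemma moment_even:
  assumes i: "i \<in> {1..n}" and k: "real k \<le> 2 * (2 * real d + e)" and ev: "even k"
  shows "integrable N (\<lambda>\<omega>. (X \<omega> i) ^ k)" "(\<integral>\<^sup>+\<omega>. ennreal ((X \<omega> i) ^ k) \<partial>N) \<le> ennreal (1 + B)"
    "expectation (\<lambda>\<omega>. (X \<omega> i) ^ k) \<le> 1 + B"
proof -
  have mp: "(\<lambda>\<omega>. ennreal (\<bar>X \<omega> i\<bar> powr (2 * (2 * real d + e)))) \<in> borel_measurable N"
    using meas_X[OF i] by measurable
  have "(\<integral>\<^sup>+\<omega>. ennreal ((X \<omega> i) ^ k) \<partial>N) \<le> (\<integral>\<^sup>+\<omega>. 1 + ennreal (\<bar>X \<omega> i\<bar> powr (2 * (2 * real d + e))) \<partial>N)"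
  proof (intro nn_integral_mono)
    fix \<omega>
    have "(X \<omega> i) ^ k = \<bar>X \<omega> i\<bar> ^ k" using ev by (simp add: power_even_abs)
    also have "\<dots> \<le> 1 + \<bar>X \<omega> i\<bar> powr (2 * (2 * real d + e))" using k by (intro power_le_one_plus_powr) auto
    finally have "ennreal ((X \<omega> i) ^ k) \<le> ennreal (1 + \<bar>X \<omega> i\<bar> powr (2 * (2 * real d + e)))" by (rule ennreal_leI)
    then show "ennreal ((X \<omega> i) ^ k) \<le> 1 + ennreal (\<bar>X \<omega> i\<bar> powr (2 * (2 * real d + e)))" by (simp add: ennreal_plus)
  qed
  also have "\<dots> = 1 + (\<integral>\<^sup>+\<omega>. ennreal (\<bar>X \<omega> i\<bar> powr (2 * (2 * real d + e))) \<partial>N)"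
    by (subst nn_integral_add) (use mp emeasure_space_1 in auto)
  also have "\<dots> \<le> 1 + ennreal B" by (intro add_left_mono b i)
  also have "\<dots> = ennreal (1 + B)" using B by (simp add: ennreal_plus)
  finally show nn: "(\<integral>\<^sup>+\<omega>. ennreal ((X \<omega> i) ^ k) \<partial>N) \<le> ennreal (1 + B)" .
  have nonneg: "(X \<omega> i) ^ k \<ge> 0" for \<omega> using ev by (rule zero_le_even_power)
  show ii: "integrable N (\<lambda>\<omega>. (X \<omega> i) ^ k)"
  proof (rule integrableI_bounded)
    show "(\<lambda>\<omega>. (X \<omega> i) ^ k) \<in> borel_measurable N" by (intro borel_measurable_power meas_X i)
    have "(\<integral>\<^sup>+\<omega>. ennreal (norm ((X \<omega> i) ^ k)) \<partial>N) = (\<integral>\<^sup>+\<omega>. ennreal ((X \<omega> i) ^ k) \<partial>N)"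
      by (simp only: real_norm_def abs_of_nonneg[OF nonneg])
    also have "\<dots> < \<infinity>" using nn by (rule le_less_trans) simp
    finally show "(\<integral>\<^sup>+\<omega>. ennreal (norm ((X \<omega> i) ^ k)) \<partial>N) < \<infinity>" .
  qed
  have "ennreal (expectation (\<lambda>\<omega>. (X \<omega> i) ^ k)) \<le> ennreal (1 + B)"
    using nn nn_integral_eq_integral[OF ii] nonneg by simp
  then show "expectation (\<lambda>\<omega>. (X \<omega> i) ^ k) \<le> 1 + B" using B by (subst (asm) ennreal_le_iff) auto
qed

text \<open>The left side is E (Z^d - 1)^2. \<open>power_minus_one_square_le\<close> compares it
  with E (Z - 1)^2 at a price growing with R, plus a tail that the additional e in the moment makes
  decay with R.\<close>

lemma zmom_variance_le:
  assumes R: "R \<ge> 1"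
  shows "0 \<le> zmom N n X (2 * d) - 2 * zmom N n X d + 1"
    "zmom N n X (2 * d) - 2 * zmom N n X d + 1 \<le>
      (real d * R ^ d)\<^sup>2 * (zmom N n X 2 - 2 * zmom N n X 1 + 1) + R powr (- e) * B"
proof -
  let ?Z = "\<lambda>\<omega>. (\<Sum>i=1..n. (X \<omega> i)\<^sup>2) / real n"
  have Z: "zmom N n X k = expectation (\<lambda>\<omega>. ?Z \<omega> ^ k)" for k by (simp add: zmom_def power_divide)
  have i: "integrable N (\<lambda>\<omega>. ?Z \<omega> ^ k)" if "k \<le> 2 * d" for k
    using integrable_P[OF that] by (simp add: power_divide sq_def)
  have sqr: "zmom N n X (2 * k) - 2 * zmom N n X k + 1 = expectation (\<lambda>\<omega>. (?Z \<omega> ^ k - 1)\<^sup>2)"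
    and isq: "integrable N (\<lambda>\<omega>. (?Z \<omega> ^ k - 1)\<^sup>2)" if k: "k \<le> d" for k
  proof -
    have e2: "(z ^ k - 1)\<^sup>2 = z ^ (2 * k) - 2 * z ^ k + 1" for z :: real
      by (simp add: power2_diff power_mult[symmetric] mult.commute)
    show "integrable N (\<lambda>\<omega>. (?Z \<omega> ^ k - 1)\<^sup>2)" unfolding e2 using i[of k] i[of "2 * k"] k by simp
    show "zmom N n X (2 * k) - 2 * zmom N n X k + 1 = expectation (\<lambda>\<omega>. (?Z \<omega> ^ k - 1)\<^sup>2)"
      unfolding e2 Z using i[of k] i[of "2 * k"] k prob_space by simp
  qed
  show "0 \<le> zmom N n X (2 * d) - 2 * zmom N n X d + 1"
    unfolding sqr[OF order_refl] by (intro Bochner_Integration.integral_nonneg) simp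
  have n1: "n \<ge> 1" using n_pos by simp
  have p1: "2 * real d + e \<ge> 1" using d1 e by (simp add: add_increasing2)
  note Zp = normalized_powr_bound[OF n1 X p1 B b]
  have "zmom N n X (2 * d) - 2 * zmom N n X d + 1 \<le>
    expectation (\<lambda>\<omega>. (real d * R ^ d)\<^sup>2 * (?Z \<omega> ^ 1 - 1)\<^sup>2 + R powr (- e) * ?Z \<omega> powr (2 * real d + e))"
    unfolding sqr[OF order_refl]
  proof (rule integral_mono)
    show "integrable N (\<lambda>\<omega>. (?Z \<omega> ^ d - 1)\<^sup>2)" by (rule isq) simp
    show "integrable N (\<lambda>\<omega>. (real d * R ^ d)\<^sup>2 * (?Z \<omega> ^ 1 - 1)\<^sup>2 + R powr (- e) * ?Z \<omega> powr (2 * real d + e))"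
      by (intro Bochner_Integration.integrable_add integrable_mult_right isq d1 Zp)
    fix \<omega>
    show "(?Z \<omega> ^ d - 1)\<^sup>2 \<le> (real d * R ^ d)\<^sup>2 * (?Z \<omega> ^ 1 - 1)\<^sup>2 + R powr (- e) * ?Z \<omega> powr (2 * real d + e)"
      unfolding power_one_right by (rule power_minus_one_square_le[OF _ R e]) (auto intro!: divide_nonneg_nonneg sum_nonneg)
  qed
  also have "\<dots> = (real d * R ^ d)\<^sup>2 * expectation (\<lambda>\<omega>. (?Z \<omega> ^ 1 - 1)\<^sup>2) + R powr (- e) * expectation (\<lambda>\<omega>. ?Z \<omega> powr (2 * real d + e))"
  proof -
    have lin: "expectation (\<lambda>\<omega>. a * f \<omega> + b * g \<omega>) = a * expectation f + b * expectation g"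
      if "integrable N f" "integrable N g" for a b :: real and f g
      using that by simp
    show ?thesis by (rule lin[OF isq[OF d1] Zp(1)])
  qed
  also have "expectation (\<lambda>\<omega>. (?Z \<omega> ^ 1 - 1)\<^sup>2) = zmom N n X 2 - 2 * zmom N n X 1 + 1"
    using sqr[OF d1] by simp
  also have "R powr (- e) * expectation (\<lambda>\<omega>. ?Z \<omega> powr (2 * real d + e)) \<le> R powr (- e) * B"
    by (intro mult_left_mono Zp powr_ge_zero)
  finally show "zmom N n X (2 * d) - 2 * zmom N n X d + 1 \<le>
      (real d * R ^ d)\<^sup>2 * (zmom N n X 2 - 2 * zmom N n X 1 + 1) + R powr (- e) * B" by simp
qed

text \<open>\<open>square_mult_power_le\<close> is applied to each coordinate, with b = X_i^2 and P
  = |X|^2. The first parts add up to \<delta> P^(2d); the second need E X_i^(4d) and gain a factor 1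
  / n from the normalisation, as n / n^(2d) <= 1 / n.\<close>

lemma dmom_le_split:
  assumes \<delta>: "\<delta> > 0"
  shows "dmom N n d X \<le> \<delta> * zmom N n X (2 * d) + (1 / \<delta>) ^ (2 * d - 2) * ((1 + B) / real n)"
proof -
  let ?P = "\<lambda>\<omega>. \<Sum>i=1..n. sq \<omega> i" and ?D = "(1 / \<delta>) ^ (2 * d - 2)"
  have n: "real n > 0" by (rule n_pos)
  have s2: "sq \<omega> i ^ (2 * d) = (X \<omega> i) ^ (4 * d)" for \<omega> i by (simp add: sq_def power_mult[symmetric])
  have iX: "integrable N (\<lambda>\<omega>. sq \<omega> i ^ (2 * d))" and EX: "expectation (\<lambda>\<omega>. sq \<omega> i ^ (2 * d)) \<le> 1 + B" if "i \<in> {1..n}" for i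
    unfolding s2 by (rule moment_even[OF that]; use e in simp)+
  have "expectation (\<lambda>\<omega>. (\<Sum>i=1..n. (sq \<omega> i)\<^sup>2) * ?P \<omega> ^ (2 * d - 2))
    \<le> expectation (\<lambda>\<omega>. \<delta> * ?P \<omega> ^ (2 * d) + ?D * (\<Sum>i=1..n. sq \<omega> i ^ (2 * d)))"
  proof (rule integral_mono[OF integrable_QP])
    show "integrable N (\<lambda>\<omega>. \<delta> * ?P \<omega> ^ (2 * d) + ?D * (\<Sum>i=1..n. sq \<omega> i ^ (2 * d)))"
      by (intro Bochner_Integration.integrable_add integrable_mult_right integrable_P Bochner_Integration.integrable_sum iX order_refl)
    fix \<omega>
    have "(\<Sum>i=1..n. (sq \<omega> i)\<^sup>2) * ?P \<omega> ^ (2 * d - 2) = (\<Sum>i=1..n. (sq \<omega> i)\<^sup>2 * ?P \<omega> ^ (2 * d - 2))"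
      by (rule sum_distrib_right)
    also have "\<dots> \<le> (\<Sum>i=1..n. \<delta> * (sq \<omega> i * ?P \<omega> ^ (2 * d - 1)) + ?D * sq \<omega> i ^ (2 * d))"
    proof (intro sum_mono square_mult_power_le \<delta> d1 sq_nonneg)
      fix i assume "i \<in> {1..n}"
      then show "sq \<omega> i \<le> ?P \<omega>" by (intro member_le_sum[where f = "sq \<omega>"]) auto
    qed
    also have "\<dots> = \<delta> * (?P \<omega> * ?P \<omega> ^ (2 * d - 1)) + ?D * (\<Sum>i=1..n. sq \<omega> i ^ (2 * d))"
      by (simp only: sum.distrib sum_distrib_left[symmetric] sum_distrib_right[symmetric])
    also have "?P \<omega> * ?P \<omega> ^ (2 * d - 1) = ?P \<omega> ^ (2 * d)"
      using d1 by (subst power_Suc[symmetric]) (intro arg_cong[where f = "(^) _"], simp)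
    finally show "(\<Sum>i=1..n. (sq \<omega> i)\<^sup>2) * ?P \<omega> ^ (2 * d - 2) \<le> \<delta> * ?P \<omega> ^ (2 * d) + ?D * (\<Sum>i=1..n. sq \<omega> i ^ (2 * d))" .
  qed
  also have "\<dots> = \<delta> * expectation (\<lambda>\<omega>. ?P \<omega> ^ (2 * d)) + ?D * (\<Sum>i=1..n. expectation (\<lambda>\<omega>. sq \<omega> i ^ (2 * d)))"
    by (subst Bochner_Integration.integral_add, intro integrable_mult_right integrable_P order_refl,
        intro integrable_mult_right Bochner_Integration.integrable_sum iX, assumption,
        simp only: integral_mult_right_zero Bochner_Integration.integral_sum[OF iX])
  also have "\<dots> \<le> \<delta> * expectation (\<lambda>\<omega>. ?P \<omega> ^ (2 * d)) + ?D * (\<Sum>i=1..n. 1 + B)"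
    using \<delta> by (intro add_left_mono mult_left_mono sum_mono EX) auto
  finally have "dmom N n d X \<le> (\<delta> * expectation (\<lambda>\<omega>. ?P \<omega> ^ (2 * d)) + ?D * (\<Sum>i=1..n. 1 + B)) / real n ^ (2 * d)"
    unfolding dmom_eq by (rule divide_right_mono) simp
  also have "\<dots> = \<delta> * zmom N n X (2 * d) + ?D * (real n * (1 + B) / real n ^ (2 * d))"
    unfolding zmom_eq by (simp add: add_divide_distrib)
  also have "\<dots> \<le> \<delta> * zmom N n X (2 * d) + ?D * ((1 + B) / real n)"
  proof (intro add_left_mono mult_left_mono)
    have "real n ^ 2 \<le> real n ^ (2 * d)" using d1 n by (intro power_increasing) auto
    then have "real n * (1 + B) / real n ^ (2 * d) \<le> real n * (1 + B) / real n ^ 2"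
      using B n by (intro divide_left_mono mult_nonneg_nonneg) auto
    also have "\<dots> = (1 + B) / real n" using n by (simp add: power2_eq_square)
    finally show "real n * (1 + B) / real n ^ (2 * d) \<le> (1 + B) / real n" .
  qed (use \<delta> in auto)
  finally show ?thesis .
qed

end

end

text \<open>The condition on the covariance makes E (Z - 1)^2 vanish, and the moment of order 4 d +
  \<epsilon> provides the uniform integrability that lifts this to E (Z^d - 1)^2. In both
  truncations the parameter, R or \<delta>, is chosen from the precision before n tends to
  infinity.\<close>

lemma defect_tendsto_0_fixed_degree:
  fixes N :: "nat \<Rightarrow> 'b measure" and X :: "nat \<Rightarrow> 'b \<Rightarrow> nat \<Rightarrow> real"
  assumes d: "d \<ge> 1"
    and N: "\<And>n. n \<ge> 1 \<Longrightarrow> prob_space (N n)"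
    and X: "\<And>n. n \<ge> 1 \<Longrightarrow> X n \<in> measurable (N n) (Rn n)"
    and exch: "\<And>n. n \<ge> 1 \<Longrightarrow> exchangeable (N n) n (X n)"
    and uncond: "\<And>n. n \<ge> 1 \<Longrightarrow> unconditional (N n) n (X n)"
    and m1: "(\<lambda>n. \<integral>\<omega>. (X n \<omega> 1)\<^sup>2 \<partial>N n) \<longlonglongrightarrow> 1"
    and cov: "(\<lambda>n. (\<integral>\<omega>. (X n \<omega> 1)\<^sup>2 * (X n \<omega> 2)\<^sup>2 \<partial>N n)
                 - (\<integral>\<omega>. (X n \<omega> 1)\<^sup>2 \<partial>N n) * (\<integral>\<omega>. (X n \<omega> 2)\<^sup>2 \<partial>N n)) \<longlonglongrightarrow> 0"
    and eps: "\<epsilon> > 0" "(SUP n\<in>{1..}. \<integral>\<^sup>+\<omega>. ennreal (\<bar>X n \<omega> 1\<bar> powr (4 * real d + \<epsilon>)) \<partial>N n) < \<infinity>"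
  shows "\<forall>\<^sub>F n in sequentially. power_vector (N n) n d (X n)"
    "(\<lambda>n. power_vector.defect (N n) n d (X n)) \<longlonglongrightarrow> 0"
proof -
  \<comment> \<open>Halved because the moments are taken of X^2: |X|^(4d+\<epsilon>) =
    (X^2)^(2d+e).\<close>
  define e where "e = \<epsilon> / 2"
  have e: "e > 0" "4 * real d + \<epsilon> = 2 * (2 * real d + e)" using eps by (auto simp: e_def)
  define B where "B = enn2real (SUP n\<in>{1..}. \<integral>\<^sup>+\<omega>. ennreal (\<bar>X n \<omega> 1\<bar> powr (4 * real d + \<epsilon>)) \<partial>N n)"
  have B0: "B \<ge> 0" by (simp add: B_def)
  have b: "(\<integral>\<^sup>+\<omega>. ennreal (\<bar>X n \<omega> i\<bar> powr (2 * (2 * real d + e))) \<partial>N n) \<le> ennreal B"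
    if n: "n \<ge> 1" and i: "i \<in> {1..n}" for n i
  proof -
    have "(\<integral>\<^sup>+\<omega>. ennreal (\<bar>X n \<omega> i\<bar> powr (2 * (2 * real d + e))) \<partial>N n)
        = (\<integral>\<^sup>+\<omega>. ennreal (\<bar>X n \<omega> 1\<bar> powr (2 * (2 * real d + e))) \<partial>N n)"
      by (rule exchangeable_nn_integral[OF X[OF n] exch[OF n] i, where f = "\<lambda>x. ennreal (\<bar>x\<bar> powr (2 * (2 * real d + e)))"]) measurable
    also have "\<dots> \<le> (SUP n\<in>{1..}. \<integral>\<^sup>+\<omega>. ennreal (\<bar>X n \<omega> 1\<bar> powr (4 * real d + \<epsilon>)) \<partial>N n)"
      unfolding e(2) using n by (intro SUP_upper) simp
    also have "\<dots> = ennreal B" unfolding B_def using eps(2) by simp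
    finally show ?thesis .
  qed
  have p1: "2 * real d + e \<ge> 1" using d e by (simp add: add_increasing2)
  have pv: "\<forall>\<^sub>F n in sequentially. n \<ge> 1 \<and> power_vector (N n) n d (X n)"
    using eventually_ge_at_top[of "4 * d"]
  proof eventually_elim
    case (elim n)
    then have n: "n \<ge> 1" using d by simp
    interpret prob_space "N n" by (rule N[OF n])
    note Zp = normalized_powr_bound[OF n X[OF n] p1 B0 b[OF n]]
    let ?Z = "\<lambda>\<omega>. (\<Sum>i=1..n. (X n \<omega> i)\<^sup>2) / real n"
    have m: "(\<lambda>\<omega>. \<Sum>i=1..n. (X n \<omega> i)\<^sup>2) \<in> borel_measurable (N n)"
      by (intro borel_measurable_sum borel_measurable_power measurable_Rn_component[OF X[OF n]]) auto
    have "integrable (N n) (\<lambda>\<omega>. ?Z \<omega> ^ (2 * d))"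
    proof (rule Bochner_Integration.integrable_bound)
      show "integrable (N n) (\<lambda>\<omega>. 1 + ?Z \<omega> powr (2 * real d + e))" using Zp by simp
      show "(\<lambda>\<omega>. ?Z \<omega> ^ (2 * d)) \<in> borel_measurable (N n)" using m by measurable
      have Z0: "?Z \<omega> \<ge> 0" for \<omega> by (intro divide_nonneg_nonneg sum_nonneg) auto
      have "?Z \<omega> ^ (2 * d) \<le> 1 + ?Z \<omega> powr (2 * real d + e)" for \<omega>
        by (rule power_le_one_plus_powr[OF Z0]) (use e in simp)
      then show "AE \<omega> in N n. norm (?Z \<omega> ^ (2 * d)) \<le> norm (1 + ?Z \<omega> powr (2 * real d + e))"
        using Z0 by (intro AE_I2) (simp add: abs_of_nonneg)
    qed
    from integrable_mult_left[OF this, of "real n ^ (2 * d)"]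
    have "integrable (N n) (\<lambda>\<omega>. (\<Sum>i=1..n. (X n \<omega> i)\<^sup>2) ^ (2 * d))"
      using n by (simp add: power_divide)
    then show ?case
      using elim n d X exch uncond by (auto intro!: power_vector.intro power_vector_axioms.intro prob_space_axioms)
  qed
  then show pv': "\<forall>\<^sub>F n in sequentially. power_vector (N n) n d (X n)" by eventually_elim simp
  define c where "c n = (\<integral>\<omega>. (X n \<omega> 1)\<^sup>2 * (X n \<omega> 2)\<^sup>2 \<partial>N n)" for n
  have X2: "\<forall>\<^sub>F n in sequentially. (\<integral>\<omega>. (X n \<omega> 2)\<^sup>2 \<partial>N n) = (\<integral>\<omega>. (X n \<omega> 1)\<^sup>2 \<partial>N n)"
    using pv
  proof eventually_elim
    case (elim n)
    then interpret power_vector "N n" n d "X n" by simp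
    have D: "{1} \<in> subset_idx n 1" "{2} \<in> subset_idx n 1" using nd d1 by (auto simp: subset_idx_def)
    have "real n * expectation (\<lambda>\<omega>. sq \<omega> 1) = real n * expectation (\<lambda>\<omega>. sq \<omega> 2)"
      using expectation_prod_sq(2)[OF D(1)] expectation_prod_sq(2)[OF D(2)] d1 by simp
    then show ?case using n_pos by (simp add: sq_def)
  qed
  have c: "c \<longlonglongrightarrow> 1"
  proof -
    have "(\<lambda>n. (\<integral>\<omega>. (X n \<omega> 2)\<^sup>2 \<partial>N n)) \<longlonglongrightarrow> 1"
      using tendsto_cong[OF X2] m1 by simp
    from tendsto_add[OF cov tendsto_mult[OF m1 this]] show ?thesis by (simp add: c_def[abs_def])
  qed
  have z1: "(\<lambda>n. zmom (N n) n (X n) 1) \<longlonglongrightarrow> 1"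
  proof -
    have "\<forall>\<^sub>F n in sequentially. zmom (N n) n (X n) 1 = (\<integral>\<omega>. (X n \<omega> 1)\<^sup>2 \<partial>N n)"
      using pv by eventually_elim (erule conjE, rule power_vector.zmom_1)
    from tendsto_cong[OF this] m1 show ?thesis by simp
  qed
  have inv0: "(\<lambda>n. K / real n) \<longlonglongrightarrow> 0" for K :: real
    by (rule lim_const_over_n)
  \<comment> \<open>An upper bound for E (Z - 1)^2, by \<open>zmom_2_le\<close>.\<close>
  define v where "v n = (1 + B) / real n + c n - 2 * zmom (N n) n (X n) 1 + 1" for n
  have v: "v \<longlonglongrightarrow> 0"
  proof -
    have "v \<longlonglongrightarrow> 0 + 1 - 2 * 1 + 1" unfolding v_def by (intro tendsto_intros inv0 c z1)
    then show ?thesis by simp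
  qed
  have ev: "\<forall>\<^sub>F n in sequentially.
    0 \<le> zmom (N n) n (X n) (2 * d) - 2 * zmom (N n) n (X n) d + 1 \<and>
    (\<forall>R\<ge>1. zmom (N n) n (X n) (2 * d) - 2 * zmom (N n) n (X n) d + 1 \<le> (real d * R ^ d)\<^sup>2 * v n + R powr (- e) * B) \<and>
    0 \<le> dmom (N n) n d (X n) \<and>
    (\<forall>\<delta>>0. dmom (N n) n d (X n) \<le> \<delta> * zmom (N n) n (X n) (2 * d) + (1 / \<delta>) ^ (2 * d - 2) * ((1 + B) / real n)) \<and>
    (zmom (N n) n (X n) d)\<^sup>2 \<le> zmom (N n) n (X n) (2 * d)"
    using pv
  proof eventually_elim
    case (elim n)
    then have n: "n \<ge> 1" by simp
    from elim interpret power_vector "N n" n d "X n" by simp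
    note vl = zmom_variance_le[OF e(1) B0 b[OF n]]
    have "zmom (N n) n (X n) 2 \<le> (1 + B) / real n + c n"
      unfolding c_def
    proof (rule zmom_2_le)
      show "(\<integral>\<^sup>+\<omega>. ennreal ((X n \<omega> i) ^ 4) \<partial>N n) \<le> ennreal (1 + B)" if "i \<in> {1..n}" for i
      proof (rule moment_even(2)[OF e(1) B0 b[OF n] that])
        show "real 4 \<le> 2 * (2 * real d + e)" using d1 e(1) by (simp add: add_increasing2)
      qed simp_all
    qed (use B0 in simp)
    then have "zmom (N n) n (X n) 2 - 2 * zmom (N n) n (X n) 1 + 1 \<le> v n" by (simp add: v_def)
    then have "\<forall>R. (real d * R ^ d)\<^sup>2 * (zmom (N n) n (X n) 2 - 2 * zmom (N n) n (X n) 1 + 1) \<le> (real d * R ^ d)\<^sup>2 * v n"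
      by (intro allI mult_left_mono) auto
    moreover have "integrable (N n) (\<lambda>\<omega>. (\<Sum>i=1..n. (X n \<omega> i)\<^sup>2) ^ k)" if "k \<le> 2 * d" for k
      using integrable_P[OF that] unfolding sq_def .
    ultimately show ?case
      using vl dmom_nonneg dmom_le_split[OF e(1) B0 b[OF n]]
      by (intro conjI allI impI zmom_square_le) (auto intro: order_trans[OF vl(2)] vl(1)[of 1])
  qed
  define w where "w n = zmom (N n) n (X n) (2 * d) - 2 * zmom (N n) n (X n) d + 1" for n
  have w: "w \<longlonglongrightarrow> 0"
  proof (rule LIMSEQ_I)
    fix \<eta> :: real assume \<eta>: "\<eta> > 0"
    have "((\<lambda>R :: real. R powr (- e) * B) \<longlongrightarrow> 0 * B) at_top"
      by (intro tendsto_mult tendsto_const tendsto_neg_powr) (use e in \<open>auto intro: filterlim_ident\<close>)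
    then have "\<forall>\<^sub>F R in at_top. R powr (- e) * B < \<eta> / 2" using \<eta> by (intro order_tendstoD) auto
    then obtain R where R: "R \<ge> 1" "R powr (- e) * B < \<eta> / 2"
      using eventually_conj[OF eventually_ge_at_top[of 1]] eventually_happens trivial_limit_at_top_linorder by blast
    have "(\<lambda>n. (real d * R ^ d)\<^sup>2 * v n) \<longlonglongrightarrow> (real d * R ^ d)\<^sup>2 * 0" by (intro tendsto_intros v)
    then have "\<forall>\<^sub>F n in sequentially. (real d * R ^ d)\<^sup>2 * v n < \<eta> / 2" using \<eta> by (intro order_tendstoD) auto
    then have "\<forall>\<^sub>F n in sequentially. norm (w n - 0) < \<eta>"
      using ev
    proof eventually_elim
      case (elim n)
      then have "w n \<le> (real d * R ^ d)\<^sup>2 * v n + R powr (- e) * B" "0 \<le> w n" using R(1) by (auto simp: w_def)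
      then show ?case using elim(1) R(2) by simp
    qed
    then show "\<exists>no. \<forall>n\<ge>no. norm (w n - 0) < \<eta>" by (simp add: eventually_sequentially)
  qed
  have zd: "(\<lambda>n. zmom (N n) n (X n) d) \<longlonglongrightarrow> 1"
  proof -
    have "(\<lambda>n. zmom (N n) n (X n) d - 1) \<longlonglongrightarrow> 0"
    proof (rule Lim_null_comparison)
      show "(\<lambda>n. sqrt (w n)) \<longlonglongrightarrow> 0" using tendsto_real_sqrt[OF w] by simp
      show "\<forall>\<^sub>F n in sequentially. norm (zmom (N n) n (X n) d - 1) \<le> sqrt (w n)"
        using ev
      proof eventually_elim
        case (elim n)
        \<comment> \<open>The mean deviates from 1 at most as much as the root mean square does,
          because (E Z^d)^2 <= E Z^(2d).\<close>
        then have "(zmom (N n) n (X n) d - 1)\<^sup>2 \<le> w n" by (simp add: w_def power2_diff)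
        then have "sqrt ((zmom (N n) n (X n) d - 1)\<^sup>2) \<le> sqrt (w n)" by (rule real_sqrt_le_mono)
        then show ?case by simp
      qed
    qed
    from tendsto_add[OF this tendsto_const[of 1]] show ?thesis by simp
  qed
  have z2d: "(\<lambda>n. zmom (N n) n (X n) (2 * d)) \<longlonglongrightarrow> 1"
  proof -
    have "(\<lambda>n. w n + 2 * zmom (N n) n (X n) d - 1) \<longlonglongrightarrow> 0 + 2 * 1 - 1" by (intro tendsto_intros w zd)
    then show ?thesis by (simp add: w_def)
  qed
  have D: "(\<lambda>n. (real d)\<^sup>2 * dmom (N n) n d (X n)) \<longlonglongrightarrow> 0"
  proof -
    have "(\<lambda>n. dmom (N n) n d (X n)) \<longlonglongrightarrow> 0"
    proof (rule LIMSEQ_I)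
      fix \<eta> :: real assume \<eta>: "\<eta> > 0"
      define \<delta> where "\<delta> = \<eta> / 4"
      have \<delta>: "\<delta> > 0" using \<eta> by (simp add: \<delta>_def)
      have "(\<lambda>n. \<delta> * zmom (N n) n (X n) (2 * d) + (1 / \<delta>) ^ (2 * d - 2) * ((1 + B) / real n)) \<longlonglongrightarrow> \<delta> * 1 + (1 / \<delta>) ^ (2 * d - 2) * 0"
        by (intro tendsto_intros z2d inv0)
      then have L: "(\<lambda>n. \<delta> * zmom (N n) n (X n) (2 * d) + (1 / \<delta>) ^ (2 * d - 2) * ((1 + B) / real n)) \<longlonglongrightarrow> \<delta>"
        by (simp only: mult_1_right mult_zero_right add_0_right)
      have "\<delta> < \<eta>" using \<eta> by (simp add: \<delta>_def)
      then have "\<forall>\<^sub>F n in sequentially. \<delta> * zmom (N n) n (X n) (2 * d) + (1 / \<delta>) ^ (2 * d - 2) * ((1 + B) / real n) < \<eta>"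
        by (rule order_tendstoD(2)[OF L])
      then have "\<forall>\<^sub>F n in sequentially. norm (dmom (N n) n d (X n) - 0) < \<eta>"
        using ev
      proof eventually_elim
        case (elim n)
        then have "dmom (N n) n d (X n) \<le> \<delta> * zmom (N n) n (X n) (2 * d) + (1 / \<delta>) ^ (2 * d - 2) * ((1 + B) / real n)"
          using \<delta> by blast
        then show ?case using elim by simp
      qed
      then show "\<exists>no. \<forall>n\<ge>no. norm (dmom (N n) n d (X n) - 0) < \<eta>" by (simp add: eventually_sequentially)
    qed
    from tendsto_mult[OF tendsto_const this, of "(real d)\<^sup>2"] show ?thesis by simp
  qed
  show "(\<lambda>n. power_vector.defect (N n) n d (X n)) \<longlonglongrightarrow> 0"
    by (rule defect_tendsto_0[OF pv' inv0 zd z2d D])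
qed

section \<open>The self-consistent equation\<close>

text \<open>The coordinates at indices without repetition, each index set represented by its sorted
  list; the factor 1 / m of the sample covariance is absorbed into the vectors.\<close>

definition vec_of :: "nat \<Rightarrow> (nat list \<Rightarrow> real) \<Rightarrow> nat set \<Rightarrow> real" where
  "vec_of m x S = x (sorted_list_of_set S) / sqrt (real m)"

lemma measurable_vec_of:
  assumes "S \<in> subset_idx n d"
  shows "(\<lambda>x. vec_of m x S) \<in> borel_measurable (Rnd n d)"
proof -
  have "sorted_list_of_set S \<in> multi_idx n d"
    using bij_sorted_list_of_set[of n d] assms by (auto simp: bij_betw_def sorted_idx_def)
  then have "(\<lambda>x. x (sorted_list_of_set S)) \<in> borel_measurable (Rnd n d)"
    by (rule measurable_component_singleton)
  then show ?thesis unfolding vec_of_def by (rule borel_measurable_divide) simp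
qed

text \<open>\<open>resolvent\<close> is a choice, so measurability cannot be read off its
  definition; Sherman--Morrison makes the entries rational functions of the data, one sample at a
  time.\<close>

lemma measurable_resolvent:
  assumes I: "finite I" and K: "finite K" and t: "t > 0"
    and V: "\<And>k i. k \<in> K \<Longrightarrow> i \<in> I \<Longrightarrow> (\<lambda>x. V x k i) \<in> borel_measurable M"
    and ij: "i \<in> I" "j \<in> I"
  shows "(\<lambda>x. resolvent I t K (V x) i j) \<in> borel_measurable M"
  using K V ij
proof (induction K arbitrary: i j rule: finite_induct)
  case empty
  have "(\<lambda>x. resolvent I t {} (V x) i j) = (\<lambda>x. if i = j then 1 / t else 0)"
    using resolvent_empty[OF I t empty(2,3)] by (rule ext)
  then show ?case by simp
next
  case (insert k K)
  have R: "(\<lambda>x. resolvent I t K (V x) i j) \<in> borel_measurable M" if "i \<in> I" "j \<in> I" for i j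
    using insert that by auto
  have v: "(\<lambda>x. V x k i) \<in> borel_measurable M" if "i \<in> I" for i using insert.prems(1) that by auto
  have u: "(\<lambda>x. app I (resolvent I t K (V x)) (V x k) i) \<in> borel_measurable M" if "i \<in> I" for i
    unfolding app_def using that by (intro borel_measurable_sum borel_measurable_times R v)
  have q: "(\<lambda>x. qform I (resolvent I t K (V x)) (V x k)) \<in> borel_measurable M"
    unfolding qform_def by (intro borel_measurable_sum borel_measurable_times u v)
  have "(\<lambda>x. resolvent I t (insert k K) (V x) i j) = (\<lambda>x. resolvent I t K (V x) i j
    - app I (resolvent I t K (V x)) (V x k) i * app I (resolvent I t K (V x)) (V x k) j / (1 + qform I (resolvent I t K (V x)) (V x k)))"
    using resolvent_insert[OF I insert(1,2) t insert.prems(2,3)] by (rule ext)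
  then show ?case
    using insert.prems(2,3)
    by (simp only:) (intro borel_measurable_diff borel_measurable_divide borel_measurable_times borel_measurable_add
        borel_measurable_const R u q)
qed

lemma resolvent_cong_vec:
  assumes "finite I" "finite K" "t > 0" "\<And>k i. k \<in> K \<Longrightarrow> i \<in> I \<Longrightarrow> V k i = V' k i" "i \<in> I" "j \<in> I"
  shows "resolvent I t K V i j = resolvent I t K V' i j"
  by (rule resolvent_cong_gram[OF assms(1,2,2,3,5,6)]) (rule sum.cong[OF refl], simp add: assms(4))

lemma rtrace_cong_vec:
  assumes "finite I" "finite K" "t > 0" "\<And>k i. k \<in> K \<Longrightarrow> i \<in> I \<Longrightarrow> V k i = V' k i"
  shows "rtrace I t K V = rtrace I t K V'"
  unfolding rtrace_def by (rule sum.cong[OF refl]) (rule resolvent_cong_vec[OF assms(1-3)], auto simp: assms(4))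

lemma qform_cong:
  "(\<And>i j. i \<in> I \<Longrightarrow> j \<in> I \<Longrightarrow> R i j = R' i j) \<Longrightarrow> (\<And>i. i \<in> I \<Longrightarrow> v i = v' i) \<Longrightarrow> qform I R v = qform I R' v'"
  unfolding qform_def app_def by (intro sum.cong[OF refl] arg_cong2[where f = "(*)"]) auto

text \<open>Sherman--Morrison turns \<open>p - t tr R\<close> into
  \<open>m - \<Sum>\<^sub>k 1 / (1 + q\<^sub>k)\<close>, and \<open>q\<^sub>k\<close> is close to \<open>\<tau> = tr R / m\<close>.\<close>

lemma self_consistent:
  fixes V :: "'k \<Rightarrow> 'i \<Rightarrow> real"
  assumes I: "finite I" and K: "finite K" "K \<noteq> {}" and t: "t > 0"
  defines "m \<equiv> real (card K)" and "\<tau> \<equiv> rtrace I t K V / real (card K)"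
    and "q \<equiv> \<lambda>k. qform I (resolvent I t (K - {k}) V) (V k)"
  shows "\<bar>real (card I) / m - 1 - t * \<tau> + 1 / (1 + \<tau>)\<bar>
    \<le> (\<Sum>k\<in>K. \<bar>q k - rtrace I t (K - {k}) V / m\<bar>) / m + 1 / (m * t)"
proof -
  have m: "m > 0" using K by (simp add: m_def card_gt_0_iff)
  have \<tau>0: "\<tau> \<ge> 0" unfolding \<tau>_def by (intro divide_nonneg_nonneg rtrace_nonneg I K t) simp
  have q0: "q k \<ge> 0" for k
    unfolding q_def using K by (intro qform_nonneg[OF I inv_on_resolvent t] I t) auto
  have ins: "insert k (K - {k}) = K" if "k \<in> K" for k using that by auto
  have qk: "qform I (resolvent I t K V) (V k) = q k / (1 + q k)" if k: "k \<in> K" for k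
    using qform_resolvent_insert[OF I _ t, of "K - {k}" k V] K unfolding ins[OF k] q_def by simp
  have tr: "rtrace I t K V \<le> rtrace I t (K - {k}) V" "rtrace I t (K - {k}) V \<le> rtrace I t K V + 1 / t" if k: "k \<in> K" for k
    using rtrace_insert[OF I _ t, of "K - {k}" k V] K unfolding ins[OF k] by simp_all
  have "real (card I) - t * rtrace I t K V = (\<Sum>k\<in>K. q k / (1 + q k))"
    using sum_qform_resolvent[OF I K(1) t, of V] qk by simp
  also have "\<dots> = (\<Sum>k\<in>K. 1 - 1 / (1 + q k))"
  proof (rule sum.cong[OF refl])
    fix k
    show "q k / (1 + q k) = 1 - 1 / (1 + q k)" using q0[of k] by (simp add: field_simps)
  qed
  also have "\<dots> = m - (\<Sum>k\<in>K. 1 / (1 + q k))" by (simp add: sum_subtractf m_def)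
  finally have "real (card I) / m - t * \<tau> = 1 - (\<Sum>k\<in>K. 1 / (1 + q k)) / m"
    using m unfolding \<tau>_def m_def[symmetric] by (simp add: field_simps)
  moreover have "1 / (1 + \<tau>) = (\<Sum>k\<in>K. 1 / (1 + \<tau>)) / m" using m by (simp add: m_def)
  ultimately have "real (card I) / m - 1 - t * \<tau> + 1 / (1 + \<tau>) = (\<Sum>k\<in>K. 1 / (1 + \<tau>) - 1 / (1 + q k)) / m"
    unfolding sum_subtractf diff_divide_distrib by linarith
  then have "\<bar>real (card I) / m - 1 - t * \<tau> + 1 / (1 + \<tau>)\<bar> = \<bar>\<Sum>k\<in>K. 1 / (1 + \<tau>) - 1 / (1 + q k)\<bar> / m"
    using m by simp
  also have "\<dots> \<le> (\<Sum>k\<in>K. \<bar>1 / (1 + \<tau>) - 1 / (1 + q k)\<bar>) / m"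
    using m by (intro divide_right_mono sum_abs) auto
  also have "\<dots> \<le> (\<Sum>k\<in>K. \<bar>q k - rtrace I t (K - {k}) V / m\<bar> + 1 / (m * t)) / m"
  proof (intro divide_right_mono sum_mono)
    fix k assume k: "k \<in> K"
    \<comment> \<open>The function 1 / (1 + x) is 1-Lipschitz on the nonnegative reals.\<close>
    have "1 / (1 + \<tau>) - 1 / (1 + q k) = (q k - \<tau>) / ((1 + \<tau>) * (1 + q k))"
      using \<tau>0 q0[of k] by (simp add: field_simps)
    also have "\<bar>\<dots>\<bar> \<le> \<bar>q k - \<tau>\<bar> / 1"
    proof -
      have "1 * 1 \<le> (1 + \<tau>) * (1 + q k)" using \<tau>0 q0[of k] by (intro mult_mono) auto
      then show ?thesis unfolding abs_divide by (intro frac_le) auto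
    qed
    finally have a: "\<bar>1 / (1 + \<tau>) - 1 / (1 + q k)\<bar> \<le> \<bar>q k - \<tau>\<bar>" by simp
    \<comment> \<open>\<tau> is built from all samples, whereas q k is compared with the trace
      without sample k; the two traces differ by the effect of one rank-one term.\<close>
    have "rtrace I t (K - {k}) V / m - \<tau> = (rtrace I t (K - {k}) V - rtrace I t K V) / m"
      by (simp add: \<tau>_def m_def diff_divide_distrib)
    also have "\<bar>\<dots>\<bar> \<le> (1 / t) / m"
      unfolding abs_divide using tr[OF k] m t by (intro frac_le) auto
    finally have b: "\<bar>rtrace I t (K - {k}) V / m - \<tau>\<bar> \<le> 1 / (m * t)" by (simp add: mult.commute)
    show "\<bar>1 / (1 + \<tau>) - 1 / (1 + q k)\<bar> \<le> \<bar>q k - rtrace I t (K - {k}) V / m\<bar> + 1 / (m * t)"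
      using a b by linarith
  qed (use m in simp)
  also have "\<dots> = (\<Sum>k\<in>K. \<bar>q k - rtrace I t (K - {k}) V / m\<bar>) / m + 1 / (m * t)"
    using m by (simp add: sum.distrib add_divide_distrib m_def[symmetric])
  finally show ?thesis .
qed

text \<open>Multiplied by 1 + \<tau>, the equation is the quadratic one for \<open>MP_tau\<close>.
  Its discriminant is at least (t + 1 - c)^2, so the larger root is nonnegative.\<close>

lemma MP_tau_root:
  assumes c: "c > 0" and t: "t > 0"
  shows "MP_tau c t \<ge> 0" "c - 1 - t * MP_tau c t + 1 / (1 + MP_tau c t) = 0"
proof -
  define s where "s = sqrt ((t + 1 - c)\<^sup>2 + 4 * c * t)"
  have s2: "s\<^sup>2 = (t + 1 - c)\<^sup>2 + 4 * c * t" unfolding s_def using c t by (intro real_sqrt_pow2) auto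
  have s: "\<bar>t + 1 - c\<bar> \<le> s" unfolding s_def by (rule real_le_rsqrt) (use c t in simp)
  define \<tau> where "\<tau> = MP_tau c t"
  have \<tau>: "2 * t * \<tau> = c - 1 - t + s" using t by (simp add: \<tau>_def MP_tau_def s_def)
  have "2 * t * \<tau> \<ge> 0" unfolding \<tau> using s by linarith
  then have \<tau>0: "\<tau> \<ge> 0" using t by (simp add: zero_le_mult_iff)
  then show "MP_tau c t \<ge> 0" by (simp add: \<tau>_def)
  have "(2 * t * \<tau> + (t + 1 - c))\<^sup>2 = s\<^sup>2" unfolding \<tau> by simp
  then have "4 * t * (t * \<tau>\<^sup>2 + (t + 1 - c) * \<tau> - c) = 0" unfolding s2 by (simp add: power2_eq_square algebra_simps)
  then have e: "t * \<tau>\<^sup>2 + (t + 1 - c) * \<tau> - c = 0" using t by simp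
  have "(c - 1 - t * \<tau>) * (1 + \<tau>) + 1 = - (t * \<tau>\<^sup>2 + (t + 1 - c) * \<tau> - c)"
    by (simp add: power2_eq_square algebra_simps)
  then have "(c - 1 - t * \<tau>) * (1 + \<tau>) + 1 = 0" using e by simp
  moreover have "c - 1 - t * \<tau> + 1 / (1 + \<tau>) = ((c - 1 - t * \<tau>) * (1 + \<tau>) + 1) / (1 + \<tau>)"
    using \<tau>0 by (simp add: add_divide_distrib)
  ultimately show "c - 1 - t * MP_tau c t + 1 / (1 + MP_tau c t) = 0" by (simp add: \<tau>_def)
qed

text \<open>The function 1 / (1 + x) - t x decreases at rate at least t on the nonnegative reals, so
  the distance to the root is at most the residual over t. The ratio c' of the finite problem may
  differ from its limit c.\<close>

lemma MP_tau_stable: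
  assumes c: "c > 0" and t: "t > 0" and \<tau>: "\<tau> \<ge> 0"
  shows "\<bar>\<tau> - MP_tau c t\<bar> \<le> (\<bar>c' - 1 - t * \<tau> + 1 / (1 + \<tau>)\<bar> + \<bar>c' - c\<bar>) / t"
proof -
  let ?r = "MP_tau c t"
  note r = MP_tau_root[OF c t]
  define f where "f x = 1 / (1 + x) - t * x" for x :: real
  have gap: "t * (y - x) \<le> f x - f y" if "0 \<le> x" "x \<le> y" for x y
  proof -
    have "1 / (1 + y) \<le> 1 / (1 + x)" using that by (intro divide_left_mono mult_pos_pos) auto
    then show ?thesis by (simp add: f_def algebra_simps)
  qed
  have "t * \<bar>\<tau> - ?r\<bar> \<le> \<bar>f \<tau> - f ?r\<bar>"
  proof (cases "\<tau> \<le> ?r")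
    case True
    then show ?thesis using gap[OF \<tau> True] t by (simp add: abs_if)
  next
    case False
    then have "?r \<le> \<tau>" by simp
    from gap[OF r(1) this] this show ?thesis by (simp add: abs_if)
  qed
  also have "f ?r = 1 - c" using r(2) by (simp add: f_def)
  also have "f \<tau> - (1 - c) = (c' - 1 - t * \<tau> + 1 / (1 + \<tau>)) - (c' - c)" by (simp add: f_def)
  also have "\<bar>\<dots>\<bar> \<le> \<bar>c' - 1 - t * \<tau> + 1 / (1 + \<tau>)\<bar> + \<bar>c' - c\<bar>" by (rule abs_triangle_ineq4)
  finally show ?thesis using t by (simp add: pos_le_divide_eq mult.commute)
qed

section \<open>Concentration of the resolvent trace\<close>

lemma measurable_power_prod:
  assumes "X \<in> measurable N (Rn n)"
  shows "(\<lambda>\<omega>. \<lambda>i\<in>multi_idx n d. \<Prod>j=1..d. X \<omega> (i ! (j - 1))) \<in> measurable N (Rnd n d)"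
proof (rule measurable_restrict)
  fix i assume i: "i \<in> multi_idx n d"
  have "i ! (j - 1) \<in> {1..n}" if "j \<in> {1..d}" for j
  proof -
    have "i ! (j - 1) \<in> set i" using i that by (intro nth_mem) (auto simp: multi_idx_def)
    then show ?thesis using i by (auto simp: multi_idx_def)
  qed
  then show "(\<lambda>\<omega>. \<Prod>j=1..d. X \<omega> (i ! (j - 1))) \<in> borel_measurable N"
    by (intro borel_measurable_prod measurable_Rn_component[OF assms])
qed

lemma prod_nth_eq_prod_mset:
  "(\<Prod>j=1..length i. f (i ! (j - 1))) = (\<Prod>a\<in>#mset i. f a :: real)"
proof -
  have "(\<Prod>j=1..length i. f (i ! (j - 1))) = (\<Prod>j<length i. f (i ! j))"
    by (rule prod.reindex_bij_witness[where i = Suc and j = "\<lambda>j. j - 1"]) auto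
  also have "\<dots> = prod_list (map f i)" by (simp add: prod.list_conv_set_nth atLeast0LessThan)
  also have "\<dots> = (\<Prod>a\<in>#mset i. f a)" by (metis mset_map prod_mset_prod_list)
  finally show ?thesis .
qed

context power_vector
begin

abbreviation "p \<equiv> n choose d"
abbreviation "P \<equiv> PowerT N n d X"
abbreviation "idx \<equiv> subset_idx n d"

lemma sets_P [simp, measurable_cong]: "sets P = sets (Rnd n d)"
  by (simp add: PowerT_def)

lemma prob_space_P: "prob_space P"
  unfolding PowerT_def by (rule prob_space_distr[OF measurable_power_prod[OF X]])

lemma sorted_list_of_idx:
  assumes "S \<in> idx" shows "sorted_list_of_set S \<in> multi_idx n d"
  using bij_sorted_list_of_set[of n d] assms by (auto simp: bij_betw_def sorted_idx_def)

lemma power_prod_eq_y: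
  assumes S: "S \<in> idx"
  shows "(\<Prod>j=1..d. X \<omega> (sorted_list_of_set S ! (j - 1))) = y S \<omega>"
proof -
  have fin: "finite S" "card S = d" using subset_idxD[OF S] by auto
  have "(\<Prod>j=1..d. X \<omega> (sorted_list_of_set S ! (j - 1))) = (\<Prod>a\<in>#mset (sorted_list_of_set S). X \<omega> a)"
    using prod_nth_eq_prod_mset[of "X \<omega>" "sorted_list_of_set S"] fin by simp
  also have "mset (sorted_list_of_set S) = mset_set S"
    using mset_set_set[OF distinct_sorted_list_of_set, of S] fin(1) by simp
  also have "(\<Prod>a\<in>#mset_set S. X \<omega> a) = y S \<omega>" by (simp add: y_def prod_unfold_prod_mset)
  finally show ?thesis .
qed

lemma measurable_y: "S \<in> idx \<Longrightarrow> y S \<in> borel_measurable N"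
  unfolding y_def using subset_idxD[of S n d] by (intro borel_measurable_prod meas_X) auto

lemma p_pos: "p > 0" using nd d1 by (simp add: zero_less_binomial_iff)

text \<open>R is fixed here, to stand later for the resolvent of the other samples. The second
  moment from \<open>quadratic_form_bound\<close> for t R passes to the first by (E |q|)^2 <= E q^2.
  A nonnegative integral is estimated, so that it can be iterated without questions of
  integrability.\<close>

lemma nn_integral_quadratic_form_le:
  fixes R :: "nat set \<Rightarrow> nat set \<Rightarrow> real"
  assumes t: "t > 0" and m: "m \<ge> 1"
    and diag: "\<And>S. S \<in> idx \<Longrightarrow> \<bar>R S S\<bar> \<le> 1 / t"
    and frob: "(\<Sum>S\<in>idx. \<Sum>T\<in>idx. (R S T)\<^sup>2) \<le> real p / t\<^sup>2"
  shows "(\<integral>\<^sup>+ x. ennreal \<bar>qform idx R (vec_of m x) - (\<Sum>S\<in>idx. R S S) / real m\<bar> \<partial>P)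
    \<le> ennreal (real p / real m * sqrt (2 * defect) / t)"
proof -
  define q where "q \<omega> = (\<Sum>S\<in>idx. y S \<omega> * (\<Sum>T\<in>idx. t * R S T * y T \<omega>)) - (\<Sum>S\<in>idx. t * R S S)" for \<omega>
  have d': "\<bar>t * R S S\<bar> \<le> 1" if "S \<in> idx" for S
    using diag[OF that] t by (simp add: abs_mult field_simps)
  have f': "(\<Sum>S\<in>idx. \<Sum>T\<in>idx. (t * R S T)\<^sup>2) \<le> real p"
  proof -
    have "(\<Sum>S\<in>idx. \<Sum>T\<in>idx. (t * R S T)\<^sup>2) = t\<^sup>2 * (\<Sum>S\<in>idx. \<Sum>T\<in>idx. (R S T)\<^sup>2)"
      by (simp add: power_mult_distrib sum_distrib_left)
    also have "\<dots> \<le> t\<^sup>2 * (real p / t\<^sup>2)" using frob by (intro mult_left_mono) auto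
    finally show ?thesis using t by simp
  qed
  note qb = quadratic_form_bound[of "\<lambda>S T. t * R S T", OF d' f', folded q_def]
  have mq: "q \<in> borel_measurable N"
    unfolding q_def by (intro borel_measurable_diff borel_measurable_sum borel_measurable_times borel_measurable_const measurable_y)
  have qi: "integrable N q" using square_integrable_imp_integrable[OF mq qb(1)] .
  have "(expectation (\<lambda>\<omega>. \<bar>q \<omega>\<bar>))\<^sup>2 \<le> expectation (\<lambda>\<omega>. (q \<omega>)\<^sup>2)"
  proof -
    have "0 \<le> variance (\<lambda>\<omega>. \<bar>q \<omega>\<bar>)" by simp
    also have "\<dots> = expectation (\<lambda>\<omega>. (\<bar>q \<omega>\<bar>)\<^sup>2) - (expectation (\<lambda>\<omega>. \<bar>q \<omega>\<bar>))\<^sup>2"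
      using qi qb(1) by (intro variance_eq) auto
    finally show ?thesis by simp
  qed
  also have "\<dots> \<le> 2 * (real p)\<^sup>2 * defect" by (rule qb(2))
  finally have "sqrt ((expectation (\<lambda>\<omega>. \<bar>q \<omega>\<bar>))\<^sup>2) \<le> sqrt (2 * (real p)\<^sup>2 * defect)" by (rule real_sqrt_le_mono)
  moreover have "sqrt (2 * (real p)\<^sup>2 * defect) = real p * sqrt (2 * defect)" by (simp add: real_sqrt_mult)
  moreover have "expectation (\<lambda>\<omega>. \<bar>q \<omega>\<bar>) \<ge> 0" by simp
  ultimately have Eq: "expectation (\<lambda>\<omega>. \<bar>q \<omega>\<bar>) \<le> real p * sqrt (2 * defect)" by simp
  define \<Phi> where "\<Phi> = (\<lambda>\<omega>. \<lambda>i\<in>multi_idx n d. \<Prod>j=1..d. X \<omega> (i ! (j - 1)))"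
  have \<Phi>: "\<Phi> \<in> measurable N (Rnd n d)" unfolding \<Phi>_def by (rule measurable_power_prod[OF X])
  have v: "vec_of m (\<Phi> \<omega>) S = y S \<omega> / sqrt (real m)" if "S \<in> idx" for S \<omega>
    using power_prod_eq_y[OF that] sorted_list_of_idx[OF that] by (simp add: vec_of_def \<Phi>_def)
  have qf: "qform idx R (vec_of m (\<Phi> \<omega>)) - (\<Sum>S\<in>idx. R S S) / real m = q \<omega> / (t * real m)" for \<omega>
  proof -
    have "qform idx R (vec_of m (\<Phi> \<omega>)) = qform idx R (\<lambda>S. y S \<omega> / sqrt (real m))"
      by (rule qform_cong) (auto simp: v)
    also have "\<dots> = (\<Sum>S\<in>idx. \<Sum>T\<in>idx. (y S \<omega> / sqrt (real m)) * (R S T * (y T \<omega> / sqrt (real m))))"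
      by (simp add: qform_def app_def sum_distrib_left)
    also have "\<dots> = (\<Sum>S\<in>idx. \<Sum>T\<in>idx. (y S \<omega> * (t * R S T * y T \<omega>)) / (t * real m))"
    proof (intro sum.cong[OF refl])
      fix S T
      have "sqrt (real m) * sqrt (real m) = real m" by simp
      then show "(y S \<omega> / sqrt (real m)) * (R S T * (y T \<omega> / sqrt (real m))) = (y S \<omega> * (t * R S T * y T \<omega>)) / (t * real m)"
        using t m by (simp add: field_simps)
    qed
    also have "\<dots> = (\<Sum>S\<in>idx. y S \<omega> * (\<Sum>T\<in>idx. t * R S T * y T \<omega>)) / (t * real m)"
      by (simp add: sum_divide_distrib sum_distrib_left)
    finally have a: "qform idx R (vec_of m (\<Phi> \<omega>)) = \<dots>" .
    have "(\<Sum>S\<in>idx. R S S) / real m = (\<Sum>S\<in>idx. t * R S S) / (t * real m)"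
      using t m by (simp add: sum_distrib_left[symmetric])
    then show ?thesis unfolding a q_def diff_divide_distrib by simp
  qed
  have "(\<integral>\<^sup>+ x. ennreal \<bar>qform idx R (vec_of m x) - (\<Sum>S\<in>idx. R S S) / real m\<bar> \<partial>P)
    = (\<integral>\<^sup>+ \<omega>. ennreal \<bar>qform idx R (vec_of m (\<Phi> \<omega>)) - (\<Sum>S\<in>idx. R S S) / real m\<bar> \<partial>N)"
    unfolding PowerT_def \<Phi>_def[symmetric]
    by (rule nn_integral_distr[OF \<Phi>], simp only: measurable_distr_eq1, unfold qform_def app_def)
      (intro measurable_compose[OF _ measurable_ennreal] borel_measurable_abs borel_measurable_diff borel_measurable_sum
        borel_measurable_times borel_measurable_const measurable_vec_of)
  also have "\<dots> = (\<integral>\<^sup>+ \<omega>. ennreal (\<bar>q \<omega>\<bar> / (t * real m)) \<partial>N)"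
    unfolding qf using t by (simp add: abs_mult)
  also have "\<dots> = ennreal (expectation (\<lambda>\<omega>. \<bar>q \<omega>\<bar> / (t * real m)))"
    using qi t by (intro nn_integral_eq_integral integrable_divide integrable_abs) auto
  also have "\<dots> \<le> ennreal (real p * sqrt (2 * defect) / (t * real m))"
    using Eq t m by (intro ennreal_leI) (simp add: divide_right_mono)
  finally show ?thesis by (simp add: mult.commute)
qed

abbreviation "Q m \<equiv> Pi\<^sub>M {1..m} (\<lambda>_. P)"

lemma measurable_sample_vec:
  assumes "k \<in> K" "S \<in> idx"
  shows "(\<lambda>z. vec_of m (z k) S) \<in> borel_measurable (Pi\<^sub>M K (\<lambda>_. P))"
proof -
  have "(\<lambda>x. vec_of m x S) \<in> borel_measurable P"
    using measurable_vec_of[OF assms(2)] by (simp cong: measurable_cong_sets)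
  then show ?thesis by (rule measurable_compose[OF measurable_component_singleton[OF assms(1)]])
qed

text \<open>The resolvent does not see sample k. Integrating over the k-th coordinate first
  therefore leaves a quadratic form with a fixed matrix, and the bound is the same for all values of
  the other samples.\<close>

lemma nn_integral_leave_one_out_le:
  assumes t: "t > 0" and m: "m \<ge> 1" and k: "k \<in> {1..m}"
  defines "V \<equiv> \<lambda>(z :: nat \<Rightarrow> nat list \<Rightarrow> real) k. vec_of m (z k)"
  shows "(\<integral>\<^sup>+ z. ennreal \<bar>qform idx (resolvent idx t ({1..m} - {k}) (V z)) (V z k)
      - rtrace idx t ({1..m} - {k}) (V z) / real m\<bar> \<partial>Q m)
    \<le> ennreal (real p / real m * sqrt (2 * defect) / t)"
proof -
  interpret P: prob_space P by (rule prob_space_P)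
  interpret product_sigma_finite "\<lambda>_. P" by unfold_locales
  define K where "K = {1..m} - {k}"
  have K: "finite K" "k \<notin> K" "insert k K = {1..m}" using k by (auto simp: K_def)
  have fin: "finite idx" by (rule finite_subset_idx)
  define f where "f z = ennreal \<bar>qform idx (resolvent idx t K (V z)) (V z k) - rtrace idx t K (V z) / real m\<bar>" for z
  have mV: "(\<lambda>z. V z l S) \<in> borel_measurable (Pi\<^sub>M (insert k K) (\<lambda>_. P))" if "l \<in> insert k K" "S \<in> idx" for l S
    unfolding V_def by (rule measurable_sample_vec[OF that])
  have mf: "f \<in> borel_measurable (Pi\<^sub>M (insert k K) (\<lambda>_. P))"
    unfolding f_def qform_def app_def rtrace_def
    by (intro measurable_compose[OF _ measurable_ennreal] borel_measurable_abs borel_measurable_diff borel_measurable_sum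
        borel_measurable_divide borel_measurable_times borel_measurable_const mV measurable_resolvent fin K t) auto
  have inner: "(\<integral>\<^sup>+ x. f (z(k := x)) \<partial>P) \<le> ennreal (real p / real m * sqrt (2 * defect) / t)" for z
  proof -
    have "f (z(k := x)) = ennreal \<bar>qform idx (resolvent idx t K (V z)) (vec_of m x) - (\<Sum>S\<in>idx. resolvent idx t K (V z) S S) / real m\<bar>" for x
    proof -
      have eq: "V (z(k := x)) l i = V z l i" if "l \<in> K" for l i using that K by (auto simp: V_def)
      have "qform idx (resolvent idx t K (V (z(k := x)))) (V (z(k := x)) k) = qform idx (resolvent idx t K (V z)) (vec_of m x)"
        by (rule qform_cong, rule resolvent_cong_vec[OF fin K(1) t]) (auto simp: eq, simp add: V_def)
      moreover have "rtrace idx t K (V (z(k := x))) = rtrace idx t K (V z)"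
        by (rule rtrace_cong_vec[OF fin K(1) t]) (simp add: eq)
      ultimately show ?thesis unfolding f_def by (simp add: rtrace_def)
    qed
    moreover have "(\<integral>\<^sup>+ x. ennreal \<bar>qform idx (resolvent idx t K (V z)) (vec_of m x) - (\<Sum>S\<in>idx. resolvent idx t K (V z) S S) / real m\<bar> \<partial>P)
      \<le> ennreal (real p / real m * sqrt (2 * defect) / t)"
    proof (rule nn_integral_quadratic_form_le[OF t m])
      show "\<bar>resolvent idx t K (V z) S S\<bar> \<le> 1 / t" if "S \<in> idx" for S
        using resolvent_diag_nonneg[OF fin K(1) t that] resolvent_diag_le[OF fin K(1) t that] by simp
      show "(\<Sum>S\<in>idx. \<Sum>T\<in>idx. (resolvent idx t K (V z) S T)\<^sup>2) \<le> real p / t\<^sup>2"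
        using resolvent_frobenius_le[OF fin K(1) t] by (simp add: card_subset_idx)
    qed
    ultimately show ?thesis by simp
  qed
  have "(\<integral>\<^sup>+ z. f z \<partial>Q m) = (\<integral>\<^sup>+ z. (\<integral>\<^sup>+ x. f (z(k := x)) \<partial>P) \<partial>Pi\<^sub>M K (\<lambda>_. P))"
    using product_nn_integral_insert[OF K(1,2) mf] unfolding K(3) .
  also have "\<dots> \<le> (\<integral>\<^sup>+ z. ennreal (real p / real m * sqrt (2 * defect) / t) \<partial>Pi\<^sub>M K (\<lambda>_. P))"
    by (intro nn_integral_mono inner)
  also have "\<dots> = ennreal (real p / real m * sqrt (2 * defect) / t)"
    using prob_space.emeasure_space_1[OF prob_space_PiM[of K "\<lambda>_. P", OF prob_space_P]] by simp
  finally show ?thesis by (simp add: f_def K_def)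
qed

text \<open>\<open>quadratic_form_bound\<close> for the zero matrix reads 0 <= 2 p^2
  \<open>defect\<close>.\<close>

lemma defect_nonneg: "defect \<ge> 0"
proof -
  have "0 \<le> expectation (\<lambda>\<omega>. ((\<Sum>S\<in>idx. y S \<omega> * (\<Sum>T\<in>idx. 0 * y T \<omega>)) - (\<Sum>S\<in>idx. 0))\<^sup>2)" by simp
  also have "\<dots> \<le> 2 * (real p)\<^sup>2 * defect"
    by (rule quadratic_form_bound(2)) auto
  finally show ?thesis using p_pos by (simp add: zero_le_mult_iff)
qed

definition trace_stat :: "nat \<Rightarrow> real \<Rightarrow> (nat \<Rightarrow> nat list \<Rightarrow> real) \<Rightarrow> real" where
  "trace_stat m t x = rtrace idx t {1..m} (\<lambda>k. vec_of m (x k)) / real m"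

lemma measurable_trace_stat:
  assumes "t > 0" shows "trace_stat m t \<in> borel_measurable (Q m)"
  unfolding trace_stat_def rtrace_def
  by (intro borel_measurable_divide borel_measurable_sum measurable_resolvent finite_subset_idx
      measurable_sample_vec borel_measurable_const) (use assms in auto)

lemma trace_stat_bounds:
  assumes "t > 0" shows "0 \<le> trace_stat m t x" "trace_stat m t x \<le> real p / t / real m"
  unfolding trace_stat_def
  using rtrace_nonneg[OF finite_subset_idx _ assms, of "{1..m}" n d] rtrace_le[OF finite_subset_idx _ assms, of "{1..m}" n d]
  by (intro divide_nonneg_nonneg divide_right_mono; simp add: card_subset_idx)+

text \<open>The pointwise estimates \<open>self_consistent\<close> and \<open>MP_tau_stable\<close>
  are averaged over the samples; the mean of the m leave-one-out errors obeys the bound that holds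
  for each of them.\<close>

lemma expectation_trace_stat:
  assumes c: "c > 0" and t: "t > 0" and m: "m \<ge> 1"
  shows "\<bar>(\<integral>z. trace_stat m t z \<partial>Q m) - MP_tau c t\<bar>
    \<le> (real p / real m * sqrt (2 * defect) / t + 1 / (real m * t) + \<bar>real p / real m - c\<bar>) / t"
proof -
  interpret Q: prob_space "Q m" by (intro prob_space_PiM prob_space_P)
  define C where "C = real p / real m * sqrt (2 * defect) / t"
  have C0: "C \<ge> 0" unfolding C_def using t defect_nonneg by (intro divide_nonneg_nonneg mult_nonneg_nonneg) auto
  define V where "V z k = vec_of m (z k)" for z :: "nat \<Rightarrow> nat list \<Rightarrow> real" and k
  define g where "g k z = \<bar>qform idx (resolvent idx t ({1..m} - {k}) (V z)) (V z k)
      - rtrace idx t ({1..m} - {k}) (V z) / real m\<bar>" for k z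
  let ?T = "trace_stat m t"
  let ?\<delta> = "\<bar>real p / real m - c\<bar>"
  have fin: "finite idx" by (rule finite_subset_idx)
  have mV: "(\<lambda>z. V z l S) \<in> borel_measurable (Q m)" if "l \<in> {1..m}" "S \<in> idx" for l S
    unfolding V_def by (rule measurable_sample_vec[OF that])
  have mg: "g k \<in> borel_measurable (Q m)" if "k \<in> {1..m}" for k
    unfolding g_def qform_def app_def rtrace_def using that
    by (intro borel_measurable_abs borel_measurable_diff borel_measurable_sum
        borel_measurable_divide borel_measurable_times borel_measurable_const mV measurable_resolvent fin t) auto
  have g0: "g k z \<ge> 0" for k z by (simp add: g_def)
  have pt: "\<bar>?T z - MP_tau c t\<bar> \<le> ((\<Sum>k=1..m. g k z) / real m + 1 / (real m * t) + ?\<delta>) / t" for z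
  proof -
    have "\<bar>real p / real m - 1 - t * ?T z + 1 / (1 + ?T z)\<bar> \<le> (\<Sum>k=1..m. g k z) / real m + 1 / (real m * t)"
      using self_consistent[OF fin _ _ t, of "{1..m}" "V z"] m
      by (simp add: trace_stat_def g_def V_def[abs_def] card_subset_idx)
    then have "\<bar>real p / real m - 1 - t * ?T z + 1 / (1 + ?T z)\<bar> + ?\<delta> \<le> (\<Sum>k=1..m. g k z) / real m + 1 / (real m * t) + ?\<delta>"
      by simp
    from divide_right_mono[OF this, of t] show ?thesis
      using MP_tau_stable[OF c t trace_stat_bounds(1)[OF t], of m z "real p / real m"] t by linarith
  qed
  have Ti: "integrable (Q m) ?T"
    using trace_stat_bounds[OF t] by (intro Q.integrable_const_bound[where B = "real p / t / real m"] measurable_trace_stat t) auto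
  have nn: "(\<integral>\<^sup>+ z. ennreal ((\<Sum>k=1..m. g k z) / real m) \<partial>Q m) \<le> ennreal C"
  proof -
    have "(\<integral>\<^sup>+ z. ennreal ((\<Sum>k=1..m. g k z) / real m) \<partial>Q m) = (\<integral>\<^sup>+ z. ennreal (1 / real m) * (\<Sum>k=1..m. ennreal (g k z)) \<partial>Q m)"
      by (simp add: sum_ennreal g0 sum_nonneg ennreal_mult'[symmetric])
    also have "\<dots> = ennreal (1 / real m) * (\<Sum>k=1..m. \<integral>\<^sup>+ z. ennreal (g k z) \<partial>Q m)"
      using mg by (subst nn_integral_cmult, intro borel_measurable_sum measurable_compose[OF _ measurable_ennreal], simp)
        (subst nn_integral_sum, auto intro!: measurable_compose[OF _ measurable_ennreal])
    also have "\<dots> \<le> ennreal (1 / real m) * (\<Sum>k=1..m. ennreal C)"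
      using nn_integral_leave_one_out_le[OF t m] unfolding g_def V_def C_def by (intro mult_left_mono sum_mono) auto
    also have "\<dots> = ennreal (1 / real m * (\<Sum>k=1..m. C))"
      using C0 by (subst sum_ennreal) (auto simp: ennreal_mult'[symmetric])
    also have "1 / real m * (\<Sum>k=1..m. C) = C" using m by simp
    finally show ?thesis .
  qed
  have hi: "integrable (Q m) (\<lambda>z. (\<Sum>k=1..m. g k z) / real m)"
    using nn mg g0 by (intro integrableI_nonneg borel_measurable_divide borel_measurable_sum AE_I2 divide_nonneg_nonneg sum_nonneg)
      (auto simp: less_top[symmetric] top_unique)
  have hC: "(\<integral>z. (\<Sum>k=1..m. g k z) / real m \<partial>Q m) \<le> C"
    using nn nn_integral_eq_integral[OF hi] g0 C0 by (simp add: sum_nonneg)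
  have "\<bar>(\<integral>z. ?T z \<partial>Q m) - MP_tau c t\<bar> = \<bar>\<integral>z. ?T z - MP_tau c t \<partial>Q m\<bar>"
    using Ti by (simp add: Q.prob_space del: One_nat_def)
  also have "\<dots> \<le> (\<integral>z. \<bar>?T z - MP_tau c t\<bar> \<partial>Q m)" by (rule integral_abs_bound)
  also have "\<dots> \<le> (\<integral>z. ((\<Sum>k=1..m. g k z) / real m + 1 / (real m * t) + ?\<delta>) / t \<partial>Q m)"
    using Ti hi by (intro integral_mono pt integrable_divide integrable_add integrable_abs integrable_diff) (auto simp del: One_nat_def)
  also have "\<dots> = ((\<integral>z. (\<Sum>k=1..m. g k z) / real m \<partial>Q m) + 1 / (real m * t) + ?\<delta>) / t"
    using hi by (simp add: Q.prob_space del: One_nat_def integral_divide_zero)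
  also have "\<dots> \<le> (C + 1 / (real m * t) + ?\<delta>) / t"
    using hC t by (intro divide_right_mono add_right_mono) auto
  finally show ?thesis by (simp add: C_def)
qed

text \<open>By \<open>small\<close> the expectation is within e / 2 of the limit, so a deviation of
  e forces one of e / 2 from the expectation. With m coordinates and differences 1 / (m t) the
  exponent in McDiarmid's inequality is (e / 2)^2 m t^2 / 2.\<close>

lemma trace_stat_concentration:
  assumes c: "c > 0" and t: "t > 0" and m: "m \<ge> 1" and e: "e > 0"
    and small: "(real p / real m * sqrt (2 * defect) / t + 1 / (real m * t) + \<bar>real p / real m - c\<bar>) / t \<le> e / 2"
  shows "measure (Q m) {z \<in> space (Q m). \<bar>trace_stat m t z - MP_tau c t\<bar> \<ge> e} \<le> 2 * exp (- (e\<^sup>2 * t\<^sup>2 / 8) * real m)"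
proof -
  interpret Q: prob_space "Q m" by (intro prob_space_PiM prob_space_P)
  let ?T = "trace_stat m t" and ?E = "\<integral>z. trace_stat m t z \<partial>Q m"
  have fin: "finite idx" by (rule finite_subset_idx)
  have m0: "real m > 0" using m by simp
  have E: "\<bar>?E - MP_tau c t\<bar> \<le> e / 2" using expectation_trace_stat[OF c t m] small by linarith
  have mT: "?T \<in> borel_measurable (Q m)" by (rule measurable_trace_stat[OF t])
  have "measure (Q m) {z \<in> space (Q m). \<bar>?T z - MP_tau c t\<bar> \<ge> e} \<le> measure (Q m) {z \<in> space (Q m). \<bar>?T z - ?E\<bar> \<ge> e / 2}"
  proof (rule Q.finite_measure_mono)
    show "{z \<in> space (Q m). \<bar>?T z - MP_tau c t\<bar> \<ge> e} \<subseteq> {z \<in> space (Q m). \<bar>?T z - ?E\<bar> \<ge> e / 2}"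
    proof safe
      fix z assume "e \<le> \<bar>?T z - MP_tau c t\<bar>"
      with E show "e / 2 \<le> \<bar>?T z - ?E\<bar>" by (auto simp: abs_if field_simps split: if_splits)
    qed
    show "{z \<in> space (Q m). \<bar>?T z - ?E\<bar> \<ge> e / 2} \<in> sets (Q m)" using mT by measurable
  qed
  also have "\<dots> \<le> 2 * exp (- (e / 2)\<^sup>2 / (2 * real (card {1..m}) * (1 / (real m * t))\<^sup>2))"
  proof (rule mcdiarmid[OF prob_space_P _ _ _ _ mT])
    show "\<bar>?T z\<bar> \<le> real p / t / real m" for z using trace_stat_bounds[OF t, of m z] by simp
    fix z k x assume k: "k \<in> {1..m}"
    define K where "K = {1..m} - {k}"
    have K: "finite K" "k \<notin> K" "{1..m} = insert k K" using k by (auto simp: K_def)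
    \<comment> \<open>Both traces lie within 1 / t below the trace without sample k, which the
      replacement leaves unchanged; so they differ by at most 1 / t, not 2 / t.\<close>
    have ins: "\<exists>s. ?T z' = s / real m \<and> rtrace idx t K (\<lambda>k. vec_of m (z' k)) - 1 / t \<le> s \<and> s \<le> rtrace idx t K (\<lambda>k. vec_of m (z' k))" for z'
      using rtrace_insert[OF fin K(1) t K(2), of "\<lambda>k. vec_of m (z' k)"] unfolding trace_stat_def K(3)
      by (intro exI[of _ "rtrace idx t (insert k K) (\<lambda>k. vec_of m (z' k))"]) auto
    have "rtrace idx t K (\<lambda>l. vec_of m ((z(k := x)) l)) = rtrace idx t K (\<lambda>k. vec_of m (z k))"
      using K by (intro rtrace_cong_vec[OF fin K(1) t]) auto
    then obtain s s' where s: "?T z = s / real m" "?T (z(k := x)) = s' / real m" "\<bar>s - s'\<bar> \<le> 1 / t"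
      using ins[of z] ins[of "z(k := x)"] by (auto simp: abs_le_iff) (smt (verit))
    have "\<bar>?T z - ?T (z(k := x))\<bar> = \<bar>s - s'\<bar> / real m" unfolding s(1,2) diff_divide_distrib[symmetric] by simp
    also have "\<dots> \<le> 1 / t / real m" by (rule divide_right_mono[OF s(3)]) simp
    finally show "\<bar>?T z - ?T (z(k := x))\<bar> \<le> 1 / (real m * t)" by (simp add: mult.commute)
  qed (use m e t in auto)
  also have "- (e / 2)\<^sup>2 / (2 * real (card {1..m}) * (1 / (real m * t))\<^sup>2) = - (e\<^sup>2 * t\<^sup>2 / 8) * real m"
    using m0 t by (simp add: power2_eq_square field_simps)
  finally show ?thesis .
qed

end

section \<open>Almost sure convergence\<close>

text \<open>The concentration bounds live on the product space of copies of the law; this carries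
  them over to samples given on an abstract space.\<close>

lemma (in prob_space) distr_iid_eq_PiM:
  assumes "indep_vars (\<lambda>_. L) x K" "K \<noteq> {}" "finite K" "\<And>k. k \<in> K \<Longrightarrow> distr M L (x k) = P" "sets P = sets L"
  shows "distr M (Pi\<^sub>M K (\<lambda>_. P)) (\<lambda>\<omega>. \<lambda>k\<in>K. x k \<omega>) = Pi\<^sub>M K (\<lambda>_. P)"
proof -
  have rv: "x k \<in> measurable M L" if "k \<in> K" for k using assms(1) that unfolding indep_vars_def by auto
  have "distr M (Pi\<^sub>M K (\<lambda>_. P)) (\<lambda>\<omega>. \<lambda>k\<in>K. x k \<omega>) = distr M (Pi\<^sub>M K (\<lambda>_. L)) (\<lambda>\<omega>. \<lambda>k\<in>K. x k \<omega>)"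
    by (intro distr_cong refl sets_PiM_cong assms(5))
  also have "\<dots> = Pi\<^sub>M K (\<lambda>k. distr M L (x k))"
    using indep_vars_iff_distr_eq_PiM'[OF assms(2), where M' = "\<lambda>_. L" and X = x] rv assms(1) by simp
  also have "\<dots> = Pi\<^sub>M K (\<lambda>_. P)" by (intro PiM_cong refl assms(4))
  finally show ?thesis .
qed

lemma LIMSEQ_of_eventually_lt:
  fixes f :: "nat \<Rightarrow> real"
  assumes "\<And>i. \<forall>\<^sub>F n in sequentially. \<bar>f n - l\<bar> < inverse (real (Suc i))"
  shows "f \<longlonglongrightarrow> l"
proof (rule tendstoI)
  fix e :: real assume "e > 0"
  then obtain i where "inverse (real (Suc i)) < e" using reals_Archimedean by blast
  with assms[of i] show "\<forall>\<^sub>F n in sequentially. dist (f n) l < e"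
    by (elim eventually_mono) (simp add: dist_real_def)
qed

text \<open>As 1 <= d <= n / 4, the binomial n choose d is at least n, so m grows at least linearly,
  which makes tails exponential in m summable over n. A sample size of 0 is excluded by the limit,
  as the quotient would then be 0.\<close>

lemma eventually_sample_size:
  assumes c: "c > 0" "(\<lambda>n. real (n choose d n) / real (m n)) \<longlonglongrightarrow> c"
    and d: "\<forall>\<^sub>F n in sequentially. d n \<ge> 1 \<and> 4 * d n \<le> n"
  shows "\<forall>\<^sub>F n in sequentially. m n \<ge> 1 \<and> real n / (2 * c) \<le> real (m n)"
proof -
  have "\<forall>\<^sub>F n in sequentially. real (n choose d n) / real (m n) > c / 2"
    using c by (intro order_tendstoD(1)[OF c(2)]) auto
  moreover have "\<forall>\<^sub>F n in sequentially. real (n choose d n) / real (m n) < 2 * c"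
    using c by (intro order_tendstoD(2)[OF c(2)]) auto
  ultimately show ?thesis using d
  proof eventually_elim
    case (elim n)
    have m: "m n \<ge> 1" using elim(1) c(1) by (cases "m n = 0") auto
    have "n choose 1 \<le> n choose d n" using elim(3) by (intro binomial_mono) auto
    then have "real n \<le> real (n choose d n)" by simp
    also have "\<dots> \<le> 2 * c * real (m n)" using elim(2) m by (simp add: field_simps)
    finally show ?case using m c(1) by (simp add: field_simps)
  qed
qed

text \<open>The samples for different n may be coupled in any way, since the first Borel--Cantelli
  lemma does not ask for independence. The error of the expectation is at most \<open>B n\<close>,
  which tends to 0 at an unknown rate but has only to fall below e / 2, while the tails are
  geometric in n.\<close>

lemma trace_AE_tendsto:
  fixes M :: "'a measure" and N :: "nat \<Rightarrow> 'b measure" and d m :: "nat \<Rightarrow> nat"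
    and x :: "nat \<Rightarrow> nat \<Rightarrow> 'a \<Rightarrow> nat list \<Rightarrow> real"
  assumes pv: "\<forall>\<^sub>F n in sequentially. power_vector (N n) n (d n) (X n)"
    and defect: "(\<lambda>n. power_vector.defect (N n) n (d n) (X n)) \<longlonglongrightarrow> 0"
    and c: "c > 0" "(\<lambda>n. real (n choose d n) / real (m n)) \<longlonglongrightarrow> c"
    and M: "prob_space M"
    and indep: "\<And>n. n \<ge> 1 \<Longrightarrow>
      prob_space.indep_vars M (\<lambda>_. Rnd n (d n)) (\<lambda>k. x n k) {1..m n}"
    and law: "\<And>n k. n \<ge> 1 \<Longrightarrow> k \<in> {1..m n} \<Longrightarrow>
      distr M (Rnd n (d n)) (x n k) = PowerT (N n) n (d n) (X n)"
    and t: "t > 0"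
  shows "AE \<omega> in M. (\<lambda>n. rtrace (subset_idx n (d n)) t {1..m n} (\<lambda>k. vec_of (m n) (x n k \<omega>)) / real (m n))
    \<longlonglongrightarrow> MP_tau c t"
proof -
  interpret M: prob_space M by fact
  define T where "T n \<omega> = rtrace (subset_idx n (d n)) t {1..m n} (\<lambda>k. vec_of (m n) (x n k \<omega>)) / real (m n)" for n \<omega>
  define B where "B n = (real (n choose d n) / real (m n) * sqrt (2 * power_vector.defect (N n) n (d n) (X n)) / t
    + 1 / (real (m n) * t) + \<bar>real (n choose d n) / real (m n) - c\<bar>) / t" for n
  have dn: "\<forall>\<^sub>F n in sequentially. d n \<ge> 1 \<and> 4 * d n \<le> n"
    using pv by eventually_elim (auto simp: power_vector_def power_vector_axioms_def)
  note size = eventually_sample_size[OF c dn]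
  have "filterlim (\<lambda>n. real (m n)) at_top sequentially"
  proof (rule filterlim_at_top_mono)
    show "filterlim (\<lambda>n. real n / (2 * c)) at_top sequentially"
      unfolding divide_inverse using c(1)
      by (intro filterlim_at_top_mult_tendsto_pos[OF tendsto_const] filterlim_real_sequentially) simp
    show "\<forall>\<^sub>F n in sequentially. real n / (2 * c) \<le> real (m n)" using size by eventually_elim simp
  qed
  then have h1: "(\<lambda>n. 1 / (real (m n) * t)) \<longlonglongrightarrow> 0"
    using t by (intro tendsto_divide_0[OF tendsto_const] filterlim_at_top_imp_at_infinity
        filterlim_at_top_mult_tendsto_pos[OF tendsto_const]) auto
  have h2: "(\<lambda>n. real (n choose d n) / real (m n) * sqrt (2 * power_vector.defect (N n) n (d n) (X n)) / t)
      \<longlonglongrightarrow> c * sqrt (2 * 0) / t"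
    using t by (intro tendsto_intros c(2) defect) auto
  have h3: "(\<lambda>n. \<bar>real (n choose d n) / real (m n) - c\<bar>) \<longlonglongrightarrow> \<bar>c - c\<bar>"
    by (intro tendsto_intros c(2))
  have "B \<longlonglongrightarrow> (c * sqrt (2 * 0) / t + 0 + \<bar>c - c\<bar>) / t"
    unfolding B_def using tendsto_divide[OF tendsto_add[OF tendsto_add[OF h2 h1] h3] tendsto_const[of t]] t by simp
  then have B: "B \<longlonglongrightarrow> 0" by simp
  have main: "AE \<omega> in M. \<forall>\<^sub>F n in sequentially. \<bar>T n \<omega> - MP_tau c t\<bar> < e" if e: "e > 0" for e
  proof -
    define good where "good n \<longleftrightarrow> n \<ge> 1 \<and> power_vector (N n) n (d n) (X n) \<and> m n \<ge> 1
      \<and> real n / (2 * c) \<le> real (m n) \<and> B n \<le> e / 2" for n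
    have good: "\<forall>\<^sub>F n in sequentially. good n"
    proof -
      have "\<forall>\<^sub>F n in sequentially. B n < e / 2" using order_tendstoD(2)[OF B, of "e / 2"] e by simp
      with pv size eventually_ge_at_top[of 1] show ?thesis by eventually_elim (auto simp: good_def)
    qed
    \<comment> \<open>Empty for the finitely many n at which some estimate is not yet valid, so that
      the tail bound holds for every n.\<close>
    define A where "A n = (if good n then {\<omega> \<in> space M. \<bar>T n \<omega> - MP_tau c t\<bar> \<ge> e} else {})" for n
    define r where "r = exp (- (e\<^sup>2 * t\<^sup>2 / 8) / (2 * c))"
    have r: "0 \<le> r" "r < 1" unfolding r_def using e t c(1) by auto
    have A: "A n \<in> sets M \<and> measure M (A n) \<le> 2 * r ^ n" for n
    proof (cases "good n")
      case False
      then show ?thesis using r by (simp add: A_def)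
    next
      case True
      then have g: "n \<ge> 1" "power_vector (N n) n (d n) (X n)" "m n \<ge> 1" "real n / (2 * c) \<le> real (m n)" "B n \<le> e / 2"
        by (auto simp: good_def)
      interpret power_vector "N n" n "d n" "X n" by (rule g(2))
      define x' where "x' \<omega> = (\<lambda>k\<in>{1..m n}. x n k \<omega>)" for \<omega>
      have D: "distr M (Q (m n)) x' = Q (m n)"
        unfolding x'_def using M.distr_iid_eq_PiM[OF indep[OF g(1)] _ _ law[OF g(1)]] g(3) by simp
      have x'm: "x' \<in> measurable M (Q (m n))"
      proof -
        have "x n k \<in> measurable M P" if "k \<in> {1..m n}" for k
          using indep[OF g(1)] that unfolding M.indep_vars_def by (auto cong: measurable_cong_sets)
        then show ?thesis unfolding x'_def by (intro measurable_restrict)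
      qed
      have eq: "trace_stat (m n) t (x' \<omega>) = T n \<omega>" for \<omega>
        unfolding trace_stat_def T_def x'_def
        by (rule arg_cong2[where f = "(/)", OF rtrace_cong_vec[OF finite_subset_idx _ t] refl]) auto
      define Z where "Z = {z \<in> space (Q (m n)). \<bar>trace_stat (m n) t z - MP_tau c t\<bar> \<ge> e}"
      have Zm: "Z \<in> sets (Q (m n))"
        using measurable_trace_stat[OF t, of "m n"] unfolding Z_def by measurable
      have An: "A n = x' -` Z \<inter> space M"
        using measurable_space[OF x'm] True by (auto simp: A_def Z_def eq)
      have "measure M (A n) = measure (Q (m n)) Z"
        using measure_distr[OF x'm Zm] unfolding D An ..
      also have "\<dots> \<le> 2 * exp (- (e\<^sup>2 * t\<^sup>2 / 8) * real (m n))"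
        unfolding Z_def using g(5) by (intro trace_stat_concentration[OF c(1) t g(3) e]) (simp add: B_def)
      also have "\<dots> \<le> 2 * exp (- (e\<^sup>2 * t\<^sup>2 / 8) * (real n / (2 * c)))"
      proof -
        have "(e\<^sup>2 * t\<^sup>2 / 8) * (real n / (2 * c)) \<le> (e\<^sup>2 * t\<^sup>2 / 8) * real (m n)"
          using g(4) by (intro mult_left_mono) auto
        then show ?thesis by simp
      qed
      also have "- (e\<^sup>2 * t\<^sup>2 / 8) * (real n / (2 * c)) = real n * (- (e\<^sup>2 * t\<^sup>2 / 8) / (2 * c))" by simp
      also have "exp \<dots> = r ^ n" unfolding r_def by (rule exp_of_nat_mult)
      finally show ?thesis using measurable_sets[OF x'm Zm] An by simp
    qed
    have "AE \<omega> in M. \<forall>\<^sub>F n in sequentially. \<omega> \<in> space M - A n"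
    proof (rule borel_cantelli_AE1)
      show "summable (\<lambda>n. measure M (A n))"
      proof (rule summable_comparison_test')
        show "summable (\<lambda>n. 2 * r ^ n)" using r by (intro summable_mult summable_geometric) simp
        show "norm (measure M (A n)) \<le> 2 * r ^ n" if "0 \<le> n" for n using A[of n] by (simp only: real_norm_def abs_of_nonneg measure_nonneg)
      qed
    qed (use A in \<open>auto simp: M.emeasure_eq_measure\<close>)
    then show ?thesis
    proof eventually_elim
      case (elim \<omega>)
      then show ?case using good by eventually_elim (auto simp: A_def not_le)
    qed
  qed
  have "AE \<omega> in M. \<forall>i. \<forall>\<^sub>F n in sequentially. \<bar>T n \<omega> - MP_tau c t\<bar> < inverse (real (Suc i))"
    unfolding AE_all_countable by (intro allI main) simp
  then show ?thesis unfolding T_def[symmetric] by eventually_elim (rule LIMSEQ_of_eventually_lt, blast)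
qed

section \<open>From the trace to the spectral law\<close>

lemma PowerT_AE_sorted:
  assumes X: "X \<in> measurable N (Rn n)" and x: "x \<in> measurable M (Rnd n d)"
    and law: "distr M (Rnd n d) x = PowerT N n d X"
  shows "AE \<omega> in M. \<forall>i\<in>multi_idx n d. x \<omega> i = x \<omega> (sort i)"
proof (rule AE_finite_allI[OF finite_multi_idx])
  fix i assume i: "i \<in> multi_idx n d"
  then have s: "sort i \<in> multi_idx n d" by (simp add: multi_idx_def)
  have [measurable]: "(\<lambda>y. y i) \<in> borel_measurable (Rnd n d)" "(\<lambda>y. y (sort i)) \<in> borel_measurable (Rnd n d)"
    using i s by (auto intro: measurable_component_singleton)
  have len: "length i = d" using i by (simp add: multi_idx_def)
  \<comment> \<open>Only the law of the samples is given, so the symmetry under rearrangement of i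
    holds almost surely and is transported through the law.\<close>
  have "AE y in PowerT N n d X. y i = y (sort i)"
    unfolding PowerT_def
  proof (subst AE_distr_iff[OF measurable_power_prod[OF X]])
    show "{y \<in> space (Rnd n d). y i = y (sort i)} \<in> sets (Rnd n d)" by measurable
    have "(\<Prod>j=1..d. X \<omega> (i ! (j - 1))) = (\<Prod>j=1..d. X \<omega> (sort i ! (j - 1)))" for \<omega>
      using prod_nth_eq_prod_mset[of "X \<omega>" i] prod_nth_eq_prod_mset[of "X \<omega>" "sort i"] len by simp
    then show "AE \<omega> in N. (\<lambda>i\<in>multi_idx n d. \<Prod>j=1..d. X \<omega> (i ! (j - 1))) i = (\<lambda>i\<in>multi_idx n d. \<Prod>j=1..d. X \<omega> (i ! (j - 1))) (sort i)"
      using i s by simp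
  qed
  then show "AE \<omega> in M. x \<omega> i = x \<omega> (sort i)"
    unfolding law[symmetric] by (rule AE_distrD[OF x])
qed

text \<open>d! times the numerator is at least (1 - d^2 / n) n^d by the birthday bound, and d! times
  the denominator is at most (n + d)^d. Bernoulli's inequality bounds (n / (n + d))^d below by 1 -
  d^2 / n once more, hence the square.\<close>

lemma binomial_ratio_ge:
  assumes n: "n \<ge> 1" and d: "d \<ge> 1" "d \<le> n" and d2: "(real d)\<^sup>2 / real n \<le> 1"
  shows "(1 - (real d)\<^sup>2 / real n)\<^sup>2 \<le> real (n choose d) / real ((n + d - 1) choose d)"
proof -
  let ?N = "(n + d - 1) choose d"
  have N: "real ?N > 0" using n d by (simp add: zero_less_binomial_iff)
  let ?a = "1 - (real d)\<^sup>2 / real n"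
  have "fact d * real ?N \<le> real (n + d - 1) ^ d"
    using binomial_fact_pow[of "n + d - 1" d] by (metis mult.commute of_nat_fact of_nat_le_iff of_nat_mult of_nat_power)
  also have "\<dots> \<le> real (n + d) ^ d" by (intro power_mono) auto
  finally have up: "fact d * real ?N \<le> real (n + d) ^ d" .
  have bern: "?a \<le> (real n / real (n + d)) ^ d"
  proof -
    have "real d * real d / real (n + d) \<le> (real d)\<^sup>2 / real n"
      using n by (simp add: power2_eq_square frac_le)
    then have "?a \<le> 1 + real d * (- (real d / real (n + d)))" by simp
    also have "\<dots> \<le> (1 + - (real d / real (n + d))) ^ d"
      using n by (intro Bernoulli_inequality) (simp add: field_simps)
    also have "1 + - (real d / real (n + d)) = real n / real (n + d)" using n by (simp add: field_simps)
    finally show ?thesis .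
  qed
  have "?a\<^sup>2 * real ?N = ?a * ?a * real ?N" by (simp add: power2_eq_square)
  also have "\<dots> \<le> (fact d * real (n choose d) / real n ^ d) * (real n / real (n + d)) ^ d * real ?N"
    using fact_binomial_ge[OF n d(2)] bern d2 by (intro mult_mono mult_right_mono) auto
  also have "\<dots> = real (n choose d) * (fact d * real ?N / real (n + d) ^ d)"
    using n by (simp add: power_divide)
  also have "\<dots> \<le> real (n choose d) * 1"
    using up n by (intro mult_left_mono) (auto simp: divide_le_eq)
  finally show ?thesis using N by (simp add: le_divide_eq)
qed

lemma empirical_dist_props:
  fixes g :: "real \<Rightarrow> real"
  assumes N: "N \<ge> 1"
  shows "real_distribution (empirical_dist N f)"
    "(\<And>j. j \<in> {1..N} \<Longrightarrow> f j \<ge> 0) \<Longrightarrow> AE x in empirical_dist N f. 0 \<le> x"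
    "g \<in> borel_measurable borel \<Longrightarrow> (\<integral>x. g x \<partial>empirical_dist N f) = (\<Sum>j=1..N. g (f j)) / real N"
proof -
  let ?U = "uniform_count_measure {1..N}"
  have f: "f \<in> borel_measurable ?U"
    by (simp add: measurable_def sets_uniform_count_measure space_uniform_count_measure)
  interpret U: prob_space ?U using N by (intro prob_space_uniform_count_measure) auto
  show "real_distribution (empirical_dist N f)"
    unfolding empirical_dist_def by (rule U.real_distribution_distr[OF f])
  show "AE x in empirical_dist N f. 0 \<le> x" if "\<And>j. j \<in> {1..N} \<Longrightarrow> f j \<ge> 0"
    unfolding empirical_dist_def using that
    by (subst AE_distr_iff[OF f]) (auto intro!: AE_I2 simp: space_uniform_count_measure)
  show "(\<integral>x. g x \<partial>empirical_dist N f) = (\<Sum>j=1..N. g (f j)) / real N" if "g \<in> borel_measurable borel"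
    unfolding empirical_dist_def by (subst integral_distr[OF f that]) (simp add: integral_uniform_count_measure)
qed

text \<open>The hypotheses concern n >= 1; the shift avoids n = 0, where the empirical distribution
  need not be a probability measure.\<close>

lemma weak_conv_m_Suc: "weak_conv_m (\<lambda>n. \<mu> (Suc n)) \<nu> \<Longrightarrow> weak_conv_m \<mu> \<nu>"
  unfolding weak_conv_m_def weak_conv_def by (auto intro: LIMSEQ_imp_Suc)

text \<open>Randomness enters through two almost sure events: the symmetry of all samples, and the
  convergence of the traces at the countably many points \<theta> j. For a fixed outcome in both,
  \<open>sample_cov_stieltjes\<close> sandwiches the Stieltjes transform with a gap (1 - p / D) /
  \<theta> j, and p / D tends to 1 because d^2 / n tends to 0.\<close>

lemma Marchenko_Pastur_power_vectors:
  fixes M :: "'a measure" and N :: "nat \<Rightarrow> 'b measure" and X :: "nat \<Rightarrow> 'b \<Rightarrow> nat \<Rightarrow> real" and d m :: "nat \<Rightarrow> nat"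
    and x :: "nat \<Rightarrow> nat \<Rightarrow> 'a \<Rightarrow> nat list \<Rightarrow> real"
  assumes d_pos: "\<And>n. n \<ge> 1 \<Longrightarrow> d n \<ge> 1"
    and X: "\<And>n. n \<ge> 1 \<Longrightarrow> X n \<in> measurable (N n) (Rn n)"
    and d2: "(\<lambda>n. (real (d n))\<^sup>2 / real n) \<longlonglongrightarrow> 0"
    and pv: "\<forall>\<^sub>F n in sequentially. power_vector (N n) n (d n) (X n)"
    and defect: "(\<lambda>n. power_vector.defect (N n) n (d n) (X n)) \<longlonglongrightarrow> 0"
    and c: "c > 0" "(\<lambda>n. real (n choose d n) / real (m n)) \<longlonglongrightarrow> c"
    and M: "prob_space M"
    and indep: "\<And>n. n \<ge> 1 \<Longrightarrow>
      prob_space.indep_vars M (\<lambda>_. Rnd n (d n)) (\<lambda>k. x n k) {1..m n}"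
    and law: "\<And>n k. n \<ge> 1 \<Longrightarrow> k \<in> {1..m n} \<Longrightarrow>
      distr M (Rnd n (d n)) (x n k) = PowerT (N n) n (d n) (X n)"
  shows "AE \<omega> in M.
    weak_conv_m
      (\<lambda>n. empirical_dist ((n + d n - 1) choose d n)
             (\<lambda>j. eigval (sample_cov n (d n) (m n) (\<lambda>k. x n k \<omega>)) j / fact (d n)))
      (MP_law c)"
proof -
  interpret M: prob_space M by fact
  define p D where "p n = real (n choose d n)" and "D n = (n + d n - 1) choose d n" for n
  define tr where "tr t n \<omega> = rtrace (subset_idx n (d n)) t {1..m n} (\<lambda>k. vec_of (m n) (x n k \<omega>))" for t n \<omega>
  \<comment> \<open>The points at which \<open>weak_conv_stieltjes\<close> asks for
    convergence.\<close>
  define \<theta> where "\<theta> j = 1 - 1 / (real j + 2)" for j :: nat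
  have \<theta>: "\<theta> j > 0" for j by (simp add: \<theta>_def)
  have D1: "D n \<ge> 1" if "n \<ge> 1" for n using that d_pos[OF that] by (simp add: D_def Suc_le_eq zero_less_binomial_iff)
  have dn: "\<forall>\<^sub>F n in sequentially. d n \<ge> 1 \<and> 4 * d n \<le> n"
    using pv by eventually_elim (auto simp: power_vector_def power_vector_axioms_def)
  note size = eventually_sample_size[OF c dn]
  have pD: "(\<lambda>n. p n / real (D n)) \<longlonglongrightarrow> 1"
  proof (rule tendsto_sandwich)
    have "(\<lambda>n. (1 - (real (d n))\<^sup>2 / real n)\<^sup>2) \<longlonglongrightarrow> (1 - 0)\<^sup>2" by (intro tendsto_intros d2)
    then show "(\<lambda>n. (1 - (real (d n))\<^sup>2 / real n)\<^sup>2) \<longlonglongrightarrow> 1" by simp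
    have "\<forall>\<^sub>F n in sequentially. (real (d n))\<^sup>2 / real n < 1" by (rule order_tendstoD(2)[OF d2]) simp
    then show "\<forall>\<^sub>F n in sequentially. (1 - (real (d n))\<^sup>2 / real n)\<^sup>2 \<le> p n / real (D n)"
      using dn eventually_ge_at_top[of 1]
      unfolding p_def D_def by eventually_elim (rule binomial_ratio_ge, auto)
    show "\<forall>\<^sub>F n in sequentially. p n / real (D n) \<le> 1"
      using eventually_ge_at_top[of 1]
    proof eventually_elim
      case (elim n)
      have "n choose d n \<le> D n" unfolding D_def using d_pos[OF elim] by (intro binomial_right_mono) simp
      then show ?case using D1[OF elim] by (simp add: p_def)
    qed
  qed (rule tendsto_const)
  have symm: "AE \<omega> in M. \<forall>n\<in>{1..}. \<forall>k\<in>{1..m n}. \<forall>i\<in>multi_idx n (d n). x n k \<omega> i = x n k \<omega> (sort i)"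
  proof (subst AE_ball_countable; (intro ballI)?)
    fix n :: nat assume n: "n \<in> {1..}"
    show "AE \<omega> in M. \<forall>k\<in>{1..m n}. \<forall>i\<in>multi_idx n (d n). x n k \<omega> i = x n k \<omega> (sort i)"
    proof (rule AE_finite_allI)
      fix k assume k: "k \<in> {1..m n}"
      have "x n k \<in> measurable M (Rnd n (d n))"
        using indep[of n] n k unfolding M.indep_vars_def by auto
      then show "AE \<omega> in M. \<forall>i\<in>multi_idx n (d n). x n k \<omega> i = x n k \<omega> (sort i)"
        using n by (intro PowerT_AE_sorted[OF X _ law] k) auto
    qed simp
  qed simp
  have "AE \<omega> in M. \<forall>j. (\<lambda>n. tr (\<theta> j) n \<omega> / real (m n)) \<longlonglongrightarrow> MP_tau c (\<theta> j)"
    unfolding AE_all_countable tr_def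
    by (intro allI trace_AE_tendsto[OF pv defect c M indep law \<theta>])
  with symm show ?thesis
  proof eventually_elim
    case (elim \<omega>)
    define lam where "lam n j = eigval (sample_cov n (d n) (m n) (\<lambda>k. x n k \<omega>)) j / fact (d n)" for n j
    define \<mu> where "\<mu> n = empirical_dist (D n) (lam n)" for n
    note sc = sample_cov_stieltjes[where x = "\<lambda>k. x n k \<omega>" and n = n and m = "m n" and d = "d n" for n,
        folded D_def lam_def]
    have sy: "x n k \<omega> i = x n k \<omega> (sort i)" if "n \<ge> 1" "k \<in> {1..m n}" "i \<in> multi_idx n (d n)" for n k i
      using elim(1) that by auto
    have lam0: "lam n j \<ge> 0" if "n \<ge> 1" "j \<in> {1..D n}" for n j
      using sc(3)[OF that(1) d_pos[OF that(1)] sy[OF that(1)] that(2)] .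
    have lim: "(\<lambda>n. (\<Sum>i=1..D n. 1 / (lam n i + \<theta> j)) / real (D n)) \<longlonglongrightarrow> MP_tau c (\<theta> j) / c" for j
    proof -
      define a where "a n = tr (\<theta> j) n \<omega> / real (D n)" for n
      \<comment> \<open>The trace was normalised by m and is now wanted over D: tr / D = (tr / m) (p
        / D) / (p / m), with limits \<open>MP_tau\<close>, 1 and c of the three factors.\<close>
      have "(\<lambda>n. tr (\<theta> j) n \<omega> / real (m n) * (p n / real (D n)) / (p n / real (m n))) \<longlonglongrightarrow> MP_tau c (\<theta> j) * 1 / c"
        using c(1) elim(2) unfolding p_def[symmetric]
        by (intro tendsto_divide tendsto_mult pD c(2)[folded p_def]) auto
      moreover have "\<forall>\<^sub>F n in sequentially. tr (\<theta> j) n \<omega> / real (m n) * (p n / real (D n)) / (p n / real (m n)) = a n"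
        using size dn
      proof eventually_elim
        case (elim n)
        then have "p n > 0" by (simp add: p_def zero_less_binomial_iff)
        then show ?case using elim by (simp add: a_def field_simps)
      qed
      ultimately have a: "a \<longlonglongrightarrow> MP_tau c (\<theta> j) / c"
        by (simp add: Lim_transform_eventually)
      show ?thesis
      proof (rule tendsto_sandwich)
        show "a \<longlonglongrightarrow> MP_tau c (\<theta> j) / c" by (rule a)
        have "(\<lambda>n. a n + (1 - p n / real (D n)) / \<theta> j) \<longlonglongrightarrow> MP_tau c (\<theta> j) / c + (1 - 1) / \<theta> j"
          using \<theta>[of j] by (intro tendsto_intros a pD) auto
        then show "(\<lambda>n. a n + (1 - p n / real (D n)) / \<theta> j) \<longlonglongrightarrow> MP_tau c (\<theta> j) / c" by simp
        show "\<forall>\<^sub>F n in sequentially. a n \<le> (\<Sum>i=1..D n. 1 / (lam n i + \<theta> j)) / real (D n)"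
          using eventually_ge_at_top[of 1]
        proof eventually_elim
          case (elim n)
          show ?case unfolding a_def tr_def vec_of_def[abs_def]
            using sc(4)[OF elim d_pos[OF elim] sy[OF elim] \<theta>[of j]] by (intro divide_right_mono) auto
        qed
        show "\<forall>\<^sub>F n in sequentially. (\<Sum>i=1..D n. 1 / (lam n i + \<theta> j)) / real (D n) \<le> a n + (1 - p n / real (D n)) / \<theta> j"
          using eventually_ge_at_top[of 1]
        proof eventually_elim
          case (elim n)
          have "(\<Sum>i=1..D n. 1 / (lam n i + \<theta> j)) / real (D n) \<le> (tr (\<theta> j) n \<omega> + (real (D n) - p n) / \<theta> j) / real (D n)"
            unfolding tr_def p_def vec_of_def[abs_def]
            using sc(5)[OF elim d_pos[OF elim] sy[OF elim] \<theta>[of j]] by (intro divide_right_mono) auto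
          also have "\<dots> = a n + (1 - p n / real (D n)) / \<theta> j"
            using D1[OF elim] \<theta>[of j] by (simp add: a_def add_divide_distrib diff_divide_distrib)
          finally show ?case .
        qed
      qed
    qed
    have "weak_conv_m (\<lambda>n. \<mu> (Suc n)) (MP_law c)"
    proof (rule weak_conv_stieltjes)
      show "real_distribution (\<mu> (Suc n))" for n
        unfolding \<mu>_def by (rule empirical_dist_props(1)) (rule D1, simp)
      show "AE x in \<mu> (Suc n). 0 \<le> x" for n
        unfolding \<mu>_def by (rule empirical_dist_props(2)[OF D1 lam0]) auto
      show "(\<lambda>n. \<integral>x. 1 / (x + (1 - 1 / (real j + 2))) \<partial>\<mu> (Suc n)) \<longlonglongrightarrow> (\<integral>x. 1 / (x + (1 - 1 / (real j + 2))) \<partial>MP_law c)" for j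
      proof -
        have "(\<integral>x. 1 / (x + \<theta> j) \<partial>\<mu> (Suc n)) = (\<Sum>i=1..D (Suc n). 1 / (lam (Suc n) i + \<theta> j)) / real (D (Suc n))" for n
          unfolding \<mu>_def by (rule empirical_dist_props(3)[OF D1]) auto
        then show ?thesis
          unfolding \<theta>_def[symmetric] MP_stieltjes[OF c(1) \<theta>] using LIMSEQ_Suc[OF lim[of j]] by simp
      qed
    qed (rule real_distribution_MP_law[OF c(1)] AE_MP_law_nonneg[OF c(1)])+
    from weak_conv_m_Suc[OF this] show ?case unfolding \<mu>_def lam_def D_def .
  qed
qed

theorem theorem2p6:
  fixes M :: "'a measure"
    and N :: "nat \<Rightarrow> 'b measure"
    and X :: "nat \<Rightarrow> 'b \<Rightarrow> nat \<Rightarrow> real"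
    and d m :: "nat \<Rightarrow> nat"
    and x :: "nat \<Rightarrow> nat \<Rightarrow> 'a \<Rightarrow> nat list \<Rightarrow> real"
    and c :: real
  assumes d_pos: "\<And>n. n \<ge> 1 \<Longrightarrow> d n \<ge> 1"
    and N: "\<And>n. n \<ge> 1 \<Longrightarrow> prob_space (N n)"
    and X: "\<And>n. n \<ge> 1 \<Longrightarrow> X n \<in> measurable (N n) (Rn n)"
    and exch: "\<And>n. n \<ge> 1 \<Longrightarrow> exchangeable (N n) n (X n)"
    and uncond: "\<And>n. n \<ge> 1 \<Longrightarrow> unconditional (N n) n (X n)"
    and hyps:
      "(\<exists>d0. (\<forall>n\<ge>1. d n = d0) \<and>
          (\<lambda>n. \<integral>\<omega>. (X n \<omega> 1)\<^sup>2 \<partial>N n) \<longlonglongrightarrow> 1 \<and>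
          (\<lambda>n. (\<integral>\<omega>. (X n \<omega> 1)\<^sup>2 * (X n \<omega> 2)\<^sup>2 \<partial>N n)
                 - (\<integral>\<omega>. (X n \<omega> 1)\<^sup>2 \<partial>N n) * (\<integral>\<omega>. (X n \<omega> 2)\<^sup>2 \<partial>N n)) \<longlonglongrightarrow> 0 \<and>
          (\<exists>\<epsilon>>0. (SUP n\<in>{1..}. \<integral>\<^sup>+\<omega>. ennreal (\<bar>X n \<omega> 1\<bar> powr (4 * real d0 + \<epsilon>)) \<partial>N n) < \<infinity>))
       \<or>
       ((\<lambda>n. real (d n)) \<in> o(\<lambda>n. sqrt (real n)) \<and>
          (\<forall>n\<ge>1. (\<integral>\<omega>. (X n \<omega> 1)\<^sup>2 \<partial>N n) = 1) \<and>
          (\<lambda>n. 1 / real n ^ (4 * d n) * (\<integral>\<omega>. lnorm 2 n (X n \<omega>) ^ (8 * d n) \<partial>N n)) \<longlonglongrightarrow> 1 \<and>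
          (\<exists>L :: nat \<Rightarrow> real.
             (\<lambda>n. L n * (real (d n))\<^sup>2 / real n) \<longlonglongrightarrow> 0 \<and>
             ((\<forall>n\<ge>1. \<forall>r. 1 \<le> r \<and> r \<le> d n \<and> r \<le> n \<longrightarrow>
                 (\<integral>\<^sup>+\<omega>. ennreal (\<Prod>i=1..r. (X n \<omega> i) ^ 8) \<partial>N n) \<le> ennreal (L n ^ (2 * r)))
              \<or>
              (\<forall>n\<ge>1. \<forall>r. 1 \<le> r \<and> r \<le> d n \<longrightarrow>
                 ennreal (1 / real n ^ (2 * r)) *
                   (\<integral>\<^sup>+\<omega>. ennreal (lnorm 4 n (X n \<omega>) ^ (8 * r)) \<partial>N n) \<le> ennreal (L n ^ (2 * r))))))"
    and c: "c > 0" "(\<lambda>n. real (n choose d n) / real (m n)) \<longlonglongrightarrow> c"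
    and M: "prob_space M"
    and indep: "\<And>n. n \<ge> 1 \<Longrightarrow>
      prob_space.indep_vars M (\<lambda>_. Rnd n (d n)) (\<lambda>k. x n k) {1..m n}"
    and law: "\<And>n k. n \<ge> 1 \<Longrightarrow> k \<in> {1..m n} \<Longrightarrow>
      distr M (Rnd n (d n)) (x n k) = PowerT (N n) n (d n) (X n)"
  shows "AE \<omega> in M.
    weak_conv_m
      (\<lambda>n. empirical_dist ((n + d n - 1) choose d n)
             (\<lambda>j. eigval (sample_cov n (d n) (m n) (\<lambda>k. x n k \<omega>)) j / fact (d n)))
      (MP_law c)"
proof -
  obtain "(\<lambda>n. (real (d n))\<^sup>2 / real n) \<longlonglongrightarrow> 0"
    "\<forall>\<^sub>F n in sequentially. power_vector (N n) n (d n) (X n)"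
    "(\<lambda>n. power_vector.defect (N n) n (d n) (X n)) \<longlonglongrightarrow> 0"
    using hyps
  proof (elim disjE exE conjE)
    fix d0 \<epsilon>
    assume d0: "\<forall>n\<ge>1. d n = d0" and "\<epsilon> > 0"
      and lims: "(\<lambda>n. \<integral>\<omega>. (X n \<omega> 1)\<^sup>2 \<partial>N n) \<longlonglongrightarrow> 1"
        "(\<lambda>n. (\<integral>\<omega>. (X n \<omega> 1)\<^sup>2 * (X n \<omega> 2)\<^sup>2 \<partial>N n)
          - (\<integral>\<omega>. (X n \<omega> 1)\<^sup>2 \<partial>N n) * (\<integral>\<omega>. (X n \<omega> 2)\<^sup>2 \<partial>N n)) \<longlonglongrightarrow> 0"
      and sup: "(SUP n\<in>{1..}. \<integral>\<^sup>+\<omega>. ennreal (\<bar>X n \<omega> 1\<bar> powr (4 * real d0 + \<epsilon>)) \<partial>N n) < \<infinity>"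
    have "d0 \<ge> 1" using d0 d_pos[of 1] by simp
    note lim1 = defect_tendsto_0_fixed_degree[OF this N X exch uncond lims \<open>\<epsilon> > 0\<close> sup, simplified]
    \<comment> \<open>\<open>d\<close> is constant only from n = 1 on, so statements about
      \<open>d0\<close> carry over eventually, which is enough for limits.\<close>
    have d: "\<forall>\<^sub>F n in sequentially. d n = d0"
      using eventually_ge_at_top[of 1] by eventually_elim (use d0 in blast)
    show thesis
    proof (rule that)
      have "(\<lambda>n. (real d0)\<^sup>2 * inverse (real n)) \<longlonglongrightarrow> (real d0)\<^sup>2 * 0"
        by (intro tendsto_mult tendsto_const lim_inverse_n)
      then have "(\<lambda>n. (real d0)\<^sup>2 / real n) \<longlonglongrightarrow> 0" by (simp add: divide_inverse)
      moreover have "\<forall>\<^sub>F n in sequentially. (real d0)\<^sup>2 / real n = (real (d n))\<^sup>2 / real n"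
        using d by eventually_elim simp
      ultimately show "(\<lambda>n. (real (d n))\<^sup>2 / real n) \<longlonglongrightarrow> 0" by (rule Lim_transform_eventually)
      show "\<forall>\<^sub>F n in sequentially. power_vector (N n) n (d n) (X n)"
        using d lim1(1) by eventually_elim simp
      have "\<forall>\<^sub>F n in sequentially. power_vector.defect (N n) n d0 (X n) = power_vector.defect (N n) n (d n) (X n)"
        using d by eventually_elim simp
      with lim1(2) show "(\<lambda>n. power_vector.defect (N n) n (d n) (X n)) \<longlonglongrightarrow> 0"
        by (rule Lim_transform_eventually)
    qed
  next
    fix L :: "nat \<Rightarrow> real"
    assume d: "(\<lambda>n. real (d n)) \<in> o(\<lambda>n. sqrt (real n))"
      and EX: "\<forall>n\<ge>1. (\<integral>\<omega>. (X n \<omega> 1)\<^sup>2 \<partial>N n) = 1"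
      and lims: "(\<lambda>n. 1 / real n ^ (4 * d n) * (\<integral>\<omega>. lnorm 2 n (X n \<omega>) ^ (8 * d n) \<partial>N n)) \<longlonglongrightarrow> 1"
        "(\<lambda>n. L n * (real (d n))\<^sup>2 / real n) \<longlonglongrightarrow> 0"
      and L: "\<forall>n\<ge>1. \<forall>r. 1 \<le> r \<and> r \<le> d n \<and> r \<le> n \<longrightarrow>
        (\<integral>\<^sup>+\<omega>. ennreal (\<Prod>i=1..r. (X n \<omega> i) ^ 8) \<partial>N n) \<le> ennreal (L n ^ (2 * r))"
    note defect_tendsto_0_growing_degree[OF d_pos N X exch uncond d EX[rule_format] lims disjI1[OF L]]
    then show thesis by (rule that)
  next
    fix L :: "nat \<Rightarrow> real"
    assume d: "(\<lambda>n. real (d n)) \<in> o(\<lambda>n. sqrt (real n))"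
      and EX: "\<forall>n\<ge>1. (\<integral>\<omega>. (X n \<omega> 1)\<^sup>2 \<partial>N n) = 1"
      and lims: "(\<lambda>n. 1 / real n ^ (4 * d n) * (\<integral>\<omega>. lnorm 2 n (X n \<omega>) ^ (8 * d n) \<partial>N n)) \<longlonglongrightarrow> 1"
        "(\<lambda>n. L n * (real (d n))\<^sup>2 / real n) \<longlonglongrightarrow> 0"
      and L: "\<forall>n\<ge>1. \<forall>r. 1 \<le> r \<and> r \<le> d n \<longrightarrow>
        ennreal (1 / real n ^ (2 * r)) *
          (\<integral>\<^sup>+\<omega>. ennreal (lnorm 4 n (X n \<omega>) ^ (8 * r)) \<partial>N n) \<le> ennreal (L n ^ (2 * r))"
    note defect_tendsto_0_growing_degree[OF d_pos N X exch uncond d EX[rule_format] lims disjI2[OF L]]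
    then show thesis by (rule that)
  qed
  from Marchenko_Pastur_power_vectors[OF d_pos X this c M indep law]
  show ?thesis .
qed

end
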